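(* Let $Z_N$, $N\ge 2$, be the $\mathbb{R}^2$-valued continuous process obtained by linearly interpolating the values $Z_N(n/N)=(N\ln N)^{-1/2}S_n$, $n\in\mathbb{N}_0$, as defined in the context, where the Markov chain $\{X_n\}$ starts from an initial distribution $\mu$ satisfying: for every $\varepsilon>0$ there is $\delta>0$ with $\mu[|k|<\delta]<\varepsilon$. Then for any $0<\mathcal{T}<\infty$, as $N\to\infty$, $\{Z_N(t)\}_{0\le t\le \mathcal{T}}$ converges to the two-dimensional Wiener process $\{\bar W_\sigma(t)\}_{0\le t\le\mathcal{T}}$, in distribution on the space of continuous functions $C([0,\mathcal{T}],\mathbb{R}^2)$ equipped with the uniform topology.
   Context: $\mathbb{T}^2=\mathbb{R}^2/\mathbb{Z}^2$ is the two-dimensional torus with Lebesgue measure $dk$ of total mass 1; $|k|$ is the distance to $0$. For $k\in\mathbb{T}^2$ (away from $k=0$ where needed) and $\alpha\in\{1,2\}$ let $$v_\alpha(k)=\frac{\sin(\pi k_\alpha)\cos(\pi k_\alpha)}{\big(\sum_{\beta=1}^2\sin^2(\pi k_\beta)\big)^{1/2}},\qquad \Phi(k)=8\sum_{\alpha=1}^2\sin^2(\pi k_\alpha),$$ $$P(k,dk')=\frac{2\sum_{\alpha}\sin^2(\pi k_\alpha)\sin^2(\pi k'_\alpha)}{\sum_\beta\sin^2(\pi k_\beta)}\,dk',\qquad v=(v_1,v_2).$$ $\{X_n\}_{n\ge0}$ is the Markov chain on $\mathbb{T}^2$ with transition kernel $P$ and initial distribution $\mu$; its invariant probability is $\pi(dk)=\frac18\Phi(k)\,dk$.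 $\{e_n\}_{n\ge0}$ are i.i.d. exponential random variables of parameter 1, independent of the chain. Set $S_0=0$ and $S_n=\sum_{\ell=0}^{n-1}e_\ell\,v(X_\ell)\Phi(X_\ell)^{-1}\in\mathbb{R}^2$. For $N\ge2$, $t\ge0$, $$Z_N(t)=\frac{1}{\sqrt{N\ln N}}\Big(S_{\lfloor Nt\rfloor}+(Nt-\lfloor Nt\rfloor)\,e_{\lfloor Nt\rfloor}\,v(X_{\lfloor Nt\rfloor})\Phi(X_{\lfloor Nt\rfloor})^{-1}\Big).$$ The constant $\sigma^2$ is $$\sigma^2=\lim_{N\to\infty}\frac1{\ln N}\,\mathbb{E}_\pi\left[\left|\frac{e_1v_1(X_1)}{\Phi(X_1)}\right|^2\mathbf{1}_{\left\{\left|\frac{e_1v_1(X_1)}{\Phi(X_1)}\right|\le\sqrt N\right\}}\right],$$ where $\mathbb{E}_\pi$ is expectation for the stationary chain; the limit exists and equals $\frac1{128\pi}$. $\bar W_\sigma=(W^1_\sigma,W^2_\sigma)$ where $W^1_\sigma,W^2_\sigma$ are independent Wiener processes started at $0$ with $W^\alpha_\sigma(t)-W^\alpha_\sigma(s)\sim\mathcal{N}(0,\sigma^2(t-s))$ for $0\le s<t$. *)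

theory Defs
  imports "HOL-Probability.Probability"
begin

section \<open>The torus and the coefficients\<close>

text \<open>
  The torus is represented by the fundamental domain $[0,1)^2$ of $\mathbb{R}^2/\mathbb{Z}^2$, with its
  Borel sets and Lebesgue measure. All coefficient functions below are $\mathbb{Z}^2$-periodic.
\<close>

definition torus :: "(real ^ 2) measure" where
  "torus = restrict_space lborel {k. \<forall>i. 0 \<le> k $ i \<and> k $ i < 1}"

text \<open>The distance from \<^term>\<open>k\<close> to \<open>0\<close> on the torus, that is, from \<^term>\<open>k\<close> to $\mathbb{Z}^2$.\<close>

definition torus_norm :: "real ^ 2 \<Rightarrow> real" where
  "torus_norm k = infdist k {m. \<forall>i. m $ i \<in> \<int>}"

text \<open>At \<open>k = 0\<close> the quotients in \<open>velocity\<close> and \<open>kernel\<close> are \<open>0\<close> by the convention \<open>x / 0 = 0\<close>.\<close>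

definition velocity :: "real ^ 2 \<Rightarrow> real ^ 2" where
  "velocity k = (\<chi> \<alpha>. sin (pi * k $ \<alpha>) * cos (pi * k $ \<alpha>) / sqrt (\<Sum>\<beta>\<in>UNIV. (sin (pi * k $ \<beta>))\<^sup>2))"

definition Phi :: "real ^ 2 \<Rightarrow> real" where
  "Phi k = 8 * (\<Sum>\<alpha>\<in>UNIV. (sin (pi * k $ \<alpha>))\<^sup>2)"

definition kernel :: "real ^ 2 \<Rightarrow> (real ^ 2) measure" where
  "kernel k = density torus (\<lambda>k'. ennreal
     (2 * (\<Sum>\<alpha>\<in>UNIV. (sin (pi * k $ \<alpha>))\<^sup>2 * (sin (pi * k' $ \<alpha>))\<^sup>2) / (\<Sum>\<beta>\<in>UNIV. (sin (pi * k $ \<beta>))\<^sup>2)))"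

definition invariant_measure :: "(real ^ 2) measure" where
  "invariant_measure = density torus (\<lambda>k. ennreal (Phi k / 8))"

definition exp1 :: "real measure" where
  "exp1 = density lborel (\<lambda>x. ennreal (exponential_density 1 x))"


section \<open>Markov chains, the processes $S_n$ and $Z_N$\<close>

text \<open>
  Here \<^term>\<open>K\<close> is the transition kernel on the state space \<^term>\<open>E\<close> and \<open>\<mu>\<close> the initial law. The Markov
  property is only required almost surely, so the value of \<^term>\<open>K\<close> on a set of states which the chain
  almost surely never visits is irrelevant.
\<close>

definition markov_chain ::
  "'w measure \<Rightarrow> 'a measure \<Rightarrow> ('a \<Rightarrow> 'a measure) \<Rightarrow> 'a measure \<Rightarrow> (nat \<Rightarrow> 'w \<Rightarrow> 'a) \<Rightarrow> bool" where
  "markov_chain M E K \<mu> X \<longleftrightarrow>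
     prob_space M \<and>
     (\<forall>n. X n \<in> measurable M E) \<and>
     distr M E (X 0) = \<mu> \<and>
     (\<forall>n. \<forall>B\<in>sets E. AE \<omega> in M.
        real_cond_exp M
          (vimage_algebra (space M) (\<lambda>\<omega>. \<lambda>i\<in>{..n}. X i \<omega>) (PiM {..n} (\<lambda>_. E)))
          (indicator {\<omega> \<in> space M. X (Suc n) \<omega> \<in> B}) \<omega>
        = measure (K (X n \<omega>)) B)"

definition kinetic_chain ::
  "'w measure \<Rightarrow> (real ^ 2) measure \<Rightarrow> (nat \<Rightarrow> 'w \<Rightarrow> real ^ 2) \<Rightarrow> (nat \<Rightarrow> 'w \<Rightarrow> real) \<Rightarrow> bool" where
  "kinetic_chain M \<mu> X e \<longleftrightarrow>
     markov_chain M torus kernel \<mu> X \<and>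
     prob_space.indep_vars M (\<lambda>_. borel) e UNIV \<and>
     (\<forall>n. distr M borel (e n) = exp1) \<and>
     prob_space.indep_set M
       (sets (vimage_algebra (space M) (\<lambda>\<omega> n. X n \<omega>) (PiM UNIV (\<lambda>_. torus))))
       (sets (vimage_algebra (space M) (\<lambda>\<omega> n. e n \<omega>) (PiM UNIV (\<lambda>_. borel))))"

definition S :: "(nat \<Rightarrow> 'w \<Rightarrow> real ^ 2) \<Rightarrow> (nat \<Rightarrow> 'w \<Rightarrow> real) \<Rightarrow> nat \<Rightarrow> 'w \<Rightarrow> real ^ 2" where
  "S X e n \<omega> = (\<Sum>l<n. (e l \<omega> / Phi (X l \<omega>)) *\<^sub>R velocity (X l \<omega>))"

definition Z ::
  "(nat \<Rightarrow> 'w \<Rightarrow> real ^ 2) \<Rightarrow> (nat \<Rightarrow> 'w \<Rightarrow> real) \<Rightarrow> nat \<Rightarrow> real \<Rightarrow> 'w \<Rightarrow> real ^ 2" where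
  "Z X e N t \<omega> =
     (let n = nat \<lfloor>real N * t\<rfloor> in
      (1 / sqrt (real N * ln (real N))) *\<^sub>R
        (S X e n \<omega> + ((real N * t - real n) * e n \<omega> / Phi (X n \<omega>)) *\<^sub>R velocity (X n \<omega>)))"


section \<open>The variance\<close>

text \<open>
  The expectation of \<open>F e\<^sub>1 X\<^sub>1\<close> for the stationary chain: \<open>X\<^sub>0\<close> has the invariant law, \<open>X\<^sub>1\<close> is drawn
  from the transition kernel at \<open>X\<^sub>0\<close>, and \<open>e\<^sub>1\<close> is exponential and independent of the chain.
\<close>

definition stationary_expectation1 :: "(real \<Rightarrow> real ^ 2 \<Rightarrow> real) \<Rightarrow> real" where
  "stationary_expectation1 F =
     (\<integral>k0. (\<integral>k1. (\<integral>x. F x k1 \<partial>exp1) \<partial>kernel k0) \<partial>invariant_measure)"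

definition sigma_sq :: real where
  "sigma_sq = lim (\<lambda>N::nat. 1 / ln (real N) *
     stationary_expectation1 (\<lambda>x k.
       \<bar>x * velocity k $ 1 / Phi k\<bar>\<^sup>2 * of_bool (\<bar>x * velocity k $ 1 / Phi k\<bar> \<le> sqrt (real N))))"


section \<open>Wiener processes\<close>

definition wiener_process :: "'w measure \<Rightarrow> real \<Rightarrow> (real \<Rightarrow> 'w \<Rightarrow> real) \<Rightarrow> bool" where
  "wiener_process M s2 W \<longleftrightarrow>
     prob_space M \<and>
     (\<forall>t\<ge>0. W t \<in> borel_measurable M) \<and>
     (\<forall>\<omega>\<in>space M. W 0 \<omega> = 0 \<and> continuous_on {0..} (\<lambda>t. W t \<omega>)) \<and>
     (\<forall>(n::nat) \<tau>. 0 \<le> \<tau> 0 \<and> mono \<tau> \<longrightarrow>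
        prob_space.indep_vars M (\<lambda>_. borel) (\<lambda>i \<omega>. W (\<tau> (Suc i)) \<omega> - W (\<tau> i) \<omega>) {..<n}) \<and>
     (\<forall>s t. 0 \<le> s \<and> s < t \<longrightarrow>
        distributed M lborel (\<lambda>\<omega>. W t \<omega> - W s \<omega>) (normal_density 0 (sqrt (s2 * (t - s)))))"

definition wiener_process2 :: "'w measure \<Rightarrow> real \<Rightarrow> (real \<Rightarrow> 'w \<Rightarrow> real ^ 2) \<Rightarrow> bool" where
  "wiener_process2 M s2 W \<longleftrightarrow>
     (\<forall>\<alpha>. wiener_process M s2 (\<lambda>t \<omega>. W t \<omega> $ \<alpha>)) \<and>
     prob_space.indep_vars M (\<lambda>_. PiM {0..} (\<lambda>_. borel)) (\<lambda>\<alpha> \<omega>. \<lambda>t\<in>{0..}. W t \<omega> $ \<alpha>) UNIV"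


section \<open>Convergence in distribution on a space of continuous functions\<close>

text \<open>
  The space $C([0,T],\mathbb{R}^2)$ with the topology of the supremum metric. Its elements are functions
  that are \<^const>\<open>undefined\<close> outside of \<open>{0..T}\<close>, whence the use of \<^const>\<open>restrict\<close> for paths.
\<close>

definition C_space :: "real \<Rightarrow> (real \<Rightarrow> real ^ 2) topology" where
  "C_space T = mtopology_of (cfunspace (top_of_set {0..T}) euclidean_metric)"

definition borel_of :: "'a topology \<Rightarrow> 'a measure" where
  "borel_of X = sigma (topspace X) {U. openin X U}"

definition converges_in_distribution ::
  "'a topology \<Rightarrow> 'w measure \<Rightarrow> (nat \<Rightarrow> 'w \<Rightarrow> 'a) \<Rightarrow> 'v measure \<Rightarrow> ('v \<Rightarrow> 'a) \<Rightarrow> bool" where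
  "converges_in_distribution X M Y M' Y' \<longleftrightarrow>
     (\<forall>\<^sub>F N in sequentially. Y N \<in> measurable M (borel_of X)) \<and>
     Y' \<in> measurable M' (borel_of X) \<and>
     (\<forall>f. continuous_map X euclideanreal f \<and> bounded (f ` topspace X) \<longrightarrow>
        (\<lambda>N. \<integral>y. f y \<partial>distr M (borel_of X) (Y N)) \<longlonglongrightarrow> (\<integral>y. f y \<partial>distr M' (borel_of X) Y'))"

end

theory Submission
  imports Defs "HOL-Real_Asymp.Real_Asymp"
begin

text \<open>
  The transition kernel is a mixture of the two probability measures \<open>2 sin\<^sup>2(\<pi> k\<^sub>a) dk\<close>, so the conditional
  characteristic function of a sum of increments satisfies a two-dimensional linear recursion. The increments are
  odd in each coordinate, hence centred, and their tail near \<open>k = 0\<close> gives them variance of order \<open>ln N\<close> after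
  truncation at \<open>\<surd>N\<close>; the defect \<open>1 - E cos\<close> of one scaled increment is therefore asymptotically the Gaussian one,
  and the recursion yields the characteristic functions of the increments of \<open>Z\<^sub>N\<close> over finitely many blocks.

  For tightness, conditionally on the past each increment is symmetric, so that reflection gives Levy's maximal
  inequality. It reduces the oscillation within a block of length \<open>T/m\<close> to the tail of the block sum, which in the limit is
  Gaussian with fourth moment of order \<open>m\<^sup>-\<^sup>2\<close>; summing over \<open>m\<close> blocks leaves a term of order \<open>1/m\<close>. Bounded Lipschitz
  functionals of the paths are compared with functionals of the polygons through \<open>m\<close> nodes.
\<close>

section \<open>The torus\<close>

text \<open>The second moment of a step diverges, but only logarithmically: the step has size of
  order \<open>1 / ssq k\<close>, the invariant density is \<open>ssq k\<close>, and
  \<open>ssq k\<close> behaves like the squared distance to 0 in dimension two. Truncation is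
  therefore done in the position, at \<open>\<rho> \<le> ssq k\<close>, and both the limit defining
  \<open>sigma_sq\<close> and the characteristic function at scale \<open>sqrt (N ln N)\<close> are
  expressed through the same quantity \<open>trunc_var \<rho>\<close> with
  \<open>ln (1 / \<rho>)\<close> close to \<open>ln N / 2\<close>. Their agreement becomes an
  identity between constants containing \<open>c_disc\<close>. Dependence between steps is governed
  by one eigenvalue \<open>2 * kappa\<close> of absolute value below 1; because steps are odd while
  the weights are even, the past enters the characteristic function of the next step only at the
  order of the defect, that is \<open>1 / N\<close>. Before the limit the steps have infinite
  variance, so tail bounds are read off the limiting Gaussian after \<open>N\<close> has gone to
  infinity with the number \<open>m\<close> of blocks fixed; \<open>m\<close> is sent to infinity
  last.\<close>

definition reflect :: "2 \<Rightarrow> real ^ 2 \<Rightarrow> real ^ 2" where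
  "reflect a k = (\<chi> i. if i = a \<and> k $ i \<noteq> 0 then 1 - k $ i else k $ i)"

definition swap :: "real ^ 2 \<Rightarrow> real ^ 2" where
  "swap k = (\<chi> i. k $ (if i = 1 then 2 else 1))"

definition cell :: "(real ^ 2) set" where
  "cell = {k. \<forall>i. 0 \<le> k $ i \<and> k $ i < 1}"

section \<open>Lebesgue measure on the plane through areas of boxes\<close>

lemma prod_Basis_2: "(\<Prod>b\<in>(Basis::(real^2) set). x \<bullet> b) = x $ 1 * x $ 2"
proof -
  have B: "(Basis::(real^2) set) = {axis 1 1, axis 2 1}"
    unfolding Basis_vec_def by (auto simp: UNIV_2)
  have "axis 1 1 \<noteq> (axis 2 1 :: real^2)"
    by (simp add: axis_eq_axis)
  then show ?thesis unfolding B by (subst prod.insert) (auto simp: inner_axis)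
qed

lemma ball_Basis_2: "(\<forall>b\<in>(Basis::(real^2) set). P (x \<bullet> b) (y \<bullet> b)) \<longleftrightarrow> P (x $ 1) (y $ 1) \<and> P (x $ 2) (y $ 2)"
  unfolding Basis_vec_def by (auto simp: UNIV_2 cart_eq_inner_axis)

lemma forall_le_Basis: "(\<forall>b\<in>(Basis::(real^2) set). l \<bullet> b \<le> u \<bullet> b) \<longleftrightarrow> l $ 1 \<le> u $ 1 \<and> l $ 2 \<le> u $ 2"
  using ball_Basis_2[of "(\<le>)" l u] by blast

lemma emeasure_lborel_box_2:
  fixes l u :: "real ^ 2"
  assumes "l $ 1 \<le> u $ 1" "l $ 2 \<le> u $ 2"
  shows "emeasure lborel (box l u) = ennreal ((u $ 1 - l $ 1) * (u $ 2 - l $ 2))"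
  using emeasure_lborel_box[of l u] assms forall_le_Basis[of l u] by (simp add: prod_Basis_2)

text \<open>Reduces every identification of planar Lebesgue measure (reflection, swap, product form)
  to an area computation for boxes in coordinates.\<close>

lemma lborel_eqI_2:
  fixes M :: "(real^2) measure"
  assumes "\<And>l u. l $ 1 \<le> u $ 1 \<Longrightarrow> l $ 2 \<le> u $ 2 \<Longrightarrow>
      emeasure M (box l u) = ennreal ((u $ 1 - l $ 1) * (u $ 2 - l $ 2))"
    and "sets M = sets borel"
  shows "lborel = M"
  proof (rule lborel_eqI)
  fix l u :: "real^2" assume "\<And>b. b \<in> Basis \<Longrightarrow> l \<bullet> b \<le> u \<bullet> b"
  then show "emeasure M (box l u) = ennreal (\<Prod>b\<in>Basis. (u - l) \<bullet> b)"
    using assms(1)[of l u] forall_le_Basis[of l u] by (auto simp: prod_Basis_2)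
qed (use assms in auto)

lemma borel_measurable_vec_lambda [measurable (raw)]:
  fixes f :: "'b \<Rightarrow> 2 \<Rightarrow> real"
  assumes [measurable]: "\<And>i. (\<lambda>x. f x i) \<in> borel_measurable M"
  shows "(\<lambda>x. \<chi> i. f x i) \<in> borel_measurable M"
proof -
  have "(\<lambda>x. \<chi> i. f x i) = (\<lambda>x. \<Sum>i\<in>UNIV. f x i *\<^sub>R axis i 1)"
    by (auto simp: fun_eq_iff vec_eq_iff axis_def if_distrib sum.delta cong: if_cong)
  then show ?thesis by simp
qed

lemma borel_measurable_vec_nth_real [measurable (raw)]:
  fixes f :: "'b \<Rightarrow> real ^ 2"
  assumes [measurable]: "f \<in> borel_measurable M"
  shows "(\<lambda>x. f x $ i) \<in> borel_measurable M"
  by (rule borel_measurable_continuous_on[OF _ assms]) (intro continuous_intros)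

text \<open>This is the affine reflection on the whole plane, without the exceptional value of
  \<open>reflect\<close>; it sends boxes to boxes of the same area.\<close>

lemma lborel_distr_reflect0:
  "distr lborel borel (\<lambda>k::real^2. \<chi> i. if i = a then 1 - k $ i else k $ i) = lborel" (is "distr _ _ ?r = _")
proof (rule lborel_eqI_2[symmetric])
  fix l u :: "real^2" assume le: "l $ 1 \<le> u $ 1" "l $ 2 \<le> u $ 2"
  \<comment> \<open>Reflection interchanges the roles of lower and upper corner in coordinate
    \<open>a\<close>.\<close>
  define l' u' :: "real^2" where "l' = (\<chi> i. if i = a then 1 - u $ i else l $ i)"
    and "u' = (\<chi> i. if i = a then 1 - l $ i else u $ i)"
  have "?r -` box l u = box l' u'"
    using exhaust_2[of a] by (auto simp: mem_box_cart l'_def u'_def forall_2)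
  moreover have "emeasure lborel (box l' u') = ennreal ((u $ 1 - l $ 1) * (u $ 2 - l $ 2))"
    using exhaust_2[of a] le by (subst emeasure_lborel_box_2) (auto simp: l'_def u'_def)
  ultimately show "emeasure (distr lborel borel ?r) (box l u) = ennreal ((u $ 1 - l $ 1) * (u $ 2 - l $ 2))"
    by (subst emeasure_distr) auto
qed auto

lemma lborel_distr_swap: "distr lborel borel swap = lborel"
proof (rule lborel_eqI_2[symmetric])
  fix l u :: "real^2" assume le: "l $ 1 \<le> u $ 1" "l $ 2 \<le> u $ 2"
  have "swap -` box l u = box (swap l) (swap u)"
    by (auto simp: mem_box_cart swap_def forall_2)
  moreover have "emeasure lborel (box (swap l) (swap u)) = ennreal ((u $ 1 - l $ 1) * (u $ 2 - l $ 2))"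
    using le by (subst emeasure_lborel_box_2) (auto simp: swap_def mult.commute)
  moreover have "swap \<in> borel_measurable borel" unfolding swap_def by measurable
  ultimately show "emeasure (distr lborel borel swap) (box l u) = ennreal ((u $ 1 - l $ 1) * (u $ 2 - l $ 2))"
    by (subst emeasure_distr) auto
qed auto

section \<open>The half-open unit cell and its measure-preserving symmetries\<close>

lemma cell_borel [measurable]: "cell \<in> sets borel"
  unfolding cell_def by measurable

lemma space_torus: "space torus = cell"
  and sets_torus [measurable_cong]: "sets torus = sets (restrict_space borel cell)"
  by (auto simp: torus_def cell_def space_restrict_space sets_restrict_space)

lemma sets_torus_iff: "B \<in> sets torus \<longleftrightarrow> B \<in> sets borel \<and> B \<subseteq> cell"
  by (auto simp: sets_torus sets_restrict_space_iff)

lemma emeasure_torus: "B \<in> sets torus \<Longrightarrow> emeasure torus B = emeasure lborel B"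
  unfolding torus_def using cell_borel by (subst emeasure_restrict_space) (auto simp: cell_def sets_torus_iff[unfolded cell_def torus_def])

lemma null_hyperplane: "{k::real^2. k $ a = c} \<in> null_sets lborel"
proof -
  have "negligible {k::real^2. k $ a = c}" using negligible_standard_hyperplane[of "axis a 1 :: real^2" c] by (auto simp: inner_axis Basis_vec_def)
  moreover have "{k::real^2. k $ a = c} \<in> sets borel" by measurable
  ultimately show ?thesis
    using negligible_iff_null_sets null_sets_completion_iff by (metis sets_lborel)
qed

lemma measurable_ident_torus [measurable]: "(\<lambda>k. k) \<in> borel_measurable torus"
  and measurable_ident_cell [measurable]: "(\<lambda>k. k) \<in> borel_measurable (restrict_space borel cell)"
proof -
  show *: "(\<lambda>k. k) \<in> borel_measurable (restrict_space borel cell)" by (rule measurable_restrict_space1) simp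
  then show "(\<lambda>k. k) \<in> borel_measurable torus" by (simp add: measurable_cong_sets[OF sets_torus refl])
qed

text \<open>On the circle \<open>reflect a\<close> is negation of one coordinate. Keeping the
  coordinate value 0 fixed is what makes it map the half-open cell into itself, since
  \<open>1 - 0\<close> would leave the cell.\<close>

lemma measurable_reflect [measurable]: "reflect a \<in> torus \<rightarrow>\<^sub>M torus"
proof -
  have 1: "reflect a \<in> torus \<rightarrow>\<^sub>M borel"
    unfolding reflect_def by measurable
  show ?thesis unfolding measurable_cong_sets[OF refl sets_torus]
    by (rule measurable_restrict_space2[OF _ 1])
      (auto simp: space_torus cell_def reflect_def order.strict_iff_order)
qed

lemma measurable_swap [measurable]: "swap \<in> torus \<rightarrow>\<^sub>M torus"
proof -
  have 1: "swap \<in> torus \<rightarrow>\<^sub>M borel"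
    unfolding swap_def by measurable
  show ?thesis unfolding measurable_cong_sets[OF refl sets_torus]
    by (rule measurable_restrict_space2[OF _ 1]) (auto simp: space_torus cell_def swap_def)
qed

lemma distr_torus_swap: "distr torus torus swap = torus"
proof (rule measure_eqI)
  fix B assume "B \<in> sets (distr torus torus swap)"
  then have B: "B \<in> sets torus" by simp
  have m: "swap \<in> borel_measurable borel" unfolding swap_def by measurable
  have eq: "swap -` B \<inter> space torus = swap -` B"
    using B by (auto simp: space_torus sets_torus_iff cell_def swap_def subset_iff forall_2)
  have "emeasure (distr torus torus swap) B = emeasure lborel (swap -` B)"
    using measurable_sets[OF measurable_swap B] B
    by (simp add: emeasure_distr eq emeasure_torus)
  also have "\<dots> = emeasure (distr lborel borel swap) B"
    using m B by (subst emeasure_distr) (auto simp: sets_torus_iff)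
  also have "\<dots> = emeasure torus B" using B by (simp add: lborel_distr_swap emeasure_torus)
  finally show "emeasure (distr torus torus swap) B = emeasure torus B" .
qed auto

text \<open>Off a null set \<open>reflect a\<close> is the affine reflection, and the preimage under
  the latter of a subset of the cell lies again in the cell; so invariance of Lebesgue measure
  carries over.\<close>

lemma distr_torus_reflect: "distr torus torus (reflect a) = torus"
proof (rule measure_eqI)
  fix B assume "B \<in> sets (distr torus torus (reflect a))"
  then have B: "B \<in> sets torus" by simp
  let ?r = "\<lambda>k::real^2. \<chi> i. if i = a then 1 - k $ i else k $ i"
  have m: "?r \<in> borel_measurable borel" by measurable
  let ?A = "reflect a -` B \<inter> space torus"
  have A: "?A \<in> sets torus" using measurable_sets[OF measurable_reflect B] .
  have sA: "?A \<in> sets borel" using A by (simp add: sets_torus_iff)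
  have sB: "?r -` B \<in> sets borel"
    using measurable_sets[OF m, of B] B by (auto simp: sets_torus_iff)
  have "emeasure lborel ?A = emeasure lborel (?r -` B)"
  proof (rule emeasure_eq_AE)
    have "AE k in lborel. k \<notin> {k::real^2. k $ a = 0}" by (rule AE_not_in[OF null_hyperplane])
    \<comment> \<open>Points with coordinate 1 lie outside the cell although the affine reflection
      sends them to coordinate 0, hence possibly into \<open>B\<close>; they are discarded as
      well.\<close>
    moreover have "AE k in lborel. k \<notin> {k::real^2. k $ a = 1}" by (rule AE_not_in[OF null_hyperplane])
    ultimately show "AE x in lborel. (x \<in> ?A) = (x \<in> ?r -` B)"
    proof eventually_elim
      case (elim k)
      have r: "reflect a k = ?r k" using elim by (auto simp: reflect_def vec_eq_iff)
      have "k \<in> cell" if "?r k \<in> B"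
      proof -
        have c: "?r k \<in> cell" using that B by (auto simp: sets_torus_iff)
        have "0 \<le> k $ i \<and> k $ i < 1" for i
          using c[unfolded cell_def, simplified, rule_format, of i] elim by (auto split: if_splits)
        then show ?thesis by (auto simp: cell_def)
      qed
      then show ?case using r by (auto simp: space_torus)
    qed
  qed (use sA sB in auto)
  moreover have "emeasure lborel (?r -` B) = emeasure (distr lborel borel ?r) B"
    using m B by (subst emeasure_distr) (auto simp: sets_torus_iff)
  ultimately show "emeasure (distr torus torus (reflect a)) B = emeasure torus B"
    using A B by (simp add: emeasure_distr emeasure_torus lborel_distr_reflect0)
qed auto

lemma prob_space_torus: "prob_space torus"
proof
  have "emeasure torus (space torus) = emeasure lborel cell"
    by (subst emeasure_torus) (auto simp: space_torus[symmetric])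
  also have "\<dots> = emeasure lborel (box 0 1 :: (real^2) set)"
  proof (rule emeasure_eq_AE)
    have "AE k in lborel. k \<notin> {k::real^2. k $ 1 = 0}" by (rule AE_not_in[OF null_hyperplane])
    moreover have "AE k in lborel. k \<notin> {k::real^2. k $ 2 = 0}" by (rule AE_not_in[OF null_hyperplane])
    ultimately show "AE x in lborel. (x \<in> cell) = (x \<in> box 0 1)"
      by eventually_elim (auto simp: cell_def mem_box_cart forall_2 order.strict_iff_order)
  qed auto
  also have "\<dots> = 1" by (subst emeasure_lborel_box_2) auto
  finally show "emeasure torus (space torus) = 1" .
qed

text \<open>One eighth of \<open>Phi\<close>, hence the density of the invariant measure, and near 0
  asymptotic to \<open>pi ^ 2\<close> times the squared distance. It serves as the truncation
  variable because the size of a step is controlled by it.\<close>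

definition ssq :: "real ^ 2 \<Rightarrow> real" where
  "ssq k = (\<Sum>\<beta>\<in>UNIV. (sin (pi * k $ \<beta>))\<^sup>2)"

lemma ssq_alt: "ssq k = (sin (pi * k $ 1))\<^sup>2 + (sin (pi * k $ 2))\<^sup>2"
  by (simp add: ssq_def UNIV_2)

lemma ssq_nonneg: "0 \<le> ssq k" and ssq_le_2: "ssq k \<le> 2"
proof -
  show "0 \<le> ssq k" by (simp add: ssq_alt)
  have "(sin (pi * k $ i))\<^sup>2 \<le> 1" for i by (simp add: abs_square_le_1)
  from this[of 1] this[of 2] show "ssq k \<le> 2" by (simp add: ssq_alt)
qed

lemma measurable_ssq [measurable]: "ssq \<in> borel_measurable torus"
  unfolding ssq_def by measurable

lemma integral_torus_reflect:
  fixes f :: "real^2 \<Rightarrow> 'b::{banach, second_countable_topology}"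
  assumes "f \<in> borel_measurable torus"
  shows "(\<integral>k. f (reflect a k) \<partial>torus) = (\<integral>k. f k \<partial>torus)"
  using integral_distr[OF measurable_reflect assms] by (simp add: distr_torus_reflect)

lemma integral_torus_swap:
  fixes f :: "real^2 \<Rightarrow> 'b::{banach, second_countable_topology}"
  assumes "f \<in> borel_measurable torus"
  shows "(\<integral>k. f (swap k) \<partial>torus) = (\<integral>k. f k \<partial>torus)"
  using integral_distr[OF measurable_swap assms] by (simp add: distr_torus_swap)

lemma sin_reflect [simp]: "(sin (pi * reflect a k $ i))\<^sup>2 = (sin (pi * k $ i))\<^sup>2"
  by (simp add: reflect_def right_diff_distrib sin_diff)

lemma sin_cos_reflect:
  "sin (pi * reflect a k $ i) * cos (pi * reflect a k $ i) =
    (if i = a then - 1 else 1) * (sin (pi * k $ i) * cos (pi * k $ i))"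
  by (auto simp: reflect_def right_diff_distrib sin_diff cos_diff)

lemma ssq_reflect [simp]: "ssq (reflect a k) = ssq k"
  by (simp add: ssq_def)

lemma swap_nth [simp]: "swap k $ 1 = k $ 2" "swap k $ 2 = k $ 1"
  by (simp_all add: swap_def)

lemma ssq_swap [simp]: "ssq (swap k) = ssq k"
  by (simp add: ssq_alt)

text \<open>The reflection exchanges the two halves of the cell up to the null sets where the
  coordinate is 0 or 1/2. Applied twice, it reduces a sublevel set of \<open>ssq\<close> to a
  quarter of the cell, where the sine is comparable to its argument.\<close>

lemma measure_torus_half:
  assumes B [measurable]: "B \<in> sets torus" and inv: "\<And>k. k \<in> cell \<Longrightarrow> reflect a k \<in> B \<longleftrightarrow> k \<in> B"
  shows "measure torus B = 2 * measure torus (B \<inter> {k. k $ a < 1 / 2})"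
proof -
  interpret prob_space torus by (rule prob_space_torus)
  let ?L = "B \<inter> {k. k $ a < 1 / 2}" and ?R = "B \<inter> {k. \<not> k $ a < 1 / 2}"
  have B': "B \<in> sets borel" "B \<subseteq> cell" using B by (auto simp: sets_torus_iff)
  have "{k::real^2. k $ a < 1 / 2} \<in> sets borel" "{k::real^2. \<not> k $ a < 1 / 2} \<in> sets borel" by measurable
  with B' have sb: "?L \<in> sets torus" "?R \<in> sets torus"
    unfolding sets_torus_iff by (blast intro: sets.Int)+
  have [measurable]: "?L \<in> sets torus" "?R \<in> sets torus"
    by (rule sb)+
  have "measure torus (?L \<union> ?R) = measure torus ?L + measure torus ?R"
    by (rule finite_measure_Union[OF sb]) auto
  moreover have "?L \<union> ?R = B" by auto
  moreover have "measure torus ?R = measure torus ?L"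
  proof -
    have "measure torus ?L = measure (distr torus torus (reflect a)) ?L" by (simp add: distr_torus_reflect)
    also have "\<dots> = measure torus (reflect a -` ?L \<inter> space torus)" by (rule measure_distr[OF measurable_reflect sb(1)])
    also have "\<dots> = measure torus ?R"
    proof (rule finite_measure_eq_AE)
      have *: "{k::real^2. k $ a = c} \<inter> cell \<in> null_sets torus" for c
      proof -
        have m: "{k::real^2. k $ a = c} \<inter> cell \<in> sets torus" by (simp add: sets_torus_iff)
        have "{k::real^2. k $ a = c} \<inter> cell \<in> null_sets lborel"
          using null_hyperplane[of a c] by (rule null_set_Int2) simp
        then show ?thesis using m by (auto simp: null_sets_def emeasure_torus)
      qed
      have "AE k in torus. k \<notin> {k. k $ a = 0} \<inter> cell" by (rule AE_not_in[OF *])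
      moreover have "AE k in torus. k \<notin> {k. k $ a = 1/2} \<inter> cell" by (rule AE_not_in[OF *])
      moreover have "AE k in torus. k \<in> cell" by (metis AE_space space_torus)
      ultimately show "AE k in torus. (k \<in> reflect a -` ?L \<inter> space torus) = (k \<in> ?R)"
        by eventually_elim (auto simp: inv space_torus, auto simp: reflect_def split: if_splits)
    qed (rule measurable_sets[OF measurable_reflect sb(1)] sb)+
    finally show ?thesis ..
  qed
  ultimately show ?thesis by simp
qed

section \<open>Singular integrals on the torus\<close>

text \<open>The parameter is the squared radius, so that areas are linear in it.\<close>

definition quarter_disc :: "real \<Rightarrow> (real ^ 2) set" where
  "quarter_disc r = {k. 0 \<le> k $ 1 \<and> 0 \<le> k $ 2 \<and> (k $ 1)\<^sup>2 + (k $ 2)\<^sup>2 < r}"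

lemma quarter_disc_borel [measurable]: "quarter_disc r \<in> sets borel"
  unfolding quarter_disc_def by measurable

lemma emeasure_quarter_disc_finite: "emeasure lborel (quarter_disc r) < \<infinity>"
proof -
  have "bounded (quarter_disc r)"
  proof (rule boundedI)
    fix k assume "k \<in> quarter_disc r"
    then have "(norm k)\<^sup>2 \<le> r" by (simp add: quarter_disc_def norm_vec_def L2_set_def UNIV_2)
    then show "norm k \<le> sqrt r" by (simp add: real_le_rsqrt)
  qed
  then show ?thesis by (rule emeasure_bounded_finite)
qed

text \<open>Scaling by \<open>sqrt r\<close> multiplies areas in dimension two by \<open>r\<close>;
  the area of the unit quarter disc is left as a symbol.\<close>

lemma measure_quarter_disc:
  assumes "0 < r"
  shows "measure lborel (quarter_disc r) = r * measure lborel (quarter_disc 1)"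
proof -
  have "emeasure lborel (quarter_disc r) =
      emeasure (density (distr lborel borel (\<lambda>x::real^2. 0 + sqrt r *\<^sub>R x)) (\<lambda>_. \<bar>sqrt r\<bar> ^ DIM(real^2))) (quarter_disc r)"
    using assms by (subst lborel_affine[symmetric]) auto
  also have "\<dots> = ennreal r * emeasure lborel ((\<lambda>x. sqrt r *\<^sub>R x) -` quarter_disc r)"
    using assms by (subst emeasure_density) (auto simp: emeasure_distr nn_integral_cmult_indicator)
  also have "(\<lambda>x. sqrt r *\<^sub>R x) -` quarter_disc r = quarter_disc 1"
    using assms by (auto simp: quarter_disc_def power_mult_distrib zero_le_mult_iff simp flip: distrib_left)
  finally show ?thesis using assms by (simp add: measure_def enn2real_mult)
qed

text \<open>On \<open>[0, pi / 2]\<close> the Taylor polynomial \<open>x - x ^ 3 / 6\<close> is a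
  non-negative lower bound of the sine, so it may be squared. The cruder second bound absorbs the
  quartic term through \<open>x ^ 2 \<le> 5 / 2\<close>.\<close>

lemma sin_sq_lower:
  assumes "0 \<le> x" "x \<le> pi / 2"
  shows "x\<^sup>2 - x ^ 4 / 3 \<le> (sin x)\<^sup>2" "x\<^sup>2 / 6 \<le> (sin x)\<^sup>2"
proof -
  have pi: "pi < 3.15" using pi_approx by simp
  have x2: "x\<^sup>2 \<le> 5 / 2"
  proof -
    have "x \<le> 1.575" using assms pi by simp
    then have "x * x \<le> 1.575 * 1.575" using assms by (intro mult_mono) auto
    then show ?thesis by (simp add: power2_eq_square)
  qed
  have "\<bar>sin x - (\<Sum>m<3. sin_coeff m * x ^ m)\<bar> \<le> inverse (fact 3) * \<bar>x\<bar> ^ 3"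
    by (rule Maclaurin_sin_bound)
  then have "x - x ^ 3 / 6 \<le> sin x"
    using assms by (auto simp: eval_nat_numeral sin_coeff_def fact_numeral divide_simps abs_if split: if_splits)
  moreover have "0 \<le> x - x ^ 3 / 6"
  proof -
    have "x - x ^ 3 / 6 = x * (1 - x\<^sup>2 / 6)" by (simp add: power2_eq_square power3_eq_cube algebra_simps)
    then show ?thesis using assms x2 by simp
  qed
  ultimately have "(x - x ^ 3 / 6)\<^sup>2 \<le> (sin x)\<^sup>2" by (simp add: power_mono)
  moreover have "(x - x ^ 3 / 6)\<^sup>2 = x\<^sup>2 - x ^ 4 / 3 + (x ^ 3 / 6)\<^sup>2"
    by (simp add: power2_eq_square algebra_simps eval_nat_numeral)
  ultimately show 1: "x\<^sup>2 - x ^ 4 / 3 \<le> (sin x)\<^sup>2" using zero_le_power2[of "x ^ 3 / 6"] by linarith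
  have "x ^ 4 = x\<^sup>2 * x\<^sup>2" by (simp add: power2_eq_square eval_nat_numeral)
  also have "\<dots> \<le> x\<^sup>2 * (5/2)" using x2 by (intro mult_left_mono) auto
  finally show "x\<^sup>2 / 6 \<le> (sin x)\<^sup>2" using 1 by simp
qed

section \<open>Volume of the sublevel sets of \<open>ssq\<close> and integration over its
  layers\<close>

definition vol_below :: "real \<Rightarrow> real" where
  "vol_below t = measure torus {k \<in> space torus. ssq k < t}"

text \<open>The density at 0 of the law of \<open>ssq\<close> on the torus: four quarter discs, in
  the variable \<open>pi * k\<close>. Its value is \<open>1 / pi\<close>; only the symbol is carried
  along.\<close>

definition c_disc :: real where
  "c_disc = 4 * measure lborel (quarter_disc 1) / pi\<^sup>2"

lemma c_disc_nonneg: "0 \<le> c_disc"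
  by (simp add: c_disc_def)

text \<open>In the quarter cell the sublevel set lies between two quarter discs:
  \<open>sin x \<le> x\<close> places the smaller disc inside, and the quartic lower bound of the
  squared sine places the set inside the larger one.\<close>

lemma vol_below_bounds:
  assumes t: "0 < t"
  shows "t \<le> 2 \<Longrightarrow> c_disc * t \<le> vol_below t" "vol_below t \<le> c_disc * (t + 12 * t\<^sup>2)"
proof -
  let ?B = "{k \<in> space torus. ssq k < t}"
  let ?Q = "?B \<inter> {k. k $ 1 < 1/2} \<inter> {k. k $ 2 < 1/2}"
  have B: "?B \<in> sets torus" by measurable
  have B1: "?B \<inter> {k. k $ 1 < 1/2} \<in> sets torus"
    using B by (auto simp: sets_torus_iff)
  have r: "reflect a k \<in> cell" if "k \<in> cell" for a k
    using that by (auto simp: cell_def reflect_def order.strict_iff_order)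
  have "vol_below t = 2 * (2 * measure torus ?Q)"
    unfolding vol_below_def using B B1
    by (subst measure_torus_half[where a=1], simp, simp add: space_torus r)
       (subst measure_torus_half[where a=2], simp, simp add: space_torus r, simp add: reflect_def, simp)
  moreover have "?Q \<in> sets torus" using B by (auto simp: sets_torus_iff)
  ultimately have v: "vol_below t = 4 * measure lborel ?Q"
    by (simp add: measure_def emeasure_torus)
  have Qb: "?Q \<in> sets lborel" using \<open>?Q \<in> sets torus\<close> by (simp add: sets_torus_iff)
  have sub2: "?Q \<subseteq> quarter_disc ((t + 12 * t\<^sup>2) / pi\<^sup>2)"
  proof
    fix k assume k: "k \<in> ?Q"
    then have k0: "0 \<le> k $ 1" "0 \<le> k $ 2" and k1: "k $ 1 < 1/2" "k $ 2 < 1/2" and s: "ssq k < t"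
      by (auto simp: space_torus cell_def)
    define x y where "x = pi * k $ 1" and "y = pi * k $ 2"
    have x: "0 \<le> x" "x \<le> pi / 2" and y: "0 \<le> y" "y \<le> pi / 2" using k0 k1 by (auto simp: x_def y_def)
    have s': "(sin x)\<^sup>2 + (sin y)\<^sup>2 < t" using s by (simp add: ssq_alt x_def y_def)
    \<comment> \<open>A first crude bound, inserted into the quartic correction:
      \<open>(6 * t) ^ 2 / 3 = 12 * t ^ 2\<close>.\<close>
    have 6: "x\<^sup>2 + y\<^sup>2 \<le> 6 * t" using sin_sq_lower(2)[OF x] sin_sq_lower(2)[OF y] s' by simp
    have "x ^ 4 + y ^ 4 \<le> (x\<^sup>2 + y\<^sup>2)\<^sup>2"
      using mult_nonneg_nonneg[of "x\<^sup>2" "y\<^sup>2"] by (simp add: power2_eq_square eval_nat_numeral algebra_simps)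
    also have "\<dots> \<le> (6 * t)\<^sup>2" using 6 by (intro power_mono) auto
    finally have "x\<^sup>2 + y\<^sup>2 < t + 12 * t\<^sup>2"
      using sin_sq_lower(1)[OF x] sin_sq_lower(1)[OF y] s' by (simp add: power2_eq_square)
    then show "k \<in> quarter_disc ((t + 12 * t\<^sup>2) / pi\<^sup>2)"
      using k0 by (simp add: quarter_disc_def x_def y_def power_mult_distrib pos_less_divide_eq algebra_simps)
  qed
  have sub1: "t \<le> 2 \<Longrightarrow> quarter_disc (t / pi\<^sup>2) \<subseteq> ?Q"
  proof
    fix k assume t2: "t \<le> 2" and k: "k \<in> quarter_disc (t / pi\<^sup>2)"
    then have k0: "0 \<le> k $ 1" "0 \<le> k $ 2" and kk: "(k $ 1)\<^sup>2 + (k $ 2)\<^sup>2 < t / pi\<^sup>2"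
      by (auto simp: quarter_disc_def)
    have "3\<^sup>2 \<le> pi\<^sup>2" using pi_gt3 by (intro power_mono) auto
    then have "9 \<le> pi\<^sup>2" by simp
    \<comment> \<open>As 2/9 is below 1/4, the disc of squared radius \<open>t / pi ^ 2\<close> has
      radius below 1/2 and stays in the quarter cell.\<close>
    then have "t / pi\<^sup>2 \<le> 2 / 9" using t t2 by (intro frac_le) auto
    then have "(k $ 1)\<^sup>2 + (k $ 2)\<^sup>2 < 1/4" using kk by linarith
    then have "(k $ 1)\<^sup>2 < (1/2)\<^sup>2" "(k $ 2)\<^sup>2 < (1/2)\<^sup>2"
      using zero_le_power2[of "k $ 1"] zero_le_power2[of "k $ 2"] by (auto simp only: power_divide power_one power2_eq_square[of 2])
    then have k1: "k $ 1 < 1/2" "k $ 2 < 1/2" using power2_less_imp_less by fastforce+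
    have le: "(sin (pi * k $ i))\<^sup>2 \<le> (pi * k $ i)\<^sup>2" for i
      using abs_sin_x_le_abs_x[of "pi * k $ i"] abs_le_square_iff by blast
    have "ssq k \<le> pi\<^sup>2 * ((k $ 1)\<^sup>2 + (k $ 2)\<^sup>2)"
      using le[of 1] le[of 2] by (simp add: ssq_alt power_mult_distrib algebra_simps)
    also have "\<dots> < t" using kk by (simp add: pos_less_divide_eq algebra_simps)
    finally show "k \<in> ?Q" using k0 k1 by (auto simp: space_torus cell_def forall_2)
  qed
  have "measure lborel (quarter_disc (t / pi\<^sup>2)) \<le> measure lborel ?Q" if "t \<le> 2"
  proof (rule measure_mono_fmeasurable[OF sub1[OF that]])
    show "?Q \<in> fmeasurable lborel"
      using Qb emeasure_mono[OF sub2, of lborel] emeasure_quarter_disc_finite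
      by (auto simp: fmeasurable_def intro: le_less_trans)
  qed auto
  then show "c_disc * t \<le> vol_below t" if "t \<le> 2"
    unfolding v using t that by (subst (asm) measure_quarter_disc) (auto simp: c_disc_def field_simps)
  have "measure lborel ?Q \<le> measure lborel (quarter_disc ((t + 12 * t\<^sup>2) / pi\<^sup>2))"
    by (rule measure_mono_fmeasurable[OF sub2 Qb])
      (use emeasure_quarter_disc_finite in \<open>auto simp: fmeasurable_def\<close>)
  moreover have "0 < (t + 12 * t\<^sup>2) / pi\<^sup>2" using t by (simp add: add_pos_pos)
  ultimately show "vol_below t \<le> c_disc * (t + 12 * t\<^sup>2)"
    unfolding v by (subst (asm) measure_quarter_disc) (auto simp: c_disc_def field_simps)
qed

text \<open>\<open>G (ssq k) - G 2\<close> is the integral of \<open>g\<close> from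
  \<open>ssq k\<close> to 2, the bound of \<open>ssq\<close>; exchanging the two integrations by
  Fubini leaves \<open>g\<close> against the volume of the layer.\<close>

lemma measure_torus_layer_cake:
  fixes g G :: "real \<Rightarrow> real"
  assumes \<rho>: "0 < \<rho>" "\<rho> \<le> 2"
    and G: "\<And>x. \<rho> \<le> x \<Longrightarrow> x \<le> 2 \<Longrightarrow> (G has_real_derivative - g x) (at x)"
    and g: "continuous_on {\<rho>..2} g"
  shows "(\<integral>k. indicator {k. \<rho> \<le> ssq k} k * (G (ssq k) - G 2) \<partial>torus) =
    (\<integral>t. indicator {\<rho>..2} t * (g t * measure torus {k \<in> space torus. \<rho> \<le> ssq k \<and> ssq k \<le> t}) \<partial>lborel)"
proof -
  interpret T: prob_space torus by (rule prob_space_torus)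
  \<comment> \<open>On the compact range of \<open>t\<close> the measure is finite, so boundedness
    of the integrand is enough for Fubini.\<close>
  define R where "R = restrict_space lborel {\<rho>..2}"
  have sR [simp]: "space R = {\<rho>..2}" by (simp add: R_def space_restrict_space)
  interpret R: finite_measure R
    by standard (use \<rho> in \<open>simp add: R_def space_restrict_space emeasure_restrict_space\<close>)
  interpret P: pair_sigma_finite R torus ..
  interpret PF: finite_measure "R \<Otimes>\<^sub>M torus"
    by (rule finite_measure_pair_measure) unfold_locales
  have sets_R: "sets R = sets (restrict_space borel {\<rho>..2})" by (simp add: R_def sets_restrict_space)
  have g_meas [measurable]: "g \<in> borel_measurable R"
    unfolding measurable_cong_sets[OF sets_R refl]
    by (rule borel_measurable_continuous_on_restrict[OF g])
  have id_meas [measurable]: "(\<lambda>t. t) \<in> borel_measurable R"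
    unfolding measurable_cong_sets[OF sets_R refl] by (rule measurable_restrict_space1) simp
  have "bounded (g ` {\<rho>..2})"
    by (rule compact_imp_bounded[OF compact_continuous_image[OF g compact_Icc]])
  then obtain B where "\<forall>x\<in>g ` {\<rho>..2}. norm x \<le> B" unfolding bounded_iff by blast
  then have B: "\<And>t. t \<in> {\<rho>..2} \<Longrightarrow> norm (g t) \<le> B" by blast
  let ?f = "\<lambda>t k. g t * (if \<rho> \<le> ssq k \<and> ssq k \<le> t then 1 else 0)"
  have int: "integrable (R \<Otimes>\<^sub>M torus) (case_prod ?f)"
    by (rule PF.integrable_const_bound[where B=B]) (auto simp: space_pair_measure intro!: order_trans[OF _ B] AE_I2)
  have "(\<integral>k. (\<integral>t. ?f t k \<partial>R) \<partial>torus) = (\<integral>t. (\<integral>k. ?f t k \<partial>torus) \<partial>R)"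
    by (rule P.Fubini_integral[OF int])
  also have "(\<integral>t. (\<integral>k. ?f t k \<partial>torus) \<partial>R) =
     (\<integral>t. g t * measure torus {k \<in> space torus. \<rho> \<le> ssq k \<and> ssq k \<le> t} \<partial>R)"
  proof (rule Bochner_Integration.integral_cong[OF refl])
    fix t
    have "(\<integral>k. (if \<rho> \<le> ssq k \<and> ssq k \<le> t then 1 else 0::real) \<partial>torus) =
        (\<integral>k. indicator {k \<in> space torus. \<rho> \<le> ssq k \<and> ssq k \<le> t} k \<partial>torus)"
      by (rule Bochner_Integration.integral_cong) (auto simp: indicator_def)
    also have "\<dots> = measure torus {k \<in> space torus. \<rho> \<le> ssq k \<and> ssq k \<le> t}"
      by (simp add: Int_def conj_commute conj_left_commute cong: conj_cong)
    finally show "(\<integral>k. ?f t k \<partial>torus) = g t * measure torus {k \<in> space torus. \<rho> \<le> ssq k \<and> ssq k \<le> t}"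
      by simp
  qed
  also have "\<dots> = (\<integral>t. indicator {\<rho>..2} t * (g t * measure torus {k \<in> space torus. \<rho> \<le> ssq k \<and> ssq k \<le> t}) \<partial>lborel)"
    unfolding R_def by (subst integral_restrict_space) (auto)
  also have "(\<integral>k. (\<integral>t. ?f t k \<partial>R) \<partial>torus) = (\<integral>k. indicator {k. \<rho> \<le> ssq k} k * (G (ssq k) - G 2) \<partial>torus)"
  proof (rule Bochner_Integration.integral_cong[OF refl])
    fix k
    show "(\<integral>t. ?f t k \<partial>R) = indicator {k. \<rho> \<le> ssq k} k * (G (ssq k) - G 2)"
    proof (cases "\<rho> \<le> ssq k")
      case True
      have "(\<integral>t. ?f t k \<partial>R) = (\<integral>t. indicator {\<rho>..2} t * ?f t k \<partial>lborel)"
        unfolding R_def by (subst integral_restrict_space) auto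
      also have "\<dots> = (\<integral>t. indicator {ssq k..2} t *\<^sub>R g t \<partial>lborel)"
        using True by (intro Bochner_Integration.integral_cong) (auto simp: indicator_def)
      also have "\<dots> = (- G 2) - (- G (ssq k))"
      proof (rule integral_FTC_atLeastAtMost)
        show "continuous_on {ssq k..2} g" by (rule continuous_on_subset[OF g]) (use True in auto)
        show "((\<lambda>a. - G a) has_vector_derivative g x) (at x within {ssq k..2})"
          if "ssq k \<le> x" "x \<le> 2" for x
          using DERIV_minus[OF G[of x]] that True
          by (auto simp: has_real_derivative_iff_has_vector_derivative intro: has_vector_derivative_at_within)
      qed (rule ssq_le_2)
      finally show ?thesis using True by simp
    next
      case False
      then show ?thesis by simp
    qed
  qed
  finally show ?thesis .
qed

text \<open>The lower bound subtracts the volume below \<open>\<rho>\<close>, at most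
  \<open>25 * c_disc * \<rho>\<close> since \<open>\<rho> \<le> 2\<close>. For the upper bound the
  closed condition \<open>ssq k \<le> t\<close> is enlarged to \<open>ssq k < t + t ^ 2\<close>;
  with \<open>t + t ^ 2 \<le> 3 * t\<close> the quadratic coefficient becomes
  \<open>1 + 12 * 9 = 109\<close>.\<close>

lemma measure_torus_between:
  assumes \<rho>: "0 < \<rho>" "\<rho> \<le> t" "t \<le> 2"
  shows "c_disc * t - c_disc * 25 * \<rho> \<le> measure torus {k \<in> space torus. \<rho> \<le> ssq k \<and> ssq k \<le> t}"
    and "measure torus {k \<in> space torus. \<rho> \<le> ssq k \<and> ssq k \<le> t} \<le> c_disc * (t + 109 * t\<^sup>2)"
proof -
  interpret T: prob_space torus by (rule prob_space_torus)
  let ?A = "{k \<in> space torus. \<rho> \<le> ssq k \<and> ssq k \<le> t}"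
  have "vol_below t \<le> measure torus (?A \<union> {k \<in> space torus. ssq k < \<rho>})"
    unfolding vol_below_def by (rule T.finite_measure_mono) auto
  also have "\<dots> \<le> measure torus ?A + vol_below \<rho>"
    unfolding vol_below_def by (rule measure_Un_le) auto
  finally have 1: "vol_below t - vol_below \<rho> \<le> measure torus ?A" by simp
  have "c_disc * (\<rho> + 12 * \<rho>\<^sup>2) \<le> c_disc * (\<rho> + 12 * (\<rho> * 2))"
    using \<rho> c_disc_nonneg by (intro mult_left_mono add_left_mono) (auto simp: power2_eq_square)
  then show "c_disc * t - c_disc * 25 * \<rho> \<le> measure torus ?A"
    using 1 vol_below_bounds(1)[of t] vol_below_bounds(2)[of \<rho>] \<rho> by (simp add: algebra_simps)
  have t: "0 < t" using \<rho> by simp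
  have "measure torus ?A \<le> vol_below (t + t\<^sup>2)"
    unfolding vol_below_def
  proof (rule T.finite_measure_mono)
    have "0 < t\<^sup>2" using t by simp
    then have "x \<le> t \<Longrightarrow> x < t + t\<^sup>2" for x by linarith
    then show "?A \<subseteq> {k \<in> space torus. ssq k < t + t\<^sup>2}" by auto
  qed measurable
  also have "\<dots> \<le> c_disc * (t + t\<^sup>2 + 12 * (t + t\<^sup>2)\<^sup>2)"
    using t by (intro vol_below_bounds) (simp add: add_pos_pos)
  also have "\<dots> \<le> c_disc * (t + t\<^sup>2 + 12 * (3 * t)\<^sup>2)"
    using t \<rho> c_disc_nonneg by (intro mult_left_mono add_left_mono power_mono) (auto simp: power2_eq_square)
  finally show "measure torus ?A \<le> c_disc * (t + 109 * t\<^sup>2)" by (simp add: power2_eq_square algebra_simps)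
qed

lemma measurable_measure_between [measurable]:
  "(\<lambda>t. measure torus {k \<in> space torus. \<rho> \<le> ssq k \<and> ssq k \<le> t}) \<in> borel_measurable borel"
proof (rule borel_measurable_mono)
  interpret T: prob_space torus by (rule prob_space_torus)
  show "mono (\<lambda>t. measure torus {k \<in> space torus. \<rho> \<le> ssq k \<and> ssq k \<le> t})"
    by (intro monoI T.finite_measure_mono) auto
qed

lemma integrable_torus_truncated:
  assumes "continuous_on {0<..} h" "0 < \<rho>"
  shows "integrable torus (\<lambda>k. indicator {k. \<rho> \<le> ssq k} k * (h (ssq k) :: real))"
proof -
  interpret T: prob_space torus by (rule prob_space_torus)
  have c: "continuous_on {\<rho>..2} h" by (rule continuous_on_subset[OF assms(1)]) (use assms in auto)
  have "bounded (h ` {\<rho>..2})"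
    by (rule compact_imp_bounded[OF compact_continuous_image[OF c compact_Icc]])
  then obtain B where "\<forall>x\<in>h ` {\<rho>..2}. norm x \<le> B" unfolding bounded_iff by blast
  then have B: "\<And>t. t \<in> {\<rho>..2} \<Longrightarrow> norm (h t) \<le> B" by blast
  have m: "(\<lambda>x. indicator {\<rho>..2} x *\<^sub>R h x) \<in> borel_measurable borel"
    by (rule borel_measurable_continuous_on_indicator[OF _ c]) simp
  have "(\<lambda>k. indicator {k. \<rho> \<le> ssq k} k * h (ssq k)) = (\<lambda>k. indicator {\<rho>..2} (ssq k) *\<^sub>R h (ssq k))"
    using ssq_le_2 by (auto simp: indicator_def)
  then have [measurable]: "(\<lambda>k. indicator {k. \<rho> \<le> ssq k} k * h (ssq k)) \<in> borel_measurable torus"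
    using measurable_compose[OF measurable_ssq m] by simp
  show ?thesis
  proof (rule T.integrable_const_bound[where B="max 0 B"])
    show "AE k in torus. norm (indicator {k. \<rho> \<le> ssq k} k * h (ssq k)) \<le> max 0 B"
    proof (rule AE_I2)
      fix k
      show "norm (indicator {k. \<rho> \<le> ssq k} k * h (ssq k)) \<le> max 0 B"
        using B[of "ssq k"] ssq_le_2[of k] by (cases "\<rho> \<le> ssq k") auto
    qed
  qed measurable
qed

lemma integrable_torus_indicator_const: "integrable torus (\<lambda>k. indicator {k. \<rho> \<le> ssq k} k * (c::real))"
proof -
  interpret T: prob_space torus by (rule prob_space_torus)
  show ?thesis
    by (rule T.integrable_const_bound[where B="\<bar>c\<bar>"]) (auto simp: indicator_def)
qed

text \<open>The layer cake with \<open>G t = 1 / t\<close> leaves the integral of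
  \<open>1 / t ^ 2\<close> against the layer volume, which is \<open>c_disc * t\<close> up to a
  quadratic error and an error of order \<open>\<rho>\<close>. The main part gives the logarithm,
  the quadratic error contributes at most \<open>218 * c_disc\<close>, the other at most
  \<open>25 * c_disc\<close>, and the summand 1 covers the boundary value
  \<open>G 2 = 1 / 2\<close>.\<close>

lemma integral_inverse_ssq_asymp:
  assumes \<rho>: "0 < \<rho>" "\<rho> \<le> 2"
  shows "\<bar>(\<integral>k. indicator {k. \<rho> \<le> ssq k} k * (1 / ssq k) \<partial>torus) - c_disc * ln (1 / \<rho>)\<bar> \<le> 1 + 250 * c_disc"
proof -
  interpret T: prob_space torus by (rule prob_space_torus)
  let ?m = "\<lambda>t. measure torus {k \<in> space torus. \<rho> \<le> ssq k \<and> ssq k \<le> t}"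
  let ?J = "\<integral>k. indicator {k. \<rho> \<le> ssq k} k * (1 / ssq k) \<partial>torus"
  let ?L = "\<integral>t. indicator {\<rho>..2} t * (1 / t\<^sup>2 * ?m t) \<partial>lborel"
  have "(\<integral>k. indicator {k. \<rho> \<le> ssq k} k * (1 / ssq k - 1 / 2) \<partial>torus) = ?L"
    by (rule measure_torus_layer_cake[OF \<rho>, of "\<lambda>t. 1 / t"])
      (use \<rho> in \<open>auto intro!: derivative_eq_intros continuous_intros simp: power2_eq_square\<close>)
  moreover have "(\<integral>k. indicator {k. \<rho> \<le> ssq k} k * (1 / ssq k - 1 / 2) \<partial>torus) =
      ?J - (\<integral>k. indicator {k. \<rho> \<le> ssq k} k * (1 / 2 :: real) \<partial>torus)"
    unfolding right_diff_distrib
    using \<rho> by (intro Bochner_Integration.integral_diff integrable_torus_indicator_const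
        integrable_torus_truncated[of "\<lambda>x. 1 / x"]) (auto intro!: continuous_intros)
  moreover have "0 \<le> (\<integral>k. indicator {k. \<rho> \<le> ssq k} k * (1 / 2 :: real) \<partial>torus)"
    by (rule integral_nonneg_AE) auto
  moreover have "(\<integral>k. indicator {k. \<rho> \<le> ssq k} k * (1 / 2 :: real) \<partial>torus) \<le> 1"
    by (rule T.integral_le_const[OF integrable_torus_indicator_const]) (auto simp: indicator_def)
  ultimately have JL: "?L \<le> ?J" "?J \<le> ?L + 1" by linarith+
  \<comment> \<open>One antiderivative with free coefficients serves both the upper and the lower
    comparison function.\<close>
  have FTC: "(\<integral>t. indicator {\<rho>..2} t *\<^sub>R (a / t + b + d / t\<^sup>2) \<partial>lborel) = 
      (a * ln 2 + b * 2 - d / 2) - (a * ln \<rho> + b * \<rho> - d / \<rho>)" for a b d :: real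
    by (rule integral_FTC_atLeastAtMost[of _ _ "\<lambda>t. a * ln t + b * t - d / t"])
      (use \<rho> in \<open>auto intro!: derivative_eq_intros continuous_intros simp: power2_eq_square
         simp flip: has_real_derivative_iff_has_vector_derivative\<close>)
  have int: "integrable lborel (\<lambda>t. indicator {\<rho>..2} t *\<^sub>R (a / t + b + d / t\<^sup>2))" for a b d :: real
    by (rule borel_integrable_compact) (use \<rho> in \<open>auto intro!: continuous_intros\<close>)
  have int2: "integrable lborel (\<lambda>t. indicator {\<rho>..2} t * (1 / t\<^sup>2 * ?m t))"
  proof (rule Bochner_Integration.integrable_bound[OF int[of 0 0 1]])
    show "AE t in lborel. norm (indicator {\<rho>..2} t * (1 / t\<^sup>2 * ?m t)) \<le> norm (indicator {\<rho>..2} t *\<^sub>R (0 / t + 0 + 1 / t\<^sup>2) :: real)"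
      using T.prob_le_1 by (auto simp: abs_mult mult_left_le intro!: mult_left_mono divide_right_mono AE_I2)
  qed measurable
  have "?L \<le> (\<integral>t. indicator {\<rho>..2} t *\<^sub>R (c_disc / t + 109 * c_disc + 0 / t\<^sup>2) \<partial>lborel)"
  proof (rule integral_mono[OF int2 int])
    fix t
    show "indicator {\<rho>..2} t * (1 / t\<^sup>2 * ?m t) \<le> indicator {\<rho>..2} t *\<^sub>R (c_disc / t + 109 * c_disc + 0 / t\<^sup>2)"
    proof (cases "t \<in> {\<rho>..2}")
      case True
      then have "1 / t\<^sup>2 * ?m t \<le> 1 / t\<^sup>2 * (c_disc * (t + 109 * t\<^sup>2))"
        using \<rho> by (intro mult_left_mono measure_torus_between) auto
      also have "\<dots> = c_disc / t + 109 * c_disc"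
        using True \<rho> by (simp add: field_simps power2_eq_square)
      finally show ?thesis using True by simp
    qed auto
  qed
  then have "?L \<le> c_disc * ln 2 + 218 * c_disc - (c_disc * ln \<rho> + 109 * (c_disc * \<rho>))"
    unfolding FTC by simp
  moreover have "0 \<le> c_disc * \<rho>" using \<rho> c_disc_nonneg by simp
  ultimately have up: "?L \<le> c_disc * ln 2 + 218 * c_disc - c_disc * ln \<rho>" by linarith
  have "(\<integral>t. indicator {\<rho>..2} t *\<^sub>R (c_disc / t + 0 + (- 25 * c_disc * \<rho>) / t\<^sup>2) \<partial>lborel) \<le> ?L"
  proof (rule integral_mono[OF int int2])
    fix t
    show "indicator {\<rho>..2} t *\<^sub>R (c_disc / t + 0 + (- 25 * c_disc * \<rho>) / t\<^sup>2) \<le> indicator {\<rho>..2} t * (1 / t\<^sup>2 * ?m t)"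
    proof (cases "t \<in> {\<rho>..2}")
      case True
      then have "1 / t\<^sup>2 * (c_disc * t - c_disc * 25 * \<rho>) \<le> 1 / t\<^sup>2 * ?m t"
        using \<rho> by (intro mult_left_mono measure_torus_between) auto
      moreover have "1 / t\<^sup>2 * (c_disc * t - c_disc * 25 * \<rho>) = c_disc / t + 0 + (- 25 * c_disc * \<rho>) / t\<^sup>2"
        using True \<rho> by (simp add: field_simps power2_eq_square)
      ultimately show ?thesis using True by simp
    qed auto
  qed
  then have "c_disc * ln 2 - 25 * c_disc - c_disc * ln \<rho> + 25 * (c_disc * \<rho>) / 2 \<le> ?L"
    unfolding FTC using \<rho> by simp
  moreover have "0 \<le> c_disc * \<rho>" using \<rho> c_disc_nonneg by simp
  ultimately have lo: "c_disc * ln 2 - 25 * c_disc - c_disc * ln \<rho> \<le> ?L" by linarith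
  have "c_disc * ln 2 \<le> c_disc * 1"
    by (rule mult_left_mono) (use c_disc_nonneg ln2_le_25_over_36 in auto)
  moreover have "0 \<le> c_disc * ln 2" using c_disc_nonneg by simp
  ultimately have "0 \<le> c_disc * ln 2" "c_disc * ln 2 \<le> c_disc" by simp_all
  moreover have "c_disc * ln (1 / \<rho>) = - (c_disc * ln \<rho>)" using \<rho> by (simp add: ln_div)
  ultimately have "?J - c_disc * ln (1 / \<rho>) \<le> 1 + 250 * c_disc"
      "- (?J - c_disc * ln (1 / \<rho>)) \<le> 1 + 250 * c_disc"
    using JL up lo c_disc_nonneg by linarith+
  then show ?thesis by (rule abs_leI)
qed

text \<open>Layer cake with \<open>G t = 1 / t ^ 2\<close>. For \<open>t \<le> 2\<close> the layer
  volume is at most \<open>219 * c_disc * t\<close>, which leaves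
  \<open>438 * c_disc / t ^ 2\<close> to integrate; the boundary value 1/4 is absorbed by
  \<open>1 / \<rho>\<close>.\<close>

lemma integral_inverse_ssq_sq_le:
  assumes \<rho>: "0 < \<rho>" "\<rho> \<le> 2"
  shows "(\<integral>k. indicator {k. \<rho> \<le> ssq k} k * (1 / (ssq k)\<^sup>2) \<partial>torus) \<le> (1 + 438 * c_disc) / \<rho>"
proof -
  interpret T: prob_space torus by (rule prob_space_torus)
  let ?m = "\<lambda>t. measure torus {k \<in> space torus. \<rho> \<le> ssq k \<and> ssq k \<le> t}"
  let ?J = "\<integral>k. indicator {k. \<rho> \<le> ssq k} k * (1 / (ssq k)\<^sup>2) \<partial>torus"
  let ?L = "\<integral>t. indicator {\<rho>..2} t * (2 / t ^ 3 * ?m t) \<partial>lborel"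
  have "(\<integral>k. indicator {k. \<rho> \<le> ssq k} k * (1 / (ssq k)\<^sup>2 - 1 / 2\<^sup>2) \<partial>torus) = ?L"
    by (rule measure_torus_layer_cake[OF \<rho>, of "\<lambda>t. 1 / t\<^sup>2"])
      (use \<rho> in \<open>auto intro!: derivative_eq_intros continuous_intros simp: power2_eq_square power3_eq_cube\<close>)
  moreover have "(\<integral>k. indicator {k. \<rho> \<le> ssq k} k * (1 / (ssq k)\<^sup>2 - 1 / 2\<^sup>2) \<partial>torus) =
      ?J - (\<integral>k. indicator {k. \<rho> \<le> ssq k} k * (1 / 2\<^sup>2 :: real) \<partial>torus)"
    unfolding right_diff_distrib
    using \<rho> by (intro Bochner_Integration.integral_diff integrable_torus_indicator_const
        integrable_torus_truncated[of "\<lambda>x. 1 / x\<^sup>2"]) (auto intro!: continuous_intros)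
  moreover have "(\<integral>k. indicator {k. \<rho> \<le> ssq k} k * (1 / 2\<^sup>2 :: real) \<partial>torus) \<le> 1 / 4"
    by (rule T.integral_le_const[OF integrable_torus_indicator_const]) (auto simp: indicator_def)
  ultimately have JL: "?J \<le> ?L + 1/4" by linarith
  have FTC: "(\<integral>t. indicator {\<rho>..2} t *\<^sub>R (d / t\<^sup>2) \<partial>lborel) = (- d / 2) - (- d / \<rho>)" for d :: real
    by (rule integral_FTC_atLeastAtMost[of _ _ "\<lambda>t. - d / t"])
      (use \<rho> in \<open>auto intro!: derivative_eq_intros continuous_intros simp: power2_eq_square
         simp flip: has_real_derivative_iff_has_vector_derivative\<close>)
  have int: "integrable lborel (\<lambda>t. indicator {\<rho>..2} t *\<^sub>R (h t :: real))" if "continuous_on {\<rho>..2} h" for h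
    by (rule borel_integrable_compact) (use that in auto)
  have c3: "continuous_on {\<rho>..2} (\<lambda>t. 2 / t ^ 3)" "continuous_on {\<rho>..2} (\<lambda>t. d / t\<^sup>2)" for d :: real
    using \<rho> by (auto intro!: continuous_intros)
  have int2: "integrable lborel (\<lambda>t. indicator {\<rho>..2} t * (2 / t ^ 3 * ?m t))"
  proof (rule Bochner_Integration.integrable_bound[OF int[OF c3(1)]])
    show "AE t in lborel. norm (indicator {\<rho>..2} t * (2 / t ^ 3 * ?m t)) \<le> norm (indicator {\<rho>..2} t *\<^sub>R (2 / t ^ 3) :: real)"
      using T.prob_le_1 by (auto simp: abs_mult mult_left_le intro!: mult_left_mono divide_right_mono)
  qed measurable
  have "?L \<le> (\<integral>t. indicator {\<rho>..2} t *\<^sub>R (438 * c_disc / t\<^sup>2) \<partial>lborel)"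
  proof (rule integral_mono[OF int2 int[OF c3(2)]])
    fix t
    show "indicator {\<rho>..2} t * (2 / t ^ 3 * ?m t) \<le> indicator {\<rho>..2} t *\<^sub>R (438 * c_disc / t\<^sup>2)"
    proof (cases "t \<in> {\<rho>..2}")
      case True
      then have t: "0 < t" "t \<le> 2" using \<rho> by auto
      have "?m t \<le> c_disc * (t + 109 * t\<^sup>2)" using True \<rho> by (intro measure_torus_between) auto
      also have "\<dots> \<le> c_disc * (219 * t)"
        using t by (intro mult_left_mono c_disc_nonneg) (simp add: power2_eq_square)
      finally have "2 / t ^ 3 * ?m t \<le> 2 / t ^ 3 * (c_disc * (219 * t))"
        using t by (intro mult_left_mono) auto
      also have "\<dots> = 438 * c_disc / t\<^sup>2"
        using t by (simp add: field_simps power2_eq_square power3_eq_cube)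
      finally show ?thesis using True by simp
    qed auto
  qed
  then have "?L \<le> 438 * c_disc / \<rho>"
    unfolding FTC using c_disc_nonneg by simp
  moreover have "1 / 4 \<le> 1 / \<rho>" using \<rho> by (intro frac_le) auto
  ultimately show ?thesis using JL by (simp add: add_divide_distrib)
qed

lemma vol_below_le: "0 < \<rho> \<Longrightarrow> \<rho> \<le> 2 \<Longrightarrow> vol_below \<rho> \<le> 25 * c_disc * \<rho>"
proof -
  assume \<rho>: "0 < \<rho>" "\<rho> \<le> 2"
  have "vol_below \<rho> \<le> c_disc * (\<rho> + 12 * \<rho>\<^sup>2)" by (rule vol_below_bounds) (rule \<rho>)
  also have "\<dots> \<le> c_disc * (\<rho> + 12 * (\<rho> * 2))"
    using \<rho> c_disc_nonneg by (intro mult_left_mono add_left_mono) (auto simp: power2_eq_square)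
  finally show ?thesis by simp
qed

section \<open>Means of squared sines and moments of the exponential law\<close>

lemma lborel_real2_eq_distr:
  "lborel = distr (lborel \<Otimes>\<^sub>M lborel) borel (\<lambda>(x, y). \<chi> i. if i = 1 then x else (y::real) :: real^2)"
proof (rule lborel_eqI_2)
  fix l u :: "real^2" assume le: "l $ 1 \<le> u $ 1" "l $ 2 \<le> u $ 2"
  have m: "(\<lambda>(x, y). \<chi> i. if i = 1 then x else (y::real) :: real^2) \<in> borel_measurable (lborel \<Otimes>\<^sub>M lborel)"
    by measurable
  have "(\<lambda>(x, y). \<chi> i. if i = 1 then x else (y::real) :: real^2) -` box l u \<inter> space (lborel \<Otimes>\<^sub>M lborel) = {l $ 1<..<u $ 1} \<times> {l $ 2<..<u $ 2}"
    by (auto simp: mem_box_cart forall_2 space_pair_measure)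
  then show "emeasure (distr (lborel \<Otimes>\<^sub>M lborel) borel (\<lambda>(x, y). \<chi> i. if i = 1 then x else (y::real) :: real^2)) (box l u) =
      ennreal ((u $ 1 - l $ 1) * (u $ 2 - l $ 2))"
    using le m by (subst emeasure_distr) (auto simp: lborel.emeasure_pair_measure_Times ennreal_mult)
qed simp

lemma integral_sin_sq_torus: "(\<integral>k. (sin (pi * k $ i))\<^sup>2 \<partial>torus) = 1 / 2"
proof -
  interpret T: prob_space torus by (rule prob_space_torus)
  have P: "pair_sigma_finite (lborel :: real measure) (lborel :: real measure)" ..
  have 1: "(\<integral>k. (sin (pi * k $ 1))\<^sup>2 \<partial>torus) = 1 / 2"
  proof -
    let ?g = "\<lambda>x::real. indicator {0..<1} x * (sin (pi * x))\<^sup>2 :: real"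
    let ?I = "indicator {0..<1} :: real \<Rightarrow> real"
    have "(\<integral>k. (sin (pi * k $ 1))\<^sup>2 \<partial>torus) = (\<integral>k. indicator cell k *\<^sub>R (sin (pi * k $ 1))\<^sup>2 \<partial>lborel)"
      unfolding torus_def cell_def[symmetric] by (subst integral_restrict_space) auto
    also have "\<dots> = (\<integral>p. ?g (fst p) * ?I (snd p) \<partial>(lborel \<Otimes>\<^sub>M lborel))"
      by (subst lborel_real2_eq_distr, subst integral_distr)
        (auto intro!: Bochner_Integration.integral_cong simp: cell_def forall_2 indicator_def split: if_splits)
    also have "\<dots> = (\<integral>x. (\<integral>y. ?g x * ?I y \<partial>lborel) \<partial>lborel)"
    proof (subst pair_sigma_finite.integral_fst'[OF P, symmetric])
      show "integrable (lborel \<Otimes>\<^sub>M lborel) (\<lambda>p. ?g (fst p) * ?I (snd p))"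
      proof (rule Bochner_Integration.integrable_bound)
        show "integrable (lborel \<Otimes>\<^sub>M lborel) (indicator ({0..<1::real} \<times> {0..<1::real}) :: _ \<Rightarrow> real)"
          by (auto simp: lborel.emeasure_pair_measure_Times)
        show "AE p in lborel \<Otimes>\<^sub>M lborel. norm (?g (fst p) * ?I (snd p)) \<le> norm (indicator ({0..<1::real} \<times> {0..<1::real}) p :: real)"
          by (auto simp: indicator_def abs_square_le_1)
      qed measurable
    qed auto
    also have "\<dots> = (\<integral>x. ?g x \<partial>lborel)" by simp
    also have "\<dots> = (\<integral>x. indicator {0..1} x *\<^sub>R (sin (pi * x))\<^sup>2 \<partial>lborel)"
      by (rule Bochner_Integration.integral_cong) (auto simp: indicator_def)
    also have "\<dots> = (1 / 2 - sin (2 * pi * 1) / (4 * pi)) - (0 / 2 - sin (2 * pi * 0) / (4 * pi))"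
    proof (rule integral_FTC_atLeastAtMost[of _ _ "\<lambda>x. x / 2 - sin (2 * pi * x) / (4 * pi)"])
      fix x :: real
      have "((\<lambda>x. x / 2 - sin (2 * pi * x) / (4 * pi)) has_real_derivative 1 / 2 - cos (2 * (pi * x)) / 2) (at x within {0..1})"
        by (auto intro!: derivative_eq_intros simp: field_simps)
      then show "((\<lambda>x. x / 2 - sin (2 * pi * x) / (4 * pi)) has_vector_derivative (sin (pi * x))\<^sup>2) (at x within {0..1})"
        by (simp add: cos_double_sin diff_divide_distrib has_real_derivative_iff_has_vector_derivative)
    qed (auto intro!: continuous_intros)
    also have "\<dots> = 1 / 2" by simp
    finally show ?thesis .
  qed
  have "(\<integral>k. (sin (pi * swap k $ 1))\<^sup>2 \<partial>torus) = (\<integral>k. (sin (pi * k $ 1))\<^sup>2 \<partial>torus)"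
    by (rule integral_torus_swap) measurable
  then show ?thesis using 1 exhaust_2[of i] by auto
qed

lemma prob_space_exp1: "prob_space exp1"
  unfolding exp1_def by (rule prob_space_exponential_density) simp

lemma sets_exp1 [measurable_cong, simp]: "sets exp1 = sets borel"
  and space_exp1 [simp]: "space exp1 = UNIV"
  by (simp_all add: exp1_def)

lemma AE_exp1_nonneg: "AE x in exp1. 0 \<le> x"
  unfolding exp1_def by (subst AE_density) (auto simp: exponential_density_def)

text \<open>The exponential law is the Erlang law with index 0, whose moments are
  factorials.\<close>

lemma exp1_moment: "has_bochner_integral exp1 (\<lambda>x. x ^ n) (fact n)"
proof (rule has_bochner_integral_nn_integral)
  show "AE x in exp1. 0 \<le> x ^ n" using AE_exp1_nonneg by eventually_elim auto
  have "(\<integral>\<^sup>+x. ennreal (x ^ n) \<partial>exp1) = (\<integral>\<^sup>+x. ennreal (erlang_density 0 1 x * x ^ n) \<partial>lborel)"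
    unfolding exp1_def by (subst nn_integral_density)
      (auto intro!: nn_integral_cong simp: exponential_density_def erlang_density_def simp flip: ennreal_mult')
  also have "\<dots> = ennreal (fact n)"
    using nn_integral_erlang_ith_moment[of 1 0 n] by simp
  finally show "(\<integral>\<^sup>+x. ennreal (x ^ n) \<partial>exp1) = ennreal (fact n)" .
qed auto

section \<open>Increments\<close>

text \<open>The displacement per unit of exponential time: the \<open>l\<close>-th step of the walk
  is \<open>e l *\<^sub>R vf (X l)\<close>.\<close>

definition vf :: "real ^ 2 \<Rightarrow> real ^ 2" where
  "vf k = (1 / Phi k) *\<^sub>R velocity k"

lemma Phi_eq: "Phi k = 8 * ssq k"
  by (simp add: Phi_def ssq_def)

lemma vf_nth: "vf k $ i = sin (pi * k $ i) * cos (pi * k $ i) / (8 * ssq k * sqrt (ssq k))"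
  by (simp add: vf_def velocity_def Phi_eq ssq_def)

lemma measurable_vf_nth [measurable]: "(\<lambda>k. vf k $ i) \<in> borel_measurable torus"
  unfolding vf_nth by measurable

lemma measurable_vf [measurable]: "vf \<in> borel_measurable torus"
proof -
  have "(\<lambda>k. \<chi> i. vf k $ i) \<in> borel_measurable torus"
    by (rule borel_measurable_vec_lambda[OF measurable_vf_nth])
  then show ?thesis by (simp add: vec_lambda_eta)
qed

lemma vf_reflect: "vf (reflect a k) $ i = (if i = a then - 1 else 1) * vf k $ i"
  unfolding vf_nth ssq_reflect sin_cos_reflect by simp

lemma vf_swap: "vf (swap k) $ 1 = vf k $ 2" "vf (swap k) $ 2 = vf k $ 1"
  unfolding vf_nth by simp_all

lemma sin_sq_le_ssq: "(sin (pi * k $ i))\<^sup>2 \<le> ssq k"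
  using exhaust_2[of i] by (auto simp: ssq_alt)

lemma vf_nth_sq: "(vf k $ i)\<^sup>2 = ((sin (pi * k $ i))\<^sup>2 - (sin (pi * k $ i)) ^ 4) / (64 * (ssq k) ^ 3)"
proof -
  have "(sin (pi * k $ i) * cos (pi * k $ i))\<^sup>2 = (sin (pi * k $ i))\<^sup>2 * (1 - (sin (pi * k $ i))\<^sup>2)"
    by (simp add: power_mult_distrib cos_squared_eq)
  then have "(sin (pi * k $ i) * cos (pi * k $ i))\<^sup>2 = (sin (pi * k $ i))\<^sup>2 - (sin (pi * k $ i)) ^ 4"
    by (simp add: right_diff_distrib flip: power_add power2_eq_square)
  moreover have "(8 * ssq k * sqrt (ssq k))\<^sup>2 = 64 * (ssq k) ^ 3"
    using ssq_nonneg[of k] by (simp add: power_mult_distrib eval_nat_numeral)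
  ultimately show ?thesis by (simp add: vf_nth power_divide)
qed

lemma vf_nth_sq_le: "(vf k $ i)\<^sup>2 \<le> 1 / (8 * ssq k)\<^sup>2"
proof (cases "ssq k = 0")
  case False
  then have s: "0 < ssq k" using ssq_nonneg[of k] by simp
  have "(sin (pi * k $ i))\<^sup>2 - (sin (pi * k $ i)) ^ 4 \<le> ssq k"
    using sin_sq_le_ssq[of k i] zero_le_even_power[of 4 "sin (pi * k $ i)", OF even_numeral] by linarith
  then have "(vf k $ i)\<^sup>2 \<le> ssq k / (64 * (ssq k) ^ 3)"
    unfolding vf_nth_sq using s by (intro divide_right_mono) auto
  also have "\<dots> = 1 / (8 * ssq k)\<^sup>2" using s by (simp add: field_simps eval_nat_numeral)
  finally show ?thesis .
qed (simp add: vf_nth_sq)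

lemma abs_vf_nth_le: "\<bar>vf k $ i\<bar> \<le> 1 / (8 * ssq k)"
proof -
  have "(vf k $ i)\<^sup>2 \<le> (1 / (8 * ssq k))\<^sup>2" using vf_nth_sq_le[of k i] by (simp add: power_divide)
  then have "\<bar>vf k $ i\<bar> \<le> \<bar>1 / (8 * ssq k)\<bar>" by (simp only: abs_le_square_iff)
  then show ?thesis using ssq_nonneg[of k] by simp
qed

text \<open>Summed over the two coordinates the squared sines rebuild \<open>ssq\<close>, so the
  singular part is exactly \<open>1 / (64 * ssq k)\<close> with no angular dependence, and the
  remaining quotient is bounded by 1. At \<open>ssq k = 0\<close> both sides vanish by the
  convention for division.\<close>

lemma vf_sq_sum: "((vf k $ 1)\<^sup>2 + (vf k $ 2)\<^sup>2) * ssq k =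
    (1 / 64) * (1 / ssq k) - (1 / 64) * (((sin (pi * k $ 1)) ^ 4 + (sin (pi * k $ 2)) ^ 4) / (ssq k)\<^sup>2)"
proof (cases "ssq k = 0")
  case False
  have "(vf k $ 1)\<^sup>2 + (vf k $ 2)\<^sup>2 =
     (ssq k - ((sin (pi * k $ 1)) ^ 4 + (sin (pi * k $ 2)) ^ 4)) / (64 * (ssq k) ^ 3)"
    unfolding vf_nth_sq by (simp add: ssq_alt add_divide_distrib diff_divide_distrib)
  then show ?thesis using False by (simp add: field_simps eval_nat_numeral)
qed simp

lemma norm_vec2_sq: "(norm (x :: real^2))\<^sup>2 = (x $ 1)\<^sup>2 + (x $ 2)\<^sup>2"
  by (simp add: norm_vec_def L2_set_def UNIV_2)

lemma norm_vf_sq_le: "(norm (vf k))\<^sup>2 \<le> 1 / (8 * ssq k)\<^sup>2"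
proof (cases "ssq k = 0")
  case True then show ?thesis by (simp add: norm_vec2_sq vf_nth_sq)
next
  case False
  then have s: "0 < ssq k" using ssq_nonneg[of k] by simp
  have "(norm (vf k))\<^sup>2 * ssq k \<le> (1 / 64) * (1 / ssq k)"
    unfolding norm_vec2_sq vf_sq_sum using s by simp
  then show ?thesis using s by (simp add: field_simps eval_nat_numeral)
qed

lemma sum_sin_4_le: "(sin (pi * k $ 1)) ^ 4 + (sin (pi * k $ 2)) ^ 4 \<le> (ssq k)\<^sup>2"
  using mult_nonneg_nonneg[of "(sin (pi * k $ 1))\<^sup>2" "(sin (pi * k $ 2))\<^sup>2"]
  by (simp add: ssq_alt power2_sum flip: power_mult)

section \<open>Truncated second moments of a step\<close>

abbreviation far :: "real \<Rightarrow> real^2 \<Rightarrow> real" where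
  "far \<rho> k \<equiv> indicator {k. \<rho> \<le> ssq k} k"

text \<open>The factor \<open>ssq\<close> is the invariant density, so this is the stationary second
  moment of one coordinate of \<open>vf\<close>, restricted to positions away from the
  singularity.\<close>

definition trunc_var :: "real \<Rightarrow> real" where
  "trunc_var \<rho> = (\<integral>k. far \<rho> k * ((vf k $ 1)\<^sup>2 * ssq k) \<partial>torus)"

lemma integrable_far_bound:
  assumes [measurable]: "g \<in> borel_measurable torus" and "0 < \<rho>"
    and "\<And>k. \<bar>g k\<bar> \<le> h (ssq k)" "continuous_on {0<..} h"
  shows "integrable torus (\<lambda>k. far \<rho> k * (g k :: real))"
  by (rule Bochner_Integration.integrable_bound[OF integrable_torus_truncated[OF assms(4,2)]])
    (use assms(3) in \<open>auto simp: indicator_def intro!: AE_I2 order_trans[OF assms(3)]\<close>)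

lemma vf_prod_le: "\<bar>vf k $ i * vf k $ j * ssq k\<bar> \<le> 1 / (64 * ssq k)"
proof (cases "ssq k = 0")
  case False
  have "\<bar>vf k $ i\<bar> * \<bar>vf k $ j\<bar> * ssq k \<le> 1 / (8 * ssq k) * (1 / (8 * ssq k)) * ssq k"
    using ssq_nonneg[of k] by (intro mult_mono abs_vf_nth_le) auto
  also have "\<dots> = 1 / (64 * ssq k)" using False by simp
  finally show ?thesis using ssq_nonneg[of k] by (simp add: abs_mult)
qed simp

lemma integrable_far_prod: "0 < \<rho> \<Longrightarrow> integrable torus (\<lambda>k. far \<rho> k * (vf k $ i * vf k $ j * ssq k))"
  by (rule integrable_far_bound[where h = "\<lambda>s. 1 / (64 * s)"])
    (auto intro!: vf_prod_le continuous_intros)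

lemma trunc_var_component: "(\<integral>k. far \<rho> k * ((vf k $ i)\<^sup>2 * ssq k) \<partial>torus) = trunc_var \<rho>"
proof -
  have "(\<integral>k. far \<rho> (swap k) * ((vf (swap k) $ 1)\<^sup>2 * ssq (swap k)) \<partial>torus) = trunc_var \<rho>"
    unfolding trunc_var_def by (rule integral_torus_swap) measurable
  then have "(\<integral>k. far \<rho> k * ((vf k $ 2)\<^sup>2 * ssq k) \<partial>torus) = trunc_var \<rho>"
    by (simp add: vf_swap indicator_def)
  then show ?thesis using exhaust_2[of i] by (auto simp: trunc_var_def)
qed

text \<open>Reflecting the first coordinate changes the sign of the integrand and preserves the
  measure.\<close>

lemma far_cross_zero: "(\<integral>k. far \<rho> k * (vf k $ 1 * vf k $ 2 * ssq k) \<partial>torus) = 0"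
proof -
  let ?f = "\<lambda>k. far \<rho> k * (vf k $ 1 * vf k $ 2 * ssq k)"
  have "(\<integral>k. ?f (reflect 1 k) \<partial>torus) = (\<integral>k. ?f k \<partial>torus)"
    by (rule integral_torus_reflect) measurable
  moreover have "?f (reflect 1 k) = - ?f k" for k
    by (simp add: vf_reflect indicator_def)
  ultimately show ?thesis by simp
qed

text \<open>The swap equalises the diagonal terms and the reflection removes the cross term: the
  truncated covariance matrix is a multiple of the identity, which is the origin of the isotropy of
  the limit.\<close>

lemma far_inner_sq:
  assumes "0 < \<rho>"
  shows "(\<integral>k. far \<rho> k * ((w \<bullet> vf k)\<^sup>2 * ssq k) \<partial>torus) = (norm w)\<^sup>2 * trunc_var \<rho>"
proof -
  note int = integrable_far_prod[OF assms]
  have "far \<rho> k * ((w \<bullet> vf k)\<^sup>2 * ssq k) =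
      (w $ 1)\<^sup>2 * (far \<rho> k * (vf k $ 1 * vf k $ 1 * ssq k)) + (w $ 2)\<^sup>2 * (far \<rho> k * (vf k $ 2 * vf k $ 2 * ssq k))
      + 2 * w $ 1 * w $ 2 * (far \<rho> k * (vf k $ 1 * vf k $ 2 * ssq k))" for k
    by (simp add: inner_vec_def UNIV_2 power2_eq_square algebra_simps)
  then have "(\<integral>k. far \<rho> k * ((w \<bullet> vf k)\<^sup>2 * ssq k) \<partial>torus) =
      (w $ 1)\<^sup>2 * (\<integral>k. far \<rho> k * (vf k $ 1 * vf k $ 1 * ssq k) \<partial>torus) +
      (w $ 2)\<^sup>2 * (\<integral>k. far \<rho> k * (vf k $ 2 * vf k $ 2 * ssq k) \<partial>torus) +
      2 * w $ 1 * w $ 2 * (\<integral>k. far \<rho> k * (vf k $ 1 * vf k $ 2 * ssq k) \<partial>torus)"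
    using int by simp
  also have "\<dots> = (norm w)\<^sup>2 * trunc_var \<rho>"
    unfolding far_cross_zero norm_vec2_sq using trunc_var_component[of \<rho> 1] trunc_var_component[of \<rho> 2]
    by (simp add: power2_eq_square algebra_simps)
  finally show ?thesis .
qed

text \<open>Twice \<open>trunc_var\<close> is the truncated second moment of the full vector, where
  the singular part is \<open>1 / (64 * ssq k)\<close>; halving gives the constant 1/128. The
  angular remainder is bounded and goes into the error.\<close>

lemma trunc_var_asymp:
  assumes \<rho>: "0 < \<rho>" "\<rho> \<le> 2"
  shows "\<bar>trunc_var \<rho> - c_disc / 128 * ln (1 / \<rho>)\<bar> \<le> 2 + 250 * c_disc"
proof -
  interpret T: prob_space torus by (rule prob_space_torus)
  let ?J = "\<integral>k. far \<rho> k * (1 / ssq k) \<partial>torus"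
  let ?q = "\<lambda>k::real^2. ((sin (pi * k $ 1)) ^ 4 + (sin (pi * k $ 2)) ^ 4) / (ssq k)\<^sup>2"
  have q: "0 \<le> ?q k" "?q k \<le> 1" for k
    using sum_sin_4_le[of k] by (auto intro!: divide_le_eq_1[THEN iffD2] divide_nonneg_nonneg simp: order_less_le)
  have intq: "integrable torus (\<lambda>k. far \<rho> k * ?q k)"
    by (rule T.integrable_const_bound[where B=1]) (use q in \<open>auto simp: indicator_def\<close>)
  have intJ: "integrable torus (\<lambda>k. far \<rho> k * (1 / ssq k))"
    by (rule integrable_torus_truncated[of "\<lambda>x. 1 / x"]) (use \<rho> in \<open>auto intro!: continuous_intros\<close>)
  have "2 * trunc_var \<rho> = (\<integral>k. far \<rho> k * (vf k $ 1 * vf k $ 1 * ssq k) \<partial>torus) + (\<integral>k. far \<rho> k * (vf k $ 2 * vf k $ 2 * ssq k) \<partial>torus)"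
    using trunc_var_component[of \<rho> 1] trunc_var_component[of \<rho> 2] by (simp add: power2_eq_square)
  also have "\<dots> = (\<integral>k. far \<rho> k * (((vf k $ 1)\<^sup>2 + (vf k $ 2)\<^sup>2) * ssq k) \<partial>torus)"
    using integrable_far_prod[OF \<rho>(1)]
    by (subst Bochner_Integration.integral_add[symmetric]) (auto simp: power2_eq_square algebra_simps)
  also have "\<dots> = (\<integral>k. (1/64) * (far \<rho> k * (1 / ssq k)) - (1/64) * (far \<rho> k * ?q k) \<partial>torus)"
    unfolding vf_sq_sum by (rule Bochner_Integration.integral_cong) (auto simp: algebra_simps)
  also have "\<dots> = (1/64) * ?J - (1/64) * (\<integral>k. far \<rho> k * ?q k \<partial>torus)"
    using intJ intq
    by (simp only: Bochner_Integration.integral_diff integrable_mult_right integral_mult_right_zero)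
  finally have eq: "2 * trunc_var \<rho> = (1/64) * ?J - (1/64) * (\<integral>k. far \<rho> k * ?q k \<partial>torus)" .
  have "0 \<le> (\<integral>k. far \<rho> k * ?q k \<partial>torus)"
    by (rule integral_nonneg_AE) (use q in \<open>auto simp: indicator_def\<close>)
  moreover have "(\<integral>k. far \<rho> k * ?q k \<partial>torus) \<le> 1"
    by (rule T.integral_le_const[OF intq]) (use q in \<open>auto simp: indicator_def\<close>)
  moreover note integral_inverse_ssq_asymp[OF \<rho>]
  ultimately show ?thesis using eq c_disc_nonneg by (simp add: abs_le_iff, linarith+)
qed

section \<open>The two mixture components of the transition kernel\<close>

definition nu :: "2 \<Rightarrow> (real ^ 2) measure" where
  "nu a = density torus (\<lambda>k. ennreal (2 * (sin (pi * k $ a))\<^sup>2))"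

text \<open>The starting point enters the kernel only through these two mixing weights. They sum to
  1 when \<open>ssq k\<close> is non-zero; at \<open>ssq k = 0\<close> both are 0, as is the
  kernel.\<close>

definition weight :: "2 \<Rightarrow> real ^ 2 \<Rightarrow> real" where
  "weight a k = (sin (pi * k $ a))\<^sup>2 / ssq k"

lemma sets_nu [measurable_cong, simp]: "sets (nu a) = sets torus"
  and space_nu [simp]: "space (nu a) = space torus"
  and sets_kernel [measurable_cong, simp]: "sets (kernel k) = sets torus"
  and space_kernel [simp]: "space (kernel k) = space torus"
  and sets_invariant [measurable_cong, simp]: "sets invariant_measure = sets torus"
  and space_invariant [simp]: "space invariant_measure = space torus"
  by (simp_all add: nu_def kernel_def invariant_measure_def)

lemma measurable_weight [measurable]: "weight a \<in> borel_measurable torus"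
  unfolding weight_def by measurable

lemma weight_nonneg: "0 \<le> weight a k"
  by (simp add: weight_def ssq_nonneg)

lemma weight_le_1: "weight a k \<le> 1"
  using sin_sq_le_ssq[of k a] ssq_nonneg[of k] unfolding weight_def divide_le_eq_1 by linarith

lemma weight_sum: "ssq k \<noteq> 0 \<Longrightarrow> weight 1 k + weight 2 k = 1"
  by (simp add: weight_def ssq_alt flip: add_divide_distrib)

lemma integral_nu:
  fixes g :: "real^2 \<Rightarrow> 'b::{banach, second_countable_topology}"
  assumes "g \<in> borel_measurable torus"
  shows "(\<integral>k. g k \<partial>nu a) = (\<integral>k. (2 * (sin (pi * k $ a))\<^sup>2) *\<^sub>R g k \<partial>torus)"
  unfolding nu_def by (rule integral_density) (use assms in auto)

lemma integral_invariant:
  fixes g :: "real^2 \<Rightarrow> 'b::{banach, second_countable_topology}"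
  assumes "g \<in> borel_measurable torus"
  shows "(\<integral>k. g k \<partial>invariant_measure) = (\<integral>k. ssq k *\<^sub>R g k \<partial>torus)"
  unfolding invariant_measure_def Phi_eq
  by (subst integral_density) (use assms in \<open>auto simp: ssq_nonneg\<close>)

lemma integrable_torus_bounded:
  fixes g :: "real^2 \<Rightarrow> 'b::{banach, second_countable_topology}"
  assumes "g \<in> borel_measurable torus" "\<And>k. norm (g k) \<le> B"
  shows "integrable torus g"
proof -
  interpret T: prob_space torus by (rule prob_space_torus)
  show ?thesis by (rule T.integrable_const_bound[where B=B]) (use assms in auto)
qed

lemma sin_sq_le_1: "(sin (x::real))\<^sup>2 \<le> 1"
  by (simp add: abs_square_le_1)

lemma prob_space_nu: "prob_space (nu a)"
proof
  have "emeasure (nu a) (space (nu a)) = (\<integral>\<^sup>+k. ennreal (2 * (sin (pi * k $ a))\<^sup>2) \<partial>torus)"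
    unfolding nu_def by (subst emeasure_density) (auto intro!: nn_integral_cong)
  also have "\<dots> = ennreal (\<integral>k. 2 * (sin (pi * k $ a))\<^sup>2 \<partial>torus)"
    by (rule nn_integral_eq_integral)
      (auto intro!: integrable_torus_bounded[where B=1] simp: sin_sq_le_1)
  also have "\<dots> = 1" using integral_sin_sq_torus[of a] by simp
  finally show "emeasure (nu a) (space (nu a)) = 1" .
qed

lemma norm_sin_scale_le:
  assumes "norm x \<le> B" shows "norm ((2 * (sin (pi * k $ a))\<^sup>2) *\<^sub>R x) \<le> 2 * B"
proof -
  have "2 * (sin (pi * k $ a))\<^sup>2 \<le> 2" using sin_sq_le_1[of "pi * k $ a"] by simp
  then have "2 * (sin (pi * k $ a))\<^sup>2 * norm x \<le> 2 * B" using assms by (intro mult_mono) auto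
  then show ?thesis by (simp add: abs_mult)
qed

text \<open>The two densities add up to \<open>2 * ssq k\<close>, so the average of
  \<open>nu 1\<close> and \<open>nu 2\<close> is the invariant measure.\<close>

lemma integral_nu_sum:
  fixes g :: "real^2 \<Rightarrow> 'b::{banach, second_countable_topology}"
  assumes [measurable]: "g \<in> borel_measurable torus" and B: "\<And>k. norm (g k) \<le> B"
  shows "(\<integral>k. g k \<partial>nu 1) + (\<integral>k. g k \<partial>nu 2) = 2 *\<^sub>R (\<integral>k. g k \<partial>invariant_measure)"
proof -
  have int: "integrable torus (\<lambda>k. (2 * (sin (pi * k $ a))\<^sup>2) *\<^sub>R g k)" for a
    by (rule integrable_torus_bounded[where B="2 * B"]) (measurable, rule norm_sin_scale_le, rule B)
  have "(\<integral>k. g k \<partial>nu 1) + (\<integral>k. g k \<partial>nu 2) =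
      (\<integral>k. (2 * (sin (pi * k $ 1))\<^sup>2) *\<^sub>R g k + (2 * (sin (pi * k $ 2))\<^sup>2) *\<^sub>R g k \<partial>torus)"
    using int by (simp add: integral_nu)
  also have "\<dots> = (\<integral>k. 2 *\<^sub>R (ssq k *\<^sub>R g k) \<partial>torus)"
    by (rule Bochner_Integration.integral_cong) (auto simp: ssq_alt scaleR_add_left scaleR_add_right)
  also have "\<dots> = 2 *\<^sub>R (\<integral>k. ssq k *\<^sub>R g k \<partial>torus)" by (rule integral_scaleR_right)
  finally show ?thesis by (simp only: integral_invariant[OF assms(1)])
qed

lemma integral_kernel:
  fixes g :: "real^2 \<Rightarrow> 'b::{banach, second_countable_topology}"
  assumes [measurable]: "g \<in> borel_measurable torus" and B: "\<And>k. norm (g k) \<le> B"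
  shows "(\<integral>k'. g k' \<partial>kernel k) = weight 1 k *\<^sub>R (\<integral>k'. g k' \<partial>nu 1) + weight 2 k *\<^sub>R (\<integral>k'. g k' \<partial>nu 2)"
proof -
  let ?s = "\<lambda>a k'. (2 * (sin (pi * k' $ a))\<^sup>2) *\<^sub>R g k'"
  have int: "integrable torus (?s a)" for a
    by (rule integrable_torus_bounded[where B="2 * B"]) (measurable, rule norm_sin_scale_le, rule B)
  have eq: "2 * (\<Sum>\<alpha>\<in>UNIV. (sin (pi * k $ \<alpha>))\<^sup>2 * (sin (pi * k' $ \<alpha>))\<^sup>2) / (\<Sum>\<beta>\<in>UNIV. (sin (pi * k $ \<beta>))\<^sup>2) =
      weight 1 k * (2 * (sin (pi * k' $ 1))\<^sup>2) + weight 2 k * (2 * (sin (pi * k' $ 2))\<^sup>2)" for k'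
    by (simp add: weight_def ssq_alt UNIV_2 add_divide_distrib algebra_simps)
  have "(\<integral>k'. g k' \<partial>kernel k) = (\<integral>k'. weight 1 k *\<^sub>R ?s 1 k' + weight 2 k *\<^sub>R ?s 2 k' \<partial>torus)"
    unfolding kernel_def
    by (subst integral_density)
      (auto intro!: Bochner_Integration.integral_cong AE_I2 divide_nonneg_nonneg add_nonneg_nonneg mult_nonneg_nonneg weight_nonneg simp: eq scaleR_add_left)
  also have "\<dots> = weight 1 k *\<^sub>R (\<integral>k'. g k' \<partial>nu 1) + weight 2 k *\<^sub>R (\<integral>k'. g k' \<partial>nu 2)"
    using int[of 1] int[of 2] by (simp only: integral_nu[OF assms(1)] Bochner_Integration.integral_add integrable_scaleR_right integral_scaleR_right)
  finally show ?thesis .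
qed

text \<open>Invariance of the stationary law: the factor \<open>ssq\<close> cancels the denominators
  of the weights, and since each squared sine has mean 1/2 the two components receive equal
  mass.\<close>

lemma stationary_integral:
  fixes g :: "real^2 \<Rightarrow> real"
  assumes [measurable]: "g \<in> borel_measurable torus" and B: "\<And>k. \<bar>g k\<bar> \<le> B"
  shows "(\<integral>k0. (\<integral>k1. g k1 \<partial>kernel k0) \<partial>invariant_measure) = (\<integral>k. ssq k * g k \<partial>torus)"
proof -
  have B': "\<And>k. norm (g k) \<le> B" using B by simp
  have int: "integrable torus (\<lambda>k. (sin (pi * k $ a))\<^sup>2)" for a
    by (rule integrable_torus_bounded[where B=1]) (auto simp: sin_sq_le_1)
  have "ssq k * (\<integral>k'. g k' \<partial>kernel k) =
      (sin (pi * k $ 1))\<^sup>2 * (\<integral>k'. g k' \<partial>nu 1) + (sin (pi * k $ 2))\<^sup>2 * (\<integral>k'. g k' \<partial>nu 2)" for k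
    unfolding integral_kernel[OF assms(1) B']
    using sin_sq_le_ssq[of k 1] sin_sq_le_ssq[of k 2]
    by (cases "ssq k = 0") (auto simp: weight_def algebra_simps)
  moreover have "(\<lambda>k. \<integral>k'. g k' \<partial>kernel k) \<in> borel_measurable torus"
    unfolding integral_kernel[OF assms(1) B'] by measurable
  ultimately have "(\<integral>k0. (\<integral>k1. g k1 \<partial>kernel k0) \<partial>invariant_measure) =
      ((\<integral>k'. g k' \<partial>nu 1) + (\<integral>k'. g k' \<partial>nu 2)) / 2"
    using int by (simp add: integral_invariant integral_sin_sq_torus add_divide_distrib)
  then show ?thesis
    using integral_nu_sum[OF assms(1) B'] by (simp add: integral_invariant)
qed

section \<open>The defect of the characteristic function of one step\<close>

lemma one_minus_cos_bounds:
  fixes y :: real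
  shows "\<bar>(1 - cos y) - y\<^sup>2 / 2\<bar> \<le> y ^ 4 / 24"
proof -
  obtain t where t: "cos y = (\<Sum>m<4. cos_coeff m * y ^ m) + cos (t + 1 / 2 * real 4 * pi) / fact 4 * y ^ 4"
    using Maclaurin_cos_expansion[of y 4] by auto
  have "(\<Sum>m<4. cos_coeff m * y ^ m) = 1 - y\<^sup>2 / 2"
  proof -
    have "{..<4} = {0, 1, 2, 3::nat}" by auto
    then show ?thesis by (simp add: cos_coeff_def)
  qed
  then have "\<bar>(1 - cos y) - y\<^sup>2 / 2\<bar> = \<bar>cos (t + 1 / 2 * real 4 * pi)\<bar> * (y ^ 4 / 24)"
    using t by (simp add: fact_numeral abs_mult)
  also have "\<dots> \<le> 1 * (y ^ 4 / 24)" by (intro mult_right_mono) auto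
  finally show ?thesis by simp
qed

text \<open>One minus the real part of the characteristic function of the exponential law,
  explicitly \<open>\<theta> ^ 2 / (1 + \<theta> ^ 2)\<close>. The estimates below go through its
  expansion at 0.\<close>

definition cos_defect :: "real \<Rightarrow> real" where
  "cos_defect \<theta> = (\<integral>x. 1 - cos (x * \<theta>) \<partial>exp1)"

lemma measurable_cos_defect [measurable]: "cos_defect \<in> borel_measurable borel"
proof -
  interpret E: prob_space exp1 by (rule prob_space_exp1)
  show ?thesis unfolding cos_defect_def by measurable
qed

text \<open>The exponential moments 2 and 24 cancel the factorials in the cosine expansion, whence
  the coefficients 1.\<close>

lemma cos_defect_bounds: "0 \<le> cos_defect \<theta>" "cos_defect \<theta> \<le> 2" "\<bar>cos_defect \<theta> - \<theta>\<^sup>2\<bar> \<le> \<theta> ^ 4"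
proof -
  interpret E: prob_space exp1 by (rule prob_space_exp1)
  have cb: "0 \<le> 1 - cos (x * \<theta>)" "1 - cos (x * \<theta>) \<le> 2" for x
    using cos_ge_minus_one[of "x * \<theta>"] cos_le_one[of "x * \<theta>"] by linarith+
  have int: "integrable exp1 (\<lambda>x. 1 - cos (x * \<theta>))"
    by (rule E.integrable_const_bound[where B=2]) (use cb in \<open>auto simp: abs_of_nonneg\<close>)
  show "0 \<le> cos_defect \<theta>" unfolding cos_defect_def by (rule integral_nonneg_AE) (use cb in auto)
  show "cos_defect \<theta> \<le> 2" unfolding cos_defect_def by (rule E.integral_le_const[OF int]) (use cb in auto)
  have 2: "integrable exp1 (\<lambda>x. x\<^sup>2)" "(\<integral>x. x\<^sup>2 \<partial>exp1) = 2"
    using exp1_moment[of 2] by (auto simp: has_bochner_integral_iff)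
  have 4: "integrable exp1 (\<lambda>x. x ^ 4)" "(\<integral>x. x ^ 4 \<partial>exp1) = 24"
    using exp1_moment[of 4] by (auto simp: has_bochner_integral_iff fact_numeral)
  have i2: "integrable exp1 (\<lambda>x. (x * \<theta>)\<^sup>2 / 2)" and v2: "(\<integral>x. (x * \<theta>)\<^sup>2 / 2 \<partial>exp1) = \<theta>\<^sup>2"
    using 2 by (auto simp: power_mult_distrib)
  have i4: "integrable exp1 (\<lambda>x. (x * \<theta>) ^ 4 / 24)" and v4: "(\<integral>x. (x * \<theta>) ^ 4 / 24 \<partial>exp1) = \<theta> ^ 4"
    using 4 by (auto simp: power_mult_distrib)
  have "cos_defect \<theta> - \<theta>\<^sup>2 = (\<integral>x. (1 - cos (x * \<theta>)) - (x * \<theta>)\<^sup>2 / 2 \<partial>exp1)"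
    unfolding cos_defect_def v2[symmetric] by (rule Bochner_Integration.integral_diff[symmetric, OF int i2])
  also have "\<bar>\<dots>\<bar> \<le> (\<integral>x. \<bar>(1 - cos (x * \<theta>)) - (x * \<theta>)\<^sup>2 / 2\<bar> \<partial>exp1)"
    by (rule integral_abs_bound)
  also have "\<dots> \<le> (\<integral>x. (x * \<theta>) ^ 4 / 24 \<partial>exp1)"
    by (rule integral_mono[OF integrable_abs[OF Bochner_Integration.integrable_diff[OF int i2]] i4]) (rule one_minus_cos_bounds)
  finally show "\<bar>cos_defect \<theta> - \<theta>\<^sup>2\<bar> \<le> \<theta> ^ 4" unfolding v4 .
qed

text \<open>One minus the characteristic function at \<open>w\<close> of a step from a stationary
  position; by symmetry that function is real, so only the cosine appears.\<close>

definition char_defect :: "real ^ 2 \<Rightarrow> real" where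
  "char_defect w = (\<integral>k. cos_defect (w \<bullet> vf k) \<partial>invariant_measure)"

text \<open>Both the density and, up to a constant, the volume are at most \<open>\<rho>\<close> on
  the near region: its stationary mass is of second order in \<open>\<rho>\<close>.\<close>

lemma near_integral_le:
  assumes "0 < \<rho>" "\<rho> \<le> 2"
  shows "(\<integral>k. indicator {k. ssq k < \<rho>} k * ssq k \<partial>torus) \<le> 25 * c_disc * \<rho>\<^sup>2"
proof -
  interpret T: prob_space torus by (rule prob_space_torus)
  have "(\<integral>k. indicator {k. ssq k < \<rho>} k * ssq k \<partial>torus) \<le> (\<integral>k. \<rho> * indicator {k \<in> space torus. ssq k < \<rho>} k \<partial>torus)"
    by (rule integral_mono_AE)
      (use assms in \<open>auto simp: indicator_def ssq_nonneg ssq_le_2 intro!: integrable_torus_bounded[where B=2] \<close>)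
  also have "\<dots> = \<rho> * vol_below \<rho>" by (simp add: vol_below_def)
  also have "\<dots> \<le> \<rho> * (25 * c_disc * \<rho>)"
    using assms by (intro mult_left_mono vol_below_le) auto
  finally show ?thesis by (simp add: power2_eq_square algebra_simps)
qed

lemma far_inverse_cube_le:
  assumes "0 < \<rho>" "\<rho> \<le> 2"
  shows "integrable torus (\<lambda>k. far \<rho> k * (1 / (ssq k) ^ 3))"
    "(\<integral>k. far \<rho> k * (1 / (ssq k) ^ 3) \<partial>torus) \<le> (1 + 438 * c_disc) / \<rho>\<^sup>2"
proof -
  show i3: "integrable torus (\<lambda>k. far \<rho> k * (1 / (ssq k) ^ 3))"
    using assms by (intro integrable_torus_truncated[of "\<lambda>x. 1 / x ^ 3"]) (auto intro!: continuous_intros)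
  have i2: "integrable torus (\<lambda>k. 1 / \<rho> * (far \<rho> k * (1 / (ssq k)\<^sup>2)))"
    using assms by (intro integrable_mult_right integrable_torus_truncated[of "\<lambda>x. 1 / x\<^sup>2"]) (auto intro!: continuous_intros)
  have "(\<integral>k. far \<rho> k * (1 / (ssq k) ^ 3) \<partial>torus) \<le> (\<integral>k. 1 / \<rho> * (far \<rho> k * (1 / (ssq k)\<^sup>2)) \<partial>torus)"
  proof (rule integral_mono[OF i3 i2])
    fix k
    show "far \<rho> k * (1 / (ssq k) ^ 3) \<le> 1 / \<rho> * (far \<rho> k * (1 / (ssq k)\<^sup>2))"
    proof (cases "\<rho> \<le> ssq k")
      case True
      then have "1 / ssq k * (1 / (ssq k)\<^sup>2) \<le> 1 / \<rho> * (1 / (ssq k)\<^sup>2)"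
        using assms by (intro mult_right_mono frac_le) auto
      then show ?thesis using True by (simp add: power3_eq_cube power2_eq_square)
    qed auto
  qed
  also have "\<dots> = 1 / \<rho> * (\<integral>k. far \<rho> k * (1 / (ssq k)\<^sup>2) \<partial>torus)" by (rule integral_mult_right_zero)
  also have "\<dots> \<le> 1 / \<rho> * ((1 + 438 * c_disc) / \<rho>)"
    using assms by (intro mult_left_mono integral_inverse_ssq_sq_le) auto
  finally show "(\<integral>k. far \<rho> k * (1 / (ssq k) ^ 3) \<partial>torus) \<le> (1 + 438 * c_disc) / \<rho>\<^sup>2"
    by (simp add: power2_eq_square)
qed

text \<open>Near the singularity the defect is bounded by 2 and the stationary mass is of order
  \<open>\<rho> ^ 2\<close>. Far from it the quadratic expansion has the error
  \<open>(w \<bullet> vf k) ^ 4\<close>, which against the density is at most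
  \<open>(norm w) ^ 4 / (ssq k) ^ 3\<close>. The two errors balance when \<open>\<rho>\<close> is of
  the order of \<open>norm w\<close>.\<close>

lemma char_defect_approx:
  assumes \<rho>: "0 < \<rho>" "\<rho> \<le> 2"
  shows "\<bar>char_defect w - (norm w)\<^sup>2 * trunc_var \<rho>\<bar> \<le> 50 * c_disc * \<rho>\<^sup>2 + (norm w) ^ 4 * (1 + 438 * c_disc) / \<rho>\<^sup>2"
proof -
  let ?D = "\<lambda>k. cos_defect (w \<bullet> vf k)"
  let ?near = "\<lambda>k. indicator {k. ssq k < \<rho>} k :: real"
  have [measurable]: "?D \<in> borel_measurable torus" by measurable
  have iD: "integrable torus (\<lambda>k. ssq k * ?D k)"
  proof (rule integrable_torus_bounded[where B="2 * 2"])
    fix k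
    have "ssq k * ?D k \<le> 2 * 2" by (intro mult_mono ssq_le_2 cos_defect_bounds) auto
    then show "norm (ssq k * ?D k) \<le> 2 * 2" by (simp add: abs_mult ssq_nonneg cos_defect_bounds)
  qed measurable
  have bound: "(w \<bullet> vf k)\<^sup>2 \<le> (norm w)\<^sup>2 / (8 * ssq k)\<^sup>2" for k
  proof -
    have "\<bar>w \<bullet> vf k\<bar>\<^sup>2 \<le> (norm w * norm (vf k))\<^sup>2" by (intro power_mono Cauchy_Schwarz_ineq2) auto
    also have "\<dots> \<le> (norm w)\<^sup>2 * (1 / (8 * ssq k)\<^sup>2)"
      by (subst power_mult_distrib, intro mult_left_mono norm_vf_sq_le) auto
    finally show ?thesis by simp
  qed
  have iF: "integrable torus (\<lambda>k. far \<rho> k * ((w \<bullet> vf k)\<^sup>2 * ssq k))"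
  proof (rule integrable_far_bound[where h="\<lambda>s. (norm w)\<^sup>2 / (64 * s)"])
    fix k
    have "(w \<bullet> vf k)\<^sup>2 * ssq k \<le> (norm w)\<^sup>2 / (8 * ssq k)\<^sup>2 * ssq k"
      by (intro mult_right_mono bound ssq_nonneg)
    also have "\<dots> = (norm w)\<^sup>2 / (64 * ssq k)" by (simp add: power2_eq_square)
    finally show "\<bar>(w \<bullet> vf k)\<^sup>2 * ssq k\<bar> \<le> (norm w)\<^sup>2 / (64 * ssq k)" by (simp add: abs_mult ssq_nonneg)
  qed (use \<rho> in \<open>auto intro!: continuous_intros\<close>)
  let ?E = "\<lambda>k. 2 * (?near k * ssq k) + (norm w) ^ 4 * (far \<rho> k * (1 / (ssq k) ^ 3))"
  have in1: "integrable torus (\<lambda>k. ?near k * ssq k)"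
    by (rule integrable_torus_bounded[where B=2]) (auto simp: indicator_def ssq_nonneg ssq_le_2)
  have iE: "integrable torus ?E"
    by (intro Bochner_Integration.integrable_add integrable_mult_right in1 far_inverse_cube_le(1)[OF \<rho>])
  have pw: "\<bar>ssq k * ?D k - far \<rho> k * ((w \<bullet> vf k)\<^sup>2 * ssq k)\<bar> \<le> ?E k" for k
  proof (cases "\<rho> \<le> ssq k")
    case True
    then have s: "0 < ssq k" using \<rho> by simp
    have "\<bar>ssq k * ?D k - (w \<bullet> vf k)\<^sup>2 * ssq k\<bar> = ssq k * \<bar>?D k - (w \<bullet> vf k)\<^sup>2\<bar>"
      unfolding mult.commute[of _ "ssq k"] right_diff_distrib[symmetric] using s by (simp only: abs_mult abs_of_pos)
    also have "\<dots> \<le> ssq k * (w \<bullet> vf k) ^ 4"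
      using s by (intro mult_left_mono cos_defect_bounds) auto
    also have "(w \<bullet> vf k) ^ 4 = ((w \<bullet> vf k)\<^sup>2)\<^sup>2" by simp
    also have "ssq k * ((w \<bullet> vf k)\<^sup>2)\<^sup>2 \<le> ssq k * ((norm w)\<^sup>2 / (8 * ssq k)\<^sup>2)\<^sup>2"
      using s by (intro mult_left_mono power_mono bound) auto
    also have "\<dots> = (norm w) ^ 4 * (1 / (ssq k) ^ 3) / 4096"
      using s by (simp add: field_simps eval_nat_numeral)
    also have "\<dots> \<le> (norm w) ^ 4 * (1 / (ssq k) ^ 3)"
    proof -
      have "0 \<le> (norm w) ^ 4 * (1 / (ssq k) ^ 3)" using s by simp
      moreover have "x / 4096 \<le> x" if "0 \<le> x" for x :: real using that by simp
      ultimately show ?thesis by blast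
    qed
    finally show ?thesis using True by simp
  next
    case False
    have "ssq k * ?D k \<le> ssq k * 2"
      by (intro mult_left_mono cos_defect_bounds ssq_nonneg)
    then show ?thesis using False by (simp add: abs_mult ssq_nonneg cos_defect_bounds)
  qed
  have "char_defect w - (norm w)\<^sup>2 * trunc_var \<rho> = (\<integral>k. ssq k * ?D k - far \<rho> k * ((w \<bullet> vf k)\<^sup>2 * ssq k) \<partial>torus)"
    unfolding char_defect_def far_inner_sq[OF \<rho>(1), symmetric]
    using iD iF by (simp add: integral_invariant)
  also have "\<bar>\<dots>\<bar> \<le> (\<integral>k. \<bar>ssq k * ?D k - far \<rho> k * ((w \<bullet> vf k)\<^sup>2 * ssq k)\<bar> \<partial>torus)"
    by (rule integral_abs_bound)
  also have "\<dots> \<le> (\<integral>k. ?E k \<partial>torus)"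
    by (rule integral_mono[OF integrable_abs[OF Bochner_Integration.integrable_diff[OF iD iF]] iE pw])
  also have "\<dots> = 2 * (\<integral>k. ?near k * ssq k \<partial>torus) + (norm w) ^ 4 * (\<integral>k. far \<rho> k * (1 / (ssq k) ^ 3) \<partial>torus)"
    using in1 far_inverse_cube_le(1)[OF \<rho>]
    by (simp only: Bochner_Integration.integral_add integrable_mult_right integral_mult_right_zero)
  also have "\<dots> \<le> 2 * (25 * c_disc * \<rho>\<^sup>2) + (norm w) ^ 4 * ((1 + 438 * c_disc) / \<rho>\<^sup>2)"
    by (intro add_mono mult_left_mono near_integral_le far_inverse_cube_le \<rho>) auto
  finally show ?thesis by simp
qed

text \<open>The error in \<open>trunc_var_asymp\<close> is bounded, so it disappears after division
  by \<open>ln N\<close> and only the growth rate of \<open>ln (1 / r N)\<close> is left. In both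
  applications that rate is 1/2.\<close>

lemma trunc_var_asymp_ln:
  fixes r :: "nat \<Rightarrow> real"
  assumes r: "\<forall>\<^sub>F N in sequentially. 0 < r N \<and> r N \<le> 2"
    and lim: "(\<lambda>N. ln (1 / r N) / ln (real N)) \<longlonglongrightarrow> l"
  shows "(\<lambda>N. trunc_var (r N) / ln (real N)) \<longlonglongrightarrow> c_disc / 128 * l"
proof -
  have "(\<lambda>N. trunc_var (r N) / ln (real N) - c_disc / 128 * (ln (1 / r N) / ln (real N))) \<longlonglongrightarrow> 0"
  proof (rule Lim_null_comparison)
    show "\<forall>\<^sub>F N in sequentially. norm (trunc_var (r N) / ln (real N) - c_disc / 128 * (ln (1 / r N) / ln (real N)))
        \<le> (2 + 250 * c_disc) / ln (real N)"
      using r eventually_gt_at_top[of 1]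
    proof eventually_elim
      case (elim N)
      have "trunc_var (r N) / ln (real N) - c_disc / 128 * (ln (1 / r N) / ln (real N)) =
          (trunc_var (r N) - c_disc / 128 * ln (1 / r N)) / ln (real N)"
        by (simp add: diff_divide_distrib)
      then show ?case
        using elim trunc_var_asymp[of "r N"] by (simp add: divide_right_mono)
    qed
    show "(\<lambda>N. (2 + 250 * c_disc) / ln (real N)) \<longlonglongrightarrow> 0" by real_asymp
  qed
  from tendsto_add[OF this tendsto_mult_left[OF lim, of "c_disc / 128"]] show ?thesis by simp
qed

section \<open>The variance\<close>

text \<open>The integral over the exponential time, at a fixed position, in the definition of
  \<open>sigma_sq\<close>.\<close>

definition trunc_moment :: "nat \<Rightarrow> real ^ 2 \<Rightarrow> real" where
  "trunc_moment N k = (\<integral>x. \<bar>x * vf k $ 1\<bar>\<^sup>2 * of_bool (\<bar>x * vf k $ 1\<bar> \<le> sqrt (real N)) \<partial>exp1)"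

lemma measurable_trunc_moment [measurable]: "trunc_moment N \<in> borel_measurable torus"
proof -
  interpret E: prob_space exp1 by (rule prob_space_exp1)
  show ?thesis unfolding trunc_moment_def by measurable
qed

text \<open>What the truncation removes is at most the third absolute moment divided by the
  truncation level, and the third exponential moment is 6.\<close>

lemma trunc_moment_bounds:
  "0 \<le> trunc_moment N k" "trunc_moment N k \<le> real N"
  "0 < N \<Longrightarrow> \<bar>trunc_moment N k - 2 * (vf k $ 1)\<^sup>2\<bar> \<le> 6 * \<bar>vf k $ 1\<bar> ^ 3 / sqrt (real N)"
proof -
  interpret E: prob_space exp1 by (rule prob_space_exp1)
  let ?v = "vf k $ 1"
  let ?f = "\<lambda>x. \<bar>x * ?v\<bar>\<^sup>2 * of_bool (\<bar>x * ?v\<bar> \<le> sqrt (real N))"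
  have f: "0 \<le> ?f x" "?f x \<le> real N" for x
  proof -
    have "\<bar>x * ?v\<bar>\<^sup>2 \<le> (sqrt (real N))\<^sup>2" if "\<bar>x * ?v\<bar> \<le> sqrt (real N)"
      using that by (intro power_mono) auto
    then show "?f x \<le> real N" by (auto simp: of_bool_def)
  qed simp
  have intf: "integrable exp1 ?f"
    by (rule E.integrable_const_bound[where B="real N"]) (use f in auto)
  show "0 \<le> trunc_moment N k" unfolding trunc_moment_def by (rule integral_nonneg_AE) (use f in auto)
  show "trunc_moment N k \<le> real N" unfolding trunc_moment_def by (rule E.integral_le_const[OF intf]) (use f in auto)
  assume N: "0 < N"
  have 2: "integrable exp1 (\<lambda>x. x\<^sup>2)" "(\<integral>x. x\<^sup>2 \<partial>exp1) = 2"
    using exp1_moment[of 2] by (auto simp: has_bochner_integral_iff)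
  have 3: "integrable exp1 (\<lambda>x. x ^ 3)" "(\<integral>x. x ^ 3 \<partial>exp1) = 6"
    using exp1_moment[of 3] by (auto simp: has_bochner_integral_iff fact_numeral)
  have i2: "integrable exp1 (\<lambda>x. x\<^sup>2 * ?v\<^sup>2)" and v2: "(\<integral>x. x\<^sup>2 * ?v\<^sup>2 \<partial>exp1) = 2 * ?v\<^sup>2"
    using 2 by auto
  have i3: "integrable exp1 (\<lambda>x. x ^ 3 * (\<bar>?v\<bar> ^ 3 / sqrt (real N)))"
    and v3: "(\<integral>x. x ^ 3 * (\<bar>?v\<bar> ^ 3 / sqrt (real N)) \<partial>exp1) = 6 * (\<bar>?v\<bar> ^ 3 / sqrt (real N))"
    using 3 by (auto simp del: times_divide_eq_right)
  have "\<bar>trunc_moment N k - 2 * ?v\<^sup>2\<bar> = \<bar>\<integral>x. ?f x - x\<^sup>2 * ?v\<^sup>2 \<partial>exp1\<bar>"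
    unfolding trunc_moment_def v2[symmetric] using intf i2 by simp
  also have "\<dots> \<le> (\<integral>x. \<bar>?f x - x\<^sup>2 * ?v\<^sup>2\<bar> \<partial>exp1)" by (rule integral_abs_bound)
  also have "\<dots> \<le> (\<integral>x. x ^ 3 * (\<bar>?v\<bar> ^ 3 / sqrt (real N)) \<partial>exp1)"
  proof (rule integral_mono_AE[OF integrable_abs[OF Bochner_Integration.integrable_diff[OF intf i2]] i3])
    show "AE x in exp1. \<bar>?f x - x\<^sup>2 * ?v\<^sup>2\<bar> \<le> x ^ 3 * (\<bar>?v\<bar> ^ 3 / sqrt (real N))"
      using AE_exp1_nonneg
    proof eventually_elim
      case (elim x)
      show ?case
      proof (cases "\<bar>x * ?v\<bar> \<le> sqrt (real N)")
        case True
        then show ?thesis using elim by (simp add: power_mult_distrib abs_mult)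
      next
        case False
        \<comment> \<open>On the removed part the quotient of \<open>\<bar>x * ?v\<bar>\<close> by
          the level exceeds 1 and may be inserted as a factor.\<close>
        then have "1 * \<bar>x * ?v\<bar>\<^sup>2 \<le> (\<bar>x * ?v\<bar> / sqrt (real N)) * \<bar>x * ?v\<bar>\<^sup>2"
          using N by (intro mult_right_mono) (auto simp: pos_le_divide_eq)
        also have "\<dots> = x ^ 3 * (\<bar>?v\<bar> ^ 3 / sqrt (real N))"
          using elim by (simp add: abs_mult power_mult_distrib eval_nat_numeral)
        finally show ?thesis using False by (simp add: power_mult_distrib abs_mult)
      qed
    qed
  qed
  finally show "\<bar>trunc_moment N k - 2 * ?v\<^sup>2\<bar> \<le> 6 * \<bar>?v\<bar> ^ 3 / sqrt (real N)"
    unfolding v3 by simp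
qed

lemma stationary_trunc:
  "stationary_expectation1 (\<lambda>x k.
       \<bar>x * velocity k $ 1 / Phi k\<bar>\<^sup>2 * of_bool (\<bar>x * velocity k $ 1 / Phi k\<bar> \<le> sqrt (real N))) =
    (\<integral>k. ssq k * trunc_moment N k \<partial>torus)"
proof -
  have eq: "x * velocity k $ 1 / Phi k = x * vf k $ 1" for x k
    by (simp add: vf_def)
  show ?thesis
    unfolding stationary_expectation1_def eq trunc_moment_def[symmetric]
    by (rule stationary_integral[where B="real N"]) (auto simp: trunc_moment_bounds)
qed

text \<open>Truncation of the step at \<open>sqrt N\<close> is traded for truncation of the position
  at \<open>1 / sqrt N\<close>. On the near region the integrand is at most \<open>N\<close> times
  the density, whose mass is of order \<open>1 / N\<close>; on the far region the error is at most
  \<open>1 / (sqrt N * (ssq k) ^ 2)\<close>, with bounded integral. Both are negligible against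
  \<open>ln N\<close>.\<close>

lemma trunc_moment_approx:
  assumes N: "0 < N"
  shows "\<bar>(\<integral>k. ssq k * trunc_moment N k \<partial>torus) - 2 * trunc_var (1 / sqrt (real N))\<bar> \<le> 25 * c_disc + (1 + 438 * c_disc)"
proof -
  let ?\<rho> = "1 / sqrt (real N)"
  have "?\<rho> \<le> 1 / 1" using N by (intro frac_le) auto
  then have \<rho>: "0 < ?\<rho>" "?\<rho> \<le> 2" using N by (auto, linarith)
  let ?near = "\<lambda>k. indicator {k. ssq k < ?\<rho>} k :: real"
  have i1: "integrable torus (\<lambda>k. ssq k * trunc_moment N k)"
  proof (rule integrable_torus_bounded[where B="2 * real N"])
    fix k
    have "ssq k * trunc_moment N k \<le> 2 * real N" by (intro mult_mono ssq_le_2 trunc_moment_bounds) auto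
    then show "norm (ssq k * trunc_moment N k) \<le> 2 * real N" by (simp add: abs_mult ssq_nonneg trunc_moment_bounds)
  qed measurable
  have i2: "integrable torus (\<lambda>k. 2 * (far ?\<rho> k * (vf k $ 1 * vf k $ 1 * ssq k)))"
    by (intro integrable_mult_right integrable_far_prod \<rho>)
  have i2': "integrable torus (\<lambda>k. 2 * (far ?\<rho> k * ((vf k $ 1)\<^sup>2 * ssq k)))"
    using i2 by (simp add: power2_eq_square)
  have in1: "integrable torus (\<lambda>k. ?near k * ssq k)"
    by (rule integrable_torus_bounded[where B=2]) (auto simp: indicator_def ssq_nonneg ssq_le_2)
  have if1: "integrable torus (\<lambda>k. far ?\<rho> k * (1 / (ssq k)\<^sup>2))"
    using \<rho> by (intro integrable_torus_truncated[of "\<lambda>x. 1 / x\<^sup>2"]) (auto intro!: continuous_intros)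
  let ?E = "\<lambda>k. real N * (?near k * ssq k) + 1 / sqrt (real N) * (far ?\<rho> k * (1 / (ssq k)\<^sup>2))"
  have iE: "integrable torus ?E" using in1 if1 by (intro Bochner_Integration.integrable_add integrable_mult_right)
  have pw: "\<bar>ssq k * trunc_moment N k - 2 * (far ?\<rho> k * ((vf k $ 1)\<^sup>2 * ssq k))\<bar> \<le> ?E k" for k
  proof (cases "?\<rho> \<le> ssq k")
    case True
    then have s: "0 < ssq k" using \<rho>(1) by linarith
    have eq: "ssq k * trunc_moment N k - 2 * ((vf k $ 1)\<^sup>2 * ssq k) = ssq k * (trunc_moment N k - 2 * (vf k $ 1)\<^sup>2)"
      by (simp add: algebra_simps)
    have "\<bar>ssq k * trunc_moment N k - 2 * ((vf k $ 1)\<^sup>2 * ssq k)\<bar> = ssq k * \<bar>trunc_moment N k - 2 * (vf k $ 1)\<^sup>2\<bar>"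
      unfolding eq using s by (simp only: abs_mult abs_of_pos)
    also have "\<dots> \<le> ssq k * (6 * \<bar>vf k $ 1\<bar> ^ 3 / sqrt (real N))"
      using s by (intro mult_left_mono trunc_moment_bounds N) auto
    also have "\<dots> \<le> ssq k * (6 * (1 / (8 * ssq k)) ^ 3 / sqrt (real N))"
      using s by (intro mult_left_mono divide_right_mono power_mono abs_vf_nth_le) auto
    also have "\<dots> = (6 / 512) * (1 / sqrt (real N) * (1 / (ssq k)\<^sup>2))"
      using s N by (simp add: field_simps eval_nat_numeral)
    also have "\<dots> \<le> 1 * (1 / sqrt (real N) * (1 / (ssq k)\<^sup>2))"
      by (intro mult_right_mono) auto
    finally show ?thesis using True by simp
  next
    case False
    have "ssq k * trunc_moment N k \<le> ssq k * real N"
      by (intro mult_left_mono trunc_moment_bounds ssq_nonneg)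
    then show ?thesis using False by (simp add: abs_mult ssq_nonneg trunc_moment_bounds mult.commute)
  qed
  have "(\<integral>k. ssq k * trunc_moment N k \<partial>torus) - 2 * trunc_var ?\<rho> =
      (\<integral>k. ssq k * trunc_moment N k - 2 * (far ?\<rho> k * ((vf k $ 1)\<^sup>2 * ssq k)) \<partial>torus)"
    unfolding trunc_var_def using i1 i2' by simp
  also have "\<bar>\<dots>\<bar> \<le> (\<integral>k. \<bar>ssq k * trunc_moment N k - 2 * (far ?\<rho> k * ((vf k $ 1)\<^sup>2 * ssq k))\<bar> \<partial>torus)"
    by (rule integral_abs_bound)
  also have "\<dots> \<le> (\<integral>k. ?E k \<partial>torus)"
  proof (rule integral_mono)
    show "integrable torus (\<lambda>k. \<bar>ssq k * trunc_moment N k - 2 * (far ?\<rho> k * ((vf k $ 1)\<^sup>2 * ssq k))\<bar>)"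
      by (rule integrable_abs[OF Bochner_Integration.integrable_diff[OF i1 i2']])
    show "integrable torus ?E" by (rule iE)
    show "\<bar>ssq k * trunc_moment N k - 2 * (far ?\<rho> k * ((vf k $ 1)\<^sup>2 * ssq k))\<bar> \<le> ?E k" for k by (rule pw)
  qed
  also have "\<dots> = real N * (\<integral>k. ?near k * ssq k \<partial>torus) + 1 / sqrt (real N) * (\<integral>k. far ?\<rho> k * (1 / (ssq k)\<^sup>2) \<partial>torus)"
    using in1 if1
    by (simp only: Bochner_Integration.integral_add integrable_mult_right integral_mult_right_zero)
  also have "\<dots> \<le> real N * (25 * c_disc * ?\<rho>\<^sup>2) + 1 / sqrt (real N) * ((1 + 438 * c_disc) / ?\<rho>)"
    by (intro add_mono mult_left_mono near_integral_le integral_inverse_ssq_sq_le \<rho>) auto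
  also have "\<dots> = 25 * c_disc + (1 + 438 * c_disc)"
    using N by (simp add: power_divide)
  finally show ?thesis .
qed

text \<open>The factor 2 is the second exponential moment and 1/2 comes from
  \<open>\<rho> = 1 / sqrt N\<close>; they cancel and the constant of \<open>trunc_var_asymp\<close>
  remains.\<close>

lemma sigma_sq_eq: "sigma_sq = c_disc / 128"
proof -
  let ?A = "\<lambda>N::nat. \<integral>k. ssq k * trunc_moment N k \<partial>torus"
  have 1: "(\<lambda>N. trunc_var (1 / sqrt (real N)) / ln (real N)) \<longlonglongrightarrow> c_disc / 128 * (1 / 2)"
  proof (rule trunc_var_asymp_ln)
    show "\<forall>\<^sub>F N in sequentially. 0 < 1 / sqrt (real N) \<and> 1 / sqrt (real N) \<le> 2"
      using eventually_gt_at_top[of 0]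
    proof eventually_elim
      case (elim N)
      then have "1 / sqrt (real N) \<le> 1 / 1" by (intro frac_le) auto
      then have "1 / sqrt (real N) \<le> 2" by linarith
      then show ?case using elim by simp
    qed
    show "(\<lambda>N. ln (1 / (1 / sqrt (real N))) / ln (real N)) \<longlonglongrightarrow> 1 / 2" by real_asymp
  qed
  have 2: "(\<lambda>N. ?A N / ln (real N) - 2 * (trunc_var (1 / sqrt (real N)) / ln (real N))) \<longlonglongrightarrow> 0"
  proof (rule Lim_null_comparison)
    show "\<forall>\<^sub>F N in sequentially. norm (?A N / ln (real N) - 2 * (trunc_var (1 / sqrt (real N)) / ln (real N)))
        \<le> (25 * c_disc + (1 + 438 * c_disc)) / ln (real N)"
      using eventually_gt_at_top[of 1]
    proof eventually_elim
      case (elim N)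
      have "?A N / ln (real N) - 2 * (trunc_var (1 / sqrt (real N)) / ln (real N)) =
          (?A N - 2 * trunc_var (1 / sqrt (real N))) / ln (real N)"
        by (simp add: diff_divide_distrib)
      then show ?case using elim trunc_moment_approx[of N] by (simp add: divide_right_mono)
    qed
    show "(\<lambda>N. (25 * c_disc + (1 + 438 * c_disc)) / ln (real N)) \<longlonglongrightarrow> 0" by real_asymp
  qed
  have "(\<lambda>N. 1 / ln (real N) * ?A N) \<longlonglongrightarrow> c_disc / 128"
    using tendsto_add[OF 2 tendsto_mult_left[OF 1, of 2]] by simp
  then show ?thesis unfolding sigma_sq_def stationary_trunc by (rule limI)
qed

section \<open>The defect at the diffusive scale\<close>

definition scale :: "nat \<Rightarrow> real" where
  "scale N = sqrt (real N * ln (real N))"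

text \<open>With \<open>\<rho> = 1 / scale N\<close> both errors of
  \<open>char_defect_approx\<close> are of order \<open>1 / (scale N) ^ 2\<close>, that is
  \<open>1 / (N ln N)\<close>, and vanish after multiplication by \<open>N\<close>. The logarithm of
  \<open>scale N\<close> is asymptotically \<open>ln N / 2\<close>, which accounts for the division
  by 2.\<close>

lemma char_defect_asymp:
  "(\<lambda>N. real N * char_defect ((1 / scale N) *\<^sub>R w)) \<longlonglongrightarrow> sigma_sq * (norm w)\<^sup>2 / 2"
proof -
  let ?G = "\<lambda>N. trunc_var (1 / scale N)"
  have ev: "\<forall>\<^sub>F N in sequentially. 3 \<le> N" by (rule eventually_ge_at_top)
  have big: "1 \<le> scale N" "1 \<le> ln (real N)" if "3 \<le> N" for N
  proof -
    have "exp 1 \<le> real N" using exp_le that by linarith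
    then show 1: "1 \<le> ln (real N)" using that by (subst ln_ge_iff) auto
    have "1 * 1 \<le> real N * ln (real N)" using that 1 by (intro mult_mono) auto
    then show "1 \<le> scale N" by (simp add: scale_def)
  qed
  have 1: "(\<lambda>N. ?G N / ln (real N)) \<longlonglongrightarrow> c_disc / 128 * (1 / 2)"
  proof (rule trunc_var_asymp_ln)
    show "\<forall>\<^sub>F N in sequentially. 0 < 1 / scale N \<and> 1 / scale N \<le> 2"
      using ev by eventually_elim (use big in \<open>force simp: divide_le_eq\<close>)
    show "(\<lambda>N. ln (1 / (1 / scale N)) / ln (real N)) \<longlonglongrightarrow> 1 / 2"
      unfolding scale_def by real_asymp
  qed
  have 2: "(\<lambda>N. real N * char_defect ((1 / scale N) *\<^sub>R w) - (norm w)\<^sup>2 * (?G N / ln (real N))) \<longlonglongrightarrow> 0"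
  proof (rule Lim_null_comparison)
    show "\<forall>\<^sub>F N in sequentially. norm (real N * char_defect ((1 / scale N) *\<^sub>R w) - (norm w)\<^sup>2 * (?G N / ln (real N)))
        \<le> (50 * c_disc + (norm w) ^ 4 * (1 + 438 * c_disc)) / ln (real N)"
      using ev
    proof eventually_elim
      case (elim N)
      let ?a = "scale N"
      have a: "1 \<le> ?a" and l: "1 \<le> ln (real N)" using big[OF elim] by auto
      have a2: "?a\<^sup>2 = real N * ln (real N)" using l by (simp add: scale_def)
      have \<rho>: "0 < 1 / ?a" "1 / ?a \<le> 2" using a by (auto simp: divide_le_eq)
      have nw: "norm ((1 / ?a) *\<^sub>R w) = norm w / ?a" using a by simp
      have "\<bar>char_defect ((1 / ?a) *\<^sub>R w) - (norm w / ?a)\<^sup>2 * ?G N\<bar> \<le>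
          50 * c_disc * (1 / ?a)\<^sup>2 + (norm w / ?a) ^ 4 * (1 + 438 * c_disc) / (1 / ?a)\<^sup>2"
        using char_defect_approx[OF \<rho>, of "(1 / ?a) *\<^sub>R w"] unfolding nw .
      also have "\<dots> = (50 * c_disc + (norm w) ^ 4 * (1 + 438 * c_disc)) / ?a\<^sup>2"
        using a by (simp add: field_simps eval_nat_numeral)
      finally have "real N * \<bar>char_defect ((1 / ?a) *\<^sub>R w) - (norm w / ?a)\<^sup>2 * ?G N\<bar> \<le>
          real N * ((50 * c_disc + (norm w) ^ 4 * (1 + 438 * c_disc)) / ?a\<^sup>2)"
        by (rule mult_left_mono) simp
      moreover have "real N * ((norm w / ?a)\<^sup>2 * ?G N) = (norm w)\<^sup>2 * (?G N / ln (real N))"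
        using elim by (simp add: power_divide a2)
      moreover have "real N * \<bar>x - y\<bar> = \<bar>real N * x - real N * y\<bar>" for x y :: real
        by (simp add: abs_mult flip: right_diff_distrib)
      moreover have "real N * (C / ?a\<^sup>2) = C / ln (real N)" for C :: real
        using elim by (simp add: a2)
      ultimately show ?case by simp
    qed
    show "(\<lambda>N. (50 * c_disc + (norm w) ^ 4 * (1 + 438 * c_disc)) / ln (real N)) \<longlonglongrightarrow> 0" by real_asymp
  qed
  from tendsto_add[OF 2 tendsto_mult_left[OF 1, of "(norm w)\<^sup>2"]]
  show ?thesis by (simp add: sigma_sq_eq mult.commute)
qed

section \<open>Lipschitz test functions\<close>

lemma space_borel_of [simp]: "space (borel_of X) = topspace X"
  unfolding borel_of_def by (rule space_measure_of) (auto dest: openin_subset)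

lemma sets_borel_of: "sets (borel_of X) = sigma_sets (topspace X) {U. openin X U}"
  unfolding borel_of_def by (rule sets_measure_of) (auto dest: openin_subset)

lemma measurable_borel_ofI:
  assumes "\<And>\<omega>. \<omega> \<in> space M \<Longrightarrow> f \<omega> \<in> topspace X"
    and "\<And>U. openin X U \<Longrightarrow> f -` U \<inter> space M \<in> sets M"
  shows "f \<in> measurable M (borel_of X)"
  unfolding borel_of_def
  by (rule measurable_measure_of) (use assms in \<open>auto dest: openin_subset\<close>)

lemma borel_measurable_continuous_map:
  assumes "continuous_map X euclideanreal f"
  shows "f \<in> borel_measurable (borel_of X)"
proof (rule borel_measurableI)
  fix U :: "real set" assume "open U"
  then have "openin X {x \<in> topspace X. f x \<in> U}"
    using assms by (auto simp: continuous_map_def)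
  then have "{x \<in> topspace X. f x \<in> U} \<in> sets (borel_of X)"
    unfolding sets_borel_of by (intro sigma_sets.Basic) simp
  moreover have "{x \<in> topspace X. f x \<in> U} = f -` U \<inter> space (borel_of X)" by auto
  ultimately show "f -` U \<inter> space (borel_of X) \<in> sets (borel_of X)" by simp
qed

lemma Lipschitz_imp_continuous_map:
  fixes F :: "'a \<Rightarrow> real"
  assumes "\<And>x y. x \<in> mspace m \<Longrightarrow> y \<in> mspace m \<Longrightarrow> \<bar>F x - F y\<bar> \<le> L * mdist m x y"
  shows "continuous_map (mtopology_of m) euclideanreal F"
proof -
  have "Lipschitz_continuous_map m euclidean_metric F"
    unfolding Lipschitz_continuous_map_def using assms by (auto simp: dist_real_def)
  then show ?thesis using Lipschitz_continuous_imp_continuous_map by fastforce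
qed

text \<open>The Pasch-Hausdorff envelope: for bounded \<open>f\<close> and non-negative
  \<open>k\<close> the largest \<open>k\<close>-Lipschitz function below \<open>f\<close>.\<close>

definition inf_conv :: "'a metric \<Rightarrow> ('a \<Rightarrow> real) \<Rightarrow> real \<Rightarrow> 'a \<Rightarrow> real" where
  "inf_conv m f k x = (INF y\<in>mspace m. f y + k * mdist m x y)"

context
  fixes m :: "'a metric" and f :: "'a \<Rightarrow> real" and B k :: real
  assumes bd: "\<And>x. x \<in> mspace m \<Longrightarrow> \<bar>f x\<bar> \<le> B" and k: "0 \<le> k"
begin

interpretation Metric_space "mspace m" "mdist m"
  by (rule Metric_space_mspace_mdist)

lemma inf_conv_bdd_below: "bdd_below ((\<lambda>y. f y + k * mdist m x y) ` mspace m)"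
proof (rule bdd_belowI2)
  fix y assume "y \<in> mspace m"
  then have "- B \<le> f y" using bd[of y] by linarith
  moreover have "0 \<le> k * mdist m x y" using k by simp
  ultimately show "- B \<le> f y + k * mdist m x y" by linarith
qed

lemma inf_conv_le: "x \<in> mspace m \<Longrightarrow> y \<in> mspace m \<Longrightarrow> inf_conv m f k x \<le> f y + k * mdist m x y"
  unfolding inf_conv_def by (rule cINF_lower[OF inf_conv_bdd_below])

lemma inf_conv_le_self: "x \<in> mspace m \<Longrightarrow> inf_conv m f k x \<le> f x"
  using inf_conv_le[of x x] by simp

lemma inf_conv_ge:
  assumes "x \<in> mspace m" "\<And>y. y \<in> mspace m \<Longrightarrow> c \<le> f y + k * mdist m x y"
  shows "c \<le> inf_conv m f k x"
  unfolding inf_conv_def by (rule cINF_greatest) (use assms in auto)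

lemma inf_conv_abs_le: "x \<in> mspace m \<Longrightarrow> \<bar>inf_conv m f k x\<bar> \<le> B"
proof (rule abs_leI)
  assume x: "x \<in> mspace m"
  show "inf_conv m f k x \<le> B" using inf_conv_le_self[OF x] bd[OF x] by linarith
  have "- B \<le> inf_conv m f k x"
  proof (rule inf_conv_ge[OF x])
    fix y assume "y \<in> mspace m"
    then have "- B \<le> f y" using bd[of y] by linarith
    moreover have "0 \<le> k * mdist m x y" using k by simp
    ultimately show "- B \<le> f y + k * mdist m x y" by linarith
  qed
  then show "- inf_conv m f k x \<le> B" by linarith
qed

lemma inf_conv_Lipschitz:
  assumes "x \<in> mspace m" "y \<in> mspace m"
  shows "\<bar>inf_conv m f k x - inf_conv m f k y\<bar> \<le> k * mdist m x y"
proof -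
  have *: "inf_conv m f k x - k * mdist m x y \<le> inf_conv m f k y" if "x \<in> mspace m" "y \<in> mspace m" for x y
  proof (rule inf_conv_ge[OF that(2)])
    fix z assume z: "z \<in> mspace m"
    have "k * mdist m x z \<le> k * (mdist m x y + mdist m y z)"
      using that z k by (intro mult_left_mono triangle) auto
    then show "inf_conv m f k x - k * mdist m x y \<le> f z + k * mdist m y z"
      using inf_conv_le[OF that(1) z] by (simp add: distrib_left)
  qed
  show ?thesis
    using *[OF assms] *[OF assms(2,1)] commute[of x y] by (intro abs_leI) auto
qed

end

text \<open>Within distance \<open>d\<close> of \<open>x\<close> continuity keeps \<open>f\<close>
  close to \<open>f x\<close>; at larger distance the penalty \<open>n * d\<close> eventually
  exceeds \<open>2 * B\<close>, so such points cannot lower the infimum below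
  \<open>f x\<close>.\<close>

lemma inf_conv_tendsto:
  assumes bd: "\<And>x. x \<in> mspace m \<Longrightarrow> \<bar>f x\<bar> \<le> B"
    and f: "continuous_map (mtopology_of m) euclideanreal f" and x: "x \<in> mspace m"
  shows "(\<lambda>n. inf_conv m f (real n) x) \<longlonglongrightarrow> f x"
proof -
  interpret Metric_space "mspace m" "mdist m" by (rule Metric_space_mspace_mdist)
  show ?thesis
  proof (rule LIMSEQ_I)
    fix r :: real assume r: "0 < r"
    have "openin (mtopology_of m) {y \<in> topspace (mtopology_of m). f y \<in> {f x - r/2<..}}"
      by (rule openin_continuous_map_preimage[OF f]) simp
    then have "openin mtopology {y \<in> mspace m. f x - r/2 < f y}"
      by (simp add: mtopology_of_def)
    then obtain d where d: "0 < d" "mball x d \<subseteq> {y \<in> mspace m. f x - r/2 < f y}"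
      using x r unfolding openin_mtopology by (auto dest!: spec[of _ x])
    obtain n0 where n0: "2 * B / d < real n0" using reals_Archimedean2 by blast
    show "\<exists>no. \<forall>n\<ge>no. norm (inf_conv m f (real n) x - f x) < r"
    proof (intro exI[of _ n0] allI impI)
      fix n assume "n0 \<le> n"
      then have n: "2 * B < real n * d" using n0 d(1) by (simp add: pos_divide_less_eq order_less_le_trans mult_right_mono)
      have "f x - r / 2 \<le> inf_conv m f (real n) x"
      proof (rule inf_conv_ge[OF bd _ x])
        fix y assume y: "y \<in> mspace m"
        show "f x - r / 2 \<le> f y + real n * mdist m x y"
        proof (cases "mdist m x y < d")
          case True
          then have "f x - r/2 < f y" using d(2) x y by (auto simp: in_mball)
          moreover have "0 \<le> real n * mdist m x y" by simp
          ultimately show ?thesis by linarith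
        next
          case False
          then have "real n * d \<le> real n * mdist m x y" by (intro mult_left_mono) auto
          then show ?thesis using n bd[OF x] bd[OF y] r by linarith
        qed
      qed auto
      moreover have "inf_conv m f (real n) x \<le> f x" by (rule inf_conv_le_self[OF bd _ x]) auto
      ultimately show "norm (inf_conv m f (real n) x - f x) < r" using r by simp
    qed
  qed
qed

text \<open>The Lipschitz envelopes lie below \<open>f\<close>, so they bound the integrals along
  \<open>Y N\<close> from below, and their own integrals converge. The loss matters only under the
  limit law, where dominated convergence removes it.\<close>

lemma Lipschitz_conv_imp_converges_in_distribution:
  fixes m :: "'a metric"
  assumes M: "prob_space M" and M': "prob_space M'"
    and Y: "\<forall>\<^sub>F N in sequentially. Y N \<in> measurable M (borel_of (mtopology_of m))"
    and Y': "Y' \<in> measurable M' (borel_of (mtopology_of m))"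
    and conv: "\<And>F B L. 0 \<le> L \<Longrightarrow> (\<And>x. x \<in> mspace m \<Longrightarrow> \<bar>F x\<bar> \<le> B) \<Longrightarrow>
      (\<And>x y. x \<in> mspace m \<Longrightarrow> y \<in> mspace m \<Longrightarrow> \<bar>F x - F y\<bar> \<le> L * mdist m x y) \<Longrightarrow>
      (\<lambda>N. \<integral>\<omega>. F (Y N \<omega>) \<partial>M) \<longlonglongrightarrow> (\<integral>\<omega>. F (Y' \<omega>) \<partial>M')"
  shows "converges_in_distribution (mtopology_of m) M Y M' Y'"
proof -
  interpret M: prob_space M by fact
  interpret M': prob_space M' by fact
  \<comment> \<open>One-sided estimate: the envelope index \<open>n\<close> is fixed by the limit
    law before \<open>N\<close> goes to infinity.\<close>
  have lower: "\<exists>N0. \<forall>N\<ge>N0. (\<integral>\<omega>. f (Y' \<omega>) \<partial>M') - r < (\<integral>\<omega>. f (Y N \<omega>) \<partial>M)"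
    if f: "continuous_map (mtopology_of m) euclideanreal f" and bd: "\<And>x. x \<in> mspace m \<Longrightarrow> \<bar>f x\<bar> \<le> B" and r: "0 < r" for f B r
  proof -
    let ?F = "\<lambda>n. inf_conv m f (real n)"
    have Fc: "continuous_map (mtopology_of m) euclideanreal (?F n)" for n
      by (rule Lipschitz_imp_continuous_map) (rule inf_conv_Lipschitz[OF bd], auto)
    have sp: "Y' \<omega> \<in> mspace m" if "\<omega> \<in> space M'" for \<omega>
      using measurable_space[OF Y' that] by simp
    have "(\<lambda>n. \<integral>\<omega>. ?F n (Y' \<omega>) \<partial>M') \<longlonglongrightarrow> (\<integral>\<omega>. f (Y' \<omega>) \<partial>M')"
    proof (rule integral_dominated_convergence[where w="\<lambda>_. B"])
      show "(\<lambda>\<omega>. f (Y' \<omega>)) \<in> borel_measurable M'"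
        by (rule measurable_compose[OF Y' borel_measurable_continuous_map[OF f]])
      show "(\<lambda>\<omega>. ?F n (Y' \<omega>)) \<in> borel_measurable M'" for n
        by (rule measurable_compose[OF Y' borel_measurable_continuous_map[OF Fc]])
      show "AE \<omega> in M'. (\<lambda>n. ?F n (Y' \<omega>)) \<longlonglongrightarrow> f (Y' \<omega>)"
        by (rule AE_I2, rule inf_conv_tendsto[OF bd f sp])
      show "AE \<omega> in M'. norm (?F n (Y' \<omega>)) \<le> B" for n
        using inf_conv_abs_le[where k="real n", OF bd _ sp] by (auto intro!: AE_I2)
    qed auto
    then have "\<forall>\<^sub>F n in sequentially. (\<integral>\<omega>. f (Y' \<omega>) \<partial>M') - r < (\<integral>\<omega>. ?F n (Y' \<omega>) \<partial>M')"
      using r by (intro order_tendstoD(1)) auto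
    then obtain n where n: "(\<integral>\<omega>. f (Y' \<omega>) \<partial>M') - r < (\<integral>\<omega>. ?F n (Y' \<omega>) \<partial>M')"
      by (auto simp: eventually_sequentially)
    have "(\<lambda>N. \<integral>\<omega>. ?F n (Y N \<omega>) \<partial>M) \<longlonglongrightarrow> (\<integral>\<omega>. ?F n (Y' \<omega>) \<partial>M')"
      by (rule conv[of "real n" _ B]) (auto intro!: inf_conv_abs_le[OF bd] inf_conv_Lipschitz[OF bd])
    then have "\<forall>\<^sub>F N in sequentially. (\<integral>\<omega>. f (Y' \<omega>) \<partial>M') - r < (\<integral>\<omega>. ?F n (Y N \<omega>) \<partial>M)"
      using n by (rule order_tendstoD(1))
    then have "\<forall>\<^sub>F N in sequentially. (\<integral>\<omega>. f (Y' \<omega>) \<partial>M') - r < (\<integral>\<omega>. f (Y N \<omega>) \<partial>M)"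
      using Y
    proof eventually_elim
      case (elim N)
      have sp: "Y N \<omega> \<in> mspace m" if "\<omega> \<in> space M" for \<omega>
        using measurable_space[OF elim(2) that] by simp
      have "(\<integral>\<omega>. ?F n (Y N \<omega>) \<partial>M) \<le> (\<integral>\<omega>. f (Y N \<omega>) \<partial>M)"
      proof (rule integral_mono_AE)
        show "integrable M (\<lambda>\<omega>. f (Y N \<omega>))"
          by (rule M.integrable_const_bound[where B=B])
            (use bd sp in \<open>auto intro!: AE_I2 measurable_compose[OF elim(2) borel_measurable_continuous_map[OF f]]\<close>)
        show "integrable M (\<lambda>\<omega>. ?F n (Y N \<omega>))"
          by (rule M.integrable_const_bound[where B=B])
            (use inf_conv_abs_le[where k="real n", OF bd _ sp] in \<open>auto intro!: AE_I2 measurable_compose[OF elim(2) borel_measurable_continuous_map[OF Fc]]\<close>)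
        show "AE \<omega> in M. ?F n (Y N \<omega>) \<le> f (Y N \<omega>)"
          by (rule AE_I2, rule inf_conv_le_self[OF bd _ sp]) auto
      qed
      then show ?case using elim(1) by linarith
    qed
    then show ?thesis by (simp add: eventually_sequentially)
  qed
  have main: "(\<lambda>N. \<integral>\<omega>. f (Y N \<omega>) \<partial>M) \<longlonglongrightarrow> (\<integral>\<omega>. f (Y' \<omega>) \<partial>M')"
    if f: "continuous_map (mtopology_of m) euclideanreal f" and bd: "\<And>x. x \<in> mspace m \<Longrightarrow> \<bar>f x\<bar> \<le> B" for f B
  proof (rule LIMSEQ_I)
    fix r :: real assume r: "0 < r"
    obtain N1 where N1: "\<And>N. N \<ge> N1 \<Longrightarrow> (\<integral>\<omega>. f (Y' \<omega>) \<partial>M') - r < (\<integral>\<omega>. f (Y N \<omega>) \<partial>M)"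
      using lower[OF f bd r] by blast
    \<comment> \<open>The opposite inequality is the one-sided estimate for
      \<open>- f\<close>.\<close>
    have f2: "continuous_map (mtopology_of m) euclideanreal (\<lambda>x. - f x)"
      using f by (rule continuous_map_minus)
    have bd2: "\<And>x. x \<in> mspace m \<Longrightarrow> \<bar>- f x\<bar> \<le> B" using bd by simp
    obtain N2 where N2: "\<And>N. N \<ge> N2 \<Longrightarrow> (\<integral>\<omega>. - f (Y' \<omega>) \<partial>M') - r < (\<integral>\<omega>. - f (Y N \<omega>) \<partial>M)"
      using lower[OF f2 bd2 r] by blast
    show "\<exists>no. \<forall>N\<ge>no. norm ((\<integral>\<omega>. f (Y N \<omega>) \<partial>M) - (\<integral>\<omega>. f (Y' \<omega>) \<partial>M')) < r"
    proof (intro exI[of _ "max N1 N2"] allI impI)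
      fix N assume "max N1 N2 \<le> N"
      then show "norm ((\<integral>\<omega>. f (Y N \<omega>) \<partial>M) - (\<integral>\<omega>. f (Y' \<omega>) \<partial>M')) < r"
        using N1[of N] N2[of N] by (simp add: abs_less_iff)
    qed
  qed
  show ?thesis
    unfolding converges_in_distribution_def
  proof (intro conjI allI impI Y Y')
    fix f assume f: "continuous_map (mtopology_of m) euclideanreal f \<and> bounded (f ` topspace (mtopology_of m))"
    then obtain B where B: "\<forall>y\<in>f ` mspace m. norm y \<le> B" by (auto simp: bounded_iff)
    have fm: "f \<in> borel_measurable (borel_of (mtopology_of m))"
      by (rule borel_measurable_continuous_map) (use f in blast)
    have "(\<lambda>N. \<integral>\<omega>. f (Y N \<omega>) \<partial>M) \<longlonglongrightarrow> (\<integral>\<omega>. f (Y' \<omega>) \<partial>M')"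
      by (rule main[of f B]) (use f B in auto)
    moreover have "\<forall>\<^sub>F N in sequentially. (\<integral>\<omega>. f (Y N \<omega>) \<partial>M) = (\<integral>y. f y \<partial>distr M (borel_of (mtopology_of m)) (Y N))"
      using Y by eventually_elim (simp add: integral_distr[OF _ fm])
    ultimately have "(\<lambda>N. \<integral>y. f y \<partial>distr M (borel_of (mtopology_of m)) (Y N)) \<longlonglongrightarrow> (\<integral>\<omega>. f (Y' \<omega>) \<partial>M')"
      by (rule Lim_transform_eventually)
    then show "(\<lambda>N. \<integral>y. f y \<partial>distr M (borel_of (mtopology_of m)) (Y N)) \<longlonglongrightarrow>
        (\<integral>y. f y \<partial>distr M' (borel_of (mtopology_of m)) Y')"
      by (simp only: integral_distr[OF Y' fm])
  qed
qed

text \<open>For an open set \<open>U\<close> the envelope of its indicator is 1-Lipschitz and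
  positive exactly on \<open>U\<close> (it is the distance to the complement, capped at 1). The
  preimage of \<open>U\<close> is thus described by a real function that is a pointwise limit of
  measurable ones.\<close>

lemma measurable_metric_limit:
  fixes m :: "'a metric"
  assumes G: "\<And>n::nat. G n \<in> measurable M (borel_of (mtopology_of m))"
    and Y: "\<And>\<omega>. \<omega> \<in> space M \<Longrightarrow> Y \<omega> \<in> mspace m"
    and lim: "\<And>\<omega>. \<omega> \<in> space M \<Longrightarrow> (\<lambda>n. mdist m (G n \<omega>) (Y \<omega>)) \<longlonglongrightarrow> 0"
  shows "Y \<in> measurable M (borel_of (mtopology_of m))"
proof (rule measurable_borel_ofI)
  interpret Metric_space "mspace m" "mdist m" by (rule Metric_space_mspace_mdist)
  fix U assume "openin (mtopology_of m) U"
  then have U: "U \<subseteq> mspace m" "\<And>x. x \<in> U \<Longrightarrow> \<exists>r>0. mball x r \<subseteq> U"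
    by (auto simp: mtopology_of_def openin_mtopology)
  let ?f = "\<lambda>y. if y \<in> U then 1 else 0 :: real"
  let ?h = "inf_conv m ?f 1"
  have bd: "\<bar>?f x\<bar> \<le> 1" for x by simp
  have hL: "\<bar>?h x - ?h y\<bar> \<le> 1 * mdist m x y" if "x \<in> mspace m" "y \<in> mspace m" for x y
    by (rule inf_conv_Lipschitz[OF bd]) (use that in auto)
  have hm: "?h \<in> borel_measurable (borel_of (mtopology_of m))"
    by (rule borel_measurable_continuous_map[OF Lipschitz_imp_continuous_map[OF hL]])
  have hU: "x \<in> U \<longleftrightarrow> 0 < ?h x" if x: "x \<in> mspace m" for x
  proof
    assume "x \<in> U"
    then obtain r where r: "0 < r" "mball x r \<subseteq> U" using U(2) by blast
    have "min 1 r \<le> ?h x"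
    proof (rule inf_conv_ge[OF bd _ x])
      fix y assume "y \<in> mspace m"
      then show "min 1 r \<le> ?f y + 1 * mdist m x y"
        using r x by (cases "mdist m x y < r") (auto simp: in_mball subset_iff intro: min.coboundedI1)
    qed auto
    then show "0 < ?h x" using r by linarith
  next
    assume "0 < ?h x"
    then show "x \<in> U" using inf_conv_le_self[where f="?f" and k=1, OF bd _ x] by (auto split: if_splits)
  qed
  have sp: "G n \<omega> \<in> mspace m" if "\<omega> \<in> space M" for n \<omega>
    using measurable_space[OF G that] by simp
  have "(\<lambda>\<omega>. ?h (Y \<omega>)) \<in> borel_measurable M"
  proof (rule borel_measurable_LIMSEQ_real)
    show "(\<lambda>\<omega>. ?h (G n \<omega>)) \<in> borel_measurable M" for n
      by (rule measurable_compose[OF G hm])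
    fix \<omega> assume w: "\<omega> \<in> space M"
    have "(\<lambda>n. ?h (G n \<omega>) - ?h (Y \<omega>)) \<longlonglongrightarrow> 0"
      by (rule Lim_null_comparison[OF _ lim[OF w]]) (use hL[OF sp[OF w] Y[OF w]] in auto)
    then show "(\<lambda>n. ?h (G n \<omega>)) \<longlonglongrightarrow> ?h (Y \<omega>)" by (simp add: LIM_zero_iff)
  qed
  then have "{\<omega> \<in> space M. 0 < ?h (Y \<omega>)} \<in> sets M" by measurable
  moreover have "{\<omega> \<in> space M. 0 < ?h (Y \<omega>)} = Y -` U \<inter> space M"
    using hU Y by auto
  ultimately show "Y -` U \<inter> space M \<in> sets M" by simp
qed (use Y in auto)

section \<open>Polygonal paths\<close>

abbreviation path_metric :: "real \<Rightarrow> (real \<Rightarrow> real ^ 2) metric" where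
  "path_metric T \<equiv> cfunspace (top_of_set {0..T}) euclidean_metric"

lemma mspace_path_metric: "f \<in> mspace (path_metric T) \<longleftrightarrow> f \<in> extensional {0..T} \<and> continuous_on {0..T} f"
proof -
  have "compactin (top_of_set {0..T}) (topspace (top_of_set {0..T}))"
    by (simp add: compactin_subtopology)
  from compactin_mspace_cfunspace[OF this, where 'b="real^2", of euclidean_metric] show ?thesis
    by (auto simp del: mspace_cfunspace)
qed

lemma mdist_path_metric_le:
  "0 \<le> B \<Longrightarrow> (\<And>t. 0 \<le> t \<Longrightarrow> t \<le> T \<Longrightarrow> dist (f t) (g t) \<le> B) \<Longrightarrow> mdist (path_metric T) f g \<le> B"
  by (rule mdist_cfunspace_le) auto

definition polygon :: "(nat \<Rightarrow> real ^ 2) \<Rightarrow> real \<Rightarrow> real ^ 2" where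
  "polygon x r = (let n = nat \<lfloor>r\<rfloor> in x n + (r - real n) *\<^sub>R (x (Suc n) - x n))"

text \<open>The factor \<open>c\<close> rescales time, so that node \<open>j\<close> sits at time
  \<open>j / c\<close>.\<close>

definition poly_path :: "real \<Rightarrow> real \<Rightarrow> (nat \<Rightarrow> real ^ 2) \<Rightarrow> real \<Rightarrow> real ^ 2" where
  "poly_path T c x = (\<lambda>t\<in>{0..T}. polygon x (c * t))"

text \<open>Written as a finite sum of clamped ramps, the interpolation has no case distinction at
  the nodes, and continuity is immediate.\<close>

lemma polygon_clamp:
  assumes "0 \<le> r" "r \<le> real n"
  shows "polygon x r = x 0 + (\<Sum>j<n. max 0 (min 1 (r - real j)) *\<^sub>R (x (Suc j) - x j))"
proof -
  define i where "i = nat \<lfloor>r\<rfloor>"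
  have i: "real i \<le> r" "r < real i + 1" using assms(1) by (auto simp: i_def)
  then have "i \<le> n" using assms(2) by linarith
  have low: "(\<Sum>j<m. max 0 (min 1 (r - real j)) *\<^sub>R (x (Suc j) - x j)) = x m - x 0" if "m \<le> i" for m
    using that
  proof (induction m)
    case (Suc m)
    then have "max 0 (min 1 (r - real m)) = 1" using i by (auto simp: max_def min_def)
    then show ?case using Suc by simp
  qed simp
  have high: "(\<Sum>j<m. max 0 (min 1 (r - real j)) *\<^sub>R (x (Suc j) - x j)) = polygon x r - x 0" if "i < m" for m
    using that
  proof (induction m)
    case (Suc m)
    show ?case
    proof (cases "i = m")
      case True
      then have "max 0 (min 1 (r - real m)) = r - real m" using i by (auto simp: max_def min_def)
      then show ?thesis using True low[of m] by (simp add: polygon_def Let_def i_def[symmetric])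
    next
      case False
      then have "i < m" using Suc by simp
      then have "max 0 (min 1 (r - real m)) = 0" using i by (auto simp: max_def min_def)
      then show ?thesis using Suc \<open>i < m\<close> by simp
    qed
  qed simp
  show ?thesis
  proof (cases "i = n")
    case True
    then have "r = real i" using i assms(2) by simp
    then have "polygon x r = x i" by (simp add: polygon_def)
    then show ?thesis using low[of n] True by simp
  next
    case False
    then show ?thesis using high[of n] \<open>i \<le> n\<close> by simp
  qed
qed

lemma continuous_polygon: "continuous_on {0..real n} (polygon x)"
proof -
  have "continuous_on {0..real n} (\<lambda>r. x 0 + (\<Sum>j<n. max 0 (min 1 (r - real j)) *\<^sub>R (x (Suc j) - x j)))"
    by (intro continuous_intros)
  then show ?thesis by (rule continuous_on_eq) (simp add: polygon_clamp[where n=n])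
qed

text \<open>At the right end \<open>r = n\<close> both nodes are taken to be \<open>n\<close>, so
  that only indices up to \<open>n\<close> ever occur.\<close>

lemma polygon_convex:
  assumes "0 \<le> r" "r \<le> real n"
  obtains i j s where "i \<le> n" "j \<le> n" "0 \<le> s" "s \<le> 1" "real i \<le> r" "r < real i + 1" "i \<le> j" "j \<le> Suc i" "r \<le> real j"
    "\<And>x. polygon x r = (1 - s) *\<^sub>R x i + s *\<^sub>R x j"
proof -
  define i where "i = nat \<lfloor>r\<rfloor>"
  have i: "real i \<le> r" "r < real i + 1" using assms(1) by (auto simp: i_def)
  then have "i \<le> n" using assms(2) by linarith
  show ?thesis
  proof (cases "i = n")
    case True
    then have "r = real i" using i assms(2) by simp
    then show ?thesis using True by (intro that[of i i 0]) (auto simp: polygon_def)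
  next
    case False
    show ?thesis
      by (rule that[of i "Suc i" "r - real i"])
        (use False i \<open>i \<le> n\<close> in \<open>auto simp: polygon_def Let_def i_def[symmetric] algebra_simps\<close>)
  qed
qed

lemma convex_comb_norm_le:
  fixes a b :: "'a :: real_normed_vector"
  assumes "norm a \<le> d" "norm b \<le> d" "0 \<le> s" "s \<le> 1"
  shows "norm ((1 - s) *\<^sub>R a + s *\<^sub>R b) \<le> d"
proof -
  have "norm ((1 - s) *\<^sub>R a + s *\<^sub>R b) \<le> norm ((1 - s) *\<^sub>R a) + norm (s *\<^sub>R b)"
    by (rule norm_triangle_ineq)
  also have "\<dots> = (1 - s) * norm a + s * norm b" using assms by simp
  also have "\<dots> \<le> (1 - s) * d + s * d" using assms by (intro add_mono mult_left_mono) auto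
  finally show ?thesis by (simp add: algebra_simps)
qed

lemma polygon_dist_le:
  assumes "0 \<le> r" "r \<le> real n" and d: "\<And>j. j \<le> n \<Longrightarrow> norm (x j - y j) \<le> d"
  shows "dist (polygon x r) (polygon y r) \<le> d"
proof -
  obtain i j s where *: "i \<le> n" "j \<le> n" "0 \<le> s" "s \<le> 1"
    and p: "\<And>x. polygon x r = (1 - s) *\<^sub>R x i + s *\<^sub>R x j"
    by (rule polygon_convex[OF assms(1,2)]) (rule that; assumption)
  have "polygon x r - polygon y r = (1 - s) *\<^sub>R (x i - y i) + s *\<^sub>R (x j - y j)"
    by (simp add: p algebra_simps)
  then show ?thesis unfolding dist_norm
    using convex_comb_norm_le[of "x i - y i" d "x j - y j" s] d * by simp
qed

lemma poly_path_in_mspace: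
  assumes "0 \<le> c" "0 \<le> T"
  shows "poly_path T c x \<in> mspace (path_metric T)"
proof -
  obtain n where n: "c * T \<le> real n" using real_arch_simple by blast
  have "continuous_on {0..T} (\<lambda>t. polygon x (c * t))"
  proof (rule continuous_on_compose2[OF continuous_polygon[of n x]])
    show "(\<lambda>t. c * t) ` {0..T} \<subseteq> {0..real n}"
    proof (clarsimp, intro conjI)
      fix t assume t: "0 \<le> t" "t \<le> T"
      show "0 \<le> c * t" using t assms by simp
      have "c * t \<le> c * T" using t assms by (intro mult_left_mono) auto
      then show "c * t \<le> real n" using n by linarith
    qed
  qed (intro continuous_intros)
  then have "continuous_on {0..T} (poly_path T c x)"
    by (rule continuous_on_eq) (auto simp: poly_path_def)
  then show ?thesis
    unfolding mspace_path_metric by (simp add: poly_path_def)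
qed

lemma poly_path_dist_le:
  assumes "0 \<le> c" "c * T \<le> real n" "0 \<le> d" and d: "\<And>j. j \<le> n \<Longrightarrow> norm (x j - y j) \<le> d"
  shows "mdist (path_metric T) (poly_path T c x) (poly_path T c y) \<le> d"
proof (rule mdist_path_metric_le[OF assms(3)])
  fix t assume t: "0 \<le> t" "t \<le> T"
  have "c * t \<le> c * T" using t assms by (intro mult_left_mono) auto
  then have "dist (polygon x (c * t)) (polygon y (c * t)) \<le> d"
    using t assms by (intro polygon_dist_le[where n=n] d) auto
  then show "dist (poly_path T c x t) (poly_path T c y t) \<le> d"
    using t by (simp add: poly_path_def)
qed

text \<open>On \<open>[0, T]\<close> only finitely many nodes matter, so the map from node sequences
  with the product topology into the path space is continuous; measurability is then checked
  coordinate by coordinate.\<close>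

lemma measurable_poly_path:
  assumes c: "0 \<le> c" "0 \<le> T" and x: "\<And>j. (\<lambda>\<omega>. x \<omega> j) \<in> borel_measurable M"
  shows "(\<lambda>\<omega>. poly_path T c (x \<omega>)) \<in> measurable M (borel_of (mtopology_of (path_metric T)))"
proof (rule measurable_borel_ofI)
  show "poly_path T c (x \<omega>) \<in> topspace (mtopology_of (path_metric T))" for \<omega>
    unfolding topspace_mtopology_of by (rule poly_path_in_mspace[OF c])
  interpret Metric_space "mspace (path_metric T)" "mdist (path_metric T)" by (rule Metric_space_mspace_mdist)
  obtain n where n: "c * T \<le> real n" using real_arch_simple by blast
  fix U assume "openin (mtopology_of (path_metric T)) U"
  then have U: "\<And>f. f \<in> U \<Longrightarrow> \<exists>r>0. mball f r \<subseteq> U"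
    by (auto simp: mtopology_of_def openin_mtopology simp del: mspace_cfunspace)
  have "open ((poly_path T c) -` U)"
    unfolding open_subopen[of "(poly_path T c) -` U"]
  proof
    fix y assume "y \<in> poly_path T c -` U"
    then obtain r where r: "0 < r" "mball (poly_path T c y) r \<subseteq> U" using U by auto
    let ?V = "\<Inter>j\<in>{..n}. {z :: nat \<Rightarrow> real^2. norm (z j - y j) < r / 2}"
    have "open {z :: nat \<Rightarrow> real^2. norm (z j - y j) < r / 2}" for j
      by (intro open_Collect_less continuous_intros continuous_on_product_coordinates)
    then have "open ?V" by (intro open_INT) auto
    moreover have "y \<in> ?V" using r by auto
    moreover have "?V \<subseteq> poly_path T c -` U"
    proof
      fix z assume z: "z \<in> ?V"
      have "mdist (path_metric T) (poly_path T c y) (poly_path T c z) \<le> r / 2"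
        by (rule poly_path_dist_le[OF c(1) n]) (use r z in \<open>auto simp: norm_minus_commute less_imp_le\<close>)
      then have "poly_path T c z \<in> mball (poly_path T c y) r"
        unfolding in_mball using r poly_path_in_mspace[OF c] by simp
      then show "z \<in> poly_path T c -` U" using r by auto
    qed
    ultimately show "\<exists>V. open V \<and> y \<in> V \<and> V \<subseteq> poly_path T c -` U" by blast
  qed
  moreover have "x \<in> borel_measurable M"
    by (rule measurable_coordinatewise_then_product) (rule x)
  ultimately have "x -` (poly_path T c -` U) \<inter> space M \<in> sets M"
    by (intro measurable_sets[of x M borel]) auto
  then show "(\<lambda>\<omega>. poly_path T c (x \<omega>)) -` U \<inter> space M \<in> sets M" by (simp add: vimage_def)
qed

text \<open>By uniform continuity of \<open>g\<close>, once the mesh is below its modulus every node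
  used at time \<open>t\<close> has a value close to \<open>g t\<close>, and so has their convex
  combination.\<close>

lemma poly_path_approx:
  assumes T: "0 < T" and g: "continuous_on {0..T} g"
  shows "(\<lambda>m. mdist (path_metric T) (poly_path T (real (Suc m) / T) (\<lambda>j. g (min T (real j * T / real (Suc m))))) (restrict g {0..T})) \<longlonglongrightarrow> 0"
proof (rule LIMSEQ_I)
  interpret Metric_space "mspace (path_metric T)" "mdist (path_metric T)" by (rule Metric_space_mspace_mdist)
  fix r :: real assume r: "0 < r"
  have "uniformly_continuous_on {0..T} g" by (rule compact_uniformly_continuous[OF g]) simp
  then have "\<exists>d>0. \<forall>x\<in>{0..T}. \<forall>x'\<in>{0..T}. dist x' x < d \<longrightarrow> dist (g x') (g x) < r / 2"
    unfolding uniformly_continuous_on_def using half_gt_zero[OF r] by blast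
  then obtain d where d: "0 < d" "\<And>s t. s \<in> {0..T} \<Longrightarrow> t \<in> {0..T} \<Longrightarrow> dist s t < d \<Longrightarrow> dist (g s) (g t) < r / 2"
    by blast
  obtain m0 where m0: "T / d < real m0" using reals_Archimedean2 by blast
  have le: "mdist (path_metric T) (poly_path T (real (Suc m) / T) (\<lambda>j. g (min T (real j * T / real (Suc m))))) (restrict g {0..T}) \<le> r / 2"
    if "m0 \<le> m" for m
  proof (rule mdist_path_metric_le)
    fix t assume t: "0 \<le> t" "t \<le> T"
    let ?x = "\<lambda>j. g (min T (real j * T / real (Suc m)))"
    define rr where "rr = real (Suc m) / T * t"
    have "rr \<le> real (Suc m) / T * T" unfolding rr_def using t T by (intro mult_left_mono) auto
    then have r0: "0 \<le> rr" "rr \<le> real (Suc m)" using t T by (auto simp: rr_def)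
    have step: "T / real (Suc m) < d"
    proof -
      have "T / d < real (Suc m)" using m0 that by linarith
      then show ?thesis using d(1) T by (simp add: pos_divide_less_eq mult.commute)
    qed
    obtain i j s where *: "0 \<le> s" "s \<le> 1" "real i \<le> rr" "rr < real i + 1" "j \<le> Suc i" "rr \<le> real j" "i \<le> j"
      and p: "\<And>x. polygon x rr = (1 - s) *\<^sub>R x i + s *\<^sub>R x j"
      by (rule polygon_convex[OF r0]) (rule that; assumption)
    have close: "norm (?x l - g t) \<le> r / 2" if "\<bar>real l - rr\<bar> \<le> 1" for l
    proof -
      have "t = rr * (T / real (Suc m))" using T by (simp add: rr_def)
      then have "real l * T / real (Suc m) - t = (real l - rr) * (T / real (Suc m))"
        by (simp only: left_diff_distrib times_divide_eq_right diff_divide_distrib)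
      then have "\<bar>real l * T / real (Suc m) - t\<bar> = \<bar>real l - rr\<bar> * (T / real (Suc m))" using T by (simp add: abs_mult)
      also have "\<dots> \<le> 1 * (T / real (Suc m))" using that T by (intro mult_right_mono) auto
      finally have "\<bar>real l * T / real (Suc m) - t\<bar> < d" using step by simp
      \<comment> \<open>Since \<open>t \<le> T\<close>, clamping a node time at \<open>T\<close>
        only moves it closer to \<open>t\<close>.\<close>
      then have "\<bar>min T (real l * T / real (Suc m)) - t\<bar> < d" using t by (auto simp: min_def)
      then have "dist (g (min T (real l * T / real (Suc m)))) (g t) < r / 2"
        using t T by (intro d(2)) (auto simp: dist_real_def)
      then show ?thesis by (simp add: dist_norm)
    qed
    have "polygon ?x rr - g t = (1 - s) *\<^sub>R (?x i - g t) + s *\<^sub>R (?x j - g t)"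
      by (simp add: p algebra_simps)
    moreover have "norm ((1 - s) *\<^sub>R (?x i - g t) + s *\<^sub>R (?x j - g t)) \<le> r / 2"
      using * by (intro convex_comb_norm_le close) auto
    ultimately show "dist (poly_path T (real (Suc m) / T) ?x t) (restrict g {0..T} t) \<le> r / 2"
      using t by (simp add: poly_path_def dist_norm rr_def)
  qed (use r in auto)
  show "\<exists>no. \<forall>m\<ge>no. norm (mdist (path_metric T) (poly_path T (real (Suc m) / T) (\<lambda>j. g (min T (real j * T / real (Suc m))))) (restrict g {0..T}) - 0) < r"
  proof (intro exI[of _ m0] allI impI)
    fix m assume "m0 \<le> m"
    from le[OF this] r nonneg
    show "norm (mdist (path_metric T) (poly_path T (real (Suc m) / T) (\<lambda>j. g (min T (real j * T / real (Suc m))))) (restrict g {0..T}) - 0) < r"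
      by (simp del: mspace_cfunspace)
  qed
qed

section \<open>Trigonometric polynomials and characteristic functions\<close>

text \<open>The terms form a list, so frequencies may repeat and sums and products of such functions
  are obtained by concatenation. Coefficients are complex although the function is real.\<close>

definition trig_poly :: "'i set \<Rightarrow> (('i \<Rightarrow> real) \<Rightarrow> real) \<Rightarrow> bool" where
  "trig_poly I F \<longleftrightarrow> (\<exists>xs :: (complex \<times> ('i \<Rightarrow> real)) list.
     \<forall>y. complex_of_real (F y) = (\<Sum>(c, u)\<leftarrow>xs. c * cis (\<Sum>i\<in>I. u i * y i)))"

lemma trig_poly_const: "trig_poly I (\<lambda>_. c)"
  unfolding trig_poly_def by (rule exI[of _ "[(complex_of_real c, \<lambda>_. 0)]"]) simp

lemma trig_poly_add:
  assumes "trig_poly I F" "trig_poly I G"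
  shows "trig_poly I (\<lambda>y. F y + G y)"
proof -
  obtain xs ys where
    "\<And>y. complex_of_real (F y) = (\<Sum>(c, u)\<leftarrow>xs. c * cis (\<Sum>i\<in>I. u i * y i))"
    "\<And>y. complex_of_real (G y) = (\<Sum>(c, u)\<leftarrow>ys. c * cis (\<Sum>i\<in>I. u i * y i))"
    using assms unfolding trig_poly_def by blast
  then show ?thesis unfolding trig_poly_def by (intro exI[of _ "xs @ ys"]) simp
qed

lemma trig_poly_mult:
  assumes "trig_poly I F" "trig_poly I G"
  shows "trig_poly I (\<lambda>y. F y * G y)"
proof -
  obtain xs ys where
    F: "\<And>y. complex_of_real (F y) = (\<Sum>(c, u)\<leftarrow>xs. c * cis (\<Sum>i\<in>I. u i * y i))" and
    G: "\<And>y. complex_of_real (G y) = (\<Sum>(c, u)\<leftarrow>ys. c * cis (\<Sum>i\<in>I. u i * y i))"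
    using assms unfolding trig_poly_def by blast
  \<comment> \<open>Multiplication of a list of exponentials by a single term: coefficients multiply
    and frequencies add.\<close>
  define prod1 :: "complex \<times> ('a \<Rightarrow> real) \<Rightarrow> (complex \<times> ('a \<Rightarrow> real)) list \<Rightarrow> (complex \<times> ('a \<Rightarrow> real)) list" where
    "prod1 p = map (\<lambda>q. (fst p * fst q, \<lambda>i. snd p i + snd q i))" for p
  have 1: "(\<Sum>(c, u)\<leftarrow>prod1 p zs. c * cis (\<Sum>i\<in>I. u i * y i)) =
      (fst p * cis (\<Sum>i\<in>I. snd p i * y i)) * (\<Sum>(c, u)\<leftarrow>zs. c * cis (\<Sum>i\<in>I. u i * y i))" for p zs y
    by (induction zs) (auto simp: prod1_def distrib_left distrib_right sum.distrib cis_mult[symmetric] case_prod_beta algebra_simps)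
  have 2: "(\<Sum>(c, u)\<leftarrow>concat (map (\<lambda>p. prod1 p ys) xs). c * cis (\<Sum>i\<in>I. u i * y i)) =
      (\<Sum>(c, u)\<leftarrow>xs. c * cis (\<Sum>i\<in>I. u i * y i)) * (\<Sum>(c, u)\<leftarrow>ys. c * cis (\<Sum>i\<in>I. u i * y i))" for y
    by (induction xs) (auto simp: 1[unfolded case_prod_beta] distrib_right case_prod_beta)
  show ?thesis unfolding trig_poly_def
    by (rule exI[of _ "concat (map (\<lambda>p. prod1 p ys) xs)"], rule allI) (simp only: of_real_mult F G 2)
qed

lemma trig_poly_sin:
  assumes "finite I" "j \<in> I"
  shows "trig_poly I (\<lambda>y. sin (y j / K))"
proof -
  let ?u = "\<lambda>s i. if i = j then s / K else 0 :: real"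
  have *: "(\<Sum>i\<in>I. ?u s i * y i) = s * (y j / K)" for s y
  proof -
    have "(\<Sum>i\<in>I. ?u s i * y i) = (\<Sum>i\<in>I. if i = j then s / K * y i else 0)"
      by (rule sum.cong) auto
    then show ?thesis using assms by simp
  qed
  show ?thesis unfolding trig_poly_def
    by (rule exI[of _ "[(1 / (2 * \<i>), ?u 1), (- 1 / (2 * \<i>), ?u (- 1))]"])
      (auto simp only: list.map sum_list.Cons sum_list.Nil * prod.case, auto simp: complex_eq_iff Re_divide Im_divide)
qed

text \<open>Tychonoff's theorem, transferred to the topology on the function type.\<close>

lemma compact_PiE_UNIV: "compact {s :: 'i \<Rightarrow> real. \<forall>i. s i \<in> {-1..1}}"
proof -
  have "compactin (product_topology (\<lambda>_. euclidean) (UNIV :: 'i set)) (PiE UNIV (\<lambda>_. {-1..1::real}))"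
    by (subst compactin_PiE) auto
  moreover have "PiE UNIV (\<lambda>_. {-1..1::real}) = {s :: 'i \<Rightarrow> real. \<forall>i. s i \<in> {-1..1}}"
    by (auto simp: PiE_def Pi_def)
  ultimately show ?thesis
    by (simp add: euclidean_product_topology compactin_euclidean_iff)
qed

text \<open>
  Coordinates outside \<open>I\<close> are irrelevant for \<open>\<phi>\<close>; projecting them away makes the coordinate
  functions with index in \<open>I\<close> separate the points that matter.
\<close>

lemma trig_poly_approx:
  fixes \<phi> :: "('i :: countable \<Rightarrow> real) \<Rightarrow> real"
  assumes I: "finite I" and K: "0 < K" and e: "0 < \<epsilon>"
    and lip: "\<And>y z. \<bar>\<phi> y - \<phi> z\<bar> \<le> L * (\<Sum>i\<in>I. \<bar>y i - z i\<bar>)"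
  obtains P where "trig_poly I P" "\<And>y. \<bar>P y - \<phi> (\<lambda>i. K * sin (y i / K))\<bar> < \<epsilon>"
proof -
  let ?S = "{s :: 'i \<Rightarrow> real. \<forall>i. s i \<in> {-1..1}} \<inter> {s. \<forall>i. i \<notin> I \<longrightarrow> s i = 0}"
  let ?R = "{P. continuous_on ?S P \<and> trig_poly I (\<lambda>y. P (\<lambda>i. if i \<in> I then sin (y i / K) else 0))}"
  have cont_coord: "continuous_on A (\<lambda>s :: 'i \<Rightarrow> real. s i)" for A i
    by (rule continuous_on_subset[OF continuous_on_product_coordinates]) simp
  have closed: "closed {s :: 'i \<Rightarrow> real. \<forall>i. i \<notin> I \<longrightarrow> s i = 0}"
    unfolding Collect_all_eq
    by (intro closed_INT ballI closed_Collect_imp closed_Collect_eq continuous_intros cont_coord) auto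
  interpret function_ring_on ?R ?S
  proof
    show "compact ?S" by (rule compact_Int_closed[OF compact_PiE_UNIV closed])
    show "\<And>f. f \<in> ?R \<Longrightarrow> continuous_on ?S f" by simp
    show "\<And>f g. f \<in> ?R \<Longrightarrow> g \<in> ?R \<Longrightarrow> (\<lambda>x. f x + g x) \<in> ?R"
      by (auto intro!: continuous_intros trig_poly_add)
    show "\<And>f g. f \<in> ?R \<Longrightarrow> g \<in> ?R \<Longrightarrow> (\<lambda>x. f x * g x) \<in> ?R"
      by (auto intro!: continuous_intros trig_poly_mult)
    show "\<And>c. (\<lambda>_. c) \<in> ?R" by (auto intro!: trig_poly_const)
    fix x y assume xy: "x \<in> ?S" "y \<in> ?S" "x \<noteq> y"
    then obtain j where j: "x j \<noteq> y j" by (auto simp: fun_eq_iff)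
    with xy have jI: "j \<in> I" by force
    show "\<exists>f\<in>?R. f x \<noteq> f y"
      using j jI I by (intro bexI[of _ "\<lambda>s. s j"]) (auto intro!: cont_coord trig_poly_sin)
  qed
  have contphi: "continuous_on ?S (\<lambda>s. \<phi> (\<lambda>i. K * s i))"
  proof (rule continuous_on_def[THEN iffD2], intro ballI)
    fix s assume "s \<in> ?S"
    have "((\<lambda>t. L * (\<Sum>i\<in>I. \<bar>K * t i - K * s i\<bar>)) \<longlongrightarrow> L * (\<Sum>i\<in>I. \<bar>K * s i - K * s i\<bar>)) (at s within ?S)"
      by (intro tendsto_intros) (use cont_coord[of ?S] \<open>s \<in> ?S\<close> in \<open>auto simp: continuous_on_def\<close>)
    then have "((\<lambda>t. L * (\<Sum>i\<in>I. \<bar>K * t i - K * s i\<bar>)) \<longlongrightarrow> 0) (at s within ?S)" by simp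
    then have "((\<lambda>t. \<phi> (\<lambda>i. K * t i) - \<phi> (\<lambda>i. K * s i)) \<longlongrightarrow> 0) (at s within ?S)"
      by (rule Lim_null_comparison[rotated]) (use lip in auto)
    then show "((\<lambda>t. \<phi> (\<lambda>i. K * t i)) \<longlongrightarrow> \<phi> (\<lambda>i. K * s i)) (at s within ?S)"
      by (simp add: LIM_zero_iff)
  qed
  obtain P where P: "P \<in> ?R" "\<forall>x\<in>?S. \<bar>\<phi> (\<lambda>i. K * x i) - P x\<bar> < \<epsilon>"
    using Stone_Weierstrass_basic[OF contphi e] by blast
  show ?thesis
  proof (rule that)
    show "trig_poly I (\<lambda>y. P (\<lambda>i. if i \<in> I then sin (y i / K) else 0))" using P(1) by simp
    fix y
    let ?s = "\<lambda>i. if i \<in> I then sin (y i / K) else 0"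
    have "\<bar>\<phi> (\<lambda>i. K * ?s i) - \<phi> (\<lambda>i. K * sin (y i / K))\<bar> \<le> 0"
      using lip[of "\<lambda>i. K * ?s i" "\<lambda>i. K * sin (y i / K)"] by simp
    moreover have "?s \<in> ?S" by auto
    ultimately show "\<bar>P ?s - \<phi> (\<lambda>i. K * sin (y i / K))\<bar> < \<epsilon>"
      using P(2) by (auto simp: abs_minus_commute)
  qed
qed

section \<open>Expectations of trigonometric polynomials and of Lipschitz functions\<close>

lemma trig_poly_bounded:
  assumes "trig_poly I P" shows "\<exists>B. \<forall>y. \<bar>P y\<bar> \<le> B"
proof -
  obtain xs where xs: "\<And>y. complex_of_real (P y) = (\<Sum>(c, u)\<leftarrow>xs. c * cis (\<Sum>i\<in>I. u i * y i))"
    using assms unfolding trig_poly_def by blast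
  have "norm (\<Sum>(c, u)\<leftarrow>zs. c * cis (\<Sum>i\<in>I. u i * y i)) \<le> (\<Sum>(c, u)\<leftarrow>zs. norm c)" for zs :: "(complex \<times> ('a \<Rightarrow> real)) list" and y
    by (induction zs) (auto intro!: order_trans[OF norm_triangle_ineq] add_mono simp: norm_mult)
  then have "norm (complex_of_real (P y)) \<le> (\<Sum>(c, u)\<leftarrow>xs. norm c)" for y
    unfolding xs .
  then have "\<bar>P y\<bar> \<le> (\<Sum>(c, u)\<leftarrow>xs. norm c)" for y
    by simp
  then show ?thesis by blast
qed

lemma trig_poly_expectation:
  fixes I :: "'a set" and Y :: "'w \<Rightarrow> 'a \<Rightarrow> real"
  assumes M: "prob_space M" and Y: "\<And>i. i \<in> I \<Longrightarrow> (\<lambda>\<omega>. Y \<omega> i) \<in> borel_measurable M"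
    and xs: "\<And>y. complex_of_real (P y) = (\<Sum>(c, u)\<leftarrow>xs. c * cis (\<Sum>i\<in>I. u i * y i))"
  shows "(\<lambda>\<omega>. P (Y \<omega>)) \<in> borel_measurable M"
    "complex_of_real (\<integral>\<omega>. P (Y \<omega>) \<partial>M) = (\<Sum>(c, u)\<leftarrow>xs. c * (\<integral>\<omega>. cis (\<Sum>i\<in>I. u i * Y \<omega> i) \<partial>M))"
proof -
  interpret prob_space M by fact
  have [measurable]: "(\<lambda>\<omega>. cis (\<Sum>i\<in>I. u i * Y \<omega> i)) \<in> borel_measurable M" for u
  proof -
    have "(\<lambda>\<omega>. \<Sum>i\<in>I. u i * Y \<omega> i) \<in> borel_measurable M"
      by (rule borel_measurable_sum) (use Y in measurable)
    then show ?thesis by (rule measurable_compose[where N=borel]) (intro borel_measurable_continuous_onI continuous_intros)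
  qed
  have *: "(\<lambda>\<omega>. (\<Sum>(c, u)\<leftarrow>zs. c * cis (\<Sum>i\<in>I. u i * Y \<omega> i))) \<in> borel_measurable M \<and>
     integrable M (\<lambda>\<omega>. (\<Sum>(c, u)\<leftarrow>zs. c * cis (\<Sum>i\<in>I. u i * Y \<omega> i))) \<and>
     (\<integral>\<omega>. (\<Sum>(c, u)\<leftarrow>zs. c * cis (\<Sum>i\<in>I. u i * Y \<omega> i)) \<partial>M) =
      (\<Sum>(c, u)\<leftarrow>zs. c * (\<integral>\<omega>. cis (\<Sum>i\<in>I. u i * Y \<omega> i) \<partial>M))" for zs :: "(complex \<times> ('a \<Rightarrow> real)) list"
  proof (induction zs)
    case (Cons z zs)
    have "integrable M (\<lambda>\<omega>. fst z * cis (\<Sum>i\<in>I. snd z i * Y \<omega> i))"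
      by (rule integrable_mult_right, rule integrable_const_bound[where B=1]) auto
    then show ?case using Cons by (auto simp: case_prod_beta)
  qed simp
  have "(\<lambda>\<omega>. Re (complex_of_real (P (Y \<omega>)))) \<in> borel_measurable M"
    unfolding xs by (rule borel_measurable_continuous_on[OF _ conjunct1[OF *]]) (intro continuous_intros)
  then show "(\<lambda>\<omega>. P (Y \<omega>)) \<in> borel_measurable M" by simp
  have "complex_of_real (\<integral>\<omega>. P (Y \<omega>) \<partial>M) = (\<integral>\<omega>. complex_of_real (P (Y \<omega>)) \<partial>M)" by simp
  then show "complex_of_real (\<integral>\<omega>. P (Y \<omega>) \<partial>M) = (\<Sum>(c, u)\<leftarrow>xs. c * (\<integral>\<omega>. cis (\<Sum>i\<in>I. u i * Y \<omega> i) \<partial>M))"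
    unfolding xs using * by simp
qed

text \<open>The bound by coordinates in \<open>I\<close> makes \<open>\<phi>\<close> continuous for
  the product topology, where measurability can be checked coordinatewise.\<close>

lemma bounded_Lipschitz_measurable:
  fixes \<phi> :: "('i :: countable \<Rightarrow> real) \<Rightarrow> real"
  assumes Y: "\<And>i. (\<lambda>\<omega>. Y \<omega> i) \<in> borel_measurable M"
    and lip: "\<And>y z. \<bar>\<phi> y - \<phi> z\<bar> \<le> L * (\<Sum>i\<in>I. \<bar>y i - z i\<bar>)"
  shows "(\<lambda>\<omega>. \<phi> (Y \<omega>)) \<in> borel_measurable M"
proof -
  have "continuous_on UNIV \<phi>"
  proof (rule continuous_on_def[THEN iffD2], intro ballI)
    fix s :: "'i \<Rightarrow> real"
    have c: "continuous_on UNIV (\<lambda>s :: 'i \<Rightarrow> real. s i)" for i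
      by (rule continuous_on_product_coordinates)
    have "((\<lambda>t. L * (\<Sum>i\<in>I. \<bar>t i - s i\<bar>)) \<longlongrightarrow> L * (\<Sum>i\<in>I. \<bar>s i - s i\<bar>)) (at s)"
      by (intro tendsto_intros) (use c in \<open>auto simp: continuous_on_def\<close>)
    then have "((\<lambda>t. L * (\<Sum>i\<in>I. \<bar>t i - s i\<bar>)) \<longlongrightarrow> 0) (at s)" by simp
    then have "((\<lambda>t. \<phi> t - \<phi> s) \<longlongrightarrow> 0) (at s)"
      by (rule Lim_null_comparison[rotated]) (use lip in auto)
    then show "(\<phi> \<longlongrightarrow> \<phi> s) (at s)" by (simp add: LIM_zero_iff)
  qed
  moreover have "Y \<in> borel_measurable M"
    by (rule measurable_coordinatewise_then_product) (rule Y)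
  ultimately show ?thesis by (rule borel_measurable_continuous_on)
qed

lemma char_distr:
  assumes "f \<in> borel_measurable M"
  shows "char (distr M borel f) t = (\<integral>\<omega>. cis (t * f \<omega>) \<partial>M)"
  unfolding char_def using assms
  by (subst integral_distr) (auto simp: cis_conv_exp intro!: borel_measurable_continuous_onI continuous_intros)

text \<open>
  \<open>\<phi> y\<close> is compared with \<open>\<phi> (K sin (y / K))\<close>, a uniform limit of trigonometric polynomials; the error
  only involves the one-dimensional marginals.
\<close>

lemma char_conv_imp_Lipschitz_conv:
  fixes \<phi> :: "('i :: countable \<Rightarrow> real) \<Rightarrow> real"
    and Y :: "nat \<Rightarrow> 'w \<Rightarrow> 'i \<Rightarrow> real" and Y' :: "'v \<Rightarrow> 'i \<Rightarrow> real"
  assumes M: "prob_space M" and M': "prob_space M'" and I: "finite I"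
    and Y: "\<And>N i. (\<lambda>\<omega>. Y N \<omega> i) \<in> borel_measurable M"
    and Y': "\<And>i. (\<lambda>\<omega>. Y' \<omega> i) \<in> borel_measurable M'"
    and char: "\<And>u. (\<lambda>N. \<integral>\<omega>. cis (\<Sum>i\<in>I. u i * Y N \<omega> i) \<partial>M) \<longlonglongrightarrow> (\<integral>\<omega>. cis (\<Sum>i\<in>I. u i * Y' \<omega> i) \<partial>M')"
    and bd: "\<And>y. \<bar>\<phi> y\<bar> \<le> B" and L: "0 \<le> L"
    and lip: "\<And>y z. \<bar>\<phi> y - \<phi> z\<bar> \<le> L * (\<Sum>i\<in>I. \<bar>y i - z i\<bar>)"
  shows "(\<lambda>N. \<integral>\<omega>. \<phi> (Y N \<omega>) \<partial>M) \<longlonglongrightarrow> (\<integral>\<omega>. \<phi> (Y' \<omega>) \<partial>M')"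
proof -
  interpret M: prob_space M by fact
  interpret M': prob_space M' by fact
  \<comment> \<open>The price of replacing one coordinate by its sine, capped at the largest
    possible change \<open>2 * B\<close> of \<open>\<phi>\<close>; the cap makes \<open>g K\<close>
    bounded and continuous.\<close>
  define g where "g K y = min (2 * B) (L * \<bar>y - K * sin (y / K)\<bar>)" for K y :: real
  have B: "0 \<le> B" using bd[of undefined] by linarith
  have g0: "0 \<le> g K y" "g K y \<le> 2 * B" for K y using B L by (auto simp: g_def)
  have gcont: "continuous_on UNIV (g K)" if "0 < K" for K
    unfolding g_def using that by (auto intro!: continuous_intros)
  have gm: "g K \<in> borel_measurable borel" if "0 < K" for K
    by (rule borel_measurable_continuous_onI[OF gcont[OF that]])
  have marg: "(\<lambda>N. \<integral>\<omega>. g K (Y N \<omega> i) \<partial>M) \<longlonglongrightarrow> (\<integral>\<omega>. g K (Y' \<omega> i) \<partial>M')" if i: "i \<in> I" and K: "0 < K" for i K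
  proof -
    have *: "(\<Sum>j\<in>I. (if j = i then t else 0) * y j) = t * y i" for t and y :: "'i \<Rightarrow> real"
    proof -
      have "(\<Sum>j\<in>I. (if j = i then t else 0) * y j) = (\<Sum>j\<in>I. if j = i then t * y j else 0)" by (rule sum.cong) auto
      then show ?thesis using I i by simp
    qed
    have "(\<lambda>N. \<integral>\<omega>. cis (t * Y N \<omega> i) \<partial>M) \<longlonglongrightarrow> (\<integral>\<omega>. cis (t * Y' \<omega> i) \<partial>M')" for t
      using char[of "\<lambda>j. if j = i then t else 0"] unfolding * .
    \<comment> \<open>A frequency supported at a single index leaves a scalar characteristic
      function, to which Levy's continuity theorem applies.\<close>
    then have "weak_conv_m (\<lambda>N. distr M borel (\<lambda>\<omega>. Y N \<omega> i)) (distr M' borel (\<lambda>\<omega>. Y' \<omega> i))"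
      by (intro levy_continuity M.real_distribution_distr M'.real_distribution_distr Y Y') (simp add: char_distr Y Y')
    from weak_conv_imp_integral_bdd_continuous_conv[OF M.real_distribution_distr[OF Y]
        M'.real_distribution_distr[OF Y'] this, of "g K" "2 * B"]
    have "(\<lambda>N. integral\<^sup>L (distr M borel (\<lambda>\<omega>. Y N \<omega> i)) (g K)) \<longlonglongrightarrow> integral\<^sup>L (distr M' borel (\<lambda>\<omega>. Y' \<omega> i)) (g K)"
      using g0 gcont[OF K] by (auto simp: continuous_on_eq_continuous_at)
    then show ?thesis using gm[OF K] Y Y' by (simp add: integral_distr)
  qed
  \<comment> \<open>As \<open>K\<close> grows, \<open>K * sin (y / K)\<close> tends to
    \<open>y\<close>; the cap supplies the dominating function.\<close>
  have small: "(\<lambda>n. \<Sum>i\<in>I. \<integral>\<omega>. g (real (Suc n)) (Y' \<omega> i) \<partial>M') \<longlonglongrightarrow> (\<Sum>i\<in>I. \<integral>\<omega>. 0 \<partial>M')"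
  proof (rule tendsto_sum)
    fix i
    show "(\<lambda>n. \<integral>\<omega>. g (real (Suc n)) (Y' \<omega> i) \<partial>M') \<longlonglongrightarrow> (\<integral>\<omega>. 0 \<partial>M')"
    proof (rule integral_dominated_convergence[where w="\<lambda>_. 2 * B"])
      show "AE \<omega> in M'. (\<lambda>n. g (real (Suc n)) (Y' \<omega> i)) \<longlonglongrightarrow> 0"
      proof (rule AE_I2)
        fix \<omega>
        let ?y = "Y' \<omega> i"
        have "(\<lambda>n. real (Suc n) * sin (?y / real (Suc n))) \<longlonglongrightarrow> ?y" by real_asymp
        then have "(\<lambda>n. min (2 * B) (L * \<bar>?y - real (Suc n) * sin (?y / real (Suc n))\<bar>)) \<longlonglongrightarrow> min (2 * B) (L * \<bar>?y - ?y\<bar>)"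
          by (intro tendsto_intros)
        then show "(\<lambda>n. g (real (Suc n)) ?y) \<longlonglongrightarrow> 0" using B by (simp add: g_def)
      qed
      show "(\<lambda>\<omega>. g (real (Suc n)) (Y' \<omega> i)) \<in> borel_measurable M'" for n
        by (rule measurable_compose[OF Y' gm]) simp
      show "AE \<omega> in M'. norm (g (real (Suc n)) (Y' \<omega> i)) \<le> 2 * B" for n
        using g0 by (auto intro!: AE_I2)
    qed auto
  qed
  \<comment> \<open>Either one coordinate reaches the cap, which alone covers the total change, or
    all summands are in the Lipschitz regime.\<close>
  have err: "\<bar>\<phi> y - \<phi> (\<lambda>i. K * sin (y i / K))\<bar> \<le> (\<Sum>i\<in>I. g K (y i))" for y K
  proof (cases "\<exists>i\<in>I. 2 * B \<le> L * \<bar>y i - K * sin (y i / K)\<bar>")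
    case True
    then obtain i where i: "i \<in> I" "2 * B \<le> L * \<bar>y i - K * sin (y i / K)\<bar>" by blast
    have "\<bar>\<phi> y - \<phi> (\<lambda>i. K * sin (y i / K))\<bar> \<le> 2 * B"
      using bd[of y] bd[of "\<lambda>i. K * sin (y i / K)"] by linarith
    also have "\<dots> = g K (y i)" using i by (simp add: g_def)
    also have "\<dots> \<le> (\<Sum>i\<in>I. g K (y i))" by (rule member_le_sum) (use i I g0 in auto)
    finally show ?thesis .
  next
    case False
    then have "(\<Sum>i\<in>I. g K (y i)) = (\<Sum>i\<in>I. L * \<bar>y i - K * sin (y i / K)\<bar>)"
      by (intro sum.cong) (auto simp: g_def min_def)
    then show ?thesis using lip[of y "\<lambda>i. K * sin (y i / K)"] by (simp add: sum_distrib_left)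
  qed
  note phiY = bounded_Lipschitz_measurable[OF Y lip] and phiY' = bounded_Lipschitz_measurable[OF Y' lip]
  have iphi: "integrable M (\<lambda>\<omega>. \<phi> (Y N \<omega>))" for N
    by (rule M.integrable_const_bound[where B=B]) (use bd phiY in auto)
  have iphi': "integrable M' (\<lambda>\<omega>. \<phi> (Y' \<omega>))"
    by (rule M'.integrable_const_bound[where B=B]) (use bd phiY' in auto)
  show ?thesis
  proof (rule LIMSEQ_I)
    fix r :: real assume r: "0 < r"
    \<comment> \<open>Five errors of size \<open>\<epsilon>\<close> occur: the sine replacement and
      the polynomial approximation, each for \<open>Y N\<close> and for \<open>Y'\<close>, and the
      convergence of the polynomial itself.\<close>
    define \<epsilon> where "\<epsilon> = r / 7"
    have e: "0 < \<epsilon>" using r by (simp add: \<epsilon>_def)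
    have "eventually (\<lambda>n. (\<Sum>i\<in>I. \<integral>\<omega>. g (real (Suc n)) (Y' \<omega> i) \<partial>M') < \<epsilon>) sequentially"
      using order_tendstoD(2)[OF small, of \<epsilon>] e by simp
    then obtain n where n: "(\<Sum>i\<in>I. \<integral>\<omega>. g (real (Suc n)) (Y' \<omega> i) \<partial>M') < \<epsilon>"
      by (auto simp: eventually_sequentially)
    define K where "K = real (Suc n)"
    have K: "0 < K" by (simp add: K_def)
    obtain P where P: "trig_poly I P" "\<And>y. \<bar>P y - \<phi> (\<lambda>i. K * sin (y i / K))\<bar> < \<epsilon>"
      using trig_poly_approx[OF I K e lip] by blast
    obtain xs where xs: "\<And>y. complex_of_real (P y) = (\<Sum>(c, u)\<leftarrow>xs. c * cis (\<Sum>i\<in>I. u i * y i))"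
      using P(1) unfolding trig_poly_def by blast
    obtain C where C: "\<And>y. \<bar>P y\<bar> \<le> C" using trig_poly_bounded[OF P(1)] by blast
    have PM: "(\<lambda>\<omega>. P (Y N \<omega>)) \<in> borel_measurable M" for N
      by (rule trig_poly_expectation(1)[OF M _ xs]) (rule Y)
    have PM': "(\<lambda>\<omega>. P (Y' \<omega>)) \<in> borel_measurable M'"
      by (rule trig_poly_expectation(1)[OF M' _ xs]) (rule Y')
    have iP: "integrable M (\<lambda>\<omega>. P (Y N \<omega>))" for N
      by (rule M.integrable_const_bound[where B=C]) (use C PM in auto)
    have iP': "integrable M' (\<lambda>\<omega>. P (Y' \<omega>))"
      by (rule M'.integrable_const_bound[where B=C]) (use C PM' in auto)
    have ig: "integrable M (\<lambda>\<omega>. g K (Y N \<omega> i))" for N i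
      by (rule M.integrable_const_bound[where B="2 * B"])
        (use g0 in \<open>auto intro: measurable_compose[OF Y gm[OF K]]\<close>)
    have ig': "integrable M' (\<lambda>\<omega>. g K (Y' \<omega> i))" for i
      by (rule M'.integrable_const_bound[where B="2 * B"])
        (use g0 in \<open>auto intro: measurable_compose[OF Y' gm[OF K]]\<close>)
    have "(\<lambda>N. \<Sum>(c, u)\<leftarrow>zs. c * (\<integral>\<omega>. cis (\<Sum>i\<in>I. u i * Y N \<omega> i) \<partial>M)) \<longlonglongrightarrow>
        (\<Sum>(c, u)\<leftarrow>zs. c * (\<integral>\<omega>. cis (\<Sum>i\<in>I. u i * Y' \<omega> i) \<partial>M'))" for zs
      by (induction zs) (auto intro!: tendsto_intros char)
    then have "(\<lambda>N. complex_of_real (\<integral>\<omega>. P (Y N \<omega>) \<partial>M)) \<longlonglongrightarrow> complex_of_real (\<integral>\<omega>. P (Y' \<omega>) \<partial>M')"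
      by (simp add: trig_poly_expectation(2)[OF M Y xs] trig_poly_expectation(2)[OF M' Y' xs])
    then have "(\<lambda>N. \<integral>\<omega>. P (Y N \<omega>) \<partial>M) \<longlonglongrightarrow> (\<integral>\<omega>. P (Y' \<omega>) \<partial>M')"
      by (simp only: tendsto_of_real_iff)
    then have ev1: "eventually (\<lambda>N. \<bar>(\<integral>\<omega>. P (Y N \<omega>) \<partial>M) - (\<integral>\<omega>. P (Y' \<omega>) \<partial>M')\<bar> < \<epsilon>) sequentially"
      using e by (auto dest!: tendstoD simp: dist_real_def)
    have "(\<lambda>N. \<Sum>i\<in>I. \<integral>\<omega>. g K (Y N \<omega> i) \<partial>M) \<longlonglongrightarrow> (\<Sum>i\<in>I. \<integral>\<omega>. g K (Y' \<omega> i) \<partial>M')"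
      by (intro tendsto_sum marg K)
    then have ev2: "eventually (\<lambda>N. (\<Sum>i\<in>I. \<integral>\<omega>. g K (Y N \<omega> i) \<partial>M) < \<epsilon>) sequentially"
      using n by (auto dest!: order_tendstoD(2) simp: K_def)
    have diff: "\<bar>\<phi> y - P y\<bar> \<le> (\<Sum>i\<in>I. g K (y i)) + \<epsilon>" for y
      using err[of y K] P(2)[of y] by linarith
    have d: "\<bar>(\<integral>\<omega>. \<phi> (Y N \<omega>) \<partial>M) - (\<integral>\<omega>. P (Y N \<omega>) \<partial>M)\<bar> \<le> (\<Sum>i\<in>I. \<integral>\<omega>. g K (Y N \<omega> i) \<partial>M) + \<epsilon>" for N
    proof -
      have "\<bar>\<integral>\<omega>. \<phi> (Y N \<omega>) - P (Y N \<omega>) \<partial>M\<bar> \<le> (\<integral>\<omega>. \<bar>\<phi> (Y N \<omega>) - P (Y N \<omega>)\<bar> \<partial>M)"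
        by (rule integral_abs_bound)
      also have "\<dots> \<le> (\<integral>\<omega>. (\<Sum>i\<in>I. g K (Y N \<omega> i)) + \<epsilon> \<partial>M)"
        by (rule integral_mono) (use iphi iP ig diff in auto)
      finally show ?thesis using iphi iP ig by (simp add: M.prob_space)
    qed
    have d': "\<bar>(\<integral>\<omega>. \<phi> (Y' \<omega>) \<partial>M') - (\<integral>\<omega>. P (Y' \<omega>) \<partial>M')\<bar> \<le> (\<Sum>i\<in>I. \<integral>\<omega>. g K (Y' \<omega> i) \<partial>M') + \<epsilon>"
    proof -
      have "\<bar>\<integral>\<omega>. \<phi> (Y' \<omega>) - P (Y' \<omega>) \<partial>M'\<bar> \<le> (\<integral>\<omega>. \<bar>\<phi> (Y' \<omega>) - P (Y' \<omega>)\<bar> \<partial>M')"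
        by (rule integral_abs_bound)
      also have "\<dots> \<le> (\<integral>\<omega>. (\<Sum>i\<in>I. g K (Y' \<omega> i)) + \<epsilon> \<partial>M')"
        by (rule integral_mono) (use iphi' iP' ig' diff in auto)
      finally show ?thesis using iphi' iP' ig' by (simp add: M'.prob_space)
    qed
    have "eventually (\<lambda>N. norm ((\<integral>\<omega>. \<phi> (Y N \<omega>) \<partial>M) - (\<integral>\<omega>. \<phi> (Y' \<omega>) \<partial>M')) < r) sequentially"
      using ev1 ev2
    proof eventually_elim
      case (elim N)
      have "(\<Sum>i\<in>I. \<integral>\<omega>. g K (Y' \<omega> i) \<partial>M') < \<epsilon>" using n by (simp add: K_def)
      then have "\<bar>(\<integral>\<omega>. \<phi> (Y N \<omega>) \<partial>M) - (\<integral>\<omega>. \<phi> (Y' \<omega>) \<partial>M')\<bar> < 5 * \<epsilon>"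
        using elim d[of N] d' by linarith
      then show ?case using e by (simp add: \<epsilon>_def)
    qed
    then show "\<exists>no. \<forall>N\<ge>no. norm ((\<integral>\<omega>. \<phi> (Y N \<omega>) \<partial>M) - (\<integral>\<omega>. \<phi> (Y' \<omega>) \<partial>M')) < r"
      by (simp add: eventually_sequentially)
  qed
qed

section \<open>Characteristic functions of the chain\<close>

text \<open>Evenness in each coordinate separately, in the sense of the torus; functions of the
  squared sines have it.\<close>

definition even_fun :: "(real ^ 2 \<Rightarrow> real) \<Rightarrow> bool" where
  "even_fun b \<longleftrightarrow> (\<forall>a k. b (reflect a k) = b k)"

text \<open>The analogue of \<open>char_defect\<close> for a step whose position is drawn from one
  mixture component.\<close>

definition defect :: "2 \<Rightarrow> real ^ 2 \<Rightarrow> real" where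
  "defect a w = (\<integral>k. cos_defect (w \<bullet> vf k) \<partial>nu a)"

text \<open>The centred weight. Away from \<open>ssq k = 0\<close> the weights are
  \<open>1 / 2 + hfun k\<close> and \<open>1 / 2 - hfun k\<close>, so constants and
  \<open>hfun\<close> span the range of the kernel.\<close>

definition hfun :: "real ^ 2 \<Rightarrow> real" where
  "hfun k = weight 1 k - 1 / 2"

text \<open>Since \<open>hfun\<close> has means \<open>kappa\<close> and \<open>- kappa\<close>
  under the two components, the kernel maps it to \<open>kappa\<close> times the difference of the
  weights, which is \<open>2 * kappa * hfun\<close>: the second eigenvalue is
  \<open>2 * kappa\<close>.\<close>

definition kappa :: real where
  "kappa = (\<integral>k. hfun k \<partial>nu 1)"

lemma measurable_hfun [measurable]: "hfun \<in> borel_measurable torus"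
  unfolding hfun_def by measurable

lemma abs_hfun_le: "\<bar>hfun k\<bar> \<le> 1 / 2"
  using weight_nonneg[of 1 k] weight_le_1[of 1 k] by (intro abs_leI) (auto simp: hfun_def)

lemma even_weight: "even_fun (weight a)"
  by (simp add: even_fun_def weight_def)

lemma even_hfun: "even_fun hfun"
  using even_weight by (simp add: even_fun_def hfun_def)

lemma even_const: "even_fun (\<lambda>_. c)"
  by (simp add: even_fun_def)

lemma integral_nu_reflect:
  fixes f :: "real^2 \<Rightarrow> 'b::{banach, second_countable_topology}"
  assumes [measurable]: "f \<in> borel_measurable torus"
  shows "(\<integral>k. f (reflect b k) \<partial>nu a) = (\<integral>k. f k \<partial>nu a)"
proof -
  have "(\<integral>k. f (reflect b k) \<partial>nu a) = (\<integral>k. (2 * (sin (pi * reflect b k $ a))\<^sup>2) *\<^sub>R f (reflect b k) \<partial>torus)"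
    by (subst integral_nu) (auto intro: measurable_compose[OF measurable_reflect])
  also have "\<dots> = (\<integral>k. (2 * (sin (pi * k $ a))\<^sup>2) *\<^sub>R f k \<partial>torus)"
    by (rule integral_torus_reflect[where f="\<lambda>k. (2 * (sin (pi * k $ a))\<^sup>2) *\<^sub>R f k"]) measurable
  finally show ?thesis by (simp add: integral_nu)
qed

lemma vf_reflect_both: "vf (reflect 1 (reflect 2 k)) = - vf k"
  by (simp add: vec_eq_iff vf_reflect forall_2)

lemma measurable_inner_vf [measurable]: "(\<lambda>k. w \<bullet> vf k) \<in> borel_measurable torus"
  by measurable

text \<open>The characteristic function at \<open>w\<close> of a step from the fixed position
  \<open>k\<close>, taken over the exponential time.\<close>

definition char_at :: "real ^ 2 \<Rightarrow> real ^ 2 \<Rightarrow> complex" where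
  "char_at w k = (\<integral>x. cis (x * (w \<bullet> vf k)) \<partial>exp1)"

lemma measurable_cis [measurable (raw)]:
  assumes "f \<in> borel_measurable M" shows "(\<lambda>x. cis (f x)) \<in> borel_measurable M"
  by (rule borel_measurable_continuous_on[OF _ assms]) (intro continuous_intros)

lemma measurable_char_at [measurable]: "char_at w \<in> borel_measurable torus"
proof -
  interpret E: prob_space exp1 by (rule prob_space_exp1)
  show ?thesis unfolding char_at_def by measurable
qed

lemma integrable_cis_exp1: "integrable exp1 (\<lambda>x. cis (x * \<theta>))"
proof -
  interpret E: prob_space exp1 by (rule prob_space_exp1)
  show ?thesis by (rule E.integrable_const_bound[where B=1]) auto
qed

lemma norm_char_at_le: "norm (char_at w k) \<le> 1"
proof -
  interpret E: prob_space exp1 by (rule prob_space_exp1)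
  have "norm (char_at w k) \<le> (\<integral>x. norm (cis (x * (w \<bullet> vf k))) \<partial>exp1)"
    unfolding char_at_def by (rule integral_norm_bound)
  then show ?thesis using E.prob_space by simp
qed

lemma Re_char_at: "Re (char_at w k) = 1 - cos_defect (w \<bullet> vf k)"
proof -
  interpret E: prob_space exp1 by (rule prob_space_exp1)
  have i: "integrable exp1 (\<lambda>x. cos (x * (w \<bullet> vf k)))"
    by (rule E.integrable_const_bound[where B=1]) auto
  have "Re (char_at w k) = (\<integral>x. cos (x * (w \<bullet> vf k)) \<partial>exp1)"
    unfolding char_at_def using integral_Re[OF integrable_cis_exp1, of "w \<bullet> vf k"] by simp
  then show ?thesis unfolding cos_defect_def using i E.prob_space by simp
qed

text \<open>Reflecting both coordinates negates \<open>vf\<close>, hence conjugates every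
  character.\<close>

lemma char_at_reflect_both: "char_at w (reflect 1 (reflect 2 k)) = cnj (char_at w k)"
proof -
  have "cnj (char_at w k) = (\<integral>x. cnj (cis (x * (w \<bullet> vf k))) \<partial>exp1)"
    unfolding char_at_def
    by (rule integral_bounded_linear[OF bounded_linear_cnj integrable_cis_exp1, symmetric])
  then show ?thesis by (simp add: char_at_def vf_reflect_both cis_cnj)
qed

lemma norm_char_at_times_le: "\<bar>c\<bar> \<le> B \<Longrightarrow> norm (char_at w k * complex_of_real c) \<le> B"
  using mult_mono[OF norm_char_at_le[of w k], of "\<bar>c\<bar>" B] by (simp add: norm_mult)

text \<open>Reflecting both coordinates preserves \<open>nu a\<close> and \<open>b\<close> and
  conjugates \<open>char_at\<close>, so the integral equals its own conjugate. It is therefore real,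
  and the term linear in \<open>w\<close> is absent: this is the centring of the steps.\<close>

lemma char_at_nu:
  assumes [measurable]: "b \<in> borel_measurable torus" and b: "\<And>k. \<bar>b k\<bar> \<le> B" and ev: "even_fun b"
  shows "(\<integral>k. char_at w k * complex_of_real (b k) \<partial>nu a) =
    complex_of_real (\<integral>k. (1 - cos_defect (w \<bullet> vf k)) * b k \<partial>nu a)" (is "?I = _")
proof -
  interpret N: prob_space "nu a" by (rule prob_space_nu)
  have int: "integrable (nu a) (\<lambda>k. char_at w k * complex_of_real (b k))"
    by (rule N.integrable_const_bound[where B=B]) (auto intro!: norm_char_at_times_le b)
  have "?I = (\<integral>k. char_at w (reflect 1 (reflect 2 k)) * complex_of_real (b (reflect 1 (reflect 2 k))) \<partial>nu a)"
    by (subst integral_nu_reflect[symmetric, where b=1], measurable)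
      (subst integral_nu_reflect[symmetric, where b=2], auto intro: measurable_compose[OF measurable_reflect])
  also have "\<dots> = (\<integral>k. cnj (char_at w k * complex_of_real (b k)) \<partial>nu a)"
    using ev by (simp add: char_at_reflect_both even_fun_def)
  also have "\<dots> = cnj ?I" by (rule integral_bounded_linear[OF bounded_linear_cnj int])
  finally have "Im ?I = 0" by (metis complex_cnj_cancel_iff Reals_cnj_iff complex_is_Real_iff)
  moreover have "Re ?I = (\<integral>k. (1 - cos_defect (w \<bullet> vf k)) * b k \<partial>nu a)"
    using integral_Re[OF int] by (simp add: Re_char_at)
  ultimately show ?thesis by (simp add: complex_eq_iff)
qed

lemma integrable_cos_defect_nu: "integrable (nu a) (\<lambda>k. cos_defect (w \<bullet> vf k))"
proof -
  interpret N: prob_space "nu a" by (rule prob_space_nu)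
  show ?thesis
    by (rule N.integrable_const_bound[where B=2]) (auto simp: cos_defect_bounds)
qed

lemma defect_nonneg: "0 \<le> defect a w"
  unfolding defect_def by (rule integral_nonneg_AE) (simp add: cos_defect_bounds)

lemma defect_le_2: "defect a w \<le> 2"
proof -
  interpret N: prob_space "nu a" by (rule prob_space_nu)
  show ?thesis unfolding defect_def
    by (rule N.integral_le_const[OF integrable_cos_defect_nu]) (simp add: cos_defect_bounds)
qed

lemma defect_sum: "defect 1 w + defect 2 w = 2 * char_defect w"
  unfolding defect_def char_defect_def
  using integral_nu_sum[of "\<lambda>k. cos_defect (w \<bullet> vf k)" 2] by (simp add: cos_defect_bounds)

lemma char_at_nu_1: "(\<integral>k. char_at w k \<partial>nu a) = complex_of_real (1 - defect a w)"
proof -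
  interpret N: prob_space "nu a" by (rule prob_space_nu)
  show ?thesis
    using char_at_nu[where b="\<lambda>_. 1" and B=1 and w=w and a=a] integrable_cos_defect_nu[of a w]
    N.prob_space by (simp add: even_const defect_def)
qed

text \<open>Because \<open>hfun\<close> is bounded by 1/2, inserting the character perturbs its mean
  by at most half the defect.\<close>

lemma char_at_nu_hfun:
  obtains R where "(\<integral>k. char_at w k * complex_of_real (hfun k) \<partial>nu a) = complex_of_real ((\<integral>k. hfun k \<partial>nu a) - R)"
    "\<bar>R\<bar> \<le> defect a w / 2"
proof
  interpret N: prob_space "nu a" by (rule prob_space_nu)
  let ?R = "\<integral>k. cos_defect (w \<bullet> vf k) * hfun k \<partial>nu a"
  have ih: "integrable (nu a) hfun"
    by (rule N.integrable_const_bound[where B="1/2"]) (use abs_hfun_le in \<open>simp_all del: le_divide_eq_numeral1\<close>)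
  have le: "\<bar>cos_defect (w \<bullet> vf k) * hfun k\<bar> \<le> cos_defect (w \<bullet> vf k) / 2" for k
    using mult_left_mono[OF abs_hfun_le[of k] cos_defect_bounds(1)[of "w \<bullet> vf k"]]
    by (simp add: abs_mult cos_defect_bounds)
  have ic: "integrable (nu a) (\<lambda>k. cos_defect (w \<bullet> vf k) * hfun k)"
    by (rule Bochner_Integration.integrable_bound[OF integrable_cos_defect_nu[of a w]])
      (use le in \<open>auto intro!: AE_I2 order_trans[OF le] simp: cos_defect_bounds\<close>)
  show "(\<integral>k. char_at w k * complex_of_real (hfun k) \<partial>nu a) = complex_of_real ((\<integral>k. hfun k \<partial>nu a) - ?R)"
    using char_at_nu[OF measurable_hfun abs_hfun_le even_hfun, where w=w and a=a] ih ic by (simp add: left_diff_distrib)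
  have "\<bar>?R\<bar> \<le> (\<integral>k. \<bar>cos_defect (w \<bullet> vf k) * hfun k\<bar> \<partial>nu a)" by (rule integral_abs_bound)
  also have "\<dots> \<le> (\<integral>k. cos_defect (w \<bullet> vf k) / 2 \<partial>nu a)"
    by (rule integral_mono) (use ic integrable_cos_defect_nu le in auto)
  finally show "\<bar>?R\<bar> \<le> defect a w / 2" by (simp add: defect_def)
qed

section \<open>The spectral gap of the kernel\<close>

lemma integral_weight_nu: "(\<integral>k. weight b k \<partial>nu a) = (\<integral>k. 2 * (sin (pi * k $ a))\<^sup>2 * weight b k \<partial>torus)"
  by (simp add: integral_nu)

lemma integrable_sin_weight: "integrable torus (\<lambda>k. 2 * (sin (pi * k $ a))\<^sup>2 * weight b k)"
proof (rule integrable_torus_bounded[where B=2])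
  fix k
  have "(sin (pi * k $ a))\<^sup>2 * weight b k \<le> 1 * 1"
    by (intro mult_mono sin_sq_le_1 weight_le_1 weight_nonneg) auto
  then show "norm (2 * (sin (pi * k $ a))\<^sup>2 * weight b k) \<le> 2" by (simp add: abs_mult weight_nonneg)
qed measurable

text \<open>Inside the cell a squared sine vanishes only where its coordinate is 0, a null set, so
  the integrand is almost everywhere positive. The strict sign is the source of the spectral
  gap.\<close>

lemma integral_weight_pos: "0 < (\<integral>k. weight b k \<partial>nu a)"
proof -
  interpret T: prob_space torus by (rule prob_space_torus)
  let ?f = "\<lambda>k. 2 * (sin (pi * k $ a))\<^sup>2 * weight b k"
  have "(\<integral>k. ?f k \<partial>torus) \<noteq> 0"
  proof
    assume "(\<integral>k. ?f k \<partial>torus) = 0"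
    then have z: "AE k in torus. ?f k = 0"
      by (subst (asm) integral_nonneg_eq_0_iff_AE) (auto simp: integrable_sin_weight weight_nonneg)
    have *: "{k::real^2. k $ i = 0} \<inter> cell \<in> null_sets torus" for i
    proof -
      have m: "{k::real^2. k $ i = 0} \<inter> cell \<in> sets torus" by (simp add: sets_torus_iff)
      have "{k::real^2. k $ i = 0} \<inter> cell \<in> null_sets lborel"
        using null_hyperplane[of i 0] by (rule null_set_Int2) simp
      then show ?thesis using m by (auto simp: null_sets_def emeasure_torus)
    qed
    have "AE k in torus. k \<notin> {k. k $ 1 = 0} \<inter> cell" by (rule AE_not_in[OF *])
    moreover have "AE k in torus. k \<notin> {k. k $ 2 = 0} \<inter> cell" by (rule AE_not_in[OF *])
    moreover have "AE k in torus. k \<in> cell" by (metis AE_space space_torus)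
    ultimately have "AE k in torus. False"
      using z
    proof eventually_elim
      case (elim k)
      then have k: "0 < k $ i" "k $ i < 1" for i
        using exhaust_2[of i] by (auto simp: cell_def order.strict_iff_order)
      have s: "0 < sin (pi * k $ i)" for i
        by (rule sin_gt_zero) (use k[of i] in auto)
      have "0 < ssq k" using s[of 1] by (simp add: ssq_alt add_pos_nonneg)
      then have "0 < ?f k" using s[of a] s[of b] by (simp add: weight_def)
      then show False using elim by simp
    qed
    then show False by simp
  qed
  moreover have "0 \<le> (\<integral>k. ?f k \<partial>torus)" by (rule integral_nonneg_AE) (simp add: weight_nonneg)
  ultimately show ?thesis by (simp add: integral_weight_nu)
qed

lemma integral_weight_sum: "(\<integral>k. weight 1 k \<partial>nu a) + (\<integral>k. weight 2 k \<partial>nu a) = 1"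
proof -
  have "2 * (sin (pi * k $ a))\<^sup>2 * weight 1 k + 2 * (sin (pi * k $ a))\<^sup>2 * weight 2 k = 2 * (sin (pi * k $ a))\<^sup>2" for k
  proof (cases "ssq k = 0")
    case True
    then have "(sin (pi * k $ a))\<^sup>2 = 0" using sin_sq_le_ssq[of k a] by (simp add: order_antisym)
    then show ?thesis by simp
  qed (simp add: weight_sum flip: distrib_left)
  then have "(\<integral>k. weight 1 k \<partial>nu a) + (\<integral>k. weight 2 k \<partial>nu a) = (\<integral>k. 2 * (sin (pi * k $ a))\<^sup>2 \<partial>torus)"
    unfolding integral_weight_nu using integrable_sin_weight
    by (subst Bochner_Integration.integral_add[symmetric]) auto
  then show ?thesis by (simp add: integral_sin_sq_torus)
qed

text \<open>Under the invariant measure \<open>weight 1\<close> has mean 1/2, because the factor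
  \<open>ssq\<close> cancels its denominator; hence the means of \<open>hfun\<close> under the two
  components are opposite. Under \<open>nu 1\<close> both weights have positive mean and these means
  sum to 1, which puts \<open>kappa\<close> strictly between -1/2 and 1/2.\<close>

lemma integral_hfun_nu: "(\<integral>k. hfun k \<partial>nu 1) = kappa" "(\<integral>k. hfun k \<partial>nu 2) = - kappa"
  and abs_kappa: "\<bar>2 * kappa\<bar> < 1"
proof -
  have eq: "(\<integral>k. hfun k \<partial>nu a) = (\<integral>k. weight 1 k \<partial>nu a) - 1 / 2" for a
  proof -
    interpret N: prob_space "nu a" by (rule prob_space_nu)
    have "integrable (nu a) (weight 1)"
      by (rule N.integrable_const_bound[where B=1]) (auto simp: weight_nonneg weight_le_1)
    then show ?thesis unfolding hfun_def using N.prob_space by simp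
  qed
  show 1: "(\<integral>k. hfun k \<partial>nu 1) = kappa" by (simp add: kappa_def)
  have "(\<integral>k. weight 1 k \<partial>nu 1) + (\<integral>k. weight 1 k \<partial>nu 2) = 2 * (\<integral>k. ssq k * weight 1 k \<partial>torus)"
    using integral_nu_sum[of "weight 1" 1] by (simp add: weight_nonneg weight_le_1 integral_invariant)
  also have "(\<lambda>k. ssq k * weight 1 k) = (\<lambda>k. (sin (pi * k $ 1))\<^sup>2)"
  proof
    fix k show "ssq k * weight 1 k = (sin (pi * k $ 1))\<^sup>2"
      using sin_sq_le_ssq[of k 1] by (cases "ssq k = 0") (auto simp: weight_def order_antisym)
  qed
  finally show "(\<integral>k. hfun k \<partial>nu 2) = - kappa"
    using eq[of 1] eq[of 2] 1 by (simp add: integral_sin_sq_torus)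
  show "\<bar>2 * kappa\<bar> < 1"
    using eq[of 1] 1 integral_weight_pos[of 1 1] integral_weight_pos[of 1 2] integral_weight_sum[of 1]
    by (simp add: abs_less_iff)
qed

section \<open>The kernel as a jointly measurable density\<close>

definition kdens :: "real ^ 2 \<Rightarrow> real ^ 2 \<Rightarrow> real" where
  "kdens k k' = 2 * (\<Sum>\<alpha>\<in>UNIV. (sin (pi * k $ \<alpha>))\<^sup>2 * (sin (pi * k' $ \<alpha>))\<^sup>2) / (\<Sum>\<beta>\<in>UNIV. (sin (pi * k $ \<beta>))\<^sup>2)"

lemma kernel_kdens: "kernel k = density torus (\<lambda>k'. ennreal (kdens k k'))"
  by (simp add: kernel_def kdens_def)

lemma kdens_nonneg: "0 \<le> kdens k k'"
  unfolding kdens_def by (intro divide_nonneg_nonneg mult_nonneg_nonneg sum_nonneg) auto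

lemma kdens_eq: "kdens k k' = 2 * (weight 1 k * (sin (pi * k' $ 1))\<^sup>2 + weight 2 k * (sin (pi * k' $ 2))\<^sup>2)"
  by (simp add: kdens_def weight_def ssq_alt UNIV_2 add_divide_distrib)

lemma kdens_le: "kdens k k' \<le> 4"
proof -
  have "weight a k * (sin (pi * k' $ a))\<^sup>2 \<le> 1 * 1" for a
    by (intro mult_mono weight_le_1 sin_sq_le_1) auto
  from this[of 1] this[of 2] show ?thesis by (simp add: kdens_eq)
qed

lemma measurable_kdens [measurable]: "(\<lambda>p. kdens (fst p) (snd p)) \<in> borel_measurable (torus \<Otimes>\<^sub>M torus)"
proof -
  have [measurable]: "(\<lambda>k. (sin (pi * k $ a))\<^sup>2) \<in> borel_measurable torus" for a by measurable
  have [measurable]: "(\<lambda>p. weight a (fst p)) \<in> borel_measurable (torus \<Otimes>\<^sub>M torus)"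
    "(\<lambda>p. (sin (pi * snd p $ a))\<^sup>2) \<in> borel_measurable (torus \<Otimes>\<^sub>M torus)" for a
    by (rule measurable_compose[OF measurable_fst measurable_weight])
       (rule measurable_compose[OF measurable_snd \<open>(\<lambda>k. (sin (pi * k $ a))\<^sup>2) \<in> borel_measurable torus\<close>])
  show ?thesis unfolding kdens_eq by measurable
qed

text \<open>Finiteness is what holds at every point: where \<open>ssq k = 0\<close> the density
  vanishes identically and the kernel is the zero measure.\<close>

lemma finite_measure_kernel: "finite_measure (kernel k)"
proof
  interpret T: prob_space torus by (rule prob_space_torus)
  have [measurable]: "kdens k \<in> borel_measurable torus" unfolding kdens_eq[abs_def] by measurable
  have "emeasure (kernel k) (space (kernel k)) = (\<integral>\<^sup>+k'. ennreal (kdens k k') \<partial>torus)"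
    unfolding kernel_kdens by (subst emeasure_density) (auto intro!: nn_integral_cong)
  also have "\<dots> \<le> (\<integral>\<^sup>+k'. ennreal 4 \<partial>torus)"
    by (intro nn_integral_mono ennreal_leI kdens_le)
  also have "\<dots> < \<infinity>" using T.emeasure_space_1 by simp
  finally show "emeasure (kernel k) (space (kernel k)) \<noteq> \<infinity>" by simp
qed

lemma measure_kernel:
  assumes [measurable]: "B \<in> sets torus"
  shows "measure (kernel k) B = weight 1 k * measure (nu 1) B + weight 2 k * measure (nu 2) B"
proof -
  have s: "B \<inter> space torus = B" using sets.sets_into_space[OF assms] by auto
  have bd: "norm (indicator B k' :: real) \<le> 1" for k' by (simp add: indicator_def)
  show ?thesis using integral_kernel[OF borel_measurable_indicator[OF assms] bd, of k] by (simp add: s)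
qed

text \<open>
  The library's \<^const>\<open>prob_space.indep_var\<close> only relates random variables with values in the same type.
\<close>

definition (in prob_space) indep_rvs :: "'b measure \<Rightarrow> ('a \<Rightarrow> 'b) \<Rightarrow> 'c measure \<Rightarrow> ('a \<Rightarrow> 'c) \<Rightarrow> bool" where
  "indep_rvs U X T Y \<longleftrightarrow> X \<in> M \<rightarrow>\<^sub>M U \<and> Y \<in> M \<rightarrow>\<^sub>M T \<and>
     (\<forall>A\<in>sets U. \<forall>B\<in>sets T. prob ((X -` A \<inter> space M) \<inter> (Y -` B \<inter> space M)) =
        prob (X -` A \<inter> space M) * prob (Y -` B \<inter> space M))"

lemma (in prob_space) indep_rvs_compose:
  assumes "indep_rvs U X T Y" "f \<in> U \<rightarrow>\<^sub>M U'" "g \<in> T \<rightarrow>\<^sub>M T'"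
  shows "indep_rvs U' (\<lambda>\<omega>. f (X \<omega>)) T' (\<lambda>\<omega>. g (Y \<omega>))"
proof -
  have X: "X \<in> M \<rightarrow>\<^sub>M U" and Y: "Y \<in> M \<rightarrow>\<^sub>M T" using assms(1) by (auto simp: indep_rvs_def)
  have eq1: "(\<lambda>\<omega>. f (X \<omega>)) -` A \<inter> space M = X -` (f -` A \<inter> space U) \<inter> space M" for A
    using measurable_space[OF X] by auto
  have eq2: "(\<lambda>\<omega>. g (Y \<omega>)) -` B \<inter> space M = Y -` (g -` B \<inter> space T) \<inter> space M" for B
    using measurable_space[OF Y] by auto
  show ?thesis
    unfolding indep_rvs_def eq1 eq2
  proof (intro conjI ballI)
    fix A B assume A: "A \<in> sets U'" and B: "B \<in> sets T'"
    from measurable_sets[OF assms(2) A] measurable_sets[OF assms(3) B]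
    show "prob (X -` (f -` A \<inter> space U) \<inter> space M \<inter> (Y -` (g -` B \<inter> space T) \<inter> space M)) =
        prob (X -` (f -` A \<inter> space U) \<inter> space M) * prob (Y -` (g -` B \<inter> space T) \<inter> space M)"
      using assms(1) unfolding indep_rvs_def by blast
  qed (rule measurable_compose[OF X assms(2)] measurable_compose[OF Y assms(3)])+
qed

lemma (in prob_space) indep_rvs_distr:
  assumes "indep_rvs U X T Y"
  shows "distr M (U \<Otimes>\<^sub>M T) (\<lambda>\<omega>. (X \<omega>, Y \<omega>)) = distr M U X \<Otimes>\<^sub>M distr M T Y"
proof -
  have X [measurable]: "X \<in> M \<rightarrow>\<^sub>M U" and Y [measurable]: "Y \<in> M \<rightarrow>\<^sub>M T" using assms by (auto simp: indep_rvs_def)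
  interpret DX: prob_space "distr M U X" by (rule prob_space_distr) simp
  interpret DY: prob_space "distr M T Y" by (rule prob_space_distr) simp
  show ?thesis
  proof (rule pair_measure_eqI[symmetric])
    show "sigma_finite_measure (distr M U X)" "sigma_finite_measure (distr M T Y)" by unfold_locales
    show "sets (distr M U X \<Otimes>\<^sub>M distr M T Y) = sets (distr M (U \<Otimes>\<^sub>M T) (\<lambda>\<omega>. (X \<omega>, Y \<omega>)))"
      by (simp cong: sets_pair_measure_cong)
    fix A B assume "A \<in> sets (distr M U X)" "B \<in> sets (distr M T Y)"
    then have A: "A \<in> sets U" and B: "B \<in> sets T" by auto
    have "emeasure (distr M (U \<Otimes>\<^sub>M T) (\<lambda>\<omega>. (X \<omega>, Y \<omega>))) (A \<times> B) =
        emeasure M ((X -` A \<inter> space M) \<inter> (Y -` B \<inter> space M))"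
      using A B by (subst emeasure_distr) (auto intro!: arg_cong[where f="emeasure M"])
    also have "\<dots> = emeasure M (X -` A \<inter> space M) * emeasure M (Y -` B \<inter> space M)"
      using assms A B by (simp add: indep_rvs_def emeasure_eq_measure ennreal_mult)
    finally show "emeasure (distr M U X) A * emeasure (distr M T Y) B =
        emeasure (distr M (U \<Otimes>\<^sub>M T) (\<lambda>\<omega>. (X \<omega>, Y \<omega>))) (A \<times> B)"
      using A B by (simp add: emeasure_distr)
  qed
qed

section \<open>Joint law of the past and of the next step\<close>

locale kinetic =
  fixes M :: "'w measure" and \<mu> :: "(real ^ 2) measure"
    and X :: "nat \<Rightarrow> 'w \<Rightarrow> real ^ 2" and e :: "nat \<Rightarrow> 'w \<Rightarrow> real"
  assumes kc: "kinetic_chain M \<mu> X e"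
begin

abbreviation "PX n \<equiv> PiM {..n::nat} (\<lambda>_. torus)"
abbreviation "PE n \<equiv> PiM {..n::nat} (\<lambda>_. borel :: real measure)"

definition "pastX n \<omega> = (\<lambda>i\<in>{..n::nat}. X i \<omega>)"
definition "pastE n \<omega> = (\<lambda>i\<in>{..n::nat}. e i \<omega>)"

lemma prob_space_M: "prob_space M"
  using kc by (simp add: kinetic_chain_def markov_chain_def)

sublocale prob_space M by (rule prob_space_M)

lemma X_measurable [measurable]: "X n \<in> M \<rightarrow>\<^sub>M torus"
  using kc by (simp add: kinetic_chain_def markov_chain_def)

lemma e_measurable [measurable]: "e n \<in> borel_measurable M"
proof -
  have "indep_vars (\<lambda>_. borel) e UNIV" using kc by (simp add: kinetic_chain_def)
  then show ?thesis unfolding indep_vars_def by blast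
qed

lemma distr_e: "distr M borel (e n) = exp1"
  using kc by (simp add: kinetic_chain_def)

lemma pastX_measurable [measurable]: "pastX n \<in> M \<rightarrow>\<^sub>M PX n"
  unfolding pastX_def by measurable

lemma pastE_measurable [measurable]: "pastE n \<in> M \<rightarrow>\<^sub>M PE n"
  unfolding pastE_def by measurable

lemma measurable_last [measurable]: "(\<lambda>v. v n) \<in> PX n \<rightarrow>\<^sub>M torus"
  by (rule measurable_component_singleton) simp

text \<open>Integrating the conditional expectation over an event of the past turns the almost sure
  Markov property into an identity between integrals.\<close>

lemma transition:
  assumes G: "G \<in> sets (PX n)" and B: "B \<in> sets torus"
  shows "measure M {\<omega> \<in> space M. pastX n \<omega> \<in> G \<and> X (Suc n) \<omega> \<in> B} =
    (\<integral>\<omega>. indicator G (pastX n \<omega>) * measure (kernel (X n \<omega>)) B \<partial>M)"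
proof -
  define F where "F = vimage_algebra (space M) (pastX n) (PX n)"
  have "subalgebra M F"
    unfolding subalgebra_def F_def using sets_image_in_sets[OF refl pastX_measurable] by simp
  then interpret S: finite_measure_subalgebra M F
    by unfold_locales
  let ?A = "pastX n -` G \<inter> space M"
  let ?D = "{\<omega> \<in> space M. X (Suc n) \<omega> \<in> B}"
  have D: "?D \<in> sets M" using measurable_sets[OF X_measurable B, of "Suc n"] by (simp add: vimage_def Int_def conj_commute)
  have A: "?A \<in> sets F" unfolding F_def by (rule in_vimage_algebra[OF G])
  have AM: "?A \<in> sets M" using measurable_sets[OF pastX_measurable G] .
  have [measurable]: "(\<lambda>\<omega>. measure (kernel (X n \<omega>)) B) \<in> borel_measurable M"
    unfolding measure_kernel[OF B] by (intro borel_measurable_add borel_measurable_times measurable_compose[OF X_measurable measurable_weight]) auto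
  have AE: "AE \<omega> in M. real_cond_exp M F (indicator ?D) \<omega> = measure (kernel (X n \<omega>)) B"
    using kc B unfolding kinetic_chain_def markov_chain_def F_def pastX_def[abs_def] by blast
  have "measure M {\<omega> \<in> space M. pastX n \<omega> \<in> G \<and> X (Suc n) \<omega> \<in> B} = (\<integral>\<omega>\<in>?A. indicator ?D \<omega> \<partial>M)"
  proof -
    have "(\<integral>\<omega>\<in>?A. indicator ?D \<omega> \<partial>M) = (\<integral>\<omega>. indicator {\<omega> \<in> space M. pastX n \<omega> \<in> G \<and> X (Suc n) \<omega> \<in> B} \<omega> \<partial>M :: real)"
      unfolding set_lebesgue_integral_def by (rule Bochner_Integration.integral_cong) (auto simp: indicator_def)
    then show ?thesis by (simp add: Int_def conj_commute)
  qed
  also have "\<dots> = (\<integral>\<omega>\<in>?A. real_cond_exp M F (indicator ?D) \<omega> \<partial>M)"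
    by (rule S.real_cond_exp_intA[OF integrable_real_indicator[OF D] A]) (simp add: emeasure_eq_measure)
  also have "\<dots> = (\<integral>\<omega>. indicator G (pastX n \<omega>) * measure (kernel (X n \<omega>)) B \<partial>M)"
    unfolding set_lebesgue_integral_def
  proof (rule integral_cong_AE)
    show "AE \<omega> in M. indicat_real ?A \<omega> *\<^sub>R real_cond_exp M F (indicator ?D) \<omega> = indicator G (pastX n \<omega>) * measure (kernel (X n \<omega>)) B"
      using AE AE_space by eventually_elim (auto simp: indicator_def)
    show "(\<lambda>\<omega>. indicator G (pastX n \<omega>) * measure (kernel (X n \<omega>)) B) \<in> borel_measurable M"
      by (intro borel_measurable_times measurable_compose[OF pastX_measurable borel_measurable_indicator[OF G]]) measurable
    show "(\<lambda>\<omega>. indicat_real ?A \<omega> *\<^sub>R real_cond_exp M F (indicator ?D) \<omega>) \<in> borel_measurable M"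
      using AM by (intro borel_measurable_scaleR borel_measurable_indicator) auto
  qed
  finally show ?thesis .
qed

definition "LX n = distr M (PX n) (pastX n)"
definition "LE n = distr M (PE n) (pastE n)"

lemma prob_space_LX: "prob_space (LX n)" and prob_space_LE: "prob_space (LE n)"
  unfolding LX_def LE_def by (auto intro!: prob_space_distr)

lemma sets_LX [measurable_cong, simp]: "sets (LX n) = sets (PX n)" and space_LX [simp]: "space (LX n) = space (PX n)"
  and sets_LE [measurable_cong, simp]: "sets (LE n) = sets (PE n)" and space_LE [simp]: "space (LE n) = space (PE n)"
  by (simp_all add: LX_def LE_def)

lemma kdens_last_measurable [measurable]: "(\<lambda>p. kdens (fst p n) (snd p)) \<in> borel_measurable (LX n \<Otimes>\<^sub>M torus)"
proof -
  have "(\<lambda>v. v n) \<in> LX n \<rightarrow>\<^sub>M torus"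
    using measurable_last by (simp add: measurable_cong_sets[OF sets_LX refl])
  then have "(\<lambda>p. (fst p n, snd p)) \<in> LX n \<Otimes>\<^sub>M torus \<rightarrow>\<^sub>M torus \<Otimes>\<^sub>M torus"
    by (intro measurable_Pair measurable_snd measurable_compose[OF measurable_fst])
  from measurable_compose[OF this measurable_kdens] show ?thesis by simp
qed

text \<open>Both measures are finite and agree on rectangles: there the density integrates to the
  kernel, and \<open>transition\<close> identifies the result with a probability.\<close>

lemma law_next:
  "distr M (PX n \<Otimes>\<^sub>M torus) (\<lambda>\<omega>. (pastX n \<omega>, X (Suc n) \<omega>)) =
    density (LX n \<Otimes>\<^sub>M torus) (\<lambda>p. ennreal (kdens (fst p n) (snd p)))" (is "?L = ?R")
proof -
  interpret T: prob_space torus by (rule prob_space_torus)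
  interpret L: prob_space "LX n" by (rule prob_space_LX)
  let ?E = "{a \<times> b |a b. a \<in> sets (PX n) \<and> b \<in> sets torus}"
  have Lm: "(\<lambda>\<omega>. (pastX n \<omega>, X (Suc n) \<omega>)) \<in> M \<rightarrow>\<^sub>M PX n \<Otimes>\<^sub>M torus" by measurable
  have eq: "emeasure ?L (G \<times> B) = emeasure ?R (G \<times> B)" if G: "G \<in> sets (PX n)" and B: "B \<in> sets torus" for G B
  proof -
    have G': "G \<in> sets (LX n)" using G by simp
    have GB: "G \<times> B \<in> sets (LX n \<Otimes>\<^sub>M torus)" using G' B by (rule pair_measureI)
    have mk: "(\<lambda>k. measure (kernel k) B) \<in> borel_measurable torus"
      unfolding measure_kernel[OF B] by measurable
    have ek: "(\<integral>\<^sup>+k'. ennreal (kdens k k') * indicator B k' \<partial>torus) = ennreal (measure (kernel k) B)" for k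
    proof -
      interpret K: finite_measure "kernel k" by (rule finite_measure_kernel)
      have [measurable]: "kdens k \<in> borel_measurable torus" unfolding kdens_eq[abs_def] by measurable
      have "emeasure (kernel k) B = (\<integral>\<^sup>+k'. ennreal (kdens k k') * indicator B k' \<partial>torus)"
        unfolding kernel_kdens using B by (subst emeasure_density) auto
      then show ?thesis by (simp add: K.emeasure_eq_measure)
    qed
    have mk_le: "measure (kernel k) B \<le> 4" for k
    proof -
      interpret N1: prob_space "nu 1" by (rule prob_space_nu)
      interpret N2: prob_space "nu 2" by (rule prob_space_nu)
      have "weight 1 k * measure (nu 1) B \<le> 1 * 1" "weight 2 k * measure (nu 2) B \<le> 1 * 1"
        by (intro mult_mono weight_le_1; simp)+
      then show ?thesis by (simp add: measure_kernel[OF B])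
    qed
    have "emeasure ?R (G \<times> B) = (\<integral>\<^sup>+p. ennreal (kdens (fst p n) (snd p)) * indicator (G \<times> B) p \<partial>(LX n \<Otimes>\<^sub>M torus))"
      using GB by (subst emeasure_density) auto
    also have "\<dots> = (\<integral>\<^sup>+v. (\<integral>\<^sup>+k'. ennreal (kdens (v n) k') * indicator (G \<times> B) (v, k') \<partial>torus) \<partial>LX n)"
      using GB by (subst T.nn_integral_fst[symmetric]) auto
    also have "\<dots> = (\<integral>\<^sup>+v. indicator G v * ennreal (measure (kernel (v n)) B) \<partial>LX n)"
      by (intro nn_integral_cong) (auto simp: indicator_times ek[symmetric] mult.left_commute nn_integral_cmult mult.assoc split: split_indicator)
    also have "\<dots> = (\<integral>\<^sup>+\<omega>. indicator G (pastX n \<omega>) * ennreal (measure (kernel (pastX n \<omega> n)) B) \<partial>M)"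
      unfolding LX_def using G mk
      by (intro nn_integral_distr borel_measurable_times_ennreal measurable_compose[OF measurable_last] measurable_compose[OF mk, of "\<lambda>x. ennreal x" borel]) auto
    also have "\<dots> = (\<integral>\<^sup>+\<omega>. ennreal (indicator G (pastX n \<omega>) * measure (kernel (X n \<omega>)) B) \<partial>M)"
      by (intro nn_integral_cong) (auto simp: pastX_def split: split_indicator)
    also have "\<dots> = ennreal (\<integral>\<omega>. indicator G (pastX n \<omega>) * measure (kernel (X n \<omega>)) B \<partial>M)"
    proof (rule nn_integral_eq_integral)
      show "integrable M (\<lambda>\<omega>. indicator G (pastX n \<omega>) * measure (kernel (X n \<omega>)) B)"
      proof (rule integrable_const_bound[where B=4])
        show "(\<lambda>\<omega>. indicator G (pastX n \<omega>) * measure (kernel (X n \<omega>)) B) \<in> borel_measurable M"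
          by (intro borel_measurable_times measurable_compose[OF pastX_measurable borel_measurable_indicator[OF G]]
              measurable_compose[OF X_measurable mk])
      qed (use mk_le in \<open>auto split: split_indicator\<close>)
    qed simp
    also have "\<dots> = emeasure M {\<omega> \<in> space M. pastX n \<omega> \<in> G \<and> X (Suc n) \<omega> \<in> B}"
      by (simp add: transition[OF G B, symmetric] emeasure_eq_measure)
    also have "\<dots> = emeasure ?L (G \<times> B)"
      using G B Lm by (subst emeasure_distr) (auto intro!: arg_cong[where f="emeasure M"])
    finally show ?thesis ..
  qed
  show ?thesis
  proof (rule measure_eqI_generator_eq[where E="?E" and \<Omega>="space (PX n) \<times> space torus" and A="\<lambda>_. space (PX n) \<times> space torus"])
    show "Int_stable ?E" by (rule Int_stable_pair_measure_generator)
    show "?E \<subseteq> Pow (space (PX n) \<times> space torus)"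
      by (rule pair_measure_closed)
    show "\<And>Z. Z \<in> ?E \<Longrightarrow> emeasure ?L Z = emeasure ?R Z" using eq by auto
    show "sets ?L = sigma_sets (space (PX n) \<times> space torus) ?E"
      by (simp add: sets_pair_measure)
    have "sets ?R = sets (PX n \<Otimes>\<^sub>M torus)" by (simp cong: sets_pair_measure_cong)
    then show "sets ?R = sigma_sets (space (PX n) \<times> space torus) ?E"
      by (simp add: sets_pair_measure)
    show "range (\<lambda>_::nat. space (PX n) \<times> space torus) \<subseteq> ?E" by blast
    show "emeasure ?L (space (PX n) \<times> space torus) \<noteq> \<infinity>" for i :: nat
      using finite_measure.emeasure_finite[OF prob_space.finite_measure[OF prob_space_distr[OF Lm]]] by simp
  qed auto
qed

lemma indep_sequences: "indep_rvs (PiM UNIV (\<lambda>_. torus)) (\<lambda>\<omega> n. X n \<omega>) (PiM UNIV (\<lambda>_. borel)) (\<lambda>\<omega> n. e n \<omega>)"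
  unfolding indep_rvs_def
proof (intro conjI ballI)
  show "(\<lambda>\<omega> n. X n \<omega>) \<in> M \<rightarrow>\<^sub>M PiM UNIV (\<lambda>_. torus)"
    by (rule measurable_PiM_single') (auto simp: PiE_def intro: measurable_space[OF X_measurable])
  show "(\<lambda>\<omega> n. e n \<omega>) \<in> M \<rightarrow>\<^sub>M PiM UNIV (\<lambda>_. borel)"
    by (rule measurable_PiM_single') (auto simp: PiE_def)
  fix A :: "(nat \<Rightarrow> real^2) set" and B :: "(nat \<Rightarrow> real) set"
  assume A: "A \<in> sets (PiM UNIV (\<lambda>_. torus))" and B: "B \<in> sets (PiM UNIV (\<lambda>_. borel))"
  have "indep_set
       (sets (vimage_algebra (space M) (\<lambda>\<omega> n. X n \<omega>) (PiM UNIV (\<lambda>_. torus))))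
       (sets (vimage_algebra (space M) (\<lambda>\<omega> n. e n \<omega>) (PiM UNIV (\<lambda>_. borel))))"
    using kc by (simp add: kinetic_chain_def)
  then show "prob ((\<lambda>\<omega> n. X n \<omega>) -` A \<inter> space M \<inter> ((\<lambda>\<omega> n. e n \<omega>) -` B \<inter> space M)) =
      prob ((\<lambda>\<omega> n. X n \<omega>) -` A \<inter> space M) * prob ((\<lambda>\<omega> n. e n \<omega>) -` B \<inter> space M)"
    by (rule indep_setD) (intro in_vimage_algebra A B)+
qed

lemma indep_past_next:
  "indep_rvs (PX n \<Otimes>\<^sub>M torus) (\<lambda>\<omega>. (pastX n \<omega>, X (Suc n) \<omega>)) (PE n \<Otimes>\<^sub>M borel) (\<lambda>\<omega>. (pastE n \<omega>, e (Suc n) \<omega>))"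
proof -
  have "(\<lambda>x. (restrict x {..n}, x (Suc n))) \<in> PiM UNIV (\<lambda>_. torus) \<rightarrow>\<^sub>M PX n \<Otimes>\<^sub>M torus"
    by (intro measurable_Pair measurable_restrict_subset measurable_component_singleton) auto
  moreover have "(\<lambda>x. (restrict x {..n}, x (Suc n))) \<in> PiM UNIV (\<lambda>_. borel :: real measure) \<rightarrow>\<^sub>M PE n \<Otimes>\<^sub>M borel"
    by (intro measurable_Pair measurable_restrict_subset measurable_component_singleton) auto
  ultimately show ?thesis
    using indep_rvs_compose[OF indep_sequences] by (simp add: pastX_def[abs_def] pastE_def[abs_def] restrict_def)
qed

lemma indep_past: "indep_rvs (PX n) (pastX n) (PE n) (pastE n)"
  using indep_rvs_compose[OF indep_past_next measurable_fst measurable_fst, of n] by simp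

lemma indep_e_next: "indep_rvs (PE n) (pastE n) borel (e (Suc n))"
proof -
  have "indep_vars (\<lambda>_. borel) e UNIV" using kc by (simp add: kinetic_chain_def)
  then have iv: "indep_var (PE n) (\<lambda>\<omega>. restrict (\<lambda>i. e i \<omega>) {..n}) (PiM {Suc n} (\<lambda>_. borel)) (\<lambda>\<omega>. restrict (\<lambda>i. e i \<omega>) {Suc n})"
    by (rule indep_var_restrict) auto
  have "indep_rvs (PE n) (\<lambda>\<omega>. restrict (\<lambda>i. e i \<omega>) {..n}) (PiM {Suc n} (\<lambda>_. borel)) (\<lambda>\<omega>. restrict (\<lambda>i. e i \<omega>) {Suc n})"
    unfolding indep_rvs_def using indep_varD[OF iv] indep_var_rv1[OF iv] indep_var_rv2[OF iv]
    by (auto simp: vimage_def Int_def conj_commute conj_left_commute)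
  from indep_rvs_compose[OF this measurable_ident measurable_component_singleton[of "Suc n"]]
  show ?thesis by (simp add: id_def pastE_def[abs_def])
qed

text \<open>Positions are independent of times and the next time is independent of the earlier ones,
  so past and next step are coupled only through the factor \<open>kdens\<close>.\<close>

lemma law_pair:
  "distr M ((PX n \<Otimes>\<^sub>M torus) \<Otimes>\<^sub>M (PE n \<Otimes>\<^sub>M borel)) (\<lambda>\<omega>. ((pastX n \<omega>, X (Suc n) \<omega>), (pastE n \<omega>, e (Suc n) \<omega>))) =
    density (LX n \<Otimes>\<^sub>M torus) (\<lambda>p. ennreal (kdens (fst p n) (snd p))) \<Otimes>\<^sub>M (LE n \<Otimes>\<^sub>M exp1)"
proof -
  have "distr M (PE n \<Otimes>\<^sub>M borel) (\<lambda>\<omega>. (pastE n \<omega>, e (Suc n) \<omega>)) = LE n \<Otimes>\<^sub>M exp1"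
    using indep_rvs_distr[OF indep_e_next[of n]] unfolding LE_def by (simp add: distr_e)
  then show ?thesis
    using indep_rvs_distr[OF indep_past_next[of n]] by (simp add: law_next)
qed

lemma law_past: "distr M (PX n \<Otimes>\<^sub>M PE n) (\<lambda>\<omega>. (pastX n \<omega>, pastE n \<omega>)) = LX n \<Otimes>\<^sub>M LE n"
  using indep_rvs_distr[OF indep_past[of n]] unfolding LX_def LE_def by simp

text \<open>In \<open>kdens\<close> the last position enters only through the two weights, and the
  next position is drawn from \<open>nu 1\<close> or \<open>nu 2\<close>. The expectation therefore
  splits into two products of a weighted functional of the past and an integral over a fresh
  step.\<close>

lemma one_step:
  fixes \<zeta> :: "(nat \<Rightarrow> real ^ 2) \<times> (nat \<Rightarrow> real) \<Rightarrow> complex" and g :: "(real ^ 2) \<times> real \<Rightarrow> complex"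
  assumes zm [measurable]: "\<zeta> \<in> borel_measurable (PX n \<Otimes>\<^sub>M PE n)" and zb: "\<And>p. norm (\<zeta> p) \<le> Bz"
    and gm [measurable]: "g \<in> borel_measurable (torus \<Otimes>\<^sub>M borel)" and gb: "\<And>p. norm (g p) \<le> Bg"
  shows "(\<integral>\<omega>. \<zeta> (pastX n \<omega>, pastE n \<omega>) * g (X (Suc n) \<omega>, e (Suc n) \<omega>) \<partial>M) =
    (\<integral>\<omega>. \<zeta> (pastX n \<omega>, pastE n \<omega>) * complex_of_real (weight 1 (X n \<omega>)) \<partial>M) * (\<integral>k. (\<integral>x. g (k, x) \<partial>exp1) \<partial>nu 1) +
    (\<integral>\<omega>. \<zeta> (pastX n \<omega>, pastE n \<omega>) * complex_of_real (weight 2 (X n \<omega>)) \<partial>M) * (\<integral>k. (\<integral>x. g (k, x) \<partial>exp1) \<partial>nu 2)"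
proof -
  interpret T: prob_space torus by (rule prob_space_torus)
  interpret E: prob_space exp1 by (rule prob_space_exp1)
  interpret LX: prob_space "LX n" by (rule prob_space_LX)
  interpret LE: prob_space "LE n" by (rule prob_space_LE)
  interpret XE: pair_prob_space "LX n" "LE n" ..
  interpret EE: pair_prob_space "LE n" exp1 ..
  interpret XT: pair_prob_space "LX n" torus ..
  let ?D = "density (LX n \<Otimes>\<^sub>M torus) (\<lambda>p. ennreal (kdens (fst p n) (snd p)))"
  have Bz: "0 \<le> Bz" and Bg: "0 \<le> Bg" using zb[of undefined] gb[of undefined] norm_ge_zero order_trans by blast+
  have D: "prob_space ?D" unfolding law_next[symmetric] by (rule prob_space_distr) measurable
  interpret D: prob_space ?D by (rule D)
  interpret DE: pair_prob_space ?D "LE n \<Otimes>\<^sub>M exp1" ..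
  have zm': "\<zeta> \<in> borel_measurable (LX n \<Otimes>\<^sub>M LE n)"
    using zm by (simp cong: measurable_cong_sets add: measurable_cong_sets[OF sets_pair_measure_cong[OF sets_LX sets_LE] refl])
  have gm': "g \<in> borel_measurable (torus \<Otimes>\<^sub>M exp1)"
    using gm by (simp add: measurable_cong_sets[OF sets_pair_measure_cong[OF refl sets_exp1] refl])
  \<comment> \<open>The times are averaged out first, for fixed positions: \<open>zbar\<close> over
    the past times, \<open>gbar\<close> over the next one.\<close>
  define zbar where "zbar v = (\<integral>u. \<zeta> (v, u) \<partial>LE n)" for v
  define gbar where "gbar k = (\<integral>x. g (k, x) \<partial>exp1)" for k
  have zbarm [measurable]: "zbar \<in> borel_measurable (LX n)"
    unfolding zbar_def by (rule LE.borel_measurable_lebesgue_integral) (use zm' in simp)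
  have gbarm [measurable]: "gbar \<in> borel_measurable torus"
    unfolding gbar_def by (rule E.borel_measurable_lebesgue_integral) (use gm' in simp)
  have zv: "(\<lambda>u. \<zeta> (v, u)) \<in> borel_measurable (LE n)" if "v \<in> space (LX n)" for v
    by (rule measurable_compose[OF measurable_Pair1'[OF that] zm'])
  have gv: "(\<lambda>x. g (k, x)) \<in> borel_measurable exp1" if "k \<in> space torus" for k
    by (rule measurable_compose[OF measurable_Pair1'[OF that] gm'])
  have gbarb: "norm (gbar k) \<le> Bg" for k
  proof -
    have "norm (gbar k) \<le> (\<integral>x. norm (g (k, x)) \<partial>exp1)" unfolding gbar_def by (rule integral_norm_bound)
    also have "\<dots> \<le> Bg"
      using E.integral_le_const[of "\<lambda>x. norm (g (k, x))" Bg] gb Bg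
      by (cases "integrable exp1 (\<lambda>x. norm (g (k, x)))") (auto simp: not_integrable_integral_eq)
    finally show ?thesis .
  qed
  have zbarb: "norm (zbar v) \<le> Bz" for v
  proof -
    have "norm (zbar v) \<le> (\<integral>u. norm (\<zeta> (v, u)) \<partial>LE n)" unfolding zbar_def by (rule integral_norm_bound)
    also have "\<dots> \<le> Bz"
      using LE.integral_le_const[of "\<lambda>u. norm (\<zeta> (v, u))" Bz] zb Bz
      by (cases "integrable (LE n) (\<lambda>u. norm (\<zeta> (v, u)))") (auto simp: not_integrable_integral_eq)
    finally show ?thesis .
  qed
  let ?F = "\<lambda>p. \<zeta> (fst (fst p), fst (snd p)) * g (snd (fst p), snd (snd p))"
  have Fm: "?F \<in> borel_measurable ((PX n \<Otimes>\<^sub>M torus) \<Otimes>\<^sub>M (PE n \<Otimes>\<^sub>M borel))"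
    by measurable
  have sD: "sets (?D \<Otimes>\<^sub>M (LE n \<Otimes>\<^sub>M exp1)) = sets ((PX n \<Otimes>\<^sub>M torus) \<Otimes>\<^sub>M (PE n \<Otimes>\<^sub>M borel))"
    unfolding law_pair[symmetric] by simp
  have Fi: "integrable (?D \<Otimes>\<^sub>M (LE n \<Otimes>\<^sub>M exp1)) ?F"
    by (rule DE.integrable_const_bound[where B="Bz * Bg"])
      (use Fm Bz Bg zb gb in \<open>auto simp: norm_mult measurable_cong_sets[OF sD refl] intro!: mult_mono\<close>)
  \<comment> \<open>With all positions fixed, past and next times are independent and the integrand
    is a product.\<close>
  have inner: "(\<integral>q. ?F (p, q) \<partial>(LE n \<Otimes>\<^sub>M exp1)) = zbar (fst p) * gbar (snd p)" if p: "p \<in> space ?D" for p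
  proof -
    have p1: "fst p \<in> space (LX n)" "snd p \<in> space torus" using p by (auto simp: space_pair_measure)
    have [measurable]: "(\<lambda>u. \<zeta> (fst p, u)) \<in> borel_measurable (LE n)" "(\<lambda>x. g (snd p, x)) \<in> borel_measurable exp1"
      by (rule zv[OF p1(1)], rule gv[OF p1(2)])
    have "integrable (LE n \<Otimes>\<^sub>M exp1) (\<lambda>q. \<zeta> (fst p, fst q) * g (snd p, snd q))"
      by (rule EE.integrable_const_bound[where B="Bz * Bg"])
        (use Bz Bg zb gb in \<open>auto simp: norm_mult intro!: mult_mono\<close>)
    from EE.integral_fst'[OF this] show ?thesis by (simp add: zbar_def gbar_def)
  qed
  have "(\<integral>\<omega>. \<zeta> (pastX n \<omega>, pastE n \<omega>) * g (X (Suc n) \<omega>, e (Suc n) \<omega>) \<partial>M) =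
      (\<integral>p. ?F p \<partial>(?D \<Otimes>\<^sub>M (LE n \<Otimes>\<^sub>M exp1)))"
    unfolding law_pair[symmetric] by (subst integral_distr[OF _ Fm]) auto
  also have "\<dots> = (\<integral>p. (\<integral>q. ?F (p, q) \<partial>(LE n \<Otimes>\<^sub>M exp1)) \<partial>?D)"
    by (rule DE.integral_fst'[OF Fi, symmetric])
  also have "\<dots> = (\<integral>p. zbar (fst p) * gbar (snd p) \<partial>?D)"
    by (rule Bochner_Integration.integral_cong[OF refl inner])
  also have "\<dots> = (\<integral>p. kdens (fst p n) (snd p) *\<^sub>R (zbar (fst p) * gbar (snd p)) \<partial>(LX n \<Otimes>\<^sub>M torus))"
    by (rule integral_density) (auto simp: kdens_nonneg)
  also have "\<dots> = (\<integral>v. (\<integral>k'. kdens (v n) k' *\<^sub>R (zbar v * gbar k') \<partial>torus) \<partial>LX n)"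
  proof (subst XT.integral_fst'[symmetric])
    show "integrable (LX n \<Otimes>\<^sub>M torus) (\<lambda>p. kdens (fst p n) (snd p) *\<^sub>R (zbar (fst p) * gbar (snd p)))"
      by (rule XT.integrable_const_bound[where B="4 * (Bz * Bg)"])
        (use Bz Bg zbarb gbarb in \<open>auto simp: norm_mult kdens_nonneg kdens_le intro!: mult_mono AE_I2\<close>)
  qed simp
  also have "\<dots> = (\<integral>v. zbar v * (complex_of_real (weight 1 (v n)) * (\<integral>k. gbar k \<partial>nu 1) + complex_of_real (weight 2 (v n)) * (\<integral>k. gbar k \<partial>nu 2)) \<partial>LX n)"
  proof (rule Bochner_Integration.integral_cong[OF refl])
    fix v
    have [measurable]: "kdens (v n) \<in> borel_measurable torus" unfolding kdens_eq[abs_def] by measurable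
    have "(\<integral>k'. kdens (v n) k' *\<^sub>R (zbar v * gbar k') \<partial>torus) = (\<integral>k'. zbar v * gbar k' \<partial>kernel (v n))"
      unfolding kernel_kdens by (rule integral_density[symmetric]) (auto simp: kdens_nonneg)
    also have "\<dots> = zbar v * (\<integral>k'. gbar k' \<partial>kernel (v n))" by simp
    finally show "(\<integral>k'. kdens (v n) k' *\<^sub>R (zbar v * gbar k') \<partial>torus) =
        zbar v * (complex_of_real (weight 1 (v n)) * (\<integral>k. gbar k \<partial>nu 1) + complex_of_real (weight 2 (v n)) * (\<integral>k. gbar k \<partial>nu 2))"
      by (simp add: integral_kernel[OF gbarm gbarb] scaleR_conv_of_real)
  qed
  also have "\<dots> = (\<integral>v. zbar v * complex_of_real (weight 1 (v n)) \<partial>LX n) * (\<integral>k. gbar k \<partial>nu 1) +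
      (\<integral>v. zbar v * complex_of_real (weight 2 (v n)) \<partial>LX n) * (\<integral>k. gbar k \<partial>nu 2)"
  proof -
    have wm [measurable]: "(\<lambda>v. weight a (v n)) \<in> borel_measurable (LX n)" for a
      using measurable_compose[OF measurable_last measurable_weight] by (simp add: measurable_cong_sets[OF sets_LX refl])
    have wi: "integrable (LX n) (\<lambda>v. zbar v * complex_of_real (weight a (v n)))" for a
      by (rule LX.integrable_const_bound[where B="Bz * 1"])
        (use Bz zbarb in \<open>auto simp: norm_mult weight_nonneg weight_le_1 simp del: mult_1_right intro!: mult_mono AE_I2\<close>)
    show ?thesis
      using wi[of 1] wi[of 2] by (simp add: distrib_left mult.assoc[symmetric] Bochner_Integration.integral_add integrable_mult_left integral_mult_left_zero)
  qed
  finally have fin: "(\<integral>\<omega>. \<zeta> (pastX n \<omega>, pastE n \<omega>) * g (X (Suc n) \<omega>, e (Suc n) \<omega>) \<partial>M) =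
      (\<integral>v. zbar v * complex_of_real (weight 1 (v n)) \<partial>LX n) * (\<integral>k. gbar k \<partial>nu 1) +
      (\<integral>v. zbar v * complex_of_real (weight 2 (v n)) \<partial>LX n) * (\<integral>k. gbar k \<partial>nu 2)" .
  \<comment> \<open>The average over past times is undone, to return to an expectation under
    \<open>M\<close>.\<close>
  have w: "(\<integral>v. zbar v * complex_of_real (weight a (v n)) \<partial>LX n) =
      (\<integral>\<omega>. \<zeta> (pastX n \<omega>, pastE n \<omega>) * complex_of_real (weight a (X n \<omega>)) \<partial>M)" for a
  proof -
    let ?W = "\<lambda>p. \<zeta> p * complex_of_real (weight a (fst p n))"
    have wm: "(\<lambda>p. weight a (fst p n)) \<in> borel_measurable (PX n \<Otimes>\<^sub>M PE n)"
      by (rule measurable_compose[OF measurable_fst measurable_compose[OF measurable_last measurable_weight]])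
    have Wm: "?W \<in> borel_measurable (PX n \<Otimes>\<^sub>M PE n)"
      using wm by measurable
    have "(\<integral>\<omega>. \<zeta> (pastX n \<omega>, pastE n \<omega>) * complex_of_real (weight a (X n \<omega>)) \<partial>M) =
        (\<integral>\<omega>. ?W (pastX n \<omega>, pastE n \<omega>) \<partial>M)"
      by (simp add: pastX_def)
    also have "\<dots> = (\<integral>p. ?W p \<partial>(LX n \<Otimes>\<^sub>M LE n))"
      unfolding law_past[symmetric] by (subst integral_distr[OF _ Wm]) auto
    also have "\<dots> = (\<integral>v. (\<integral>u. ?W (v, u) \<partial>LE n) \<partial>LX n)"
    proof (rule XE.integral_fst'[symmetric])
      show "integrable (LX n \<Otimes>\<^sub>M LE n) ?W"
        by (rule XE.integrable_const_bound[where B="Bz * 1"])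
          (use Bz zb Wm in \<open>auto simp: norm_mult weight_nonneg weight_le_1 measurable_cong_sets[OF sets_pair_measure_cong[OF sets_LX sets_LE] refl] simp del: mult_1_right intro!: mult_mono AE_I2\<close>)
    qed
    finally show ?thesis by (simp add: zbar_def)
  qed
  show ?thesis using fin by (simp only: w gbar_def)
qed

end

context kinetic
begin

section \<open>Recursion for the characteristic function of weighted sums of steps\<close>

definition "xi n \<omega> = e n \<omega> *\<^sub>R vf (X n \<omega>)"

lemma xi_measurable [measurable]: "xi n \<in> borel_measurable M"
  unfolding xi_def[abs_def] by (intro borel_measurable_scaleR e_measurable measurable_compose[OF X_measurable measurable_vf])

lemma S_eq_xi: "S X e n \<omega> = (\<Sum>l<n. xi l \<omega>)"
  by (simp add: S_def xi_def vf_def)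

text \<open>The weights sum to at most 1, and their sum is the total mass of the kernel at the
  current position. Since the joint law of past and next position has mass 1, the expected sum is 1,
  so equality holds almost surely.\<close>

lemma AE_weight_sum: "AE \<omega> in M. weight 1 (X n \<omega>) + weight 2 (X n \<omega>) = 1"
proof -
  have m: "(\<lambda>\<omega>. weight a (X n \<omega>)) \<in> borel_measurable M" for a
    by (rule measurable_compose[OF X_measurable measurable_weight])
  have le: "weight 1 k + weight 2 k \<le> 1" for k
    by (cases "ssq k = 0") (simp_all add: weight_sum, simp add: weight_def)
  have nu1: "measure (nu a) (space torus) = 1" for a
    using prob_space.prob_space[OF prob_space_nu[of a]] by simp
  have int: "integrable M (\<lambda>\<omega>. weight 1 (X n \<omega>) + weight 2 (X n \<omega>))"
    by (rule integrable_const_bound[where B=1]) (use le weight_nonneg m in \<open>auto simp: add_nonneg_nonneg\<close>)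
  have sp: "pastX n \<omega> \<in> space (PX n)" "X (Suc n) \<omega> \<in> space torus" if "\<omega> \<in> space M" for \<omega>
    using that measurable_space[OF pastX_measurable] measurable_space[OF X_measurable] by auto
  have "1 = measure M {\<omega> \<in> space M. pastX n \<omega> \<in> space (PX n) \<and> X (Suc n) \<omega> \<in> space torus}"
    using sp prob_space by (metis (mono_tags, lifting) Collect_cong Collect_mem_eq)
  also have "\<dots> = (\<integral>\<omega>. indicator (space (PX n)) (pastX n \<omega>) * measure (kernel (X n \<omega>)) (space torus) \<partial>M)"
    by (rule transition) auto
  also have "\<dots> = (\<integral>\<omega>. weight 1 (X n \<omega>) + weight 2 (X n \<omega>) \<partial>M)"
    by (rule Bochner_Integration.integral_cong) (use sp in \<open>auto simp: measure_kernel nu1\<close>)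
  finally have "(\<integral>\<omega>. 1 - (weight 1 (X n \<omega>) + weight 2 (X n \<omega>)) \<partial>M) = 0"
    using int prob_space by (subst Bochner_Integration.integral_diff) auto
  then have "AE \<omega> in M. 1 - (weight 1 (X n \<omega>) + weight 2 (X n \<omega>)) = 0"
    using int le by (subst (asm) integral_nonneg_eq_0_iff_AE) auto
  then show ?thesis by eventually_elim simp
qed

text \<open>A product of characters as a function of the past positions and times rather than of the
  sample point, the form required by \<open>one_step\<close>. The frequency may vary with the
  index.\<close>

definition phase :: "(nat \<Rightarrow> real ^ 2) \<Rightarrow> nat set \<Rightarrow> (nat \<Rightarrow> real ^ 2) \<times> (nat \<Rightarrow> real) \<Rightarrow> complex" where
  "phase w A p = (\<Prod>l\<in>A. cis (snd p l * (w l \<bullet> vf (fst p l))))"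

lemma measurable_phase:
  assumes "A \<subseteq> {..n}"
  shows "phase w A \<in> borel_measurable (PX n \<Otimes>\<^sub>M PE n)"
proof -
  have "(\<lambda>p. cis (snd p l * (w l \<bullet> vf (fst p l)))) \<in> borel_measurable (PX n \<Otimes>\<^sub>M PE n)" if "l \<in> A" for l
  proof -
    have l: "l \<in> {..n}" using that assms by blast
    have "(\<lambda>v. w l \<bullet> vf (v l)) \<in> borel_measurable (PX n)"
      by (rule measurable_compose[OF measurable_component_singleton[OF l] measurable_inner_vf])
    then have "(\<lambda>p. w l \<bullet> vf (fst p l)) \<in> borel_measurable (PX n \<Otimes>\<^sub>M PE n)"
      by (rule measurable_compose[OF measurable_fst])
    moreover have "(\<lambda>p. snd p l) \<in> borel_measurable (PX n \<Otimes>\<^sub>M PE n)"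
      by (rule measurable_compose[OF measurable_snd measurable_component_singleton[OF l]])
    ultimately show ?thesis by (intro measurable_cis borel_measurable_times)
  qed
  then show ?thesis unfolding phase_def[abs_def] by (rule borel_measurable_prod)
qed

lemma norm_phase [simp]: "norm (phase w A p) = 1"
  by (simp add: phase_def prod_norm[symmetric])

lemma phase_past:
  "A \<subseteq> {..n} \<Longrightarrow> phase w A (pastX n \<omega>, pastE n \<omega>) = (\<Prod>l\<in>A. cis (w l \<bullet> xi l \<omega>))"
  unfolding phase_def by (intro prod.cong) (auto simp: pastX_def pastE_def xi_def)

text \<open>\<open>one_step\<close> for a character of the next step times a function of the next
  position; integrating out the next time produces \<open>char_at\<close>.\<close>

lemma phase_step:
  fixes \<zeta> :: "(nat \<Rightarrow> real ^ 2) \<times> (nat \<Rightarrow> real) \<Rightarrow> complex"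
  assumes zm: "\<zeta> \<in> borel_measurable (PX n \<Otimes>\<^sub>M PE n)" and zb: "\<And>p. norm (\<zeta> p) \<le> 1"
    and b [measurable]: "b \<in> borel_measurable torus" and bb: "\<And>k. \<bar>b k\<bar> \<le> B"
  shows "(\<integral>\<omega>. \<zeta> (pastX n \<omega>, pastE n \<omega>) * cis (w \<bullet> xi (Suc n) \<omega>) * complex_of_real (b (X (Suc n) \<omega>)) \<partial>M) =
    (\<integral>\<omega>. \<zeta> (pastX n \<omega>, pastE n \<omega>) * complex_of_real (weight 1 (X n \<omega>)) \<partial>M) *
      (\<integral>k. char_at w k * complex_of_real (b k) \<partial>nu 1) +
    (\<integral>\<omega>. \<zeta> (pastX n \<omega>, pastE n \<omega>) * complex_of_real (weight 2 (X n \<omega>)) \<partial>M) *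
      (\<integral>k. char_at w k * complex_of_real (b k) \<partial>nu 2)"
proof -
  let ?g = "\<lambda>p. cis (snd p * (w \<bullet> vf (fst p))) * complex_of_real (b (fst p))"
  have m1: "(\<lambda>p. w \<bullet> vf (fst p)) \<in> borel_measurable (torus \<Otimes>\<^sub>M borel)"
    by (rule measurable_compose[OF measurable_fst measurable_inner_vf])
  have m2: "(\<lambda>p. b (fst p)) \<in> borel_measurable (torus \<Otimes>\<^sub>M borel)"
    by (rule measurable_compose[OF measurable_fst b])
  have m3: "(\<lambda>p. cis (snd p * (w \<bullet> vf (fst p)))) \<in> borel_measurable (torus \<Otimes>\<^sub>M borel)"
    by (rule measurable_cis[OF borel_measurable_times[OF measurable_snd m1]])
  have gm: "?g \<in> borel_measurable (torus \<Otimes>\<^sub>M borel)"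
    by (rule borel_measurable_times[OF m3 measurable_compose[OF m2 borel_measurable_continuous_onI[OF continuous_on_of_real[OF continuous_on_id]]]])
  have gb: "norm (?g p) \<le> B" for p using bb by (simp add: norm_mult)
  show ?thesis
    using one_step[OF zm zb gm gb] by (simp add: xi_def mult.assoc char_at_def)
qed

text \<open>
  The kernel has rank two, so the characteristic function \<open>charA\<close> and its correlation \<open>charH\<close> with the
  second eigenfunction form a closed linear recursion up to errors of the order of the defect. Since
  \<open>charH\<close> is itself contracted to the order of the defect, it enters \<open>charA\<close> only quadratically.
\<close>

definition "charA w n = (\<integral>\<omega>. (\<Prod>l\<in>{1..n}. cis (w l \<bullet> xi l \<omega>)) \<partial>M)"
definition "charH w n = (\<integral>\<omega>. (\<Prod>l\<in>{1..n}. cis (w l \<bullet> xi l \<omega>)) * complex_of_real (hfun (X n \<omega>)) \<partial>M)"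

lemma integrable_phase_weight:
  assumes [measurable]: "b \<in> borel_measurable torus" and bb: "\<And>k. \<bar>b k\<bar> \<le> B"
  shows "integrable M (\<lambda>\<omega>. (\<Prod>l\<in>A. cis (w l \<bullet> xi l \<omega>)) * complex_of_real (b (X n \<omega>)))"
proof (rule integrable_const_bound[where B=B])
  have 1: "(\<lambda>\<omega>. b (X n \<omega>)) \<in> borel_measurable M" by (rule measurable_compose[OF X_measurable]) simp
  have 2: "(\<lambda>\<omega>. \<Prod>l\<in>A. cis (w l \<bullet> xi l \<omega>)) \<in> borel_measurable M"
    by (intro borel_measurable_prod measurable_cis borel_measurable_inner) auto
  show "(\<lambda>\<omega>. (\<Prod>l\<in>A. cis (w l \<bullet> xi l \<omega>)) * complex_of_real (b (X n \<omega>))) \<in> borel_measurable M"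
    using 1 2 by measurable
qed (use bb in \<open>auto simp: norm_mult prod_norm[symmetric]\<close>)

text \<open>The first identity is the pointwise decomposition
  \<open>weight 1 = 1 / 2 + hfun\<close>; the second holds because the weights sum to 1 along the
  chain almost surely.\<close>

lemma char_weights:
  "(\<integral>\<omega>. (\<Prod>l\<in>{1..n}. cis (w l \<bullet> xi l \<omega>)) * complex_of_real (weight 1 (X n \<omega>)) \<partial>M) = charA w n / 2 + charH w n"
  "(\<integral>\<omega>. (\<Prod>l\<in>{1..n}. cis (w l \<bullet> xi l \<omega>)) * complex_of_real (weight 2 (X n \<omega>)) \<partial>M) = charA w n / 2 - charH w n"
proof -
  let ?P = "\<lambda>\<omega>. \<Prod>l\<in>{1..n}. cis (w l \<bullet> xi l \<omega>)"
  have i0: "integrable M ?P" using integrable_phase_weight[of "\<lambda>_. 1" 1] by simp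
  have ih: "integrable M (\<lambda>\<omega>. ?P \<omega> * complex_of_real (hfun (X n \<omega>)))"
    by (rule integrable_phase_weight[OF measurable_hfun abs_hfun_le])
  have iw: "integrable M (\<lambda>\<omega>. ?P \<omega> * complex_of_real (weight a (X n \<omega>)))" for a
    by (rule integrable_phase_weight[OF measurable_weight, of _ 1]) (simp add: weight_nonneg weight_le_1)
  have "?P \<omega> * complex_of_real (weight 1 (X n \<omega>)) = ?P \<omega> / 2 + ?P \<omega> * complex_of_real (hfun (X n \<omega>))" for \<omega>
    by (simp add: hfun_def algebra_simps)
  then show 1: "(\<integral>\<omega>. ?P \<omega> * complex_of_real (weight 1 (X n \<omega>)) \<partial>M) = charA w n / 2 + charH w n"
    using i0 ih by (simp add: charA_def charH_def)
  have "(\<integral>\<omega>. ?P \<omega> * complex_of_real (weight 1 (X n \<omega>)) + ?P \<omega> * complex_of_real (weight 2 (X n \<omega>)) \<partial>M) = charA w n"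
    unfolding charA_def
  proof (rule integral_cong_AE)
    show "AE \<omega> in M. ?P \<omega> * complex_of_real (weight 1 (X n \<omega>)) + ?P \<omega> * complex_of_real (weight 2 (X n \<omega>)) = ?P \<omega>"
      using AE_weight_sum[of n]
      by eventually_elim (simp only: distrib_left[symmetric] of_real_add[symmetric] of_real_1 mult_1_right)
    show "(\<lambda>\<omega>. ?P \<omega> * complex_of_real (weight 1 (X n \<omega>)) + ?P \<omega> * complex_of_real (weight 2 (X n \<omega>))) \<in> borel_measurable M"
      using iw by (intro borel_measurable_add borel_measurable_integrable) auto
  qed (rule borel_measurable_integrable[OF i0])
  then have "(charA w n / 2 + charH w n) + (\<integral>\<omega>. ?P \<omega> * complex_of_real (weight 2 (X n \<omega>)) \<partial>M) = charA w n"
    unfolding Bochner_Integration.integral_add[OF iw iw] 1 .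
  then have "(\<integral>\<omega>. ?P \<omega> * complex_of_real (weight 2 (X n \<omega>)) \<partial>M) = charA w n - (charA w n / 2 + charH w n)"
    by (rule add_implies_diff[OF trans[OF add.commute]])
  then show "(\<integral>\<omega>. ?P \<omega> * complex_of_real (weight 2 (X n \<omega>)) \<partial>M) = charA w n / 2 - charH w n"
    by simp
qed

lemma prod_Suc_phase: "(\<Prod>l\<in>{1..Suc n}. f l) = (\<Prod>l\<in>{1..n}. f l) * (f (Suc n) :: complex)"
  by (simp add: prod.nat_ivl_Suc')

lemma char_step:
  assumes "b \<in> borel_measurable torus" "\<And>k. \<bar>b k\<bar> \<le> B"
  shows "(\<integral>\<omega>. (\<Prod>l\<in>{1..Suc n}. cis (w l \<bullet> xi l \<omega>)) * complex_of_real (b (X (Suc n) \<omega>)) \<partial>M) =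
    (charA w n / 2 + charH w n) * (\<integral>k. char_at (w (Suc n)) k * complex_of_real (b k) \<partial>nu 1) +
    (charA w n / 2 - charH w n) * (\<integral>k. char_at (w (Suc n)) k * complex_of_real (b k) \<partial>nu 2)"
proof -
  have A: "{1..n} \<subseteq> {..n}" by auto
  show ?thesis
    using phase_step[OF measurable_phase[OF A], of w b B "w (Suc n)"] assms
    unfolding phase_past[OF A] char_weights by (simp add: prod_Suc_phase)
qed

text \<open>The mean of the two defects is \<open>char_defect\<close>, while \<open>charH\<close> is
  fed back only through their difference, itself of the order of the defect.\<close>

lemma charA_Suc:
  "charA w (Suc n) = charA w n * complex_of_real (1 - char_defect (w (Suc n))) +
     charH w n * complex_of_real (defect 2 (w (Suc n)) - defect 1 (w (Suc n)))"
proof -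
  have d: "char_defect v = (defect 1 v + defect 2 v) / 2" for v using defect_sum[of v] by simp
  have "charA w (Suc n) = (charA w n / 2 + charH w n) * complex_of_real (1 - defect 1 (w (Suc n))) +
    (charA w n / 2 - charH w n) * complex_of_real (1 - defect 2 (w (Suc n)))"
    using char_step[of "\<lambda>_. 1" 1 w n] by (simp add: charA_def[of w "Suc n"] char_at_nu_1)
  also have "\<dots> = charA w n * complex_of_real (1 - char_defect (w (Suc n))) +
     charH w n * complex_of_real (defect 2 (w (Suc n)) - defect 1 (w (Suc n)))"
    unfolding d by (simp add: field_simps)
  finally show ?thesis .
qed

lemma norm_charA_le: "norm (charA w n) \<le> 1"
proof -
  have "norm (charA w n) \<le> (\<integral>\<omega>. norm (\<Prod>l\<in>{1..n}. cis (w l \<bullet> xi l \<omega>)) \<partial>M)"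
    unfolding charA_def by (rule integral_norm_bound)
  then show ?thesis using prob_space by (simp add: prod_norm[symmetric])
qed

text \<open>The means \<open>kappa\<close> and \<open>- kappa\<close> cancel in the coefficient of
  \<open>charA\<close>, leaving a source of the order of the defect; in the coefficient of
  \<open>charH\<close> they add up to the eigenvalue \<open>2 * kappa\<close>.\<close>

lemma charH_Suc: "norm (charH w (Suc n)) \<le> char_defect (w (Suc n)) + (\<bar>2 * kappa\<bar> + char_defect (w (Suc n))) * norm (charH w n)"
proof -
  let ?v = "w (Suc n)"
  obtain R1 where R1: "(\<integral>k. char_at ?v k * complex_of_real (hfun k) \<partial>nu 1) = complex_of_real ((\<integral>k. hfun k \<partial>nu 1) - R1)"
    "\<bar>R1\<bar> \<le> defect 1 ?v / 2" by (rule char_at_nu_hfun)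
  obtain R2 where R2: "(\<integral>k. char_at ?v k * complex_of_real (hfun k) \<partial>nu 2) = complex_of_real ((\<integral>k. hfun k \<partial>nu 2) - R2)"
    "\<bar>R2\<bar> \<le> defect 2 ?v / 2" by (rule char_at_nu_hfun)
  have R: "\<bar>R1\<bar> + \<bar>R2\<bar> \<le> char_defect ?v" using R1 R2 defect_sum[of ?v] by simp
  have "charH w (Suc n) = (charA w n / 2 + charH w n) * complex_of_real (kappa - R1) +
    (charA w n / 2 - charH w n) * complex_of_real (- kappa - R2)"
    using char_step[OF measurable_hfun abs_hfun_le, of w n] R1 R2
    by (simp add: charH_def[of w "Suc n"] integral_hfun_nu)
  also have "\<dots> = charA w n * complex_of_real (- (R1 + R2) / 2) + charH w n * complex_of_real (2 * kappa - R1 + R2)"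
    by (simp add: field_simps)
  also have "norm \<dots> \<le> norm (charA w n) * \<bar>- (R1 + R2) / 2\<bar> + norm (charH w n) * \<bar>2 * kappa - R1 + R2\<bar>"
    by (rule order_trans[OF norm_triangle_ineq]) (simp only: norm_mult norm_of_real order_refl)
  also have "\<dots> \<le> 1 * char_defect ?v + norm (charH w n) * (\<bar>2 * kappa\<bar> + char_defect ?v)"
    using R by (intro add_mono mult_mono norm_charA_le) auto
  finally show ?thesis by (simp add: mult.commute)
qed

lemma charA_0: "charA w 0 = 1"
  using prob_space by (simp add: charA_def)

lemma norm_charH_0: "norm (charH w 0) \<le> 1"
proof -
  have "norm (charH w 0) \<le> (\<integral>\<omega>. \<bar>hfun (X 0 \<omega>)\<bar> \<partial>M)"
    unfolding charH_def by (rule order_trans[OF integral_norm_bound]) simp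
  also have "\<dots> \<le> 1"
  proof (rule integral_le_const)
    show "integrable M (\<lambda>\<omega>. \<bar>hfun (X 0 \<omega>)\<bar>)"
      using integrable_phase_weight[OF measurable_hfun abs_hfun_le, where A="{}" and n=0, THEN integrable_norm] by simp
    have "\<bar>hfun k\<bar> \<le> 1" for k using abs_hfun_le[of k] by linarith
    then show "AE \<omega> in M. \<bar>hfun (X 0 \<omega>)\<bar> \<le> 1" by simp
  qed
  finally show ?thesis .
qed

text \<open>The recursion contracts with factor \<open>r\<close> towards the fixed point
  \<open>q / (1 - r)\<close> of \<open>x = q + r * x\<close>, and the initial value is forgotten
  geometrically.\<close>

lemma charH_bound:
  assumes q: "\<And>l. char_defect (w l) \<le> q" and q0: "0 \<le> q" and r: "\<bar>2 * kappa\<bar> + q \<le> r" "r < 1"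
  shows "norm (charH w n) \<le> r ^ n + q / (1 - r)"
proof (induction n)
  case 0
  have "0 \<le> q / (1 - r)" using q0 r by simp
  then show ?case using norm_charH_0[of w] by simp
next
  case (Suc n)
  have r0: "0 \<le> r" using r(1) q0 by linarith
  have "norm (charH w (Suc n)) \<le> q + r * norm (charH w n)"
    using charH_Suc[of w n] q[of "Suc n"] r
    by (intro order_trans[OF charH_Suc] add_mono mult_right_mono) auto
  also have "\<dots> \<le> q + r * (r ^ n + q / (1 - r))" using Suc r0 by (intro add_left_mono mult_left_mono) auto
  also have "\<dots> = r ^ Suc n + q / (1 - r)" using r(2) by (simp add: field_simps)
  finally show ?case .
qed

lemma char_defect_bounds: "0 \<le> char_defect w" "char_defect w \<le> 2"
  using defect_sum[of w] defect_nonneg[of 1 w] defect_nonneg[of 2 w] defect_le_2[of 1 w] defect_le_2[of 2 w] by linarith+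

text \<open>Each step adds an error \<open>2 * q\<close> times the size of \<open>charH\<close>. The
  initial transient sums to order \<open>q\<close> and the stationary part to order
  \<open>n * q ^ 2\<close>; both vanish when \<open>q\<close> is of order \<open>1 / N\<close> and
  \<open>n\<close> of order \<open>N\<close>.\<close>

lemma charA_approx:
  assumes q: "\<And>l. char_defect (w l) \<le> q" and r: "\<bar>2 * kappa\<bar> + q \<le> r" "r < 1"
  shows "norm (charA w n - (\<Prod>l\<in>{1..n}. complex_of_real (1 - char_defect (w l)))) \<le> 2 * q * (1 / (1 - r) + real n * (q / (1 - r)))"
proof -
  have q0: "0 \<le> q" using q[of 0] char_defect_bounds(1)[of "w 0"] by linarith
  have r0: "0 \<le> r" using r(1) q0 by linarith
  have "norm (charA w n - (\<Prod>l\<in>{1..n}. complex_of_real (1 - char_defect (w l)))) \<le> 2 * q * (\<Sum>j<n. r ^ j + q / (1 - r))"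
  proof (induction n)
    case (Suc n)
    let ?P = "\<Prod>l\<in>{1..n}. complex_of_real (1 - char_defect (w l))"
    have "charA w (Suc n) - (\<Prod>l\<in>{1..Suc n}. complex_of_real (1 - char_defect (w l))) =
        (charA w n - ?P) * complex_of_real (1 - char_defect (w (Suc n))) +
        charH w n * complex_of_real (defect 2 (w (Suc n)) - defect 1 (w (Suc n)))"
      unfolding prod_Suc_phase charA_Suc by (simp add: algebra_simps)
    also have "norm \<dots> \<le> norm (charA w n - ?P) * \<bar>1 - char_defect (w (Suc n))\<bar> +
        norm (charH w n) * \<bar>defect 2 (w (Suc n)) - defect 1 (w (Suc n))\<bar>"
      by (rule order_trans[OF norm_triangle_ineq]) (simp only: norm_mult norm_of_real order_refl)
    also have "\<dots> \<le> norm (charA w n - ?P) * 1 + (r ^ n + q / (1 - r)) * (2 * q)"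
    proof (intro add_mono mult_mono mult_left_mono)
      show "\<bar>1 - char_defect (w (Suc n))\<bar> \<le> 1" using char_defect_bounds[of "w (Suc n)"] by (simp add: abs_le_iff)
      show "norm (charH w n) \<le> r ^ n + q / (1 - r)" by (rule charH_bound[OF q q0 r])
      show "\<bar>defect 2 (w (Suc n)) - defect 1 (w (Suc n))\<bar> \<le> 2 * q"
        using defect_sum[of "w (Suc n)"] defect_nonneg[of 1 "w (Suc n)"] defect_nonneg[of 2 "w (Suc n)"] q[of "Suc n"] by linarith
      show "0 \<le> r ^ n + q / (1 - r)" using r0 r q0 by simp
    qed auto
    finally show ?case using Suc by (simp add: algebra_simps)
  qed (simp add: charA_0)
  also have "(\<Sum>j<n. r ^ j + q / (1 - r)) = (\<Sum>j<n. r ^ j) + real n * (q / (1 - r))"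
    by (simp add: sum.distrib)
  also have "2 * q * ((\<Sum>j<n. r ^ j) + real n * (q / (1 - r))) \<le> 2 * q * (1 / (1 - r) + real n * (q / (1 - r)))"
  proof -
    have "(\<Sum>j<n. r ^ j) = (1 - r ^ n) / (1 - r)" using r(2) by (simp add: sum_gp_strict)
    also have "\<dots> \<le> 1 / (1 - r)" using r r0 by (intro divide_right_mono) auto
    finally show ?thesis using q0 by (intro mult_left_mono) auto
  qed
  finally show ?thesis .
qed

end

text \<open>In the exponent \<open>k * ln (1 - x)\<close> the linear term converges, and the
  remainder is at most twice \<open>k * x ^ 2\<close>, which tends to 0 since \<open>k * x\<close>
  stays bounded.\<close>

lemma power_one_minus_tendsto:
  fixes x :: "nat \<Rightarrow> real" and k :: "nat \<Rightarrow> nat"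
  assumes x: "(\<lambda>N. real N * x N) \<longlonglongrightarrow> c" and k: "(\<lambda>N. real (k N) / real N) \<longlonglongrightarrow> \<tau>"
  shows "(\<lambda>N. (1 - x N) ^ k N) \<longlonglongrightarrow> exp (- c * \<tau>)"
proof -
  have inv: "(\<lambda>N. 1 / real N) \<longlonglongrightarrow> 0" by real_asymp
  have ev0: "\<forall>\<^sub>F N in sequentially. 0 < N" by (rule eventually_gt_at_top)
  have x0: "x \<longlonglongrightarrow> 0"
  proof (rule Lim_transform_eventually)
    show "(\<lambda>N. (real N * x N) * (1 / real N)) \<longlonglongrightarrow> 0" using tendsto_mult[OF x inv] by simp
    show "\<forall>\<^sub>F N in sequentially. real N * x N * (1 / real N) = x N" using ev0 by eventually_elim simp
  qed
  have kx: "(\<lambda>N. real (k N) * x N) \<longlonglongrightarrow> c * \<tau>"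
  proof (rule Lim_transform_eventually)
    show "(\<lambda>N. (real N * x N) * (real (k N) / real N)) \<longlonglongrightarrow> c * \<tau>" by (rule tendsto_mult[OF x k])
    show "\<forall>\<^sub>F N in sequentially. real N * x N * (real (k N) / real N) = real (k N) * x N" using ev0 by eventually_elim simp
  qed
  have small: "\<forall>\<^sub>F N in sequentially. \<bar>x N\<bar> < 1 / 2"
    using tendstoD[OF x0, of "1/2"] by (simp add: dist_real_def)
  have "(\<lambda>N. real (k N) * ln (1 - x N) + real (k N) * x N) \<longlonglongrightarrow> 0"
  proof (rule Lim_null_comparison)
    show "\<forall>\<^sub>F N in sequentially. norm (real (k N) * ln (1 - x N) + real (k N) * x N) \<le> 2 * \<bar>real (k N) * x N\<bar> * \<bar>x N\<bar>"
      using small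
    proof eventually_elim
      case (elim N)
      have "\<bar>ln (1 + - x N) - (- x N)\<bar> \<le> 2 * (- x N)\<^sup>2"
        by (rule abs_ln_one_plus_x_minus_x_bound) (use elim in auto)
      then have "real (k N) * \<bar>ln (1 - x N) + x N\<bar> \<le> real (k N) * (2 * (x N)\<^sup>2)"
        by (intro mult_left_mono) auto
      then show ?case by (simp add: abs_mult power2_eq_square mult.assoc flip: distrib_left)
    qed
    have "(\<lambda>N. 2 * \<bar>real (k N) * x N\<bar> * \<bar>x N\<bar>) \<longlonglongrightarrow> 2 * \<bar>c * \<tau>\<bar> * \<bar>0\<bar>"
      by (intro tendsto_intros kx x0)
    then show "(\<lambda>N. 2 * \<bar>real (k N) * x N\<bar> * \<bar>x N\<bar>) \<longlonglongrightarrow> 0" by simp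
  qed
  from tendsto_diff[OF this kx] have "(\<lambda>N. real (k N) * ln (1 - x N)) \<longlonglongrightarrow> - c * \<tau>" by simp
  then have "(\<lambda>N. exp (real (k N) * ln (1 - x N))) \<longlonglongrightarrow> exp (- c * \<tau>)" by (rule tendsto_exp)
  then show ?thesis
  proof (rule Lim_transform_eventually)
    show "\<forall>\<^sub>F N in sequentially. exp (real (k N) * ln (1 - x N)) = (1 - x N) ^ k N"
      using small by eventually_elim (simp add: exp_of_nat_mult)
  qed
qed

section \<open>Joint characteristic functions of block sums\<close>

lemma prod_cis: "finite A \<Longrightarrow> (\<Prod>l\<in>A. cis (f l)) = cis (\<Sum>l\<in>A. f l)"
  by (induction A rule: finite_induct) (auto simp: cis_mult)

lemma char_defect_0: "char_defect 0 = 0"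
  by (simp add: char_defect_def cos_defect_def)

context kinetic
begin

text \<open>
  The increment \<open>xi 0\<close> is left out: its law depends on the arbitrary initial distribution, and only after
  one step is the position distributed according to a mixture of the measures \<open>nu 1\<close> and \<open>nu 2\<close>.
\<close>

definition block_sum :: "nat \<Rightarrow> nat \<Rightarrow> 'w \<Rightarrow> real ^ 2" where
  "block_sum p q \<omega> = (\<Sum>l\<in>{p..<q} \<inter> {1..}. xi l \<omega>)"

lemma block_sum_measurable [measurable]: "block_sum p q \<in> borel_measurable M"
  unfolding block_sum_def[abs_def] by measurable

text \<open>With one frequency per block and frequency 0 elsewhere, the joint characteristic
  function of all blocks is a single \<open>charA\<close> up to a common horizon. Its product
  approximation factors over the blocks into powers of \<open>1 - char_defect\<close>, indices
  outside the blocks contributing 1.\<close>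

lemma char_block_sums:
  fixes p q :: "nat \<Rightarrow> 'j \<Rightarrow> nat" and u :: "'j \<Rightarrow> real ^ 2" and \<tau> :: "'j \<Rightarrow> real"
  assumes J: "finite J"
    and disj: "\<And>N i j. i \<in> J \<Longrightarrow> j \<in> J \<Longrightarrow> i \<noteq> j \<Longrightarrow> {p N i..<q N i} \<inter> {p N j..<q N j} = {}"
    and bd: "\<And>N j. j \<in> J \<Longrightarrow> real (q N j) \<le> C * (real N + 1)"
    and len: "\<And>j. j \<in> J \<Longrightarrow> (\<lambda>N. real (q N j - p N j) / real N) \<longlonglongrightarrow> \<tau> j"
  shows "(\<lambda>N. \<integral>\<omega>. cis (\<Sum>j\<in>J. u j \<bullet> ((1 / scale N) *\<^sub>R block_sum (p N j) (q N j) \<omega>)) \<partial>M) \<longlonglongrightarrow>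
    complex_of_real (\<Prod>j\<in>J. exp (- (sigma_sq * (norm (u j))\<^sup>2 / 2) * \<tau> j))"
proof -
  \<comment> \<open>An integer multiple of \<open>N + 1\<close> serves as a horizon beyond all block
    ends.\<close>
  define c where "c = nat \<lceil>\<bar>C\<bar>\<rceil>"
  define K where "K N = c * (N + 1)" for N
  have qK: "q N j \<le> K N" if "j \<in> J" for N j
  proof -
    have "real (q N j) \<le> \<bar>C\<bar> * (real N + 1)"
      using bd[OF that, of N] mult_right_mono[of C "\<bar>C\<bar>" "real N + 1"] by linarith
    also have "\<dots> \<le> real c * (real N + 1)"
      unfolding c_def by (intro mult_right_mono) (auto simp: real_nat_ceiling_ge)
    also have "\<dots> = real (K N)" by (simp add: K_def algebra_simps)
    finally show ?thesis by simp
  qed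
  have uniq: "i = j" if "i \<in> J" "j \<in> J" "l \<in> {p N i..<q N i}" "l \<in> {p N j..<q N j}" for i j l N
    using disj[OF that(1,2), of N] that(3,4) by blast
  define v where "v N j = (1 / scale N) *\<^sub>R u j" for N j
  \<comment> \<open>The blocks are disjoint, so at most one summand is non-zero and
    \<open>w N\<close> takes the value \<open>v N j\<close> on block \<open>j\<close>.\<close>
  define w where "w N l = (\<Sum>j\<in>J. if l \<in> {p N j..<q N j} then v N j else 0)" for N l
  have w_in: "w N l = v N j" if "j \<in> J" "l \<in> {p N j..<q N j}" for N l j
  proof -
    have "w N l = (\<Sum>i\<in>J. if i = j then v N j else 0)"
      unfolding w_def using that by (intro sum.cong) (auto dest: uniq[of _ j l N])
    then show ?thesis using J that by simp
  qed
  have w_out: "w N l = 0" if "\<And>j. j \<in> J \<Longrightarrow> l \<notin> {p N j..<q N j}" for N l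
    unfolding w_def using that by (intro sum.neutral) auto
  have char: "charA (w N) (K N) = (\<integral>\<omega>. cis (\<Sum>j\<in>J. u j \<bullet> ((1 / scale N) *\<^sub>R block_sum (p N j) (q N j) \<omega>)) \<partial>M)" for N
  proof -
    have "(\<Sum>l\<in>{1..K N}. w N l \<bullet> xi l \<omega>) = (\<Sum>j\<in>J. u j \<bullet> ((1 / scale N) *\<^sub>R block_sum (p N j) (q N j) \<omega>))" for \<omega>
    proof -
      have "(\<Sum>l\<in>{1..K N}. w N l \<bullet> xi l \<omega>) = (\<Sum>l\<in>{1..K N}. \<Sum>j\<in>J. if l \<in> {p N j..<q N j} then v N j \<bullet> xi l \<omega> else 0)"
        unfolding w_def inner_sum_left by (intro sum.cong) auto
      also have "\<dots> = (\<Sum>j\<in>J. \<Sum>l\<in>{1..K N}. if l \<in> {p N j..<q N j} then v N j \<bullet> xi l \<omega> else 0)"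
        by (rule sum.swap)
      also have "\<dots> = (\<Sum>j\<in>J. u j \<bullet> ((1 / scale N) *\<^sub>R block_sum (p N j) (q N j) \<omega>))"
      proof (rule sum.cong[OF refl])
        fix j assume j: "j \<in> J"
        have "{1..K N} \<inter> {l. l \<in> {p N j..<q N j}} = {p N j..<q N j} \<inter> {1..}" using qK[OF j, of N] by auto
        then show "(\<Sum>l\<in>{1..K N}. if l \<in> {p N j..<q N j} then v N j \<bullet> xi l \<omega> else 0) =
            u j \<bullet> ((1 / scale N) *\<^sub>R block_sum (p N j) (q N j) \<omega>)"
          by (simp add: sum.inter_restrict[symmetric] sum.If_cases v_def block_sum_def inner_sum_right sum_distrib_left)
      qed
      finally show ?thesis .
    qed
    then show ?thesis unfolding charA_def by (simp add: prod_cis del: atLeastAtMost_iff)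
  qed
  \<comment> \<open>A bound for the defects that is uniform in the index and still of order
    \<open>1 / N\<close>.\<close>
  define Q where "Q N = (\<Sum>j\<in>J. char_defect (v N j))" for N
  have cdQ: "char_defect (w N l) \<le> Q N" for N l
  proof (cases "\<exists>j\<in>J. l \<in> {p N j..<q N j}")
    case True
    then obtain j where j: "j \<in> J" "l \<in> {p N j..<q N j}" by blast
    show ?thesis unfolding w_in[OF j] Q_def
      by (rule member_le_sum) (use j J char_defect_bounds in auto)
  next
    case False
    then have "w N l = 0" by (intro w_out) auto
    then show ?thesis unfolding Q_def by (simp add: char_defect_0 sum_nonneg char_defect_bounds)
  qed
  have NQ: "(\<lambda>N. real N * Q N) \<longlonglongrightarrow> (\<Sum>j\<in>J. sigma_sq * (norm (u j))\<^sup>2 / 2)"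
    unfolding Q_def sum_distrib_left v_def by (intro tendsto_sum char_defect_asymp)
  have Q0: "Q \<longlonglongrightarrow> 0"
  proof (rule Lim_transform_eventually)
    have "(\<lambda>N. 1 / real N) \<longlonglongrightarrow> 0" by real_asymp
    from tendsto_mult[OF NQ this] show "(\<lambda>N. real N * Q N * (1 / real N)) \<longlonglongrightarrow> 0" by simp
    show "\<forall>\<^sub>F N in sequentially. real N * Q N * (1 / real N) = Q N"
      using eventually_gt_at_top[of 0] by eventually_elim simp
  qed
  \<comment> \<open>Midway between \<open>\<bar>2 * kappa\<bar>\<close> and 1: the gap leaves room
    for \<open>Q N\<close> once it is small.\<close>
  define r where "r = (\<bar>2 * kappa\<bar> + 1) / 2"
  have r: "r < 1" "\<bar>2 * kappa\<bar> < r" using abs_kappa by (auto simp: r_def)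
  have KN: "(\<lambda>N. real (K N) / real N) \<longlonglongrightarrow> real c"
  proof -
    have "(\<lambda>N. real (N + 1) / real N) \<longlonglongrightarrow> 1" by real_asymp
    from tendsto_mult_left[OF this, of "real c"] show ?thesis by (simp only: K_def of_nat_mult times_divide_eq_right mult_1_right)
  qed
  \<comment> \<open>Here \<open>N * Q N\<close> converges and \<open>Q N\<close> tends to 0, so the
    accumulated error, of order \<open>Q N + N * (Q N) ^ 2\<close>, vanishes.\<close>
  have lim1: "(\<lambda>N. charA (w N) (K N) - (\<Prod>l\<in>{1..K N}. complex_of_real (1 - char_defect (w N l)))) \<longlonglongrightarrow> 0"
  proof (rule Lim_null_comparison)
    have "\<forall>\<^sub>F N in sequentially. Q N < r - \<bar>2 * kappa\<bar>"
      using order_tendstoD(2)[OF Q0, of "r - \<bar>2 * kappa\<bar>"] r by simp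
    then show "\<forall>\<^sub>F N in sequentially. norm (charA (w N) (K N) - (\<Prod>l\<in>{1..K N}. complex_of_real (1 - char_defect (w N l))))
        \<le> 2 * Q N * (1 / (1 - r)) + 2 * (real N * Q N) * Q N * ((real (K N) / real N) * (1 / (1 - r)))"
      using eventually_gt_at_top[of 0]
    proof eventually_elim
      case (elim N)
      have "norm (charA (w N) (K N) - (\<Prod>l\<in>{1..K N}. complex_of_real (1 - char_defect (w N l))))
          \<le> 2 * Q N * (1 / (1 - r) + real (K N) * (Q N / (1 - r)))"
        by (rule charA_approx[OF cdQ]) (use elim r in auto)
      also have "\<dots> = 2 * Q N * (1 / (1 - r)) + 2 * (real N * Q N) * Q N * ((real (K N) / real N) * (1 / (1 - r)))"
        using elim(2) by (simp add: distrib_left)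
      finally show ?case .
    qed
    have "(\<lambda>N. 2 * Q N * (1 / (1 - r)) + 2 * (real N * Q N) * Q N * ((real (K N) / real N) * (1 / (1 - r)))) \<longlonglongrightarrow>
        2 * 0 * (1 / (1 - r)) + 2 * (\<Sum>j\<in>J. sigma_sq * (norm (u j))\<^sup>2 / 2) * 0 * (real c * (1 / (1 - r)))"
      by (intro tendsto_intros Q0 NQ KN)
    then show "(\<lambda>N. 2 * Q N * (1 / (1 - r)) + 2 * (real N * Q N) * Q N * ((real (K N) / real N) * (1 / (1 - r)))) \<longlonglongrightarrow> 0"
      by simp
  qed
  have lim2: "(\<lambda>N. \<Prod>l\<in>{1..K N}. complex_of_real (1 - char_defect (w N l))) \<longlonglongrightarrow>
      complex_of_real (\<Prod>j\<in>J. exp (- (sigma_sq * (norm (u j))\<^sup>2 / 2) * \<tau> j))"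
  proof -
    define k where "k j N = card ({p N j..<q N j} \<inter> {1..})" for j N
    have "(\<Prod>l\<in>{1..K N}. 1 - char_defect (w N l)) = (\<Prod>j\<in>J. (1 - char_defect (v N j)) ^ k j N)" for N
    proof -
      have "(\<Prod>l\<in>{1..K N}. 1 - char_defect (w N l)) =
          (\<Prod>l\<in>{1..K N}. \<Prod>j\<in>J. if l \<in> {p N j..<q N j} then 1 - char_defect (v N j) else 1)"
      proof (rule prod.cong[OF refl])
        fix l
        show "1 - char_defect (w N l) = (\<Prod>j\<in>J. if l \<in> {p N j..<q N j} then 1 - char_defect (v N j) else 1)"
        proof (cases "\<exists>j\<in>J. l \<in> {p N j..<q N j}")
          case True
          then obtain j where j: "j \<in> J" "l \<in> {p N j..<q N j}" by blast
          have "(\<Prod>i\<in>J. if l \<in> {p N i..<q N i} then 1 - char_defect (v N i) else 1) =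
              (\<Prod>i\<in>J. if i = j then 1 - char_defect (v N j) else 1)"
            using j by (intro prod.cong) (auto dest: uniq[of _ j l N])
          then show ?thesis using J j by (simp add: w_in[OF j])
        next
          case False
          then have "w N l = 0" by (intro w_out) auto
          moreover have "(\<Prod>j\<in>J. if l \<in> {p N j..<q N j} then 1 - char_defect (v N j) else 1) = 1"
            using False by (intro prod.neutral) auto
          ultimately show ?thesis by (simp add: char_defect_0)
        qed
      qed
      also have "\<dots> = (\<Prod>j\<in>J. \<Prod>l\<in>{1..K N}. if l \<in> {p N j..<q N j} then 1 - char_defect (v N j) else 1)"
        by (rule prod.swap)
      also have "\<dots> = (\<Prod>j\<in>J. (1 - char_defect (v N j)) ^ k j N)"
      proof (rule prod.cong[OF refl])
        fix j assume j: "j \<in> J"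
        have "{1..K N} \<inter> {l. l \<in> {p N j..<q N j}} = {p N j..<q N j} \<inter> {1..}" using qK[OF j, of N] by auto
        then show "(\<Prod>l\<in>{1..K N}. if l \<in> {p N j..<q N j} then 1 - char_defect (v N j) else 1) = (1 - char_defect (v N j)) ^ k j N"
          by (simp add: prod.If_cases k_def)
      qed
      finally show ?thesis .
    qed
    then have eq: "(\<Prod>l\<in>{1..K N}. complex_of_real (1 - char_defect (w N l))) = complex_of_real (\<Prod>j\<in>J. (1 - char_defect (v N j)) ^ k j N)" for N
      by (metis of_real_prod)
    have kl: "(\<lambda>N. real (k j N) / real N) \<longlonglongrightarrow> \<tau> j" if j: "j \<in> J" for j
    proof -
      \<comment> \<open>The discrepancy of 1 occurs only for a block starting at 0, which loses the
        index 0.\<close>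
      have "\<bar>real (k j N) - real (q N j - p N j)\<bar> \<le> 1" for N
      proof (cases "p N j = 0")
        case True
        then have "{p N j..<q N j} \<inter> {1..} = {1..<q N j}" by auto
        then show ?thesis using True by (cases "q N j") (auto simp: k_def)
      next
        case False
        then have "{p N j..<q N j} \<inter> {1..} = {p N j..<q N j}" by auto
        then show ?thesis by (simp add: k_def)
      qed
      then have le: "\<bar>real (k j N) - real (q N j - p N j)\<bar> / real N \<le> 1 / real N" for N
        by (intro divide_right_mono) auto
      have "(\<lambda>N. real (k j N) / real N - real (q N j - p N j) / real N) \<longlonglongrightarrow> 0"
      proof (rule Lim_null_comparison)
        show "\<forall>\<^sub>F N in sequentially. norm (real (k j N) / real N - real (q N j - p N j) / real N) \<le> 1 / real N"
          using le by (intro always_eventually allI) (simp flip: diff_divide_distrib)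
        show "(\<lambda>N. 1 / real N) \<longlonglongrightarrow> 0" by real_asymp
      qed
      from tendsto_add[OF this len[OF j]] show ?thesis by simp
    qed
    show ?thesis unfolding eq
      by (intro tendsto_of_real tendsto_prod power_one_minus_tendsto kl) (simp_all add: v_def char_defect_asymp)
  qed
  from tendsto_add[OF lim1 lim2]
  have "(\<lambda>N. charA (w N) (K N)) \<longlonglongrightarrow> complex_of_real (\<Prod>j\<in>J. exp (- (sigma_sq * (norm (u j))\<^sup>2 / 2) * \<tau> j))"
    by (simp only: diff_add_cancel add_0)
  then show ?thesis by (simp only: char)
qed

end

section \<open>A maximal inequality\<close>

context kinetic
begin

text \<open>Conditional symmetry of the later steps in terms of characters. Peeling off the last
  step leaves integrals that are real by \<open>char_at_nu\<close> and expectations of the same form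
  with \<open>weight a\<close> in place of \<open>b\<close>; the weights are even, so the induction
  closes.\<close>

lemma real_past_phase:
  assumes G: "G \<in> sets (PX n \<Otimes>\<^sub>M PE n)" and "n \<le> q"
    and "b \<in> borel_measurable torus" "\<And>k. \<bar>b k\<bar> \<le> B" "even_fun b"
  shows "(\<integral>\<omega>. indicator G (pastX n \<omega>, pastE n \<omega>) * (\<Prod>l\<in>{Suc n..q}. cis (w \<bullet> xi l \<omega>)) * complex_of_real (b (X q \<omega>)) \<partial>M) \<in> \<real>"
  using assms(2-)
proof (induction q arbitrary: b B rule: dec_induct)
  case base
  have "(\<integral>\<omega>. indicator G (pastX n \<omega>, pastE n \<omega>) * complex_of_real (b (X n \<omega>)) \<partial>M) =
      (\<integral>\<omega>. complex_of_real (indicator G (pastX n \<omega>, pastE n \<omega>) * b (X n \<omega>)) \<partial>M)"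
    by (rule Bochner_Integration.integral_cong) (auto simp: indicator_def)
  then show ?case by (simp del: of_real_mult)
next
  case (step q)
  \<comment> \<open>The event \<open>G\<close> concerns times up to \<open>n\<close>; restriction
    turns it into an event of the longer past up to \<open>q\<close>.\<close>
  let ?res = "\<lambda>p. (restrict (fst p) {..n}, restrict (snd p) {..n}) :: (nat \<Rightarrow> real^2) \<times> (nat \<Rightarrow> real)"
  let ?z = "\<lambda>p. indicator G (?res p) * phase (\<lambda>_. w) {Suc n..q} p :: complex"
  have resm: "?res \<in> PX q \<Otimes>\<^sub>M PE q \<rightarrow>\<^sub>M PX n \<Otimes>\<^sub>M PE n"
    using step.hyps by (intro measurable_Pair measurable_compose[OF measurable_fst measurable_restrict_subset]
        measurable_compose[OF measurable_snd measurable_restrict_subset]) auto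
  have zm: "?z \<in> borel_measurable (PX q \<Otimes>\<^sub>M PE q)"
    by (intro borel_measurable_times measurable_phase measurable_compose[OF resm borel_measurable_indicator[OF G]]) auto
  have zb: "norm (?z p) \<le> 1" for p by (simp add: norm_mult indicator_def)
  have res: "?res (pastX q \<omega>, pastE q \<omega>) = (pastX n \<omega>, pastE n \<omega>)" for \<omega>
    using step.hyps by (auto simp: pastX_def pastE_def fun_eq_iff restrict_def)
  have z: "?z (pastX q \<omega>, pastE q \<omega>) = indicator G (pastX n \<omega>, pastE n \<omega>) * (\<Prod>l\<in>{Suc n..q}. cis (w \<bullet> xi l \<omega>))" for \<omega>
    unfolding res by (subst phase_past) auto
  have r: "(\<integral>k. char_at w k * complex_of_real (b k) \<partial>nu a) \<in> \<real>" for a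
    unfolding char_at_nu[OF step.prems] by simp
  have w: "(\<integral>\<omega>. ?z (pastX q \<omega>, pastE q \<omega>) * complex_of_real (weight a (X q \<omega>)) \<partial>M) \<in> \<real>" for a
    unfolding z by (rule step.IH[of "weight a" 1]) (auto simp: even_weight weight_nonneg weight_le_1)
  have "{Suc n..Suc q} = insert (Suc q) {Suc n..q}" using step.hyps by auto
  then have "(\<integral>\<omega>. indicator G (pastX n \<omega>, pastE n \<omega>) * (\<Prod>l\<in>{Suc n..Suc q}. cis (w \<bullet> xi l \<omega>)) * complex_of_real (b (X (Suc q) \<omega>)) \<partial>M) =
      (\<integral>\<omega>. ?z (pastX q \<omega>, pastE q \<omega>) * cis (w \<bullet> xi (Suc q) \<omega>) * complex_of_real (b (X (Suc q) \<omega>)) \<partial>M)"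
    unfolding z by (simp add: mult_ac)
  also have "\<dots> \<in> \<real>"
    unfolding phase_step[OF zm zb step.prems(1,2)] by (intro Reals_add Reals_mult r w)
  finally show ?case .
qed

text \<open>Conditionally on an event of the past, the later sum has a real characteristic function,
  so by Levy's uniqueness theorem it has the same law as its negative.\<close>

lemma symmetric_increment:
  assumes G: "G \<in> sets (PX n \<Otimes>\<^sub>M PE n)" and nq: "n \<le> q"
  shows "prob {\<omega> \<in> space M. (pastX n \<omega>, pastE n \<omega>) \<in> G \<and> 0 < (\<Sum>l\<in>{Suc n..q}. v \<bullet> xi l \<omega>)} =
    prob {\<omega> \<in> space M. (pastX n \<omega>, pastE n \<omega>) \<in> G \<and> (\<Sum>l\<in>{Suc n..q}. v \<bullet> xi l \<omega>) < 0}"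
proof -
  let ?D = "\<lambda>\<omega>. \<Sum>l\<in>{Suc n..q}. v \<bullet> xi l \<omega>"
  have Dm [measurable]: "?D \<in> borel_measurable M" by measurable
  have pm: "(\<lambda>\<omega>. (pastX n \<omega>, pastE n \<omega>)) \<in> M \<rightarrow>\<^sub>M PX n \<Otimes>\<^sub>M PE n" by measurable
  define A where "A = {\<omega> \<in> space M. (pastX n \<omega>, pastE n \<omega>) \<in> G}"
  have A [measurable]: "A \<in> sets M"
    using measurable_sets[OF pm G] by (simp add: A_def vimage_def Int_def conj_commute)
  have sets: "{\<omega> \<in> space M. (pastX n \<omega>, pastE n \<omega>) \<in> G \<and> P \<omega>} = A \<inter> {\<omega> \<in> space M. P \<omega>}" for P
    by (auto simp: A_def)
  show ?thesis
  proof (cases "prob A = 0")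
    case True
    have "prob (A \<inter> B) = 0" if "B \<in> sets M" for B
      using finite_measure_mono[of "A \<inter> B" A] True A that measure_nonneg[of M "A \<inter> B"] by simp
    then show ?thesis unfolding sets by simp
  next
    case False
    then have pA: "0 < prob A" by (simp add: zero_less_measure_iff)
    \<comment> \<open>The conditional probability given the event \<open>A\<close>, which has
      positive probability in this case.\<close>
    define N where "N = density M (\<lambda>\<omega>. ennreal (indicator A \<omega> / prob A))"
    have dm: "(\<lambda>\<omega>. indicator A \<omega> / prob A) \<in> borel_measurable M" by measurable
    have eN: "emeasure N B = ennreal (prob (A \<inter> B) / prob A)" if B: "B \<in> sets M" for B
    proof -
      have "emeasure N B = (\<integral>\<^sup>+\<omega>. ennreal (indicator (A \<inter> B) \<omega> / prob A) \<partial>M)"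
        unfolding N_def using B dm
        by (subst emeasure_density) (auto intro!: nn_integral_cong simp: indicator_def)
      also have "\<dots> = ennreal (\<integral>\<omega>. indicator (A \<inter> B) \<omega> / prob A \<partial>M)"
        using A B by (intro nn_integral_eq_integral) (auto intro!: integrable_real_indicator simp: emeasure_eq_measure)
      also have "(\<integral>\<omega>. indicator (A \<inter> B) \<omega> / prob A \<partial>M) = prob (A \<inter> B) / prob A"
        using A B sets.sets_into_space[OF A] by (simp add: Int_absorb2 inf.absorb1 Int_assoc)
      finally show ?thesis .
    qed
    interpret N: prob_space N
    proof
      have "A \<inter> space M = A" using sets.sets_into_space[OF A] by auto
      then show "emeasure N (space N) = 1" using pA eN[OF sets.top] by (simp add: N_def)
    qed
    have sN [measurable_cong, simp]: "sets N = sets M" and spN [simp]: "space N = space M" by (simp_all add: N_def)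
    have DN [measurable]: "?D \<in> borel_measurable N" using Dm by (simp add: measurable_cong_sets[OF sN refl])
    have ch: "char (distr N borel (\<lambda>\<omega>. c * ?D \<omega>)) t = (\<integral>\<omega>. indicator A \<omega> * cis (t * (c * ?D \<omega>)) \<partial>M) / complex_of_real (prob A)" for c t
    proof -
      have "char (distr N borel (\<lambda>\<omega>. c * ?D \<omega>)) t = (\<integral>\<omega>. cis (t * (c * ?D \<omega>)) \<partial>N)"
        unfolding char_def by (subst integral_distr) (auto simp: cis_conv_exp intro!: borel_measurable_continuous_onI continuous_intros)
      also have "\<dots> = (\<integral>\<omega>. (indicator A \<omega> / prob A) *\<^sub>R cis (t * (c * ?D \<omega>)) \<partial>M)"
        unfolding N_def by (rule integral_density) auto
      also have "\<dots> = (\<integral>\<omega>. (indicator A \<omega> * cis (t * (c * ?D \<omega>))) / complex_of_real (prob A) \<partial>M)"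
        by (rule Bochner_Integration.integral_cong) (auto simp: indicator_def scaleR_conv_of_real)
      finally show ?thesis by simp
    qed
    have re: "(\<integral>\<omega>. indicator A \<omega> * cis (t * ?D \<omega>) \<partial>M) \<in> \<real>" for t
    proof -
      have "(\<integral>\<omega>. indicator A \<omega> * cis (t * ?D \<omega>) \<partial>M) =
          (\<integral>\<omega>. indicator G (pastX n \<omega>, pastE n \<omega>) * (\<Prod>l\<in>{Suc n..q}. cis ((t *\<^sub>R v) \<bullet> xi l \<omega>)) * complex_of_real 1 \<partial>M)"
      proof (rule Bochner_Integration.integral_cong[OF refl])
        fix \<omega> assume "\<omega> \<in> space M"
        have "(\<Prod>l\<in>{Suc n..q}. cis ((t *\<^sub>R v) \<bullet> xi l \<omega>)) = cis (\<Sum>l\<in>{Suc n..q}. (t *\<^sub>R v) \<bullet> xi l \<omega>)"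
          by (induction q) (auto simp: cis_mult not_less_eq_eq sum.cl_ivl_Suc prod.cl_ivl_Suc)
        then show "indicator A \<omega> * cis (t * ?D \<omega>) =
           indicator G (pastX n \<omega>, pastE n \<omega>) * (\<Prod>l\<in>{Suc n..q}. cis ((t *\<^sub>R v) \<bullet> xi l \<omega>)) * complex_of_real 1"
          using \<open>\<omega> \<in> space M\<close> by (simp add: A_def indicator_def sum_distrib_left)
      qed
      also have "\<dots> \<in> \<real>" by (rule real_past_phase[OF G nq, where b="\<lambda>_. 1" and B=1]) (auto simp: even_const)
      finally show ?thesis .
    qed
    have ch1: "char (distr N borel (\<lambda>\<omega>. 1 * ?D \<omega>)) = char (distr N borel (\<lambda>\<omega>. - 1 * ?D \<omega>))"
    proof
      fix t
      have "(\<integral>\<omega>. indicator A \<omega> * cis (t * (- 1 * ?D \<omega>)) \<partial>M) = (\<integral>\<omega>. cnj (indicator A \<omega> * cis (t * ?D \<omega>)) \<partial>M)"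
        by (rule Bochner_Integration.integral_cong) (auto simp: indicator_def cis_cnj)
      also have "\<dots> = cnj (\<integral>\<omega>. indicator A \<omega> * cis (t * ?D \<omega>) \<partial>M)"
      proof (rule integral_bounded_linear[OF bounded_linear_cnj])
        show "integrable M (\<lambda>\<omega>. indicator A \<omega> * cis (t * ?D \<omega>))"
          by (rule integrable_const_bound[where B=1]) (auto simp: norm_mult indicator_def)
      qed
      also have "\<dots> = (\<integral>\<omega>. indicator A \<omega> * cis (t * ?D \<omega>) \<partial>M)" using re[of t] by (simp add: Reals_cnj_iff)
      finally show "char (distr N borel (\<lambda>\<omega>. 1 * ?D \<omega>)) t = char (distr N borel (\<lambda>\<omega>. - 1 * ?D \<omega>)) t"
        unfolding ch by simp
    qed
    have rd: "real_distribution (distr N borel (\<lambda>\<omega>. c * ?D \<omega>))" for c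
    proof -
      have "prob_space (distr N borel (\<lambda>\<omega>. c * ?D \<omega>))" by (rule N.prob_space_distr) measurable
      then show ?thesis by (simp add: real_distribution_def real_distribution_axioms_def)
    qed
    have "distr N borel (\<lambda>\<omega>. 1 * ?D \<omega>) = distr N borel (\<lambda>\<omega>. - 1 * ?D \<omega>)"
      by (rule Levy_uniqueness[OF rd rd ch1])
    then have "emeasure (distr N borel (\<lambda>\<omega>. 1 * ?D \<omega>)) {0<..} = emeasure (distr N borel (\<lambda>\<omega>. - 1 * ?D \<omega>)) {0<..}"
      by simp
    then have "emeasure N {\<omega> \<in> space M. 0 < ?D \<omega>} = emeasure N {\<omega> \<in> space M. ?D \<omega> < 0}"
      by (subst (asm) (1 2) emeasure_distr) (auto simp: vimage_def Int_def conj_commute)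
    then have "prob (A \<inter> {\<omega> \<in> space M. 0 < ?D \<omega>}) / prob A = prob (A \<inter> {\<omega> \<in> space M. ?D \<omega> < 0}) / prob A"
      by (simp add: eN)
    then show ?thesis unfolding sets using pA by simp
  qed
qed

text \<open>Split according to the first index \<open>k\<close> at which the sum exceeds
  \<open>\<theta>\<close>. Given the past up to that passage, the remaining increment is symmetric,
  so at most half of the event is lost by requiring that the final sum exceed
  \<open>\<theta>\<close> too.\<close>

lemma Levy_maximal_inequality:
  assumes p: "1 \<le> p" and \<theta>: "0 \<le> \<theta>"
  shows "prob {\<omega> \<in> space M. \<exists>j\<in>{p..n}. \<theta> < (\<Sum>l\<in>{p..<j}. v \<bullet> xi l \<omega>)} \<le>
    2 * prob {\<omega> \<in> space M. \<theta> < (\<Sum>l\<in>{p..<n}. v \<bullet> xi l \<omega>)}"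
proof -
  let ?U = "\<lambda>j \<omega>. \<Sum>l\<in>{p..<j}. v \<bullet> xi l \<omega>"
  have [measurable]: "?U j \<in> borel_measurable M" for j by measurable
  define B where "B k = {\<omega> \<in> space M. (\<forall>j\<in>{p..<k}. ?U j \<omega> \<le> \<theta>) \<and> \<theta> < ?U k \<omega>}" for k
  have Bm [measurable]: "B k \<in> sets M" for k unfolding B_def by measurable
  define C where "C k = B k \<inter> {\<omega> \<in> space M. \<theta> < ?U n \<omega>}" for k
  have Cm [measurable]: "C k \<in> sets M" for k unfolding C_def by measurable
  have disjB: "disjoint_family_on B {p..n}"
    unfolding disjoint_family_on_def
  proof (intro ballI impI)
    fix i j assume ij: "i \<in> {p..n}" "j \<in> {p..n}" "i \<noteq> j"
    show "B i \<inter> B j = {}"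
    proof (cases "i < j")
      case True
      then have "i \<in> {p..<j}" using ij by auto
      then show ?thesis unfolding B_def by fastforce
    next
      case False
      then have "j \<in> {p..<i}" using ij by auto
      then show ?thesis unfolding B_def by fastforce
    qed
  qed
  have disjC: "disjoint_family_on C {p..n}"
    using disjB unfolding disjoint_family_on_def C_def by blast
  have step: "prob (B k) \<le> 2 * prob (C k)" if k: "k \<in> {p..n}" for k
  proof (cases "k = p")
    case True
    \<comment> \<open>The empty sum is 0 and cannot exceed \<open>\<theta>\<close>, so the first
      passage occurs after \<open>p\<close>.\<close>
    then have "B k = {}" using \<theta> by (auto simp: B_def)
    then show ?thesis by simp
  next
    case False
    \<comment> \<open>The sum \<open>?U k\<close> ends with index \<open>m\<close>, so the first
      passage at \<open>k\<close> is an event of the past up to \<open>m\<close>.\<close>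
    define m where "m = k - 1"
    have m: "k = Suc m" "p \<le> m" "m < n" using k False p by (auto simp: m_def)
    let ?u = "\<lambda>j q. \<Sum>l\<in>{p..<j}. snd q l * (v \<bullet> vf (fst q l)) :: real"
    define G where "G = {q \<in> space (PX m \<Otimes>\<^sub>M PE m). (\<forall>j\<in>{p..<k}. ?u j q \<le> \<theta>) \<and> \<theta> < ?u k q}"
    have um: "?u j \<in> borel_measurable (PX m \<Otimes>\<^sub>M PE m)" if "j \<le> k" for j
    proof (rule borel_measurable_sum)
      fix l assume "l \<in> {p..<j}"
      then have l: "l \<in> {..m}" using that m by auto
      show "(\<lambda>q. snd q l * (v \<bullet> vf (fst q l))) \<in> borel_measurable (PX m \<Otimes>\<^sub>M PE m)"
        by (intro borel_measurable_times measurable_compose[OF measurable_snd measurable_component_singleton[OF l]]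
            measurable_compose[OF measurable_fst measurable_compose[OF measurable_component_singleton[OF l] measurable_inner_vf]])
    qed
    have G: "G \<in> sets (PX m \<Otimes>\<^sub>M PE m)"
    proof -
      have eq: "G = {q \<in> space (PX m \<Otimes>\<^sub>M PE m). \<forall>j\<in>{p..<k}. ?u j q \<le> \<theta>} \<inter> {q \<in> space (PX m \<Otimes>\<^sub>M PE m). \<theta> < ?u k q}"
        by (auto simp: G_def)
      have "{q \<in> space (PX m \<Otimes>\<^sub>M PE m). \<forall>j\<in>{p..<k}. ?u j q \<le> \<theta>} \<in> sets (PX m \<Otimes>\<^sub>M PE m)"
        by (intro sets.sets_Collect_finite_All borel_measurable_le um) auto
      moreover have "{q \<in> space (PX m \<Otimes>\<^sub>M PE m). \<theta> < ?u k q} \<in> sets (PX m \<Otimes>\<^sub>M PE m)"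
        by (intro borel_measurable_less um) auto
      ultimately show ?thesis unfolding eq by blast
    qed
    have u: "?u j (pastX m \<omega>, pastE m \<omega>) = ?U j \<omega>" if "j \<le> k" for j \<omega>
      using that m by (intro sum.cong) (auto simp: pastX_def pastE_def xi_def)
    have sp: "(pastX m \<omega>, pastE m \<omega>) \<in> space (PX m \<Otimes>\<^sub>M PE m)" if "\<omega> \<in> space M" for \<omega>
      using measurable_space[OF pastX_measurable that] measurable_space[OF pastE_measurable that] by (simp add: space_pair_measure)
    have BG: "\<omega> \<in> B k \<longleftrightarrow> (pastX m \<omega>, pastE m \<omega>) \<in> G" if "\<omega> \<in> space M" for \<omega>
      unfolding B_def G_def using that sp[OF that] u by auto
    have split: "?U n \<omega> = ?U k \<omega> + (\<Sum>l\<in>{Suc m..n-1}. v \<bullet> xi l \<omega>)" for \<omega>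
    proof -
      have "{p..<n} = {p..<k} \<union> {Suc m..n-1}" using m by auto
      moreover have "{p..<k} \<inter> {Suc m..n-1} = {}" using m by auto
      ultimately show ?thesis by (simp add: sum.union_disjoint)
    qed
    let ?D = "\<lambda>\<omega>. \<Sum>l\<in>{Suc m..n-1}. v \<bullet> xi l \<omega>"
    \<comment> \<open>If the remaining increment is not negative, the final sum still exceeds
      \<open>\<theta>\<close>. The negative case is exchanged below for the positive one, which
      again lies in \<open>C k\<close>; hence the factor 2.\<close>
    have "prob (B k) \<le> prob ({\<omega> \<in> space M. (pastX m \<omega>, pastE m \<omega>) \<in> G \<and> ?D \<omega> < 0} \<union> C k)"
    proof (rule finite_measure_mono)
      show "B k \<subseteq> {\<omega> \<in> space M. (pastX m \<omega>, pastE m \<omega>) \<in> G \<and> ?D \<omega> < 0} \<union> C k"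
      proof
        fix \<omega> assume w: "\<omega> \<in> B k"
        then have "\<omega> \<in> space M" "\<theta> < ?U k \<omega>" by (auto simp: B_def)
        then show "\<omega> \<in> {\<omega> \<in> space M. (pastX m \<omega>, pastE m \<omega>) \<in> G \<and> ?D \<omega> < 0} \<union> C k"
          using w BG[of \<omega>] split[of \<omega>] by (cases "?D \<omega> < 0") (auto simp: C_def)
      qed
      have "{\<omega> \<in> space M. (pastX m \<omega>, pastE m \<omega>) \<in> G \<and> ?D \<omega> < 0} = B k \<inter> {\<omega> \<in> space M. ?D \<omega> < 0}"
        using BG by (auto simp: B_def)
      then show "{\<omega> \<in> space M. (pastX m \<omega>, pastE m \<omega>) \<in> G \<and> ?D \<omega> < 0} \<union> C k \<in> sets M" by simp
    qed
    also have "\<dots> \<le> prob {\<omega> \<in> space M. (pastX m \<omega>, pastE m \<omega>) \<in> G \<and> ?D \<omega> < 0} + prob (C k)"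
    proof (rule measure_Un_le)
      have "{\<omega> \<in> space M. (pastX m \<omega>, pastE m \<omega>) \<in> G \<and> ?D \<omega> < 0} = B k \<inter> {\<omega> \<in> space M. ?D \<omega> < 0}"
        using BG by (auto simp: B_def)
      then show "{\<omega> \<in> space M. (pastX m \<omega>, pastE m \<omega>) \<in> G \<and> ?D \<omega> < 0} \<in> sets M" by simp
    qed simp
    also have "prob {\<omega> \<in> space M. (pastX m \<omega>, pastE m \<omega>) \<in> G \<and> ?D \<omega> < 0} =
        prob {\<omega> \<in> space M. (pastX m \<omega>, pastE m \<omega>) \<in> G \<and> 0 < ?D \<omega>}"
      by (rule symmetric_increment[symmetric, OF G]) (use m in auto)
    also have "\<dots> \<le> prob (C k)"
    proof (rule finite_measure_mono)
      show "{\<omega> \<in> space M. (pastX m \<omega>, pastE m \<omega>) \<in> G \<and> 0 < ?D \<omega>} \<subseteq> C k"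
      proof
        fix \<omega> assume w: "\<omega> \<in> {\<omega> \<in> space M. (pastX m \<omega>, pastE m \<omega>) \<in> G \<and> 0 < ?D \<omega>}"
        then have "\<omega> \<in> B k" "0 < ?D \<omega>" using BG by auto
        moreover from this have "\<theta> < ?U k \<omega>" by (auto simp: B_def)
        ultimately show "\<omega> \<in> C k" using w split[of \<omega>] by (auto simp: C_def)
      qed
    qed simp
    finally show ?thesis by simp
  qed
  have "{\<omega> \<in> space M. \<exists>j\<in>{p..n}. \<theta> < ?U j \<omega>} \<subseteq> (\<Union>k\<in>{p..n}. B k)"
  proof
    fix \<omega> assume w: "\<omega> \<in> {\<omega> \<in> space M. \<exists>j\<in>{p..n}. \<theta> < ?U j \<omega>}"
    define k where "k = (LEAST j. j \<in> {p..n} \<and> \<theta> < ?U j \<omega>)"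
    have ex: "\<exists>j. j \<in> {p..n} \<and> \<theta> < ?U j \<omega>" using w by blast
    have k: "k \<in> {p..n} \<and> \<theta> < ?U k \<omega>" unfolding k_def by (rule LeastI_ex[OF ex])
    have "?U j \<omega> \<le> \<theta>" if "j \<in> {p..<k}" for j
    proof (rule ccontr)
      assume "\<not> ?U j \<omega> \<le> \<theta>"
      then have "k \<le> j" unfolding k_def using that k by (intro Least_le) auto
      then show False using that by simp
    qed
    then have "\<omega> \<in> B k" using k w by (auto simp: B_def)
    then show "\<omega> \<in> (\<Union>k\<in>{p..n}. B k)" using k by blast
  qed
  then have "prob {\<omega> \<in> space M. \<exists>j\<in>{p..n}. \<theta> < ?U j \<omega>} \<le> prob (\<Union>k\<in>{p..n}. B k)"
    by (rule finite_measure_mono) auto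
  also have "\<dots> = (\<Sum>k\<in>{p..n}. prob (B k))"
    by (rule finite_measure_finite_Union[OF _ _ disjB]) auto
  also have "\<dots> \<le> (\<Sum>k\<in>{p..n}. 2 * prob (C k))" by (rule sum_mono[OF step])
  also have "\<dots> = 2 * prob (\<Union>k\<in>{p..n}. C k)"
    by (subst finite_measure_finite_Union[OF _ _ disjC]) (auto simp: sum_distrib_left)
  also have "\<dots> \<le> 2 * prob {\<omega> \<in> space M. \<theta> < ?U n \<omega>}"
    by (intro mult_left_mono finite_measure_mono) (auto simp: C_def)
  finally show ?thesis .
qed

end

section \<open>Wiener processes\<close>

text \<open>A square of side 1/2 fits into the unit quarter disc. Positivity of
  \<open>sigma_sq\<close> ensures that the limiting normal laws are non-degenerate.\<close>

lemma c_disc_pos: "0 < c_disc"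
proof -
  let ?h = "(\<chi> i. 1 / 2) :: real^2"
  have "box 0 ?h \<subseteq> quarter_disc 1"
  proof
    fix k assume "k \<in> box 0 ?h"
    then have k: "0 < k $ i" "k $ i < 1 / 2" for i by (auto simp: mem_box_cart)
    have "(k $ i)\<^sup>2 < (1 / 2)\<^sup>2" for i using k[of i] by (intro power_strict_mono) auto
    from this[of 1] this[of 2] k[of 1] k[of 2] show "k \<in> quarter_disc 1"
      by (simp add: quarter_disc_def power2_eq_square less_imp_le)
  qed
  then have "measure lborel (box 0 ?h) \<le> measure lborel (quarter_disc 1)"
    by (rule measure_mono_fmeasurable) (use emeasure_quarter_disc_finite in \<open>auto simp: fmeasurable_def\<close>)
  moreover have "measure lborel (box 0 ?h) = 1 / 4"
    unfolding measure_def by (subst emeasure_lborel_box_2) auto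
  ultimately show ?thesis unfolding c_disc_def by simp
qed

lemma sigma_sq_pos: "0 < sigma_sq"
  using c_disc_pos by (simp add: sigma_sq_eq)

section \<open>Gaussian moments and the law of Wiener increments\<close>

lemma normal_char:
  assumes M: "prob_space M" and \<sigma>: "0 < \<sigma>" and D: "distributed M lborel D (normal_density 0 \<sigma>)"
  shows "(\<integral>\<omega>. cis (u * D \<omega>) \<partial>M) = complex_of_real (exp (- (\<sigma>\<^sup>2 * u\<^sup>2 / 2)))"
proof -
  interpret prob_space M by fact
  have "distributed M lborel (\<lambda>\<omega>. (D \<omega> - 0) / \<sigma>) std_normal_density"
    using D normal_standard_normal_convert[OF \<sigma>, of D 0] by simp
  then have D': "distributed M lborel (\<lambda>\<omega>. D \<omega> / \<sigma>) std_normal_density" by simp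
  have Dm: "(\<lambda>\<omega>. D \<omega> / \<sigma>) \<in> borel_measurable M" using distributed_measurable[OF D'] by simp
  have law: "distr M borel (\<lambda>\<omega>. D \<omega> / \<sigma>) = std_normal_distribution"
    using distributed_distr_eq_density[OF D'] by (simp cong: distr_cong)
  have "(\<integral>\<omega>. cis (u * D \<omega>) \<partial>M) = (\<integral>\<omega>. cis ((u * \<sigma>) * (D \<omega> / \<sigma>)) \<partial>M)" using \<sigma> by simp
  also have "\<dots> = char (distr M borel (\<lambda>\<omega>. D \<omega> / \<sigma>)) (u * \<sigma>)"
    unfolding char_def using Dm
    by (subst integral_distr) (auto simp: cis_conv_exp intro!: borel_measurable_continuous_onI continuous_intros)
  also have "\<dots> = complex_of_real (exp (- (\<sigma>\<^sup>2 * u\<^sup>2 / 2)))"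
    unfolding law char_std_normal_distribution by (simp add: power_mult_distrib mult.commute)
  finally show ?thesis .
qed

lemma normal_fourth_moment:
  assumes M: "prob_space M" and \<sigma>: "0 < \<sigma>" and D: "distributed M lborel D (normal_density 0 \<sigma>)"
  shows "has_bochner_integral M (\<lambda>\<omega>. (D \<omega>) ^ 4) (3 * \<sigma> ^ 4)"
proof -
  have "has_bochner_integral lborel (\<lambda>x. normal_density 0 \<sigma> x * (x - 0) ^ (2 * 2)) (fact (2 * 2) / ((2 / \<sigma>\<^sup>2) ^ 2 * fact 2))"
    by (rule normal_moment_even[OF \<sigma>])
  moreover have "fact (2 * 2) / ((2 / \<sigma>\<^sup>2) ^ 2 * fact 2) = 3 * \<sigma> ^ 4"
    using \<sigma> by (simp add: fact_numeral power_divide field_simps flip: power_mult)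
  ultimately have h: "has_bochner_integral lborel (\<lambda>x. normal_density 0 \<sigma> x * x ^ 4) (3 * \<sigma> ^ 4)" by simp
  have "integrable M (\<lambda>\<omega>. (D \<omega>) ^ 4)"
    using distributed_integrable[OF D, of "\<lambda>x. x ^ 4"] h by (auto simp: has_bochner_integral_iff normal_density_nonneg)
  moreover have "(\<integral>\<omega>. (D \<omega>) ^ 4 \<partial>M) = 3 * \<sigma> ^ 4"
    using distributed_integral[OF D, of "\<lambda>x. x ^ 4"] h by (auto simp: has_bochner_integral_iff normal_density_nonneg)
  ultimately show ?thesis by (simp add: has_bochner_integral_iff)
qed

lemma wiener_prob_space: "wiener_process2 M s2 W \<Longrightarrow> prob_space M"
  by (simp add: wiener_process2_def wiener_process_def)

text \<open>Within a coordinate the increments over successive intervals are independent; the two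
  coordinate processes are independent as whole paths. The exponentials therefore factor over pairs
  of interval and coordinate.\<close>

lemma wiener_increment_char:
  fixes W :: "real \<Rightarrow> 'v \<Rightarrow> real ^ 2" and u :: "nat \<times> 2 \<Rightarrow> real"
  assumes W: "wiener_process2 M s2 W" and s2: "0 < s2"
    and t: "0 \<le> t 0" "mono t" "\<And>j. j < m \<Longrightarrow> t (Suc j) - t j = \<tau>" and \<tau>: "0 < \<tau>"
  shows "(\<integral>\<omega>. cis (\<Sum>i\<in>{..<m} \<times> UNIV. u i * (W (t (Suc (fst i))) \<omega> $ snd i - W (t (fst i)) \<omega> $ snd i)) \<partial>M) =
    complex_of_real (\<Prod>i\<in>{..<m} \<times> UNIV. exp (- (s2 * (u i)\<^sup>2 / 2) * \<tau>))"
proof -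
  interpret prob_space M by (rule wiener_prob_space[OF W])
  have t0: "0 \<le> t j" for j using t(1) monoD[OF t(2), of 0 j] by linarith
  have Wp: "wiener_process M s2 (\<lambda>t \<omega>. W t \<omega> $ \<alpha>)" for \<alpha> using W by (simp add: wiener_process2_def)
  have Wm: "(\<lambda>\<omega>. W r \<omega> $ \<alpha>) \<in> borel_measurable M" if "0 \<le> r" for r \<alpha>
    using Wp[of \<alpha>] that by (simp add: wiener_process_def)
  let ?D = "\<lambda>j \<alpha> \<omega>. W (t (Suc j)) \<omega> $ \<alpha> - W (t j) \<omega> $ \<alpha>"
  have Dm: "?D j \<alpha> \<in> borel_measurable M" for j \<alpha> by (intro borel_measurable_diff Wm t0)
  have single: "(\<integral>\<omega>. cis (c * ?D j \<alpha> \<omega>) \<partial>M) = complex_of_real (exp (- (s2 * c\<^sup>2 / 2) * \<tau>))" if "j < m" for c j \<alpha>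
  proof -
    have "t j < t (Suc j)" using t(3)[OF that] \<tau> by simp
    moreover have "\<forall>s t. 0 \<le> s \<and> s < t \<longrightarrow> distributed M lborel (\<lambda>\<omega>. W t \<omega> $ \<alpha> - W s \<omega> $ \<alpha>) (normal_density 0 (sqrt (s2 * (t - s))))"
      using Wp[of \<alpha>] unfolding wiener_process_def by blast
    ultimately have "distributed M lborel (?D j \<alpha>) (normal_density 0 (sqrt (s2 * (t (Suc j) - t j))))"
      using t0[of j] by blast
    then have "distributed M lborel (?D j \<alpha>) (normal_density 0 (sqrt (s2 * \<tau>)))"
      unfolding t(3)[OF that] .
    from normal_char[OF prob_space_axioms _ this, of c] show ?thesis using s2 \<tau> by (simp add: algebra_simps)
  qed
  have comp: "(\<integral>\<omega>. cis (\<Sum>j<m. c j * ?D j \<alpha> \<omega>) \<partial>M) = complex_of_real (\<Prod>j<m. exp (- (s2 * (c j)\<^sup>2 / 2) * \<tau>))" for c \<alpha>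
  proof -
    have "\<forall>(n::nat) \<tau>. 0 \<le> \<tau> 0 \<and> mono \<tau> \<longrightarrow> indep_vars (\<lambda>_. borel) (\<lambda>i \<omega>. W (\<tau> (Suc i)) \<omega> $ \<alpha> - W (\<tau> i) \<omega> $ \<alpha>) {..<n}"
      using Wp[of \<alpha>] unfolding wiener_process_def by blast
    then have "indep_vars (\<lambda>_. borel) (\<lambda>j. ?D j \<alpha>) {..<m}" using t(1,2) by blast
    then have iv: "indep_vars (\<lambda>_. borel) (\<lambda>j \<omega>. cis (c j * ?D j \<alpha> \<omega>)) {..<m}"
      by (rule indep_vars_compose2) measurable
    have "(\<integral>\<omega>. (\<Prod>j\<in>{..<m}. cis (c j * ?D j \<alpha> \<omega>)) \<partial>M) = (\<Prod>j\<in>{..<m}. \<integral>\<omega>. cis (c j * ?D j \<alpha> \<omega>) \<partial>M)"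
    proof (rule indep_vars_lebesgue_integral[OF _ iv])
      fix j
      show "integrable M (\<lambda>\<omega>. cis (c j * ?D j \<alpha> \<omega>))"
        by (rule integrable_const_bound[where B=1]) (use Dm in auto)
    qed simp
    then show ?thesis by (simp add: prod_cis single)
  qed
  have iv2: "indep_vars (\<lambda>_. PiM {0..} (\<lambda>_. borel)) (\<lambda>\<alpha> \<omega>. \<lambda>t\<in>{0..}. W t \<omega> $ \<alpha>) UNIV"
    using W by (simp add: wiener_process2_def)
  \<comment> \<open>A functional of a whole coordinate path that reads only finitely many times,
    hence is measurable for the product sigma-algebra in which independence is stated.\<close>
  let ?F = "\<lambda>\<alpha> f. cis (\<Sum>j<m. u (j, \<alpha>) * (f (t (Suc j)) - f (t j)))"
  have iv3: "indep_vars (\<lambda>_. borel) (\<lambda>\<alpha> \<omega>. ?F \<alpha> (\<lambda>t\<in>{0..}. W t \<omega> $ \<alpha>)) UNIV"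
  proof (rule indep_vars_compose2[OF iv2])
    fix \<alpha> :: 2
    have "(\<lambda>f. f (t j)) \<in> borel_measurable (PiM {0..} (\<lambda>_. borel :: real measure))" for j
      by (rule measurable_component_singleton) (simp add: t0)
    then show "?F \<alpha> \<in> borel_measurable (PiM {0..} (\<lambda>_. borel))"
      by (intro measurable_cis borel_measurable_sum borel_measurable_times borel_measurable_diff) auto
  qed
  have Feq: "?F \<alpha> (\<lambda>t\<in>{0..}. W t \<omega> $ \<alpha>) = cis (\<Sum>j<m. u (j, \<alpha>) * ?D j \<alpha> \<omega>)" for \<alpha> \<omega> by (simp add: t0)
  have "(\<integral>\<omega>. (\<Prod>\<alpha>\<in>UNIV. ?F \<alpha> (\<lambda>t\<in>{0..}. W t \<omega> $ \<alpha>)) \<partial>M) = (\<Prod>\<alpha>\<in>UNIV. \<integral>\<omega>. ?F \<alpha> (\<lambda>t\<in>{0..}. W t \<omega> $ \<alpha>) \<partial>M)"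
  proof (rule indep_vars_lebesgue_integral[OF _ iv3])
    fix \<alpha> :: 2
    show "integrable M (\<lambda>\<omega>. ?F \<alpha> (\<lambda>t\<in>{0..}. W t \<omega> $ \<alpha>))"
      unfolding Feq
      by (rule integrable_const_bound[where B=1]) (use Dm in \<open>auto intro!: measurable_cis borel_measurable_sum borel_measurable_times\<close>)
  qed simp
  then have fin: "(\<integral>\<omega>. cis (\<Sum>\<alpha>\<in>UNIV. \<Sum>j<m. u (j, \<alpha>) * ?D j \<alpha> \<omega>) \<partial>M) =
      complex_of_real (\<Prod>\<alpha>\<in>UNIV. \<Prod>j<m. exp (- (s2 * (u (j, \<alpha>))\<^sup>2 / 2) * \<tau>))"
    unfolding Feq comp by (simp add: prod_cis)
  have sumswap: "(\<Sum>\<alpha>\<in>UNIV. \<Sum>j<m. g (j, \<alpha>)) = (\<Sum>i\<in>{..<m} \<times> UNIV. g i)" for g :: "nat \<times> 2 \<Rightarrow> real"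
    by (subst sum.swap) (simp add: sum.cartesian_product)
  have prodswap: "(\<Prod>\<alpha>\<in>UNIV. \<Prod>j<m. g (j, \<alpha>)) = (\<Prod>i\<in>{..<m} \<times> UNIV. g i)" for g :: "nat \<times> 2 \<Rightarrow> real"
    by (subst prod.swap) (simp add: prod.cartesian_product)
  have s: "(\<Sum>\<alpha>\<in>UNIV. \<Sum>j<m. u (j, \<alpha>) * ?D j \<alpha> \<omega>) =
      (\<Sum>i\<in>{..<m} \<times> UNIV. u i * (W (t (Suc (fst i))) \<omega> $ snd i - W (t (fst i)) \<omega> $ snd i))" for \<omega>
    using sumswap[of "\<lambda>i. u i * (W (t (Suc (fst i))) \<omega> $ snd i - W (t (fst i)) \<omega> $ snd i)"] by simp
  have p: "(\<Prod>\<alpha>\<in>UNIV. \<Prod>j<m. exp (- (s2 * (u (j, \<alpha>))\<^sup>2 / 2) * \<tau>)) =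
      (\<Prod>i\<in>{..<m} \<times> UNIV. exp (- (s2 * (u i)\<^sup>2 / 2) * \<tau>))"
    by (rule prodswap)
  show ?thesis using fin unfolding s p .
qed

section \<open>Convergence of the paths\<close>

text \<open>The number of complete steps up to the time \<open>j * T / m\<close> of the
  \<open>j\<close>-th node, on the time scale of \<open>Z\<close>.\<close>

definition grid :: "real \<Rightarrow> nat \<Rightarrow> nat \<Rightarrow> nat \<Rightarrow> nat" where
  "grid T m N j = nat \<lfloor>real N * (real j * T / real m)\<rfloor>"

lemma grid_0 [simp]: "grid T m N 0 = 0"
  by (simp add: grid_def)

lemma grid_bounds:
  assumes "0 < T"
  shows "real (grid T m N j) \<le> real N * (real j * T / real m)" "real N * (real j * T / real m) < real (grid T m N j) + 1"
proof -
  have "0 \<le> real N * (real j * T / real m)" using assms by simp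
  then show "real (grid T m N j) \<le> real N * (real j * T / real m)" "real N * (real j * T / real m) < real (grid T m N j) + 1"
    unfolding grid_def by linarith+
qed

lemma grid_mono:
  assumes "0 < T" "i \<le> j" shows "grid T m N i \<le> grid T m N j"
proof -
  have "real N * (real i * T / real m) \<le> real N * (real j * T / real m)"
    using assms by (intro mult_left_mono divide_right_mono mult_right_mono) auto
  then show ?thesis unfolding grid_def by (intro nat_mono floor_mono)
qed

lemma grid_tendsto:
  assumes "0 < T" shows "(\<lambda>N. real (grid T m N j) / real N) \<longlonglongrightarrow> real j * T / real m"
proof -
  have "(\<lambda>N. real (grid T m N j) / real N - real j * T / real m) \<longlonglongrightarrow> 0"
  proof (rule Lim_null_comparison)
    show "\<forall>\<^sub>F N in sequentially. norm (real (grid T m N j) / real N - real j * T / real m) \<le> 1 / real N"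
      using eventually_gt_at_top[of 0]
    proof eventually_elim
      case (elim N)
      have eq: "real (grid T m N j) / real N - real j * T / real m = (real (grid T m N j) - real N * (real j * T / real m)) / real N"
        using elim by (simp add: diff_divide_distrib)
      have "\<bar>real (grid T m N j) - real N * (real j * T / real m)\<bar> \<le> 1"
        using grid_bounds[OF assms, where m=m and N=N and j=j] by linarith
      then show ?case unfolding eq using elim by (simp add: divide_right_mono)
    qed
    show "(\<lambda>N. 1 / real N) \<longlonglongrightarrow> 0" by real_asymp
  qed
  then show ?thesis by (simp add: LIM_zero_iff)
qed

text \<open>The linear bound on block ends used for \<open>char_block_sums\<close>. The factor 2
  covers the index \<open>m + 1\<close>, which is at most \<open>2 * m\<close>; the added 1 allows
  for the block prolonged by one step.\<close>

lemma grid_le: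
  assumes "0 < T" "j \<le> m" "0 < m"
  shows "real (grid T m N (Suc j)) + 1 \<le> (2 * T + 1) * (real N + 1)"
proof -
  have "real (Suc j) * T / real m \<le> 2 * real m * T / real m"
    using assms by (intro divide_right_mono mult_right_mono) auto
  then have "real N * (real (Suc j) * T / real m) \<le> real N * (2 * T)"
    using assms by (intro mult_left_mono) auto
  then have "real (grid T m N (Suc j)) \<le> real N * (2 * T)" using grid_bounds(1)[OF assms(1), of m N "Suc j"] by linarith
  moreover have "real N * (2 * T) + 1 \<le> (2 * T + 1) * (real N + 1)" using assms by (simp add: algebra_simps)
  ultimately show ?thesis by linarith
qed

lemma scale_pos: "2 \<le> N \<Longrightarrow> 0 < scale N"
  by (simp add: scale_def)

lemma scale_at_top: "filterlim scale at_top sequentially"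
  unfolding scale_def by real_asymp

text \<open>The four signed coordinate directions, which reduce bounds on the norm to the one-sided
  bounds supplied by the maximal inequality.\<close>

definition dirs :: "(real ^ 2) set" where
  "dirs = {axis 1 1, - axis 1 1, axis 2 1, - axis 2 1}"

lemma finite_dirs: "finite dirs"
  by (simp add: dirs_def)

lemma card_dirs: "card dirs \<le> 4"
  using card_length[of "[axis 1 1, - axis 1 1, axis 2 1, - axis 2 1 :: real ^ 2]"] by (simp add: dirs_def)

lemma norm_dirs: "v \<in> dirs \<Longrightarrow> norm v = 1"
  by (auto simp: dirs_def norm_axis_1)

lemma norm_le_dirs: "(\<And>v. v \<in> dirs \<Longrightarrow> v \<bullet> y \<le> \<delta>) \<Longrightarrow> norm y \<le> 2 * \<delta>"
proof -
  assume *: "\<And>v. v \<in> dirs \<Longrightarrow> v \<bullet> y \<le> \<delta>"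
  have "\<bar>y $ 1\<bar> \<le> \<delta>" "\<bar>y $ 2\<bar> \<le> \<delta>"
    using *[of "axis 1 1"] *[of "- axis 1 1"] *[of "axis 2 1"] *[of "- axis 2 1"]
    by (auto simp: dirs_def inner_axis' abs_le_iff)
  moreover have "norm y \<le> \<bar>y $ 1\<bar> + \<bar>y $ 2\<bar>"
    using norm_le_l1_cart[of y] by (simp add: UNIV_2)
  ultimately show ?thesis by linarith
qed

context kinetic
begin

section \<open>Tails of block sums and oscillation within blocks\<close>

lemma S_block_sum: "S X e n \<omega> = block_sum 0 n \<omega> + (if n = 0 then 0 else xi 0 \<omega>)"
proof (cases n)
  case (Suc k)
  have "{..<n} = insert 0 ({0..<n} \<inter> {1..})" using Suc by auto
  then show ?thesis using Suc unfolding S_eq_xi block_sum_def by (simp add: add.commute)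
qed (simp add: S_eq_xi block_sum_def)

lemma block_sum_diff: "p \<le> n \<Longrightarrow> block_sum 0 n \<omega> - block_sum 0 p \<omega> = block_sum p n \<omega>"
proof -
  assume pn: "p \<le> n"
  have "{0..<n} \<inter> {1..} = ({0..<p} \<inter> {1..}) \<union> ({p..<n} \<inter> {1..})" using pn by auto
  moreover have "({0..<p} \<inter> {1..}) \<inter> ({p..<n} \<inter> {1..}) = {}" by auto
  ultimately show ?thesis unfolding block_sum_def by (simp add: sum.union_disjoint)
qed

text \<open>The term that \<open>Z\<close> interpolates is exactly one full step of
  \<open>S\<close>, so the path is the polygon through the rescaled partial sums with
  \<open>N\<close> nodes per unit time.\<close>

lemma path_eq: "(\<lambda>t\<in>{0..T}. Z X e N t \<omega>) = poly_path T (real N) (\<lambda>n. (1 / scale N) *\<^sub>R S X e n \<omega>)"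
proof -
  have "Z X e N t \<omega> = polygon (\<lambda>n. (1 / scale N) *\<^sub>R S X e n \<omega>) (real N * t)" for t
  proof -
    let ?n = "nat \<lfloor>real N * t\<rfloor>"
    have "S X e (Suc ?n) \<omega> - S X e ?n \<omega> = (e ?n \<omega> / Phi (X ?n \<omega>)) *\<^sub>R velocity (X ?n \<omega>)"
      by (simp add: S_def)
    then have "(1 / scale N) *\<^sub>R S X e (Suc ?n) \<omega> - (1 / scale N) *\<^sub>R S X e ?n \<omega> =
        (1 / scale N) *\<^sub>R ((e ?n \<omega> / Phi (X ?n \<omega>)) *\<^sub>R velocity (X ?n \<omega>))"
      by (simp only: scaleR_diff_right[symmetric])
    then show ?thesis
      unfolding Z_def polygon_def Let_def by (simp add: scale_def scaleR_add_right mult.commute)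
  qed
  then show ?thesis by (simp add: poly_path_def)
qed

text \<open>The block sum converges in law to the Gaussian variable \<open>D\<close>, so its tail is
  asymptotically controlled by the fourth moment \<open>3 * \<sigma> ^ 4\<close> of
  \<open>D\<close>. The constant is \<open>48 = 16 * 3\<close>, where 16 is the cost of starting the
  test function at \<open>\<epsilon> / 2\<close>.\<close>

lemma block_tail:
  fixes p q :: "nat \<Rightarrow> nat"
  assumes len: "(\<lambda>N. real (q N - p N) / real N) \<longlonglongrightarrow> \<tau>" and bd: "\<And>N. real (q N) \<le> C * (real N + 1)"
    and v: "norm v = 1" and \<epsilon>: "0 < \<epsilon>" and \<eta>: "0 < \<eta>" and \<tau>: "0 < \<tau>"
    and M': "prob_space M'" and D: "distributed M' lborel D (normal_density 0 (sqrt (sigma_sq * \<tau>)))"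
  shows "\<forall>\<^sub>F N in sequentially. prob {\<omega> \<in> space M. \<epsilon> < v \<bullet> ((1 / scale N) *\<^sub>R block_sum (p N) (q N) \<omega>)}
    < 48 * (sigma_sq * \<tau>)\<^sup>2 / \<epsilon> ^ 4 + \<eta>"
proof -
  interpret M': prob_space M' by fact
  define \<sigma> where "\<sigma> = sqrt (sigma_sq * \<tau>)"
  have \<sigma>: "0 < \<sigma>" using sigma_sq_pos \<tau> by (simp add: \<sigma>_def)
  have \<sigma>2: "\<sigma>\<^sup>2 = sigma_sq * \<tau>" using sigma_sq_pos \<tau> by (simp add: \<sigma>_def)
  have \<sigma>4: "\<sigma> ^ 4 = (sigma_sq * \<tau>)\<^sup>2" unfolding \<sigma>2[symmetric] by (simp flip: power_mult)
  note D = D[folded \<sigma>_def]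
  have Dm: "D \<in> borel_measurable M'" using distributed_measurable[OF D] by simp
  let ?Y = "\<lambda>N \<omega>. v \<bullet> ((1 / scale N) *\<^sub>R block_sum (p N) (q N) \<omega>)"
  have Ym [measurable]: "?Y N \<in> borel_measurable M" for N by measurable
  have cc: "(\<lambda>N. \<integral>\<omega>. cis (t * ?Y N \<omega>) \<partial>M) \<longlonglongrightarrow> (\<integral>\<omega>. cis (t * D \<omega>) \<partial>M')" for t
    using char_block_sums[where J="{()}" and p="\<lambda>N _. p N" and q="\<lambda>N _. q N" and u="\<lambda>_. t *\<^sub>R v" and \<tau>="\<lambda>_. \<tau>" and C=C] len bd
    unfolding normal_char[OF M' \<sigma> D] by (simp add: v \<sigma>2 power_mult_distrib algebra_simps)
  have "weak_conv_m (\<lambda>N. distr M borel (?Y N)) (distr M' borel D)"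
    by (rule levy_continuity[OF real_distribution_distr[OF Ym] M'.real_distribution_distr[OF Dm]])
      (simp only: char_distr[OF Ym] char_distr[OF Dm] cc)
  note wc = weak_conv_imp_integral_bdd_continuous_conv[OF real_distribution_distr[OF Ym]
        M'.real_distribution_distr[OF Dm] this]
  \<comment> \<open>A continuous ramp from 0 at \<open>\<epsilon> / 2\<close> to 1 at
    \<open>\<epsilon>\<close>: it dominates the tail indicator and is itself dominated by the fourth
    power.\<close>
  define g where "g y = min 1 (max 0 (2 * y / \<epsilon> - 1))" for y :: real
  have gc: "continuous_on UNIV g" unfolding g_def using \<epsilon> by (auto intro!: continuous_intros)
  have g: "0 \<le> g y" "g y \<le> 1" for y by (auto simp: g_def)
  have g1: "g y = 1" if "\<epsilon> < y" for y
  proof -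
    have "1 \<le> 2 * y / \<epsilon> - 1" using \<epsilon> that by (simp add: field_simps)
    then show ?thesis by (simp add: g_def)
  qed
  have gm [measurable]: "g \<in> borel_measurable borel" by (rule borel_measurable_continuous_onI[OF gc])
  have g4: "g y \<le> 16 / \<epsilon> ^ 4 * y ^ 4" for y
  proof (cases "\<epsilon> / 2 \<le> y")
    case True
    then have "(\<epsilon> / 2) ^ 4 \<le> y ^ 4" using \<epsilon> by (intro power_mono) auto
    then have "1 \<le> 16 / \<epsilon> ^ 4 * y ^ 4" using \<epsilon> by (simp add: power_divide field_simps)
    then show ?thesis using g(2)[of y] by linarith
  next
    case False
    then have "2 * y / \<epsilon> - 1 \<le> 0" using \<epsilon> by (simp add: field_simps)
    then have "g y = 0" by (simp add: g_def)
    then show ?thesis using \<epsilon> by simp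
  qed
  have "(\<lambda>N. integral\<^sup>L (distr M borel (?Y N)) g) \<longlonglongrightarrow> integral\<^sup>L (distr M' borel D) g"
    by (rule wc[where B=1]) (use g gc in \<open>auto simp: continuous_on_eq_continuous_at\<close>)
  then have conv: "(\<lambda>N. \<integral>\<omega>. g (?Y N \<omega>) \<partial>M) \<longlonglongrightarrow> (\<integral>\<omega>. g (D \<omega>) \<partial>M')"
    using Dm by (simp add: integral_distr)
  have h4: "integrable M' (\<lambda>\<omega>. (D \<omega>) ^ 4)" "(\<integral>\<omega>. (D \<omega>) ^ 4 \<partial>M') = 3 * \<sigma> ^ 4"
    using normal_fourth_moment[OF M' \<sigma> D] by (auto simp: has_bochner_integral_iff)
  have "(\<integral>\<omega>. g (D \<omega>) \<partial>M') \<le> (\<integral>\<omega>. 16 / \<epsilon> ^ 4 * (D \<omega>) ^ 4 \<partial>M')"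
  proof (rule integral_mono)
    show "integrable M' (\<lambda>\<omega>. g (D \<omega>))"
      by (rule M'.integrable_const_bound[where B=1]) (use g Dm in auto)
    show "integrable M' (\<lambda>\<omega>. 16 / \<epsilon> ^ 4 * (D \<omega>) ^ 4)" by (rule integrable_mult_right[OF h4(1)])
  qed (rule g4)
  also have "\<dots> = 48 * (sigma_sq * \<tau>)\<^sup>2 / \<epsilon> ^ 4"
    using h4(2) by (simp add: \<sigma>4)
  finally have "(\<integral>\<omega>. g (D \<omega>) \<partial>M') < 48 * (sigma_sq * \<tau>)\<^sup>2 / \<epsilon> ^ 4 + \<eta>" using \<eta> by linarith
  from order_tendstoD(2)[OF conv this] show ?thesis
  proof eventually_elim
    case (elim N)
    have "prob {\<omega> \<in> space M. \<epsilon> < ?Y N \<omega>} = (\<integral>\<omega>. indicator {\<omega> \<in> space M. \<epsilon> < ?Y N \<omega>} \<omega> \<partial>M)"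
      by (simp add: Int_def conj_commute)
    also have "\<dots> \<le> (\<integral>\<omega>. g (?Y N \<omega>) \<partial>M)"
    proof (rule integral_mono)
      show "integrable M (indicat_real {\<omega> \<in> space M. \<epsilon> < ?Y N \<omega>})"
        by (rule integrable_real_indicator) (auto simp: emeasure_eq_measure)
      show "integrable M (\<lambda>\<omega>. g (?Y N \<omega>))"
        by (rule integrable_const_bound[where B=1]) (use g in auto)
      fix \<omega>
      show "indicat_real {\<omega> \<in> space M. \<epsilon> < ?Y N \<omega>} \<omega> \<le> g (?Y N \<omega>)"
      proof (cases "\<epsilon> < ?Y N \<omega>")
        case True
        then have "g (?Y N \<omega>) = 1" by (rule g1)
        then show ?thesis by (simp add: indicator_def)
      next
        case False
        then show ?thesis using g(1) by (simp add: indicator_def)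
      qed
    qed
    finally show ?case using elim by linarith
  qed
qed

text \<open>Index 0 does not contribute to \<open>block_sum\<close>, so the sums effectively start
  at \<open>max p 1\<close>, where the maximal inequality applies; for smaller \<open>n\<close> they
  are empty and cannot exceed the positive level.\<close>

lemma block_max:
  assumes a: "0 < a" and \<epsilon>: "0 < \<epsilon>" and pq: "p \<le> q"
  shows "prob {\<omega> \<in> space M. \<exists>n\<in>{p..q}. \<epsilon> < v \<bullet> ((1 / a) *\<^sub>R (block_sum 0 n \<omega> - block_sum 0 p \<omega>))} \<le>
    2 * prob {\<omega> \<in> space M. \<epsilon> < v \<bullet> ((1 / a) *\<^sub>R block_sum p q \<omega>)}"
proof -
  let ?p = "max p 1"
  have bs: "v \<bullet> ((1 / a) *\<^sub>R block_sum p n \<omega>) = (\<Sum>l\<in>{?p..<n}. v \<bullet> xi l \<omega>) / a" for n \<omega>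
  proof -
    have "{p..<n} \<inter> {1..} = {?p..<n}" by auto
    then show ?thesis by (simp add: block_sum_def inner_sum_right)
  qed
  have lt: "\<epsilon> < y / a \<longleftrightarrow> \<epsilon> * a < y" for y using a by (simp add: pos_less_divide_eq)
  have sub: "{\<omega> \<in> space M. \<exists>n\<in>{p..q}. \<epsilon> < v \<bullet> ((1 / a) *\<^sub>R (block_sum 0 n \<omega> - block_sum 0 p \<omega>))} \<subseteq>
      {\<omega> \<in> space M. \<exists>n\<in>{?p..q}. \<epsilon> * a < (\<Sum>l\<in>{?p..<n}. v \<bullet> xi l \<omega>)}"
  proof
    fix \<omega> assume "\<omega> \<in> {\<omega> \<in> space M. \<exists>n\<in>{p..q}. \<epsilon> < v \<bullet> ((1 / a) *\<^sub>R (block_sum 0 n \<omega> - block_sum 0 p \<omega>))}"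
    then obtain n where n: "\<omega> \<in> space M" "n \<in> {p..q}" "\<epsilon> < v \<bullet> ((1 / a) *\<^sub>R (block_sum 0 n \<omega> - block_sum 0 p \<omega>))" by blast
    then have "\<epsilon> < v \<bullet> ((1 / a) *\<^sub>R block_sum p n \<omega>)" by (simp add: block_sum_diff)
    then have l: "\<epsilon> * a < (\<Sum>l\<in>{?p..<n}. v \<bullet> xi l \<omega>)" by (simp only: bs lt)
    have "?p \<le> n"
    proof (rule ccontr)
      assume "\<not> ?p \<le> n"
      then have "(\<Sum>l\<in>{?p..<n}. v \<bullet> xi l \<omega>) = 0" by (intro sum.neutral) auto
      then have "\<epsilon> * a < 0" using l by linarith
      then show False using \<epsilon> a by (simp add: mult_less_0_iff)
    qed
    then show "\<omega> \<in> {\<omega> \<in> space M. \<exists>n\<in>{?p..q}. \<epsilon> * a < (\<Sum>l\<in>{?p..<n}. v \<bullet> xi l \<omega>)}"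
      using n l by auto
  qed
  have "prob {\<omega> \<in> space M. \<exists>n\<in>{p..q}. \<epsilon> < v \<bullet> ((1 / a) *\<^sub>R (block_sum 0 n \<omega> - block_sum 0 p \<omega>))} \<le>
      prob {\<omega> \<in> space M. \<exists>n\<in>{?p..q}. \<epsilon> * a < (\<Sum>l\<in>{?p..<n}. v \<bullet> xi l \<omega>)}"
    by (rule finite_measure_mono[OF sub]) measurable
  also have "\<dots> \<le> 2 * prob {\<omega> \<in> space M. \<epsilon> * a < (\<Sum>l\<in>{?p..<q}. v \<bullet> xi l \<omega>)}"
    by (rule Levy_maximal_inequality) (use \<epsilon> a in auto)
  finally show ?thesis by (simp only: bs lt)
qed

text \<open>The block index includes \<open>m\<close>, since at \<open>t = T\<close> the left node
  is \<open>m\<close>. Each block is prolonged by one step, because the interpolation just before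
  its end already uses the next partial sum.\<close>

definition bad :: "real \<Rightarrow> nat \<Rightarrow> real \<Rightarrow> nat \<Rightarrow> 'w set" where
  "bad T m \<delta> N = (\<Union>(j, v)\<in>{..m} \<times> dirs. {\<omega> \<in> space M. \<exists>n\<in>{grid T m N j..grid T m N (Suc j) + 1}.
     \<delta> < v \<bullet> ((1 / scale N) *\<^sub>R (block_sum 0 n \<omega> - block_sum 0 (grid T m N j) \<omega>))})"

lemma bad_measurable [measurable]: "bad T m \<delta> N \<in> sets M"
  unfolding bad_def using finite_dirs by (intro sets.finite_UN) (auto, measurable)

text \<open>A union bound over at most \<open>8 * m\<close> pairs of block and direction. The
  maximal inequality costs a factor 2 and each block tail is of order \<open>1 / m ^ 2\<close>,
  which leaves order \<open>1 / m\<close>.\<close>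

lemma bad_small:
  assumes T: "0 < T" and m: "0 < m" and \<delta>: "0 < \<delta>"
    and M': "prob_space M'" and D: "distributed M' lborel D (normal_density 0 (sqrt (sigma_sq * (T / real m))))"
  shows "\<forall>\<^sub>F N in sequentially. prob (bad T m \<delta> N) \<le> 16 * (48 * (sigma_sq * T)\<^sup>2 / \<delta> ^ 4 + 1) / real m"
proof -
  \<comment> \<open>The tolerance of \<open>block_tail\<close> is set to \<open>1 / m ^ 2\<close>,
    the order of the Gaussian term.\<close>
  let ?b = "48 * (sigma_sq * (T / real m))\<^sup>2 / \<delta> ^ 4 + 1 / (real m)\<^sup>2"
  have "\<forall>\<^sub>F N in sequentially. \<forall>x\<in>{..m} \<times> dirs.
      prob {\<omega> \<in> space M. \<delta> < snd x \<bullet> ((1 / scale N) *\<^sub>R block_sum (grid T m N (fst x)) (grid T m N (Suc (fst x)) + 1) \<omega>)} < ?b"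
  proof (rule eventually_ball_finite)
    show "finite ({..m} \<times> dirs)" using finite_dirs by simp
    show "\<forall>x\<in>{..m} \<times> dirs. \<forall>\<^sub>F N in sequentially.
      prob {\<omega> \<in> space M. \<delta> < snd x \<bullet> ((1 / scale N) *\<^sub>R block_sum (grid T m N (fst x)) (grid T m N (Suc (fst x)) + 1) \<omega>)} < ?b"
    proof
      fix x assume x: "x \<in> {..m} \<times> dirs"
      let ?j = "fst x"
      have "(\<lambda>N. real (grid T m N (Suc ?j)) / real N - real (grid T m N ?j) / real N + 1 / real N) \<longlonglongrightarrow>
          real (Suc ?j) * T / real m - real ?j * T / real m + 0"
        by (intro tendsto_add tendsto_diff grid_tendsto T) real_asymp
      moreover have "real (Suc ?j) * T / real m - real ?j * T / real m + 0 = T / real m"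
        by (simp add: algebra_simps add_divide_distrib)
      moreover have "real (grid T m N (Suc ?j)) / real N - real (grid T m N ?j) / real N + 1 / real N =
          real (grid T m N (Suc ?j) + 1 - grid T m N ?j) / real N" for N
      proof -
        have "grid T m N ?j \<le> grid T m N (Suc ?j) + 1" using grid_mono[OF T, of ?j "Suc ?j" m N] by simp
        then show ?thesis by (simp add: of_nat_diff add_divide_distrib diff_divide_distrib)
      qed
      ultimately have len: "(\<lambda>N. real (grid T m N (Suc ?j) + 1 - grid T m N ?j) / real N) \<longlonglongrightarrow> T / real m"
        by simp
      have bd: "real (grid T m N (Suc ?j) + 1) \<le> (2 * T + 1) * (real N + 1)" for N
        using grid_le[OF T _ m, of ?j N] x by auto
      have v: "norm (snd x) = 1" using x by (auto simp: norm_dirs)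
      show "\<forall>\<^sub>F N in sequentially.
        prob {\<omega> \<in> space M. \<delta> < snd x \<bullet> ((1 / scale N) *\<^sub>R block_sum (grid T m N ?j) (grid T m N (Suc ?j) + 1) \<omega>)} < ?b"
        by (rule block_tail[OF len bd v \<delta> _ _ M' D]) (use T m in auto)
    qed
  qed
  then show ?thesis
    using eventually_ge_at_top[of 2]
  proof eventually_elim
    case (elim N)
    have a: "0 < scale N" using elim(2) by (rule scale_pos)
    let ?E = "\<lambda>j v. {\<omega> \<in> space M. \<exists>n\<in>{grid T m N j..grid T m N (Suc j) + 1}.
     \<delta> < v \<bullet> ((1 / scale N) *\<^sub>R (block_sum 0 n \<omega> - block_sum 0 (grid T m N j) \<omega>))}"
    have "prob (bad T m \<delta> N) \<le> (\<Sum>x\<in>{..m} \<times> dirs. prob (?E (fst x) (snd x)))"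
    proof -
      have eq: "bad T m \<delta> N = (\<Union>x\<in>{..m} \<times> dirs. ?E (fst x) (snd x))"
        unfolding bad_def by (intro SUP_cong refl) (simp only: case_prod_beta)
      show ?thesis unfolding eq using finite_dirs by (intro finite_measure_subadditive_finite) auto
    qed
    also have "\<dots> \<le> (\<Sum>x\<in>{..m} \<times> dirs. 2 * ?b)"
    proof (rule sum_mono)
      fix x assume x: "x \<in> {..m} \<times> dirs"
      have le: "grid T m N (fst x) \<le> grid T m N (Suc (fst x)) + 1" using grid_mono[OF T, of "fst x" "Suc (fst x)" m N] by simp
      have "prob (?E (fst x) (snd x)) \<le> 2 * prob {\<omega> \<in> space M. \<delta> < snd x \<bullet> ((1 / scale N) *\<^sub>R block_sum (grid T m N (fst x)) (grid T m N (Suc (fst x)) + 1) \<omega>)}"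
        by (rule block_max[OF a \<delta> le])
      also have "\<dots> \<le> 2 * ?b" using elim(1) x by (intro mult_left_mono less_imp_le) auto
      finally show "prob (?E (fst x) (snd x)) \<le> 2 * ?b" .
    qed
    also have "\<dots> = real (Suc m) * real (card dirs) * (2 * ?b)"
      by (simp only: sum_constant card_cartesian_product card_atMost of_nat_mult)
    also have "\<dots> \<le> (2 * real m) * 4 * (2 * ?b)"
      using card_dirs m by (intro mult_right_mono mult_mono) auto
    also have "\<dots> = 16 * (48 * (sigma_sq * T)\<^sup>2 / \<delta> ^ 4 + 1) / real m"
      using m \<delta> by (simp add: field_simps power2_eq_square)
    finally show ?case .
  qed
qed

text \<open>At time \<open>t\<close> both paths are compared with the value at the left coarse node.
  The partial sums interpolated at \<open>t\<close> belong to the prolonged block, and so does the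
  next coarse node; each lies within \<open>2 * \<delta>\<close>, the bound per direction being
  \<open>\<delta>\<close>. The first step \<open>xi 0\<close> shifts the partial sums and is charged
  separately.\<close>

lemma path_close:
  assumes T: "0 < T" and m: "0 < m" and N: "2 \<le> N" and \<omega>: "\<omega> \<in> space M" "\<omega> \<notin> bad T m \<delta> N" and \<delta>: "0 < \<delta>"
  shows "mdist (path_metric T) (\<lambda>t\<in>{0..T}. Z X e N t \<omega>)
      (poly_path T (real m / T) (\<lambda>j. (1 / scale N) *\<^sub>R block_sum 0 (grid T m N j) \<omega>)) \<le> norm (xi 0 \<omega>) / scale N + 4 * \<delta>"
  unfolding path_eq
proof (rule mdist_path_metric_le)
  have a: "0 < scale N" by (rule scale_pos[OF N])
  show "0 \<le> norm (xi 0 \<omega>) / scale N + 4 * \<delta>" using a \<delta> by simp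
  fix t assume t: "0 \<le> t" "t \<le> T"
  define x where "x n = (1 / scale N) *\<^sub>R S X e n \<omega>" for n
  define y where "y n = (1 / scale N) *\<^sub>R block_sum 0 n \<omega>" for n
  define g where "g j = y (grid T m N j)" for j
  have xy: "norm (x n - y n) \<le> norm (xi 0 \<omega>) / scale N" for n
    using a by (simp add: x_def y_def S_block_sum flip: scaleR_diff_right)
  have near: "norm (y n - g j) \<le> 2 * \<delta>" if "j \<le> m" "n \<in> {grid T m N j..grid T m N (Suc j) + 1}" for j n
  proof (rule norm_le_dirs)
    fix v assume "v \<in> dirs"
    then have "\<not> \<delta> < v \<bullet> ((1 / scale N) *\<^sub>R (block_sum 0 n \<omega> - block_sum 0 (grid T m N j) \<omega>))"
      using \<omega> that unfolding bad_def by blast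
    then show "v \<bullet> (y n - g j) \<le> \<delta>" by (simp add: y_def g_def scaleR_diff_right)
  qed
  have "real N * t \<le> real N * T" using t by (intro mult_left_mono) auto
  then have r: "0 \<le> real N * t" "real N * t \<le> real (nat \<lceil>real N * T\<rceil>)"
    using t(1) by (simp, linarith)
  obtain i i' s where i: "0 \<le> s" "s \<le> 1" "real i \<le> real N * t" "real N * t < real i + 1" "i \<le> i'" "i' \<le> Suc i"
    and px: "\<And>x. polygon x (real N * t) = (1 - s) *\<^sub>R x i + s *\<^sub>R x i'"
    by (rule polygon_convex[OF r]) (rule that; assumption)
  define rr where "rr = real m / T * t"
  have "rr \<le> real m / T * T" unfolding rr_def using t T by (intro mult_left_mono) auto
  then have rr: "0 \<le> rr" "rr \<le> real m" using t T by (auto simp: rr_def)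
  obtain j j' s' where j: "j \<le> m" "0 \<le> s'" "s' \<le> 1" "real j \<le> rr" "rr < real j + 1" "j \<le> j'" "j' \<le> Suc j"
    and pg: "\<And>x. polygon x rr = (1 - s') *\<^sub>R x j + s' *\<^sub>R x j'"
    by (rule polygon_convex[OF rr]) (rule that; assumption)
  have t_rr: "t = rr * T / real m" using m T by (simp add: rr_def)
  have lo: "real j * T / real m \<le> t"
    unfolding t_rr using j T by (intro divide_right_mono mult_right_mono) auto
  have hi: "t \<le> real (Suc j) * T / real m"
    unfolding t_rr using j T by (intro divide_right_mono mult_right_mono) auto
  have "real N * (real j * T / real m) \<le> real N * t" using lo by (intro mult_left_mono) auto
  then have "real (grid T m N j) < real i + 1" using grid_bounds(1)[OF T, of m N j] i by linarith
  then have gi: "grid T m N j \<le> i" by linarith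
  have "real N * t \<le> real N * (real (Suc j) * T / real m)" using hi by (intro mult_left_mono) auto
  then have "real i < real (grid T m N (Suc j)) + 1" using grid_bounds(2)[OF T, of N "Suc j" m] i by linarith
  then have ig: "i \<le> grid T m N (Suc j)" by linarith
  have n1: "norm (y i - g j) \<le> 2 * \<delta>" by (rule near[OF j(1)]) (use gi ig in auto)
  have n2: "norm (y i' - g j) \<le> 2 * \<delta>" by (rule near[OF j(1)]) (use gi ig i in auto)
  have n3: "norm (g j' - g j) \<le> 2 * \<delta>"
  proof (cases "j' = j")
    case False
    then have "j' = Suc j" using j by simp
    then show ?thesis unfolding g_def[of j'] using near[OF j(1), of "grid T m N (Suc j)"] grid_mono[OF T, of j "Suc j" m N] by simp
  qed (use \<delta> in simp)
  have tri: "norm (x n - g j) \<le> norm (xi 0 \<omega>) / scale N + 2 * \<delta>" if "norm (y n - g j) \<le> 2 * \<delta>" for n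
    using norm_triangle_ineq[of "x n - y n" "y n - g j"] xy[of n] that by simp
  have d1: "norm (polygon x (real N * t) - g j) \<le> norm (xi 0 \<omega>) / scale N + 2 * \<delta>"
  proof -
    have "polygon x (real N * t) - g j = (1 - s) *\<^sub>R (x i - g j) + s *\<^sub>R (x i' - g j)" unfolding px by (simp add: algebra_simps)
    then show ?thesis using i by (simp only:) (intro convex_comb_norm_le tri n1 n2, auto)
  qed
  have d2: "norm (polygon g rr - g j) \<le> 2 * \<delta>"
  proof -
    have "polygon g rr - g j = (1 - s') *\<^sub>R (g j - g j) + s' *\<^sub>R (g j' - g j)" unfolding pg by (simp add: algebra_simps)
    then show ?thesis using j \<delta> by (simp only:) (intro convex_comb_norm_le n3, auto)
  qed
  have "dist (polygon x (real N * t)) (polygon g rr) \<le> norm (xi 0 \<omega>) / scale N + 4 * \<delta>"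
    unfolding dist_norm using norm_triangle_ineq4[of "polygon x (real N * t) - g j" "polygon g rr - g j"] d1 d2 by simp
  then show "dist (poly_path T (real N) (\<lambda>n. (1 / scale N) *\<^sub>R S X e n \<omega>) t)
      (poly_path T (real m / T) (\<lambda>j. (1 / scale N) *\<^sub>R block_sum 0 (grid T m N j) \<omega>) t) \<le> norm (xi 0 \<omega>) / scale N + 4 * \<delta>"
    using t by (simp add: poly_path_def x_def[abs_def] g_def[abs_def] y_def rr_def)
qed

end

text \<open>Nodes beyond the horizon do not influence the path: the distance is 0, and the path
  space is a genuine metric space.\<close>

lemma poly_path_cong:
  assumes "0 \<le> c" "0 \<le> T" "c * T \<le> real n" and eq: "\<And>j. j \<le> n \<Longrightarrow> x j = y j"
  shows "poly_path T c x = poly_path T c y"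
proof -
  interpret Metric_space "mspace (path_metric T)" "mdist (path_metric T)" by (rule Metric_space_mspace_mdist)
  have "mdist (path_metric T) (poly_path T c x) (poly_path T c y) \<le> 0"
    by (rule poly_path_dist_le[OF assms(1,3)]) (use eq in auto)
  with nonneg have "mdist (path_metric T) (poly_path T c x) (poly_path T c y) = 0"
    by (intro antisym)
  then show ?thesis
    using zero[OF poly_path_in_mspace[OF assms(1,2)] poly_path_in_mspace[OF assms(1,2)]] by blast
qed

text \<open>The parameter \<open>m\<close> is fixed before \<open>N\<close> grows, so closeness of
  \<open>c m\<close> to \<open>a\<close> is asked for only from some \<open>N\<close> on that may
  depend on \<open>m\<close>.\<close>

lemma tendsto_by_approximation:
  fixes a :: "nat \<Rightarrow> real"
  assumes c: "\<And>m. (\<lambda>N. c m N) \<longlonglongrightarrow> d m" and d: "d \<longlonglongrightarrow> b"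
    and ac: "\<And>\<epsilon>. 0 < \<epsilon> \<Longrightarrow> \<exists>m0::nat. \<forall>m\<ge>m0. \<forall>\<^sub>F N in sequentially. \<bar>a N - c m N\<bar> \<le> \<epsilon>"
  shows "a \<longlonglongrightarrow> b"
proof (rule tendstoI)
  fix r :: real assume r: "0 < r"
  obtain m0 where m0: "\<And>m. m0 \<le> m \<Longrightarrow> \<forall>\<^sub>F N in sequentially. \<bar>a N - c m N\<bar> \<le> r / 4"
    using ac[of "r / 4"] r by auto
  have "\<forall>\<^sub>F m in sequentially. dist (d m) b < r / 4 \<and> m0 \<le> m"
    using r by (intro eventually_conj tendstoD[OF d] eventually_ge_at_top) auto
  then obtain m where m: "dist (d m) b < r / 4" "m0 \<le> m"
    using eventually_happens by fastforce
  have "\<forall>\<^sub>F N in sequentially. dist (c m N) (d m) < r / 4" using r by (intro tendstoD[OF c]) auto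
  then show "\<forall>\<^sub>F N in sequentially. dist (a N) b < r"
    using m0[OF m(2)]
  proof eventually_elim
    case (elim N)
    then show ?case using m(1) unfolding dist_real_def by linarith
  qed
qed

text \<open>Clamping keeps all node times in \<open>[0, T]\<close> while the sequence stays monotone
  over all indices, as the definition of independent increments requires.\<close>

definition node :: "real \<Rightarrow> nat \<Rightarrow> nat \<Rightarrow> real" where
  "node T m j = min T (real j * T / real m)"

lemma node_nonneg: "0 < T \<Longrightarrow> 0 \<le> node T m j"
  by (simp add: node_def)

lemma node_mono: "0 < T \<Longrightarrow> mono (node T m)"
  unfolding node_def by (intro monoI min.mono order_refl divide_right_mono mult_right_mono) auto

lemma node_eq: "0 < T \<Longrightarrow> j \<le> m \<Longrightarrow> node T m j = real j * T / real m"
  unfolding node_def by (cases "m = 0") (auto simp: min_def field_simps)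

lemma node_clamp: "0 < T \<Longrightarrow> 0 < m \<Longrightarrow> node T m j = node T m (min j m)"
  unfolding node_def by (auto simp: min_def field_simps)

lemma node_diff: "0 < T \<Longrightarrow> j < m \<Longrightarrow> node T m (Suc j) - node T m j = T / real m"
  by (simp add: node_eq field_simps)

text \<open>The path functional as a function of the increments only; stopping the sum at
  \<open>m\<close> makes it depend on the finite index set of pairs of block and coordinate.\<close>

definition path_of_increments :: "real \<Rightarrow> nat \<Rightarrow> (nat \<times> 2 \<Rightarrow> real) \<Rightarrow> real \<Rightarrow> real ^ 2" where
  "path_of_increments T m y = poly_path T (real m / T) (\<lambda>j. \<Sum>i<min j m. \<chi> \<beta>. y (i, \<beta>))"

text \<open>Changing one increment shifts all later nodes by the same amount, so no node moves by
  more than the total change. This is the coordinatewise Lipschitz bound needed by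
  \<open>char_conv_imp_Lipschitz_conv\<close>.\<close>

lemma path_of_increments_dist_le:
  assumes "0 < T"
  shows "mdist (path_metric T) (path_of_increments T m y) (path_of_increments T m z) \<le>
    (\<Sum>i\<in>{..<m} \<times> UNIV. \<bar>y i - z i\<bar>)"
  unfolding path_of_increments_def
proof (rule poly_path_dist_le[where n=m])
  fix j
  have "norm ((\<Sum>i<min j m. \<chi> \<beta>. y (i, \<beta>)) - (\<Sum>i<min j m. \<chi> \<beta>. z (i, \<beta>)) :: real ^ 2) \<le>
      (\<Sum>i<min j m. norm ((\<chi> \<beta>. y (i, \<beta>)) - (\<chi> \<beta>. z (i, \<beta>)) :: real ^ 2))"
    unfolding sum_subtractf[symmetric] by (rule norm_sum)
  also have "\<dots> \<le> (\<Sum>i<min j m. \<Sum>\<beta>\<in>UNIV. \<bar>y (i, \<beta>) - z (i, \<beta>)\<bar>)"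
    by (intro sum_mono order_trans[OF norm_le_l1_cart]) simp
  also have "\<dots> \<le> (\<Sum>i<m. \<Sum>\<beta>\<in>UNIV. \<bar>y (i, \<beta>) - z (i, \<beta>)\<bar>)"
    by (intro sum_mono2) (auto intro: sum_nonneg)
  also have "\<dots> = (\<Sum>i\<in>{..<m} \<times> UNIV. \<bar>y i - z i\<bar>)"
    by (simp add: sum.cartesian_product case_prod_beta)
  finally show "norm ((\<Sum>i<min j m. \<chi> \<beta>. y (i, \<beta>)) - (\<Sum>i<min j m. \<chi> \<beta>. z (i, \<beta>)) :: real ^ 2) \<le>
      (\<Sum>i\<in>{..<m} \<times> UNIV. \<bar>y i - z i\<bar>)" .
qed (use assms in \<open>auto intro: sum_nonneg\<close>)

lemma wiener2_measurable:
  assumes "wiener_process2 M s2 W" "0 \<le> t"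
  shows "W t \<in> borel_measurable M"
  unfolding borel_measurable_euclidean_space[of "W t"]
  using assms by (auto simp: wiener_process2_def wiener_process_def Basis_vec_def inner_axis)

lemma wiener2_continuous:
  assumes "wiener_process2 M s2 W" "\<omega> \<in> space M"
  shows "continuous_on {0..T} (\<lambda>t. W t \<omega>)"
proof -
  have "continuous_on {0..} (\<lambda>t. W t \<omega> $ \<alpha>)" for \<alpha>
    using assms by (auto simp: wiener_process2_def wiener_process_def)
  then have "continuous_on {0..T} (\<lambda>t. W t \<omega> $ \<alpha>)" for \<alpha>
    by (rule continuous_on_subset) auto
  then have "continuous_on {0..T} (\<lambda>t. \<chi> \<alpha>. W t \<omega> $ \<alpha>)" by (rule continuous_on_vec_lambda)
  then show ?thesis by simp
qed

lemma wiener2_path_in: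
  assumes "wiener_process2 M s2 W" "\<omega> \<in> space M"
  shows "(\<lambda>t\<in>{0..T}. W t \<omega>) \<in> mspace (path_metric T)"
proof -
  have "continuous_on {0..T} (\<lambda>t\<in>{0..T}. W t \<omega>)"
    by (rule continuous_on_eq[OF wiener2_continuous[OF assms]]) simp
  then show ?thesis unfolding mspace_path_metric by simp
qed

text \<open>A continuous path is the uniform limit of its polygons, each of which depends on
  finitely many measurable values.\<close>

lemma wiener2_path_measurable:
  assumes W: "wiener_process2 M s2 W" and T: "0 < T"
  shows "(\<lambda>\<omega>. \<lambda>t\<in>{0..T}. W t \<omega>) \<in> measurable M (borel_of (mtopology_of (path_metric T)))"
proof (rule measurable_metric_limit)
  show "(\<lambda>\<omega>. poly_path T (real (Suc m) / T) (\<lambda>j. W (node T (Suc m) j) \<omega>)) \<in> measurable M (borel_of (mtopology_of (path_metric T)))" for m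
    using T by (intro measurable_poly_path wiener2_measurable[OF W] node_nonneg) auto
  fix \<omega> assume \<omega>: "\<omega> \<in> space M"
  show "(\<lambda>t\<in>{0..T}. W t \<omega>) \<in> mspace (path_metric T)"
    by (rule wiener2_path_in[OF W \<omega>])
  show "(\<lambda>m. mdist (path_metric T) (poly_path T (real (Suc m) / T) (\<lambda>j. W (node T (Suc m) j) \<omega>)) (\<lambda>t\<in>{0..T}. W t \<omega>)) \<longlonglongrightarrow> 0"
    unfolding node_def by (rule poly_path_approx[OF T wiener2_continuous[OF W \<omega>]])
qed

section \<open>Bounded Lipschitz functionals of paths\<close>

locale bounded_Lipschitz =
  fixes T B L :: real and F :: "(real \<Rightarrow> real ^ 2) \<Rightarrow> real"
  assumes T: "0 < T" and L: "0 \<le> L"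
    and bound: "\<And>x. x \<in> mspace (path_metric T) \<Longrightarrow> \<bar>F x\<bar> \<le> B"
    and Lipschitz: "\<And>x y. x \<in> mspace (path_metric T) \<Longrightarrow> y \<in> mspace (path_metric T) \<Longrightarrow>
      \<bar>F x - F y\<bar> \<le> L * mdist (path_metric T) x y"
begin

lemma F_measurable: "F \<in> borel_measurable (borel_of (mtopology_of (path_metric T)))"
  by (rule borel_measurable_continuous_map[OF Lipschitz_imp_continuous_map[OF Lipschitz]])

lemma poly_path_in: "poly_path T (real n / T) x \<in> mspace (path_metric T)"
  "poly_path T (real n) x \<in> mspace (path_metric T)"
  using T by (auto intro!: poly_path_in_mspace simp del: mspace_cfunspace)

text \<open>Along each path the polygons converge uniformly and \<open>F\<close> is Lipschitz, so
  the integrands converge pointwise; the bound \<open>B\<close> dominates them.\<close>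

lemma wiener_approx:
  assumes W: "wiener_process2 M' s2 W"
  shows "(\<lambda>m. \<integral>\<omega>. F (poly_path T (real (Suc m) / T) (\<lambda>j. W (node T (Suc m) j) \<omega>)) \<partial>M') \<longlonglongrightarrow>
    (\<integral>\<omega>. F (\<lambda>t\<in>{0..T}. W t \<omega>) \<partial>M')"
proof (rule integral_dominated_convergence[where w="\<lambda>_. B"])
  interpret M': prob_space M' by (rule wiener_prob_space[OF W])
  show "(\<lambda>\<omega>. F (\<lambda>t\<in>{0..T}. W t \<omega>)) \<in> borel_measurable M'"
    by (rule measurable_compose[OF wiener2_path_measurable[OF W T] F_measurable])
  show "(\<lambda>\<omega>. F (poly_path T (real (Suc m) / T) (\<lambda>j. W (node T (Suc m) j) \<omega>))) \<in> borel_measurable M'" for m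
    using T by (intro measurable_compose[OF _ F_measurable] measurable_poly_path wiener2_measurable[OF W] node_nonneg) auto
  show "integrable M' (\<lambda>_. B)" by simp
  show "AE \<omega> in M'. norm (F (poly_path T (real (Suc m) / T) (\<lambda>j. W (node T (Suc m) j) \<omega>))) \<le> B" for m
    unfolding real_norm_def by (intro AE_I2 bound poly_path_in)
  show "AE \<omega> in M'. (\<lambda>m. F (poly_path T (real (Suc m) / T) (\<lambda>j. W (node T (Suc m) j) \<omega>))) \<longlonglongrightarrow> F (\<lambda>t\<in>{0..T}. W t \<omega>)"
  proof (rule AE_I2)
    fix \<omega> assume \<omega>: "\<omega> \<in> space M'"
    have mem: "(\<lambda>t\<in>{0..T}. W t \<omega>) \<in> mspace (path_metric T)"
      by (rule wiener2_path_in[OF W \<omega>])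
    have "(\<lambda>m. F (poly_path T (real (Suc m) / T) (\<lambda>j. W (node T (Suc m) j) \<omega>)) - F (\<lambda>t\<in>{0..T}. W t \<omega>)) \<longlonglongrightarrow> 0"
    proof (rule Lim_null_comparison)
      show "\<forall>\<^sub>F m in sequentially. norm (F (poly_path T (real (Suc m) / T) (\<lambda>j. W (node T (Suc m) j) \<omega>)) - F (\<lambda>t\<in>{0..T}. W t \<omega>)) \<le>
          L * mdist (path_metric T) (poly_path T (real (Suc m) / T) (\<lambda>j. W (node T (Suc m) j) \<omega>)) (\<lambda>t\<in>{0..T}. W t \<omega>)"
        unfolding real_norm_def by (intro always_eventually allI Lipschitz poly_path_in(1) mem)
      show "(\<lambda>m. L * mdist (path_metric T) (poly_path T (real (Suc m) / T) (\<lambda>j. W (node T (Suc m) j) \<omega>)) (\<lambda>t\<in>{0..T}. W t \<omega>)) \<longlonglongrightarrow> 0"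
        unfolding node_def by (intro tendsto_mult_right_zero poly_path_approx[OF T wiener2_continuous[OF W \<omega>]])
    qed
    then show "(\<lambda>m. F (poly_path T (real (Suc m) / T) (\<lambda>j. W (node T (Suc m) j) \<omega>))) \<longlonglongrightarrow> F (\<lambda>t\<in>{0..T}. W t \<omega>)"
      by (rule LIM_zero_cancel)
  qed
qed

end

lemma sum_Times_vec:
  fixes Y :: "nat \<Rightarrow> real ^ 2"
  shows "(\<Sum>i\<in>{..<m} \<times> UNIV. u i * Y (fst i) $ snd i) = (\<Sum>j<m. (\<chi> \<beta>. u (j, \<beta>)) \<bullet> Y j)"
  unfolding inner_vec_def by (simp add: sum.cartesian_product case_prod_beta)

text \<open>Passes from scalar frequencies indexed by block and coordinate to one vector frequency
  per block, the form used for block sums.\<close>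

lemma prod_Times_exp:
  fixes u :: "nat \<times> 2 \<Rightarrow> real"
  shows "(\<Prod>i\<in>{..<m} \<times> UNIV. exp (- (s2 * (u i)\<^sup>2 / 2) * \<tau>)) =
    (\<Prod>j<m. exp (- (s2 * (norm (\<chi> \<beta>. u (j, \<beta>)))\<^sup>2 / 2) * \<tau>))"
proof -
  have "(\<Prod>i\<in>{..<m} \<times> UNIV. exp (- (s2 * (u i)\<^sup>2 / 2) * \<tau>)) =
      (\<Prod>j<m. \<Prod>\<beta>\<in>UNIV. exp (- (s2 * (u (j, \<beta>))\<^sup>2 / 2) * \<tau>))"
    by (simp add: prod.cartesian_product case_prod_beta)
  also have "\<dots> = (\<Prod>j<m. exp (- (s2 * (norm (\<chi> \<beta>. u (j, \<beta>)))\<^sup>2 / 2) * \<tau>))"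
    unfolding power2_norm_eq_inner inner_vec_def
    by (intro prod.cong refl) (simp add: UNIV_2 field_simps power2_eq_square flip: exp_add)
  finally show ?thesis .
qed

context kinetic
begin

lemma block_sum_telescope:
  assumes T: "0 < T" and j: "j \<le> m"
  shows "(\<Sum>i<j. block_sum (grid T m N i) (grid T m N (Suc i)) \<omega>) = block_sum 0 (grid T m N j) \<omega>"
proof -
  have "(\<Sum>i<j. block_sum (grid T m N i) (grid T m N (Suc i)) \<omega>) =
      (\<Sum>i<j. block_sum 0 (grid T m N (Suc i)) \<omega> - block_sum 0 (grid T m N i) \<omega>)"
    by (intro sum.cong refl block_sum_diff[symmetric] grid_mono[OF T]) simp
  also have "\<dots> = block_sum 0 (grid T m N j) \<omega> - block_sum 0 (grid T m N 0) \<omega>"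
    by (rule sum_lessThan_telescope)
  finally show ?thesis by (simp add: block_sum_def)
qed

text \<open>After composition with \<open>path_of_increments\<close>, \<open>F\<close> is a
  Lipschitz function of finitely many increments. The limits of the characteristic functions of the
  blocks are those of the Wiener increments, so the integrals converge.\<close>

lemma fdd_conv:
  assumes "bounded_Lipschitz T B L F" and W: "wiener_process2 M' sigma_sq W" and m: "0 < m"
  shows "(\<lambda>N. \<integral>\<omega>. F (poly_path T (real m / T) (\<lambda>j. (1 / scale N) *\<^sub>R block_sum 0 (grid T m N j) \<omega>)) \<partial>M) \<longlonglongrightarrow>
    (\<integral>\<omega>. F (poly_path T (real m / T) (\<lambda>j. W (node T m j) \<omega>)) \<partial>M')"
proof -
  interpret bounded_Lipschitz T B L F by fact
  interpret M': prob_space M' by (rule wiener_prob_space[OF W])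
  let ?b = "\<lambda>N j \<omega>. (1 / scale N) *\<^sub>R block_sum (grid T m N j) (grid T m N (Suc j)) \<omega>"
  let ?w = "\<lambda>j \<omega>. W (node T m (Suc j)) \<omega> - W (node T m j) \<omega>"
  let ?Y = "\<lambda>N \<omega> (i :: nat \<times> 2). ?b N (fst i) \<omega> $ snd i"
  let ?Y' = "\<lambda>\<omega> (i :: nat \<times> 2). ?w (fst i) \<omega> $ snd i"
  let ?\<phi> = "\<lambda>y. F (path_of_increments T m y)"
  have cT: "real m / T * T \<le> real m" "0 \<le> real m / T" "0 \<le> T" using T by auto
  have in_space: "path_of_increments T m y \<in> mspace (path_metric T)" for y
    unfolding path_of_increments_def by (rule poly_path_in)
  have disj: "{grid T m N i..<grid T m N (Suc i)} \<inter> {grid T m N j..<grid T m N (Suc j)} = {}" if "i \<noteq> j" for N i j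
  proof -
    have "Suc i \<le> j \<or> Suc j \<le> i" using that by linarith
    then have "grid T m N (Suc i) \<le> grid T m N j \<or> grid T m N (Suc j) \<le> grid T m N i"
      using grid_mono[OF T] by blast
    then show ?thesis by auto
  qed
  have len: "(\<lambda>N. real (grid T m N (Suc j) - grid T m N j) / real N) \<longlonglongrightarrow> T / real m" for j
  proof -
    have "(\<lambda>N. real (grid T m N (Suc j)) / real N - real (grid T m N j) / real N) \<longlonglongrightarrow>
        real (Suc j) * T / real m - real j * T / real m"
      by (intro tendsto_diff grid_tendsto T)
    moreover have "real (Suc j) * T / real m - real j * T / real m = T / real m"
      by (simp add: algebra_simps add_divide_distrib)
    moreover have "real (grid T m N (Suc j)) / real N - real (grid T m N j) / real N =
        real (grid T m N (Suc j) - grid T m N j) / real N" for N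
      using grid_mono[OF T, of j "Suc j" m N] by (simp add: of_nat_diff diff_divide_distrib)
    ultimately show ?thesis by simp
  qed
  have bd: "real (grid T m N (Suc j)) \<le> (2 * T + 1) * (real N + 1)" if "j \<in> {..<m}" for N j
    using grid_le[OF T _ m, of j N] that by simp
  have "(\<lambda>N. \<integral>\<omega>. ?\<phi> (?Y N \<omega>) \<partial>M) \<longlonglongrightarrow> (\<integral>\<omega>. ?\<phi> (?Y' \<omega>) \<partial>M')"
  proof (rule char_conv_imp_Lipschitz_conv[where \<phi>="?\<phi>" and Y="?Y" and Y'="?Y'" and I="{..<m} \<times> UNIV" and B=B and L=L])
    show "(\<lambda>\<omega>. ?Y N \<omega> i) \<in> borel_measurable M" for N i by measurable
    show "(\<lambda>\<omega>. ?Y' \<omega> i) \<in> borel_measurable M'" for i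
      using wiener2_measurable[OF W node_nonneg[OF T, of m "Suc (fst i)"]]
        wiener2_measurable[OF W node_nonneg[OF T, of m "fst i"]] by measurable
    show "(\<lambda>N. \<integral>\<omega>. cis (\<Sum>i\<in>{..<m} \<times> UNIV. u i * ?Y N \<omega> i) \<partial>M) \<longlonglongrightarrow> (\<integral>\<omega>. cis (\<Sum>i\<in>{..<m} \<times> UNIV. u i * ?Y' \<omega> i) \<partial>M')" for u
    proof -
      have "(\<integral>\<omega>. cis (\<Sum>i\<in>{..<m} \<times> UNIV. u i * ?Y' \<omega> i) \<partial>M') =
          complex_of_real (\<Prod>i\<in>{..<m} \<times> UNIV. exp (- (sigma_sq * (u i)\<^sup>2 / 2) * (T / real m)))"
        unfolding vector_minus_component
        by (rule wiener_increment_char[OF W sigma_sq_pos node_nonneg[OF T] node_mono[OF T] node_diff[OF T]]) (use T m in auto)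
      also have "\<dots> = complex_of_real (\<Prod>j<m. exp (- (sigma_sq * (norm (\<chi> \<beta>. u (j, \<beta>)))\<^sup>2 / 2) * (T / real m)))"
        unfolding prod_Times_exp ..
      finally have eq: "(\<integral>\<omega>. cis (\<Sum>i\<in>{..<m} \<times> UNIV. u i * ?Y' \<omega> i) \<partial>M') = \<dots>" .
      show ?thesis
        unfolding eq sum_Times_vec[where Y="\<lambda>j. ?b N j \<omega>" for N \<omega>]
        by (rule char_block_sums[where C="2 * T + 1"]) (use disj bd len in auto)
    qed
    show "\<bar>?\<phi> y\<bar> \<le> B" for y by (rule bound[OF in_space])
    show "\<bar>?\<phi> y - ?\<phi> z\<bar> \<le> L * (\<Sum>i\<in>{..<m} \<times> UNIV. \<bar>y i - z i\<bar>)" for y z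
      by (rule order_trans[OF Lipschitz[OF in_space in_space] mult_left_mono[OF path_of_increments_dist_le[OF T] L]])
  qed (use L prob_space_axioms M'.prob_space_axioms in auto)
  moreover have "path_of_increments T m (?Y N \<omega>) = poly_path T (real m / T) (\<lambda>j. (1 / scale N) *\<^sub>R block_sum 0 (grid T m N j) \<omega>)" for N \<omega>
    unfolding path_of_increments_def fst_conv snd_conv vec_nth_inverse scaleR_sum_right[symmetric]
    by (rule poly_path_cong[OF cT(2,3,1)]) (simp only: min_absorb1 block_sum_telescope[OF T])
  moreover have "(\<integral>\<omega>. ?\<phi> (?Y' \<omega>) \<partial>M') = (\<integral>\<omega>. F (poly_path T (real m / T) (\<lambda>j. W (node T m j) \<omega>)) \<partial>M')"
  proof (rule Bochner_Integration.integral_cong[OF refl])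
    fix \<omega> assume \<omega>: "\<omega> \<in> space M'"
    \<comment> \<open>With starting value 0 the Wiener increments telescope to the node values
      themselves.\<close>
    have "W 0 \<omega> = 0" using W \<omega> by (auto simp: wiener_process2_def wiener_process_def vec_eq_iff)
    moreover have "node T m 0 = 0" using T by (simp add: node_def)
    ultimately have "(\<Sum>i<min j m. ?w i \<omega>) = W (node T m j) \<omega>" for j
      unfolding sum_lessThan_telescope[of "\<lambda>j. W (node T m j) \<omega>"] node_clamp[OF T m, of j] by simp
    then show "?\<phi> (?Y' \<omega>) = F (poly_path T (real m / T) (\<lambda>j. W (node T m j) \<omega>))"
      unfolding path_of_increments_def fst_conv snd_conv vec_nth_inverse by simp
  qed
  ultimately show ?thesis by simp
qed

lemma Z_path_measurable:
  assumes "0 < T"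
  shows "(\<lambda>\<omega>. \<lambda>t\<in>{0..T}. Z X e N t \<omega>) \<in> measurable M (borel_of (mtopology_of (path_metric T)))"
proof -
  have "(\<lambda>\<omega>. (1 / scale N) *\<^sub>R S X e j \<omega>) \<in> borel_measurable M" for j
    unfolding S_eq_xi by measurable
  then show ?thesis unfolding path_eq using assms by (intro measurable_poly_path) auto
qed

text \<open>Three errors of size \<open>\<epsilon> / 3\<close>: the first step, whose law is
  arbitrary but which is divided by \<open>scale N\<close>; the oscillation within blocks, through
  the Lipschitz constant; and the exceptional event, on which the difference is only known to be at
  most \<open>2 * B\<close>.\<close>

lemma path_discretisation:
  assumes "bounded_Lipschitz T B L F" and W: "wiener_process2 M' sigma_sq W" and \<epsilon>: "0 < \<epsilon>"
  shows "\<exists>m0. \<forall>m\<ge>m0. \<forall>\<^sub>F N in sequentially.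
    \<bar>(\<integral>\<omega>. F (\<lambda>t\<in>{0..T}. Z X e N t \<omega>) \<partial>M) -
      (\<integral>\<omega>. F (poly_path T (real (Suc m) / T) (\<lambda>j. (1 / scale N) *\<^sub>R block_sum 0 (grid T (Suc m) N j) \<omega>)) \<partial>M)\<bar> \<le> \<epsilon>"
proof -
  interpret bounded_Lipschitz T B L F by fact
  interpret M': prob_space M' by (rule wiener_prob_space[OF W])
  \<comment> \<open>Chosen so that \<open>4 * \<delta> * (L + 1) = \<epsilon> / 3\<close>;
    \<open>L + 1\<close> keeps the quotient meaningful for \<open>L = 0\<close>.\<close>
  define \<delta> where "\<delta> = \<epsilon> / (12 * (L + 1))"
  have \<delta>: "0 < \<delta>" using \<epsilon> L by (simp add: \<delta>_def)
  have "L * (4 * \<delta>) \<le> (L + 1) * (4 * \<delta>)" using \<delta> by (intro mult_right_mono) auto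
  also have "\<dots> = \<epsilon> / 3" using L by (simp add: \<delta>_def field_simps)
  finally have L\<delta>: "L * (4 * \<delta>) \<le> \<epsilon> / 3" .
  have B: "0 \<le> B" using bound[OF poly_path_in(2)] by (meson abs_ge_zero order_trans)
  let ?K = "16 * (48 * (sigma_sq * T)\<^sup>2 / \<delta> ^ 4 + 1)"
  \<comment> \<open>From \<open>m0\<close> on, \<open>2 * B\<close> times the bound
    \<open>?K / m\<close> for the exceptional event is at most
    \<open>\<epsilon> / 3\<close>.\<close>
  obtain m0 where m0: "2 * B * ?K / (\<epsilon> / 3) \<le> real m0" using real_arch_simple by blast
  \<comment> \<open>The first step is a fixed finite variable and possibly without mean; capping at
    \<open>2 * B\<close> gives a dominating constant.\<close>
  have small0: "(\<lambda>N. \<integral>\<omega>. min (2 * B) (L * (norm (xi 0 \<omega>) / scale N)) \<partial>M) \<longlonglongrightarrow> (\<integral>\<omega>. min (2 * B) 0 \<partial>M)"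
  proof (rule integral_dominated_convergence[where w="\<lambda>_. 2 * B"])
    have inf: "filterlim scale at_infinity sequentially" by (rule filterlim_at_top_imp_at_infinity[OF scale_at_top])
    show "AE \<omega> in M. (\<lambda>N. min (2 * B) (L * (norm (xi 0 \<omega>) / scale N))) \<longlonglongrightarrow> min (2 * B) 0"
      by (intro AE_I2 tendsto_min tendsto_const tendsto_mult_right_zero tendsto_divide_0[OF tendsto_const inf])
    show "AE \<omega> in M. norm (min (2 * B) (L * (norm (xi 0 \<omega>) / scale N))) \<le> 2 * B" for N
    proof (intro AE_I2)
      fix \<omega>
      have "0 \<le> ln (real N)" by (cases "N = 0") auto
      then have "0 \<le> scale N" by (simp add: scale_def)
      then have "0 \<le> L * (norm (xi 0 \<omega>) / scale N)" using L by simp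
      then show "norm (min (2 * B) (L * (norm (xi 0 \<omega>) / scale N))) \<le> 2 * B" using B by auto
    qed
  qed (auto)
  have small: "\<forall>\<^sub>F N in sequentially. (\<integral>\<omega>. min (2 * B) (L * (norm (xi 0 \<omega>) / scale N)) \<partial>M) < \<epsilon> / 3"
    by (rule order_tendstoD(2)[OF small0]) (use B \<epsilon> in simp)
  show ?thesis
  proof (intro exI allI impI)
    fix m assume m: "m0 \<le> m"
    \<comment> \<open>The Gaussian variable required by \<open>bad_small\<close> is the first
      coordinate of the Wiener increment over the first block.\<close>
    have "0 < T / real (Suc m)" using T by simp
    moreover have "wiener_process M' sigma_sq (\<lambda>t \<omega>. W t \<omega> $ 1)" using W by (simp add: wiener_process2_def)
    ultimately have "distributed M' lborel (\<lambda>\<omega>. W (T / real (Suc m)) \<omega> $ 1 - W 0 \<omega> $ 1) (normal_density 0 (sqrt (sigma_sq * (T / real (Suc m) - 0))))"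
      unfolding wiener_process_def by blast
    then have D: "distributed M' lborel (\<lambda>\<omega>. W (T / real (Suc m)) \<omega> $ 1 - W 0 \<omega> $ 1) (normal_density 0 (sqrt (sigma_sq * (T / real (Suc m)))))"
      by (simp only: diff_zero)
    have K: "0 \<le> ?K" by simp
    have "2 * B * ?K \<le> \<epsilon> / 3 * real m0" using m0 \<epsilon> by (simp add: pos_divide_le_eq mult.commute)
    also have "\<dots> \<le> \<epsilon> / 3 * real (Suc m)" using m \<epsilon> by (intro mult_left_mono) auto
    finally have Km: "2 * B * (?K / real (Suc m)) \<le> \<epsilon> / 3" by (simp add: pos_divide_le_eq del: of_nat_Suc)
    show "\<forall>\<^sub>F N in sequentially.
      \<bar>(\<integral>\<omega>. F (\<lambda>t\<in>{0..T}. Z X e N t \<omega>) \<partial>M) -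
        (\<integral>\<omega>. F (poly_path T (real (Suc m) / T) (\<lambda>j. (1 / scale N) *\<^sub>R block_sum 0 (grid T (Suc m) N j) \<omega>)) \<partial>M)\<bar> \<le> \<epsilon>"
      using small bad_small[OF T zero_less_Suc \<delta> M'.prob_space_axioms D] eventually_ge_at_top[of 2]
    proof eventually_elim
      case (elim N)
      let ?z = "\<lambda>\<omega>. \<lambda>t\<in>{0..T}. Z X e N t \<omega>"
      let ?i = "\<lambda>\<omega>. poly_path T (real (Suc m) / T) (\<lambda>j. (1 / scale N) *\<^sub>R block_sum 0 (grid T (Suc m) N j) \<omega>)"
      let ?g = "\<lambda>\<omega>. min (2 * B) (L * (norm (xi 0 \<omega>) / scale N))"
      let ?h = "\<lambda>\<omega>. ?g \<omega> + \<epsilon> / 3 + 2 * B * indicator (bad T (Suc m) \<delta> N) \<omega>"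
      have a: "0 < scale N" using elim(3) by (rule scale_pos)
      have zin: "?z \<omega> \<in> mspace (path_metric T)" for \<omega> unfolding path_eq by (rule poly_path_in)
      have iin: "?i \<omega> \<in> mspace (path_metric T)" for \<omega> by (rule poly_path_in)
      have im: "(\<lambda>\<omega>. ?i \<omega>) \<in> measurable M (borel_of (mtopology_of (path_metric T)))"
        using T by (intro measurable_poly_path) (auto simp del: of_nat_Suc)
      have Fz: "integrable M (\<lambda>\<omega>. F (?z \<omega>))"
        by (rule integrable_const_bound[where B=B])
          (use bound[OF zin] measurable_compose[OF Z_path_measurable[OF T] F_measurable] in auto)
      have Fi: "integrable M (\<lambda>\<omega>. F (?i \<omega>))"
        by (rule integrable_const_bound[where B=B])
          (use bound[OF iin] measurable_compose[OF im F_measurable] in auto)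
      have g0: "0 \<le> ?g \<omega>" for \<omega> using B L a by simp
      have gi: "integrable M ?g"
        by (rule integrable_const_bound[where B="2 * B"]) (use g0 in auto)
      have ii: "integrable M (\<lambda>\<omega>. 2 * B * indicator (bad T (Suc m) \<delta> N) \<omega>)"
        by (intro integrable_mult_right integrable_real_indicator bad_measurable) (simp add: emeasure_eq_measure)
      have pw: "\<bar>F (?z \<omega>) - F (?i \<omega>)\<bar> \<le> ?h \<omega>" if \<omega>: "\<omega> \<in> space M" for \<omega>
      proof -
        have b2: "\<bar>F (?z \<omega>) - F (?i \<omega>)\<bar> \<le> 2 * B" using bound[OF zin, of \<omega>] bound[OF iin, of \<omega>] by linarith
        show ?thesis
        proof (cases "\<omega> \<in> bad T (Suc m) \<delta> N")
          case True
          then have "?h \<omega> = ?g \<omega> + \<epsilon> / 3 + 2 * B" by simp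
          then show ?thesis using b2 g0[of \<omega>] \<epsilon> by linarith
        next
          case False
          have "\<bar>F (?z \<omega>) - F (?i \<omega>)\<bar> \<le> L * mdist (path_metric T) (?z \<omega>) (?i \<omega>)" by (rule Lipschitz[OF zin iin])
          also have "\<dots> \<le> L * (norm (xi 0 \<omega>) / scale N + 4 * \<delta>)"
            by (rule mult_left_mono[OF path_close[OF T zero_less_Suc elim(3) \<omega> False \<delta>] L])
          also have "\<dots> \<le> L * (norm (xi 0 \<omega>) / scale N) + \<epsilon> / 3" using L\<delta> by (simp only: distrib_left)
          finally have "\<bar>F (?z \<omega>) - F (?i \<omega>)\<bar> \<le> ?g \<omega> + \<epsilon> / 3" using b2 \<epsilon> by linarith
          then show ?thesis using False by simp
        qed
      qed
      have "\<bar>(\<integral>\<omega>. F (?z \<omega>) \<partial>M) - (\<integral>\<omega>. F (?i \<omega>) \<partial>M)\<bar> = \<bar>\<integral>\<omega>. F (?z \<omega>) - F (?i \<omega>) \<partial>M\<bar>"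
        by (simp only: Bochner_Integration.integral_diff[OF Fz Fi])
      also have "\<dots> \<le> (\<integral>\<omega>. \<bar>F (?z \<omega>) - F (?i \<omega>)\<bar> \<partial>M)" by (rule integral_abs_bound)
      also have "\<dots> \<le> (\<integral>\<omega>. ?h \<omega> \<partial>M)"
      proof (rule integral_mono)
        show "integrable M (\<lambda>\<omega>. \<bar>F (?z \<omega>) - F (?i \<omega>)\<bar>)" by (intro integrable_abs Bochner_Integration.integrable_diff Fz Fi)
        show "integrable M ?h" by (intro Bochner_Integration.integrable_add gi ii) simp
      qed (rule pw)
      also have "\<dots> = (\<integral>\<omega>. ?g \<omega> \<partial>M) + \<epsilon> / 3 + 2 * B * prob (bad T (Suc m) \<delta> N)"
      proof -
        have "(\<integral>\<omega>. ?h \<omega> \<partial>M) = (\<integral>\<omega>. ?g \<omega> + \<epsilon> / 3 \<partial>M) + (\<integral>\<omega>. 2 * B * indicator (bad T (Suc m) \<delta> N) \<omega> \<partial>M)"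
          by (intro Bochner_Integration.integral_add Bochner_Integration.integrable_add gi ii) simp
        also have "(\<integral>\<omega>. ?g \<omega> + \<epsilon> / 3 \<partial>M) = (\<integral>\<omega>. ?g \<omega> \<partial>M) + \<epsilon> / 3"
          by (subst Bochner_Integration.integral_add[OF gi]) (simp_all add: prob_space)
        also have "(\<integral>\<omega>. 2 * B * indicator (bad T (Suc m) \<delta> N) \<omega> \<partial>M) = 2 * B * prob (bad T (Suc m) \<delta> N)"
          by (simp add: Int_absorb2 sets.sets_into_space)
        finally show ?thesis .
      qed
      also have "2 * B * prob (bad T (Suc m) \<delta> N) \<le> 2 * B * (?K / real (Suc m))"
        using elim(2) B by (intro mult_left_mono) auto
      finally show ?case using elim(1) Km by linarith
    qed
  qed
qed

end

section \<open>Convergence in distribution on the path space\<close>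

theorem theorem3p1:
  fixes M :: "'w measure" and \<mu> :: "(real ^ 2) measure"
    and X :: "nat \<Rightarrow> 'w \<Rightarrow> real ^ 2" and e :: "nat \<Rightarrow> 'w \<Rightarrow> real"
    and M' :: "'v measure" and W :: "real \<Rightarrow> 'v \<Rightarrow> real ^ 2"
    and T :: real
  assumes "kinetic_chain M \<mu> X e"
    and "\<forall>\<epsilon>>0. \<exists>\<delta>>0. measure \<mu> {k \<in> space torus. torus_norm k < \<delta>} < \<epsilon>"
    and "wiener_process2 M' sigma_sq W"
    and "0 < T"
  shows "converges_in_distribution (C_space T)
           M (\<lambda>N \<omega>. \<lambda>t\<in>{0..T}. Z X e N t \<omega>)
           M' (\<lambda>\<omega>. \<lambda>t\<in>{0..T}. W t \<omega>)"
  unfolding C_space_def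
proof (rule Lipschitz_conv_imp_converges_in_distribution)
  interpret kinetic M \<mu> X e by unfold_locales (rule assms(1))
  show "prob_space M" by (rule prob_space_axioms)
  show "prob_space M'" by (rule wiener_prob_space[OF assms(3)])
  show "\<forall>\<^sub>F N in sequentially. (\<lambda>\<omega>. \<lambda>t\<in>{0..T}. Z X e N t \<omega>) \<in> measurable M (borel_of (mtopology_of (path_metric T)))"
    by (intro always_eventually allI Z_path_measurable assms(4))
  show "(\<lambda>\<omega>. \<lambda>t\<in>{0..T}. W t \<omega>) \<in> measurable M' (borel_of (mtopology_of (path_metric T)))"
    by (rule wiener2_path_measurable[OF assms(3,4)])
  fix F B L
  assume "0 \<le> L" "\<And>x. x \<in> mspace (path_metric T) \<Longrightarrow> \<bar>F x\<bar> \<le> B"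
    "\<And>x y. x \<in> mspace (path_metric T) \<Longrightarrow> y \<in> mspace (path_metric T) \<Longrightarrow> \<bar>F x - F y\<bar> \<le> L * mdist (path_metric T) x y"
  then have bl: "bounded_Lipschitz T B L F" using assms(4) by (intro bounded_Lipschitz.intro)
  show "(\<lambda>N. \<integral>\<omega>. F (\<lambda>t\<in>{0..T}. Z X e N t \<omega>) \<partial>M) \<longlonglongrightarrow> (\<integral>\<omega>. F (\<lambda>t\<in>{0..T}. W t \<omega>) \<partial>M')"
    \<comment> \<open>The intermediate quantity is the functional of the polygon with
      \<open>Suc m\<close> blocks: \<open>N\<close> goes to infinity for fixed \<open>m\<close>,
      then \<open>m\<close> does, on the side of the Wiener process.\<close>
    by (rule tendsto_by_approximation[OF fdd_conv[OF bl assms(3) zero_less_Suc]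
          bounded_Lipschitz.wiener_approx[OF bl assms(3)] path_discretisation[OF bl assms(3)]])
qed

end
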